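(* Let $d\ge2$ and let $p,q\in(1,\infty]$ satisfy $1/p+1/q<2/d$. Set $\rho=\frac{2qd}{q(d-2)+d}$. Let $c_f>0$. Then there exist $\kappa=\kappa(q,p,d)\in(1,\infty)$, $\gamma=\gamma(q,p,d)\in(0,1]$ and $C_2=C_2(q,p,d,c_f)>0$ such that the following holds. Let $a:\mathbb R^d\to\mathbb R^{d\times d}$ be symmetric and let $\lambda,\Lambda:\mathbb R^d\to\mathbb R$ be non-negative with $\lambda(x)|\xi|^2\le\langle a(x)\xi,\xi\rangle\le\Lambda(x)|\xi|^2$ for almost all $x\in\mathbb R^d$ and all $\xi\in\mathbb R^d$, and $\sup_{r\ge1}\frac1{|B_r|}\int_{B_r}(\Lambda^p+\lambda^{-q})\,dx<\infty$. Fix $x_0\in\mathbb R^d$ and $R>0$, and denote by $B(r)$ the ball of center $x_0$ and radius $r$. Suppose that $u\in\mathcal F_{loc}$ is a solution in $B(R)$ of the Poisson equation with datum $f$, and that $|\nabla f|\le c_f/R$. Then for any $1/2\le\sigma'<\sigma\le1$, $$\|u\|_{B(\sigma'R),\infty}\le C_2\left(\frac{1\vee\|\lambda^{-1}\|_{B(R),q}\|\Lambda\|_{B(R),p}}{(\sigma-\sigma')^2}\right)^{\kappa}\left(\|u\|^{\gamma}_{B(\sigma R),\rho}\vee\|u\|_{B(\sigma R),\rho}\right).$$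
   Context: $B_r$ is the ball of radius $r$ centered at the origin; for infinite exponents the integrability condition means essential boundedness. $\|u\|_{B,r}=\bigl(\frac1{|B|}\int_B|u|^r\,dx\bigr)^{1/r}$ for $r<\infty$, and $\|u\|_{B,\infty}$ is the essential supremum of $|u|$ on $B$. $s\vee t=\max\{s,t\}$. If $q=\infty$, $\rho$ is the limiting value ($2d/(d-2)$, or $\infty$ when $d=2$). Let $\mathcal E(u,v)=\sum_{i,j}\int_{\mathbb R^d}a_{ij}\partial_iu\,\partial_jv\,dx$. $\mathcal F$ is the completion of $C_0^\infty(\mathbb R^d)$ in $L^2(\mathbb R^d,dx)$ with respect to $\mathcal E+\langle\cdot,\cdot\rangle_{L^2(dx)}$; for a ball $B$, $\mathcal F_B$ is the completion of $C_0^\infty(B)$ in $L^2(B,dx)$ with respect to the same norm. Elements are weakly differentiable and $\mathcal E$ is given by the same formula with weak derivatives. $u\in\mathcal F_{loc}$ means: for every ball $B$ there is $u_B\in\mathcal F$ with $u=u_B$ a.e. on $B$. Let $f:\mathbb R^d\to\mathbb R$ have essentially bounded weak derivatives. $u\in\mathcal F_{loc}$ is a solution of the Poisson equation (with datum $f$) in a ball $B$ if $\mathcal E(u,\varphi)=-\int_{\mathbb R^d}\langle a\nabla f,\nabla\varphi\rangle\,dx$ for all $\varphi\in\mathcal F_B$ with $\varphi\ge0$. *)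

theory Defs
  imports "HOL-Analysis.Analysis" "HOL-Probability.Essential_Supremum"
begin

section \<open>Averaged norms\<close>

text \<open>Only meant for \<open>r > 0\<close>; then it is the usual power, with \<open>0\<close> and \<open>\<infinity>\<close> fixed.\<close>

definition ennpowr :: "ennreal \<Rightarrow> real \<Rightarrow> ennreal" where
  "ennpowr x r = (if x = \<infinity> then \<infinity> else ennreal (enn2real x powr r))"

text \<open>For \<open>r < \<infinity>\<close> the mean of \<open>g\<^sup>r\<close> over \<open>B\<close>. For \<open>r = \<infinity>\<close>, where an integrability
  condition means essential boundedness, the essential supremum.\<close>

definition avg_moment :: "'a::euclidean_space set \<Rightarrow> ennreal \<Rightarrow> ('a \<Rightarrow> ennreal) \<Rightarrow> ennreal" where
  "avg_moment B r g =
     (if r = \<infinity> then esssup (lebesgue_on B) g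
      else (\<integral>\<^sup>+x\<in>B. ennpowr (g x) (enn2real r) \<partial>lebesgue) / emeasure lebesgue B)"

definition avg_norm :: "'a::euclidean_space set \<Rightarrow> ennreal \<Rightarrow> ('a \<Rightarrow> ennreal) \<Rightarrow> ennreal" where
  "avg_norm B r g =
     (if r = \<infinity> then esssup (lebesgue_on B) g
      else ennpowr (avg_moment B r g) (1 / enn2real r))"

definition rho :: "nat \<Rightarrow> ennreal \<Rightarrow> ennreal" where
  "rho d q =
     (if q = \<infinity> then (if d = 2 then \<infinity> else ennreal (2 * real d / (real d - 2)))
      else ennreal (2 * enn2real q * real d / (enn2real q * (real d - 2) + real d)))"

section \<open>Smooth test functions and weak derivatives\<close>

definition pderiv_at :: "'n \<Rightarrow> (real^'n \<Rightarrow> real) \<Rightarrow> real^'n \<Rightarrow> real" where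
  "pderiv_at i \<phi> x = frechet_derivative \<phi> (at x) (axis i 1)"

primrec Ck :: "nat \<Rightarrow> (real^'n \<Rightarrow> real) \<Rightarrow> bool" where
  "Ck 0 \<phi> \<longleftrightarrow> continuous_on UNIV \<phi>"
| "Ck (Suc k) \<phi> \<longleftrightarrow> (\<forall>x. \<phi> differentiable (at x)) \<and> (\<forall>i. Ck k (pderiv_at i \<phi>))"

definition test_functions :: "(real^'n) set \<Rightarrow> (real^'n \<Rightarrow> real) set" where
  "test_functions U =
     {\<phi>. (\<forall>k. Ck k \<phi>) \<and> compact (closure {x. \<phi> x \<noteq> 0}) \<and> closure {x. \<phi> x \<noteq> 0} \<subseteq> U}"

definition locally_integrable :: "('a::euclidean_space \<Rightarrow> 'b::euclidean_space) \<Rightarrow> bool" where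
  "locally_integrable g \<longleftrightarrow> (\<forall>K. compact K \<longrightarrow> g absolutely_integrable_on K)"

definition is_weak_grad :: "(real^'n \<Rightarrow> real) \<Rightarrow> (real^'n \<Rightarrow> real^'n) \<Rightarrow> bool" where
  "is_weak_grad u g \<longleftrightarrow>
     locally_integrable u \<and> locally_integrable g \<and>
     (\<forall>\<phi>\<in>test_functions UNIV. \<forall>i.
        (LINT x|lebesgue. u x * pderiv_at i \<phi> x) = - (LINT x|lebesgue. g x $ i * \<phi> x))"

text \<open>A weak gradient is unique up to null sets; this picks a representative, and is
  meaningful only for weakly differentiable functions.\<close>

definition weak_grad :: "(real^'n \<Rightarrow> real) \<Rightarrow> real^'n \<Rightarrow> real^'n" where
  "weak_grad u = (SOME g. is_weak_grad u g)"

section \<open>The Dirichlet form and its domains\<close>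

text \<open>The sum over \<open>i, j\<close> stands inside the integral: for \<open>u, v\<close> of finite energy the
  single terms need not be integrable, and the Bochner integral of a non-integrable function
  is \<open>0\<close>.\<close>

definition energy :: "(real^'n \<Rightarrow> real^'n^'n) \<Rightarrow> (real^'n \<Rightarrow> real) \<Rightarrow> (real^'n \<Rightarrow> real) \<Rightarrow> real" where
  "energy a u v =
     (LINT x|lebesgue. (\<Sum>i\<in>UNIV. \<Sum>j\<in>UNIV. a x $ i $ j * weak_grad u x $ i * weak_grad v x $ j))"

definition L2_function :: "('a::euclidean_space \<Rightarrow> real) \<Rightarrow> bool" where
  "L2_function u \<longleftrightarrow>
     u \<in> borel_measurable lebesgue \<and> integrable lebesgue (\<lambda>x. (u x)\<^sup>2)"

text \<open>The completion, inside \<open>L\<^sup>2\<close>, of the test functions supported in \<open>U\<close> with respect to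
  \<open>energy a + \<langle>\<cdot>,\<cdot>\<rangle>\<close>: the \<open>L\<^sup>2\<close> limits of sequences that are Cauchy for this form. Its
  elements are functions on the whole space that vanish almost everywhere outside \<open>U\<close>.\<close>

definition form_domain :: "(real^'n \<Rightarrow> real^'n^'n) \<Rightarrow> (real^'n) set \<Rightarrow> (real^'n \<Rightarrow> real) set" where
  "form_domain a U =
     {u. L2_function u \<and>
         (\<exists>\<phi>. (\<forall>n. \<phi> n \<in> test_functions U) \<and>
              (\<lambda>n. LINT x|lebesgue. (\<phi> n x - u x)\<^sup>2) \<longlonglongrightarrow> 0 \<and>
              (\<forall>e>0. \<exists>N::nat. \<forall>m\<ge>N. \<forall>n\<ge>N.
                 energy a (\<lambda>x. \<phi> m x - \<phi> n x) (\<lambda>x. \<phi> m x - \<phi> n x) < e))}"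

definition form_domain_loc :: "(real^'n \<Rightarrow> real^'n^'n) \<Rightarrow> (real^'n \<Rightarrow> real) set" where
  "form_domain_loc a =
     {u. \<forall>y r. 0 < r \<longrightarrow> (\<exists>v\<in>form_domain a UNIV. AE x in lebesgue. x \<in> ball y r \<longrightarrow> u x = v x)}"

definition poisson_solution ::
  "(real^'n \<Rightarrow> real^'n^'n) \<Rightarrow> (real^'n \<Rightarrow> real) \<Rightarrow> (real^'n) set \<Rightarrow> (real^'n \<Rightarrow> real) \<Rightarrow> bool" where
  "poisson_solution a f B u \<longleftrightarrow>
     u \<in> form_domain_loc a \<and>
     (\<forall>\<phi>\<in>form_domain a B. (AE x in lebesgue. 0 \<le> \<phi> x) \<longrightarrow>
        energy a u \<phi> = - (LINT x|lebesgue. (a x *v weak_grad f x) \<bullet> weak_grad \<phi> x))"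

end

theory Submission
  imports Defs
begin

text \<open>
  Moser iteration. By monotonicity of averaged norms \<open>p\<close> and \<open>q\<close> may be taken finite. The weight
  \<open>\<lambda>\<close> degrades the energy to a bound on the gradient in \<open>L\<^sup>r\<close>, \<open>r = 2q/(q + 1)\<close>, whose Sobolev
  exponent is \<open>\<rho>\<close>. As \<open>1/p + 1/q < 2/d\<close> is strict, there is room for an exponent \<open>t\<close> below the Sobolev
  exponent with \<open>\<beta> = t(p - 1)/(2p) > 1\<close>. For such \<open>t\<close> the Sobolev inequality for test functions is
  elementary: \<open>\<bar>\<phi>(x)\<bar>\<close> is at most the integral of \<open>\<bar>\<nabla>\<phi>\<bar>\<close> along a ray from \<open>x\<close>, and one averages over
  the rays and applies Hoelder's inequality.

  Testing the equation with \<open>\<eta>\<^sup>2 G(u)\<close>, where \<open>G = P/(1 + \<epsilon>P)\<close> is a bounded \<open>C\<^sup>1\<close> truncation of the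
  power \<open>P\<close> of the positive part of \<open>u\<close> with exponent \<open>2\<alpha> - 1\<close>, gives a Caccioppoli inequality uniform
  in \<open>\<epsilon>\<close>, hence a reverse Hoelder inequality, which is iterated with \<open>\<alpha>\<close> running through the powers of
  \<open>\<beta>\<close>. The datum contributes the lower powers of the solution from which \<open>\<gamma>\<close> arises. Applying this
  to \<open>u\<close> and \<open>- u\<close> bounds \<open>\<bar>u\<bar>\<close>.
\<close>

section \<open>Smooth functions\<close>

text \<open>The degenerate weight makes the form domain awkward: its elements are known only as
  limits of test functions, whose gradients converge only in the energy. Along a subsequence with
  geometrically small energy increments they converge almost everywhere, because \<open>lam\<close>
  is positive almost everywhere, and this limit is the weak gradient. A truncated power is only C^1,
  so its composition with a test function is not smooth; it is reached through polynomials close to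
  it in C^1 on the range of each approximant. As the solution lies in the form domain only locally,
  it is replaced on the ball by an element \<open>v\<close> of the form domain. The reciprocal of t
  may lie anywhere strictly between 1/r - 1/d, the critical value, and (1 - 1/p)/2, where \<beta> =
  1; the midpoint is taken. With x = 1/\<beta>, the exponent \<kappa> = 1 + x/(1 - x) dominates the
  sum of the reciprocals of the powers of \<beta>, and \<gamma> bounds from below the product of the
  factors 1 - 1/\<beta>^k by which the datum lowers the power of the solution in successive
  steps.\<close>

definition grad :: "(real^'n \<Rightarrow> real) \<Rightarrow> real^'n \<Rightarrow> real^'n" where
  "grad \<phi> x = (\<chi> i. pderiv_at i \<phi> x)"

lemma grad_component [simp]: "grad \<phi> x $ i = pderiv_at i \<phi> x"
  by (simp add: grad_def)

lemma has_derivative_grad: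
  assumes "(\<phi> :: real^'n \<Rightarrow> real) differentiable at x"
  shows "(\<phi> has_derivative (\<lambda>h. grad \<phi> x \<bullet> h)) (at x)"
proof -
  let ?D = "frechet_derivative \<phi> (at x)"
  have D: "(\<phi> has_derivative ?D) (at x)"
    using assms frechet_derivative_works by blast
  then have lin: "linear ?D" by (rule has_derivative_linear)
  have "?D h = grad \<phi> x \<bullet> h" for h
  proof -
    have "?D h = ?D (\<Sum>i\<in>UNIV. h $ i *s axis i 1)"
      using basis_expansion[of h] by simp
    also have "\<dots> = (\<Sum>i\<in>UNIV. h $ i * ?D (axis i 1))"
      by (simp add: linear_sum[OF lin] scalar_mult_eq_scaleR linear_cmul[OF lin])
    also have "\<dots> = grad \<phi> x \<bullet> h"
      by (simp add: inner_vec_def pderiv_at_def mult.commute)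
    finally show ?thesis .
  qed
  then have "?D = (\<lambda>h. grad \<phi> x \<bullet> h)" by auto
  with D show ?thesis by metis
qed

lemma grad_unique:
  assumes "(\<phi> has_derivative (\<lambda>h. g \<bullet> h)) (at x)"
  shows "grad \<phi> x = (g :: real^'n)"
proof -
  have "frechet_derivative \<phi> (at x) = (\<lambda>h. g \<bullet> h)"
    using frechet_derivative_at[OF assms] by simp
  then show ?thesis
    by (simp add: vec_eq_iff pderiv_at_def inner_axis)
qed

section \<open>Closure properties of \<open>Ck\<close>\<close>

lemma differentiable_if_Ck_Suc: "Ck (Suc k) \<phi> \<Longrightarrow> \<phi> differentiable at x"
  by simp

lemma Ck_Suc_imp_Ck: "Ck (Suc k) \<phi> \<Longrightarrow> Ck k \<phi>"
proof (induction k arbitrary: \<phi>)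
  case 0
  then show ?case
    by (auto intro!: differentiable_imp_continuous_on simp: differentiable_on_def
        intro: differentiable_at_withinI)
next
  case (Suc k)
  then show ?case by (metis Ck.simps(2))
qed

text \<open>\<open>Ck\<close> is defined through \<open>frechet_derivative\<close>, a choice
  operator. Uniqueness of derivatives lets any explicit gradient field take its place, so that each
  closure property below is an induction on k with the functions generalised.\<close>

lemma Ck_SucI:
  assumes "\<And>x. (\<phi> has_derivative (\<lambda>h. g x \<bullet> h)) (at x)" "\<And>i. Ck k (\<lambda>x. g x $ i)"
  shows "Ck (Suc k) \<phi>"
proof -
  have "pderiv_at i \<phi> = (\<lambda>x. g x $ i)" for i
    using grad_unique[OF assms(1)] by (metis grad_component)
  then show ?thesis
    using assms by (auto simp: differentiable_def)
qed

lemma Ck_SucD: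
  assumes "Ck (Suc k) \<phi>"
  shows "(\<phi> has_derivative (\<lambda>h. grad \<phi> x \<bullet> h)) (at x)" "Ck k (pderiv_at i \<phi>)"
  using assms by (auto intro: has_derivative_grad)

lemma Ck_const: "Ck k (\<lambda>x. c)"
proof (induction k arbitrary: c)
  case (Suc k)
  show ?case by (rule Ck_SucI[where g="\<lambda>_. 0"]) (auto simp: Suc)
qed simp

lemma Ck_component: "Ck k (\<lambda>x. x $ i)"
proof (cases k)
  case (Suc m)
  show ?thesis unfolding Suc
  proof (rule Ck_SucI[where g="\<lambda>_. axis i 1"])
    have "bounded_linear (\<lambda>x::real^'a. axis i 1 \<bullet> x)"
      by (rule bounded_linear_inner_right)
    then have "((\<lambda>x::real^'a. axis i 1 \<bullet> x) has_derivative (\<lambda>h. axis i 1 \<bullet> h)) (at x)" for x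
      by (rule bounded_linear_imp_has_derivative)
    then show "((\<lambda>x. x $ i) has_derivative (\<lambda>h. axis i 1 \<bullet> h)) (at x)" for x :: "real^'a"
      by (simp add: inner_axis')
  qed (rule Ck_const)
qed (simp add: continuous_on_component)

lemma Ck_add: "Ck k f \<Longrightarrow> Ck k g \<Longrightarrow> Ck k (\<lambda>x. f x + g x)"
proof (induction k arbitrary: f g)
  case 0
  then show ?case by (auto intro: continuous_on_add)
next
  case (Suc k)
  show ?case
  proof (rule Ck_SucI[where g="\<lambda>x. grad f x + grad g x"])
    show "((\<lambda>x. f x + g x) has_derivative (\<lambda>h. (grad f x + grad g x) \<bullet> h)) (at x)" for x
      using Ck_SucD(1)[OF Suc.prems(1), of x] Ck_SucD(1)[OF Suc.prems(2), of x]
      by (auto intro!: derivative_eq_intros simp: inner_add_left)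
  qed (use Suc Ck_SucD(2) in \<open>auto\<close>)
qed

lemma Ck_mult: "Ck k f \<Longrightarrow> Ck k g \<Longrightarrow> Ck k (\<lambda>x. f x * g x)"
proof (induction k arbitrary: f g)
  case 0
  then show ?case by (auto intro: continuous_on_mult)
next
  case (Suc k)
  show ?case
  proof (rule Ck_SucI[where g="\<lambda>x. g x *\<^sub>R grad f x + f x *\<^sub>R grad g x"])
    show "((\<lambda>x. f x * g x) has_derivative (\<lambda>h. (g x *\<^sub>R grad f x + f x *\<^sub>R grad g x) \<bullet> h)) (at x)" for x
      using Ck_SucD(1)[OF Suc.prems(1), of x] Ck_SucD(1)[OF Suc.prems(2), of x]
      by (auto intro!: derivative_eq_intros simp: inner_add_left algebra_simps)
    show "Ck k (\<lambda>x. (g x *\<^sub>R grad f x + f x *\<^sub>R grad g x) $ i)" for i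
      using Ck_SucD(2)[OF Suc.prems(1), of i] Ck_SucD(2)[OF Suc.prems(2), of i]
        Suc.prems[THEN Ck_Suc_imp_Ck]
      by (auto intro!: Ck_add Suc.IH)
  qed
qed

lemma Ck_sum: "(\<And>i. i \<in> I \<Longrightarrow> Ck k (f i)) \<Longrightarrow> Ck k (\<lambda>x. \<Sum>i\<in>I. f i x)"
  by (induction I rule: infinite_finite_induct) (auto intro: Ck_const Ck_add)

lemma Ck_prod: "(\<And>i. i \<in> I \<Longrightarrow> Ck k (f i)) \<Longrightarrow> Ck k (\<lambda>x. \<Prod>i\<in>I. f i x)"
  by (induction I rule: infinite_finite_induct) (auto intro: Ck_const Ck_mult)

lemma Ck_power: "Ck k f \<Longrightarrow> Ck k (\<lambda>x. f x ^ m)"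
  by (induction m) (auto intro: Ck_const Ck_mult)

lemma Ck_cmult: "Ck k f \<Longrightarrow> Ck k (\<lambda>x. c * f x)"
  by (intro Ck_mult Ck_const)

lemma Ck_diff: "Ck k f \<Longrightarrow> Ck k g \<Longrightarrow> Ck k (\<lambda>x. f x - g x)"
  using Ck_add[of k f "\<lambda>x. (-1) * g x"] Ck_cmult[of k g "-1"] by simp

text \<open>The outer function comes with the whole sequence of its derivatives: one differentiation
  replaces D m by D (Suc m), to which the induction hypothesis must apply as well.\<close>

lemma Ck_compose:
  fixes D :: "nat \<Rightarrow> real \<Rightarrow> real"
  assumes D: "\<And>m t. (D m has_real_derivative D (Suc m) t) (at t)"
  shows "Ck k \<phi> \<Longrightarrow> Ck k (\<lambda>x. D m (\<phi> x))"
proof (induction k arbitrary: m)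
  case 0
  have "continuous_on UNIV (D m)"
    using D by (meson DERIV_isCont continuous_at_imp_continuous_on)
  with 0 show ?case by (auto intro: continuous_on_compose2)
next
  case (Suc k)
  show ?case
  proof (rule Ck_SucI[where g="\<lambda>x. D (Suc m) (\<phi> x) *\<^sub>R grad \<phi> x"])
    show "((\<lambda>x. D m (\<phi> x)) has_derivative (\<lambda>h. (D (Suc m) (\<phi> x) *\<^sub>R grad \<phi> x) \<bullet> h)) (at x)" for x
      using has_derivative_compose[OF Ck_SucD(1)[OF Suc.prems, of x]
          D[of m "\<phi> x", unfolded has_field_derivative_def]] by simp
    show "Ck k (\<lambda>x. (D (Suc m) (\<phi> x) *\<^sub>R grad \<phi> x) $ i)" for i
      using Ck_SucD(2)[OF Suc.prems, of i] Suc.IH[OF Ck_Suc_imp_Ck[OF Suc.prems]]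
      by (auto intro!: Ck_mult)
  qed
qed

section \<open>The flat function exp(-1/t) and a smooth step\<close>

definition smooth_bump :: "real \<Rightarrow> real" where
  "smooth_bump t = (if t > 0 then exp (- 1 / t) else 0)"

lemma poly_div_exp_tendsto_0:
  fixes p :: "real poly"
  shows "((\<lambda>x. poly p x * exp (- x)) \<longlongrightarrow> 0) at_top"
proof -
  have "((\<lambda>x. \<Sum>i\<le>degree p. coeff p i * (x ^ i / exp x)) \<longlongrightarrow> (\<Sum>i\<le>degree p. coeff p i * 0)) at_top"
    by (intro tendsto_sum tendsto_mult tendsto_const tendsto_power_div_exp_0)
  then show ?thesis
    by (simp add: poly_altdef sum_divide_distrib exp_minus divide_inverse sum_distrib_right mult.assoc)
qed

text \<open>For t > 0 every derivative is a polynomial in 1/t times exp(-1/t). Exponential decay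
  beats the polynomial, so the extension by 0 is differentiable at 0 with derivative 0, again and
  again.\<close>

lemma smooth_bump_derivatives:
  obtains D :: "nat \<Rightarrow> real \<Rightarrow> real"
  where "D 0 = smooth_bump" "\<And>m t. (D m has_real_derivative D (Suc m) t) (at t)"
proof -
  \<comment> \<open>Differentiating P(1/t) exp(-1/t) gives (1/t)^2 (P - P')(1/t) exp(-1/t);
    \<open>[:0,0,1:]\<close> is the square of the variable.\<close>
  define P :: "nat \<Rightarrow> real poly" where "P = rec_nat 1 (\<lambda>_ p. [:0,0,1:] * (p - pderiv p))"
  have P0: "P 0 = 1" and PS: "P (Suc k) = [:0,0,1:] * (P k - pderiv (P k))" for k
    by (simp_all add: P_def)
  define D where "D k t = (if t > 0 then poly (P k) (1 / t) * exp (- 1 / t) else 0)" for k and t :: real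
  have "(D m has_real_derivative D (Suc m) t) (at t)" for m t
  proof -
    consider "t > 0" | "t < 0" | "t = 0" by linarith
    then show ?thesis
    proof cases
      case 1
      have "((\<lambda>t. poly (P m) (1 / t) * exp (- 1 / t)) has_real_derivative D (Suc m) t) (at t)"
      proof -
        have inv: "((\<lambda>t. 1 / t) has_real_derivative - (1 / t\<^sup>2)) (at t)"
          using 1 DERIV_inverse[of t] by (simp add: divide_inverse power2_eq_square)
        have "((\<lambda>t. - (1 / t)) has_real_derivative 1 / t\<^sup>2) (at t)"
          using DERIV_minus[OF inv] by simp
        then have "((\<lambda>t. exp (- (1 / t))) has_real_derivative exp (- (1 / t)) * (1 / t\<^sup>2)) (at t)"
          by (rule DERIV_chain2[OF DERIV_exp])
        from DERIV_mult[OF DERIV_chain2[OF poly_DERIV[of "P m"] inv] this]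
        have "((\<lambda>t. poly (P m) (1 / t) * exp (- (1 / t))) has_real_derivative
          poly (pderiv (P m)) (1 / t) * - (1 / t\<^sup>2) * exp (- (1 / t))
          + exp (- (1 / t)) * (1 / t\<^sup>2) * poly (P m) (1 / t)) (at t)" .
        also have "poly (pderiv (P m)) (1 / t) * - (1 / t\<^sup>2) * exp (- (1 / t))
          + exp (- (1 / t)) * (1 / t\<^sup>2) * poly (P m) (1 / t) = D (Suc m) t"
          using 1 by (simp add: D_def PS algebra_simps power2_eq_square)
        finally show ?thesis by simp
      qed
      moreover have "\<forall>\<^sub>F x in nhds t. D m x = poly (P m) (1 / x) * exp (- 1 / x)"
        using 1 by (auto simp: D_def eventually_nhds intro!: exI[of _ "{0<..}"])
      ultimately show ?thesis
        by (subst DERIV_cong_ev[OF refl _ refl]) auto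
    next
      case 2
      have "\<forall>\<^sub>F x in nhds t. D m x = 0"
        using 2 by (auto simp: D_def eventually_nhds intro!: exI[of _ "{..<0}"])
      then show ?thesis
        using 2 by (subst DERIV_cong_ev[OF refl _ refl, of _ "\<lambda>_. 0"]) (auto simp: D_def)
    next
      case 3
      \<comment> \<open>With z = 1/h the difference quotient D m h / h at 0 becomes z P(z) exp(-z),
        whose limit at infinity is 0.\<close>
      have "((\<lambda>x. poly ([:0,1:] * P m) x * exp (- x)) \<longlongrightarrow> 0) at_top"
        by (rule poly_div_exp_tendsto_0)
      then have "((\<lambda>h. poly ([:0,1:] * P m) (inverse h) * exp (- inverse h)) \<longlongrightarrow> 0) (at_right 0)"
        by (rule filterlim_compose) (rule filterlim_inverse_at_top_right)
      then have R: "((\<lambda>h. D m h / h) \<longlongrightarrow> 0) (at_right 0)"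
        by (rule Lim_transform_eventually)
          (auto simp: D_def eventually_at_filter field_simps)
      have L: "((\<lambda>h. D m h / h) \<longlongrightarrow> 0) (at_left 0)"
        by (rule Lim_transform_eventually[where f="\<lambda>_. 0"])
          (auto simp: D_def eventually_at_filter)
      have "((\<lambda>h. D m h / h) \<longlongrightarrow> 0) (at 0)"
        using R L filterlim_split_at by blast
      with 3 show ?thesis
        by (simp add: DERIV_def D_def)
    qed
  qed
  moreover have "D 0 = smooth_bump"
    by (auto simp: D_def P0 smooth_bump_def)
  ultimately show ?thesis using that by blast
qed

lemma Ck_smooth_bump:
  assumes "Ck k \<phi>"
  shows "Ck k (\<lambda>x. smooth_bump (\<phi> x))"
proof -
  obtain D where D0: "D 0 = smooth_bump" and D: "\<And>m t. (D m has_real_derivative D (Suc m) t) (at t)"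
    using smooth_bump_derivatives by blast
  from Ck_compose[of D, OF D assms, of 0] show ?thesis by (simp add: D0)
qed

lemma smooth_bump_nonneg [simp]: "0 \<le> smooth_bump t"
  by (cases "0 < t") (simp_all add: smooth_bump_def)

lemma smooth_bump_le_1: "smooth_bump t \<le> 1"
  by (cases "0 < t") (simp_all add: smooth_bump_def)

lemma smooth_bump_eq_0_iff [simp]: "smooth_bump t = 0 \<longleftrightarrow> t \<le> 0"
  by (cases "0 < t") (simp_all add: smooth_bump_def)

lemma smooth_bump_pos_iff [simp]: "0 < smooth_bump t \<longleftrightarrow> 0 < t"
  by (cases "0 < t") (simp_all add: smooth_bump_def)

lemma smooth_bump_mono: "s \<le> t \<Longrightarrow> smooth_bump s \<le> smooth_bump t"
proof (cases "0 < s")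
  case True
  assume "s \<le> t"
  then have "- 1 / s \<le> - 1 / t" using True by (simp add: frac_le)
  then show ?thesis using True \<open>s \<le> t\<close> by (simp add: smooth_bump_def)
qed (simp add: smooth_bump_def)

lemma tendsto_smooth_bump_at_top: "(smooth_bump \<longlongrightarrow> 1) at_top"
proof -
  have "((\<lambda>t::real. exp (- inverse t)) \<longlongrightarrow> exp (- 0)) at_top"
    by (rule tendsto_exp[OF tendsto_minus[OF tendsto_inverse_0_at_top[OF filterlim_ident]]])
  then have "((\<lambda>t::real. exp (- inverse t)) \<longlongrightarrow> 1) at_top" by simp
  then show ?thesis
  proof (rule Lim_transform_eventually)
    show "\<forall>\<^sub>F t in at_top. exp (- inverse t) = smooth_bump t"
      using eventually_gt_at_top[of 0]
      by (rule eventually_mono) (simp add: smooth_bump_def inverse_eq_divide)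
  qed
qed

text \<open>The step is the bump composed with itself: \<open>\<theta> - smooth_bump t\<close>
  equals \<theta> for t \<le> 0 and is nonpositive for t \<ge> 1, because \<theta> is the value of
  the bump at 1. The derivative is bounded since it is continuous on [0,1] and vanishes outside,
  where S is locally constant.\<close>

lemma smooth_step_exists:
  obtains S S' :: "real \<Rightarrow> real" and K :: real where
    "\<And>k \<phi>. Ck k (\<phi> :: real^'n \<Rightarrow> real) \<Longrightarrow> Ck k (\<lambda>x. S (\<phi> x))"
    "\<And>t. 0 \<le> S t" "\<And>t. S t \<le> 1" "\<And>t. t \<le> 0 \<Longrightarrow> S t = 1" "\<And>t. t \<ge> 1 \<Longrightarrow> S t = 0"
    "\<And>t. (S has_real_derivative S' t) (at t)" "\<And>t. \<bar>S' t\<bar> \<le> K" "0 < K"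
proof -
  obtain D where D0: "D 0 = smooth_bump" and D: "\<And>m t. (D m has_real_derivative D (Suc m) t) (at t)"
    using smooth_bump_derivatives by blast
  define \<theta> where "\<theta> = smooth_bump 1"
  have \<theta>: "0 < \<theta>" by (simp add: \<theta>_def)
  define S where "S t = smooth_bump (\<theta> - smooth_bump t) / smooth_bump \<theta>" for t
  define S' where "S' t = - D 1 (\<theta> - smooth_bump t) * D 1 t / smooth_bump \<theta>" for t
  have D1: "(smooth_bump has_real_derivative D 1 t) (at t)" for t
    using D[of 0 t] D0 by simp
  have der: "(S has_real_derivative S' t) (at t)" for t
  proof -
    have "((\<lambda>t. \<theta> - smooth_bump t) has_real_derivative - D 1 t) (at t)"
      using DERIV_diff[OF DERIV_const D1] by simp
    from DERIV_chain2[OF D1 this]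
    have "((\<lambda>t. smooth_bump (\<theta> - smooth_bump t)) has_real_derivative
      D 1 (\<theta> - smooth_bump t) * - D 1 t) (at t)" .
    from DERIV_cdivide[OF this, of "smooth_bump \<theta>"] show ?thesis
      unfolding S_def[abs_def] S'_def by simp
  qed
  have cD: "continuous_on UNIV (D m)" for m
    using D by (meson DERIV_isCont continuous_at_imp_continuous_on)
  have cD': "continuous_on UNIV (\<lambda>t. D 1 (\<theta> - smooth_bump t))"
    using cD[of 0] D0 by (intro continuous_on_compose2[OF cD[of 1]] continuous_on_diff continuous_on_const) auto
  have cS': "continuous_on {0..1} S'"
  proof -
    have "continuous_on UNIV S'"
      unfolding S'_def[abs_def] divide_inverse
      by (rule continuous_on_mult[OF continuous_on_mult[OF continuous_on_minus[OF cD'] cD] continuous_on_const])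
    then show ?thesis by (rule continuous_on_subset) simp
  qed
  obtain K0 where K0: "\<And>t. t \<in> {0..1} \<Longrightarrow> \<bar>S' t\<bar> \<le> K0"
    using compact_imp_bounded[OF compact_continuous_image[OF cS' compact_Icc]]
    unfolding bounded_iff by (metis imageI real_norm_def)
  have S1: "S t = 1" if "t \<le> 0" for t
  proof -
    have "smooth_bump t = 0" using that by (rule smooth_bump_eq_0_iff[THEN iffD2])
    then have "S t = smooth_bump (\<theta> - 0) / smooth_bump \<theta>" unfolding S_def by metis
    also have "\<dots> = 1" using smooth_bump_eq_0_iff[of \<theta>] \<theta> by simp
    finally show ?thesis .
  qed
  have S0: "S t = 0" if "t \<ge> 1" for t
  proof -
    have "\<theta> - smooth_bump t \<le> 0" using smooth_bump_mono[OF that] unfolding \<theta>_def by linarith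
    from smooth_bump_eq_0_iff[THEN iffD2, OF this] show ?thesis unfolding S_def by (metis div_0)
  qed
  have out: "S' t = 0" if "t < 0 \<or> t > 1" for t
  proof -
    have "\<exists>c. \<forall>\<^sub>F x in nhds t. S x = c"
    proof (cases "t < 0")
      case True
      then show ?thesis
        by (intro exI[of _ 1]) (auto simp: eventually_nhds S1 intro!: exI[of _ "{..<0}"])
    next
      case False
      then show ?thesis using that
        by (intro exI[of _ 0]) (auto simp: eventually_nhds S0 intro!: exI[of _ "{1<..}"])
    qed
    then obtain c where "\<forall>\<^sub>F x in nhds t. S x = c" by blast
    then have "(S has_real_derivative 0) (at t)"
      by (subst DERIV_cong_ev[OF refl _ refl]) auto
    with der[of t] show ?thesis using DERIV_unique by blast
  qed
  show ?thesis
  proof (rule that[of S S' "\<bar>K0\<bar> + 1"])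
    show "Ck k (\<lambda>x. S (\<phi> x))" if "Ck k \<phi>" for k and \<phi> :: "real^'n \<Rightarrow> real"
      using Ck_cmult[OF Ck_smooth_bump[OF Ck_diff[OF Ck_const Ck_smooth_bump[OF that]]],
          of "1 / smooth_bump \<theta>" \<theta>] by (simp add: S_def)
    show "0 \<le> S t" for t unfolding S_def by (intro divide_nonneg_nonneg smooth_bump_nonneg)
    show "S t \<le> 1" for t
    proof -
      have "smooth_bump (\<theta> - smooth_bump t) \<le> smooth_bump \<theta>" by (rule smooth_bump_mono) simp
      moreover have "0 < smooth_bump \<theta>" using \<theta> smooth_bump_pos_iff by blast
      ultimately show ?thesis unfolding S_def by simp
    qed
    show "\<bar>S' t\<bar> \<le> \<bar>K0\<bar> + 1" for t
    proof (cases "t \<in> {0..1}")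
      case True
      then show ?thesis using K0 by fastforce
    next
      case False
      then have "S' t = 0" by (intro out) auto
      then show ?thesis by simp
    qed
    show "0 < \<bar>K0\<bar> + 1" by simp
  qed (fact der S0 S1)+
qed

section \<open>Test functions\<close>

lemma test_functions_Ck: "\<phi> \<in> test_functions U \<Longrightarrow> Ck k \<phi>"
  by (simp add: test_functions_def)

lemma test_functions_mono: "U \<subseteq> V \<Longrightarrow> \<phi> \<in> test_functions U \<Longrightarrow> \<phi> \<in> test_functions V"
  by (auto simp: test_functions_def)

lemma test_functionsI:
  assumes "\<And>k. Ck k \<phi>" "compact K" "K \<subseteq> U" "\<And>x. x \<notin> K \<Longrightarrow> \<phi> x = 0"
  shows "\<phi> \<in> test_functions U"
proof -
  have "closure {x. \<phi> x \<noteq> 0} \<subseteq> K"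
    using assms by (intro closure_minimal) (auto intro: compact_imp_closed)
  moreover from this have "compact (closure {x. \<phi> x \<noteq> 0})"
    using assms(2) by (metis closed_closure compact_Int_closed inf.absorb_iff2)
  ultimately show ?thesis using assms by (auto simp: test_functions_def)
qed

lemma grad_eq_0_if_locally_0:
  assumes "open S" "x \<in> S" "\<And>y. y \<in> S \<Longrightarrow> \<phi> y = 0"
  shows "grad \<phi> x = 0"
proof (rule grad_unique)
  have "((\<lambda>_. 0) has_derivative (\<lambda>h. 0 \<bullet> h)) (at x)" by simp
  then show "(\<phi> has_derivative (\<lambda>h. 0 \<bullet> h)) (at x)"
    by (rule has_derivative_transform_within_open[OF _ assms(1,2)]) (simp add: assms(3))
qed

lemma test_functionsE:
  assumes "\<phi> \<in> test_functions U"
  obtains K where "compact K" "K \<subseteq> U" "\<And>x. x \<notin> K \<Longrightarrow> \<phi> x = 0"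
    "\<And>x. x \<notin> K \<Longrightarrow> grad \<phi> x = 0"
proof -
  define K where "K = closure {x. \<phi> x \<noteq> 0}"
  have z: "\<phi> x = 0" if "x \<notin> K" for x
  proof (rule ccontr)
    assume "\<phi> x \<noteq> 0"
    then have "x \<in> {x. \<phi> x \<noteq> 0}" by simp
    then show False using that closure_subset unfolding K_def by (metis subsetD)
  qed
  have "grad \<phi> x = 0" if "x \<notin> K" for x
  proof (rule grad_eq_0_if_locally_0[where S="- K"])
    show "open (- K)" unfolding K_def by (simp add: open_Compl)
  qed (use that z in blast)+
  moreover have "compact K" "K \<subseteq> U" using assms by (simp_all add: test_functions_def K_def)
  ultimately show ?thesis using that z by blast
qed

lemma test_functions_differentiable: "\<phi> \<in> test_functions U \<Longrightarrow> \<phi> differentiable at x"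
  using test_functions_Ck[of \<phi> U "Suc 0"] by simp

lemma test_functions_has_derivative:
  "\<phi> \<in> test_functions U \<Longrightarrow> (\<phi> has_derivative (\<lambda>h. grad \<phi> x \<bullet> h)) (at x)"
  by (intro has_derivative_grad test_functions_differentiable)

lemma test_functions_continuous: "\<phi> \<in> test_functions U \<Longrightarrow> continuous_on UNIV \<phi>"
  using test_functions_Ck[of \<phi> U 0] by simp

lemma test_functions_pderiv_continuous: "\<phi> \<in> test_functions U \<Longrightarrow> continuous_on UNIV (pderiv_at i \<phi>)"
  using test_functions_Ck[of \<phi> U "Suc 0"] by simp

lemma test_functions_grad_continuous:
  assumes "\<phi> \<in> test_functions U"
  shows "continuous_on UNIV (grad \<phi>)"
  unfolding grad_def[abs_def]
  by (intro continuous_on_vec_lambda test_functions_pderiv_continuous[OF assms])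

lemma test_functions_measurable:
  assumes "\<phi> \<in> test_functions U"
  shows "\<phi> \<in> borel_measurable borel" "grad \<phi> \<in> borel_measurable borel"
    "pderiv_at i \<phi> \<in> borel_measurable borel"
  by (intro borel_measurable_continuous_onI test_functions_continuous[OF assms]
      test_functions_grad_continuous[OF assms] test_functions_pderiv_continuous[OF assms])+

lemma measurable_lebesgueI: "f \<in> borel_measurable borel \<Longrightarrow> f \<in> borel_measurable lebesgue"
  by (rule measurable_completion) simp

lemma test_functions_measurable_lebesgue:
  assumes "\<phi> \<in> test_functions U"
  shows "\<phi> \<in> borel_measurable lebesgue" "grad \<phi> \<in> borel_measurable lebesgue"
    "pderiv_at i \<phi> \<in> borel_measurable lebesgue"
  by (auto intro: measurable_lebesgueI test_functions_measurable assms)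

lemma bounded_if_continuous_compact_support:
  fixes f :: "'a::topological_space \<Rightarrow> 'b::real_normed_vector"
  assumes "continuous_on UNIV f" "compact K" "\<And>x. x \<notin> K \<Longrightarrow> f x = 0"
  obtains M where "M > 0" "\<And>x. norm (f x) \<le> M"
proof -
  have "bounded (f ` K)"
    using assms by (intro compact_imp_bounded compact_continuous_image) (auto intro: continuous_on_subset)
  then obtain M where "M > 0" "\<And>x. x \<in> K \<Longrightarrow> norm (f x) \<le> M"
    unfolding bounded_pos by (metis imageI)
  with assms(3) that[of M] show ?thesis by (metis less_imp_le norm_zero)
qed

lemma test_functions_bounded:
  assumes "\<phi> \<in> test_functions U"
  obtains M where "M > 0" "\<And>x. \<bar>\<phi> x\<bar> \<le> M" "\<And>x. norm (grad \<phi> x) \<le> M"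
proof -
  obtain K where K: "compact K" "\<And>x. x \<notin> K \<Longrightarrow> \<phi> x = 0" "\<And>x. x \<notin> K \<Longrightarrow> grad \<phi> x = 0"
    using test_functionsE[OF assms] by metis
  obtain M1 where M1: "M1 > 0" "\<And>x. norm (\<phi> x) \<le> M1"
    using bounded_if_continuous_compact_support[OF test_functions_continuous[OF assms] K(1,2)] by blast
  obtain M2 where M2: "M2 > 0" "\<And>x. norm (grad \<phi> x) \<le> M2"
    using bounded_if_continuous_compact_support[OF test_functions_grad_continuous[OF assms] K(1,3)] by blast
  have "\<bar>\<phi> x\<bar> \<le> max M1 M2" "norm (grad \<phi> x) \<le> max M1 M2" for x
    using M1(2)[of x] M2(2)[of x] by auto
  with that[of "max M1 M2"] M1(1) show ?thesis by auto
qed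

lemma test_functions_mult:
  assumes "\<phi> \<in> test_functions U" "\<And>k. Ck k \<psi>"
  shows "(\<lambda>x. \<phi> x * \<psi> x) \<in> test_functions U"
proof -
  obtain K where "compact K" "K \<subseteq> U" "\<And>x. x \<notin> K \<Longrightarrow> \<phi> x = 0"
    using test_functionsE[OF assms(1)] by metis
  then show ?thesis
    by (intro test_functionsI[where K=K] Ck_mult test_functions_Ck[OF assms(1)] assms(2)) auto
qed

lemma test_functions_diff:
  assumes "\<phi> \<in> test_functions U" "\<psi> \<in> test_functions U"
  shows "(\<lambda>x. \<phi> x - \<psi> x) \<in> test_functions U"
proof -
  obtain K where "compact K" "K \<subseteq> U" "\<And>x. x \<notin> K \<Longrightarrow> \<phi> x = 0"
    using test_functionsE[OF assms(1)] by metis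
  moreover obtain L where "compact L" "L \<subseteq> U" "\<And>x. x \<notin> L \<Longrightarrow> \<psi> x = 0"
    using test_functionsE[OF assms(2)] by metis
  ultimately show ?thesis
    by (intro test_functionsI[where K="K \<union> L"] Ck_diff test_functions_Ck[OF assms(1)] test_functions_Ck[OF assms(2)])
      (auto intro: compact_Un)
qed

lemma grad_mult:
  assumes "\<phi> differentiable at x" "\<psi> differentiable at x"
  shows "grad (\<lambda>x. \<phi> x * \<psi> x) x = \<phi> x *\<^sub>R grad \<psi> x + \<psi> x *\<^sub>R grad \<phi> x"
  by (rule grad_unique)
    (use has_derivative_mult[OF assms[THEN has_derivative_grad]] in
      \<open>simp add: inner_add_left algebra_simps\<close>)

lemma grad_diff:
  assumes "\<phi> differentiable at x" "\<psi> differentiable at x"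
  shows "grad (\<lambda>x. \<phi> x - \<psi> x) x = grad \<phi> x - grad \<psi> x"
  by (rule grad_unique)
    (use has_derivative_diff[OF assms[THEN has_derivative_grad]] in
      \<open>simp add: inner_diff_left\<close>)

lemma grad_compose:
  assumes "\<phi> differentiable at x" "(P has_real_derivative P') (at (\<phi> x))"
  shows "grad (\<lambda>x. P (\<phi> x)) x = P' *\<^sub>R grad \<phi> x"
  by (rule grad_unique)
    (use has_derivative_compose[OF has_derivative_grad[OF assms(1)]
        assms(2)[unfolded has_field_derivative_def]] in simp)

text \<open>The step is applied to an affine function of the squared distance to the centre, a
  polynomial and hence smooth also at the centre. The constant does not depend on the centre or the
  radii, which makes the dependence of the final estimate on \<sigma> - \<sigma>' explicit.\<close>

lemma cutoff_exists:
  obtains C where "C > 0"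
    "\<And>(x0::real^'n) s t. 0 < s \<Longrightarrow> s < t \<Longrightarrow> \<exists>\<eta>\<in>test_functions (ball x0 t).
       (\<forall>x. 0 \<le> \<eta> x \<and> \<eta> x \<le> 1 \<and> norm (grad \<eta> x) \<le> C / (t - s)) \<and> (\<forall>x\<in>ball x0 s. \<eta> x = 1)"
proof -
  obtain S S' :: "real \<Rightarrow> real" and K :: real where S:
    "\<And>k \<phi>. Ck k (\<phi> :: real^'n \<Rightarrow> real) \<Longrightarrow> Ck k (\<lambda>x. S (\<phi> x))"
    "\<And>t. 0 \<le> S t" "\<And>t. S t \<le> 1" "\<And>t. t \<le> 0 \<Longrightarrow> S t = 1" "\<And>t. t \<ge> 1 \<Longrightarrow> S t = 0"
    "\<And>t. (S has_real_derivative S' t) (at t)" "\<And>t. \<bar>S' t\<bar> \<le> K" "0 < K"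
    using smooth_step_exists[where 'n='n] by blast
  show ?thesis
  proof (rule that[of "4 * K"])
    fix x0 :: "real^'n" and s t :: real
    assume st: "0 < s" "s < t"
    \<comment> \<open>The transition ends at the midpoint, so that the support is a closed ball
      inside the open one.\<close>
    define t' where "t' = (s + t) / 2"
    have t': "s < t'" "t' < t" "0 < t'" using st by (auto simp: t'_def)
    define c where "c = t'\<^sup>2 - s\<^sup>2"
    have c: "c > 0" using t' st by (simp add: c_def power_strict_mono)
    define N where "N x = ((x - x0) \<bullet> (x - x0) - s\<^sup>2) / c" for x
    have N_Ck: "Ck k N" for k
    proof -
      have "Ck k (\<lambda>x. (1 / c) * ((\<Sum>i\<in>UNIV. (x $ i - x0 $ i) * (x $ i - x0 $ i)) - s\<^sup>2))"
        by (intro Ck_cmult Ck_diff Ck_sum Ck_mult Ck_component Ck_const)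
      then show ?thesis by (simp add: N_def[abs_def] inner_vec_def)
    qed
    have gN: "(N has_derivative (\<lambda>h. ((2 / c) *\<^sub>R (x - x0)) \<bullet> h)) (at x)" for x
    proof -
      have "((\<lambda>x. x - x0) has_derivative (\<lambda>h. h - 0)) (at x)"
        by (rule has_derivative_diff[OF has_derivative_ident has_derivative_const])
      then have "((\<lambda>x. x - x0) has_derivative (\<lambda>h. h)) (at x)" by simp
      from has_derivative_mult_right[OF has_derivative_diff[OF has_derivative_inner[OF this this]
          has_derivative_const[of "s\<^sup>2"]], of "1 / c"]
      have "(N has_derivative (\<lambda>h. 1 / c * ((x - x0) \<bullet> h + h \<bullet> (x - x0) - 0))) (at x)"
        unfolding N_def[abs_def] by simp
      also have "(\<lambda>h. 1 / c * ((x - x0) \<bullet> h + h \<bullet> (x - x0) - 0)) = (\<lambda>h. ((2 / c) *\<^sub>R (x - x0)) \<bullet> h)"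
        by (rule ext) (simp add: inner_commute)
      finally show ?thesis .
    qed
    define \<eta> where "\<eta> x = S (N x)" for x
    have N0: "N x \<le> 0" if "x \<in> ball x0 s" for x
    proof -
      have "(norm (x - x0))\<^sup>2 \<le> s\<^sup>2"
        using that st by (intro power_mono) (auto simp: dist_norm norm_minus_commute)
      then show ?thesis using c unfolding N_def by (simp add: power2_norm_eq_inner divide_le_0_iff)
    qed
    have N1: "N x \<ge> 1" if "x \<notin> cball x0 t'" for x
    proof -
      have "t'\<^sup>2 \<le> (norm (x - x0))\<^sup>2"
        using that t' by (intro power_mono) (auto simp: dist_norm norm_minus_commute)
      then show ?thesis using c unfolding N_def by (simp add: power2_norm_eq_inner c_def)
    qed
    have test: "\<eta> \<in> test_functions (ball x0 t)"
    proof (rule test_functionsI)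
      show "Ck k \<eta>" for k unfolding \<eta>_def[abs_def] by (rule S(1)[OF N_Ck])
      show "cball x0 t' \<subseteq> ball x0 t" using t' by auto
    qed (use S(5) N1 in \<open>auto simp: \<eta>_def\<close>)
    have g: "grad \<eta> x = S' (N x) *\<^sub>R (2 / c) *\<^sub>R (x - x0)" for x
    proof -
      have "grad \<eta> x = S' (N x) *\<^sub>R grad N x"
        unfolding \<eta>_def[abs_def] by (rule grad_compose[OF _ S(6)]) (use gN differentiable_def in blast)
      then show ?thesis by (simp add: grad_unique[OF gN])
    qed
    \<comment> \<open>Vanishing of S' at these values is not among the listed properties of the
      step; it is read off from the gradient of \<eta>, which is 0 on the open complement of the
      closed ball.\<close>
    have out: "S' (N x) = 0" if "x \<notin> cball x0 t'" for x
    proof -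

      have "grad \<eta> x = 0"
        by (rule grad_eq_0_if_locally_0[where S="- cball x0 t'"])
          (use that S(5)[OF N1] in \<open>simp_all add: open_Compl \<eta>_def\<close>)
      moreover have "x \<noteq> x0" using that t' by auto
      ultimately show ?thesis using g[of x] c by simp
    qed
    have "norm (grad \<eta> x) \<le> 4 * K / (t - s)" for x
    proof (cases "x \<in> cball x0 t'")
      case True
      then have n: "norm (x - x0) \<le> t'" by (simp add: dist_norm norm_minus_commute)
      have "norm (grad \<eta> x) = \<bar>S' (N x)\<bar> * (2 / c) * norm (x - x0)"
        using c by (simp add: g abs_mult)
      also have "\<dots> \<le> K * (2 / c) * t'"
        using S(7,8) n c by (intro mult_mono) auto
      \<comment> \<open>Enlarging t' to t' + s cancels one factor of c = (t' - s)(t' + s), and t' -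
        s is half of t - s.\<close>
      also have "\<dots> \<le> K * (2 / c) * (t' + s)" using S(8) c st by (intro mult_left_mono) auto
      also have "\<dots> = 4 * K / (t - s)"
      proof -
        have "c = (t' + s) * ((t - s) / 2)" by (simp add: c_def t'_def power2_eq_square field_simps)
        moreover have "K * (2 / (A * (D / 2))) * A = 4 * K / D" if "A > 0" "D > 0" for A D
          using that by (simp add: field_simps)
        ultimately show ?thesis using t' st by (metis add_pos_pos diff_gt_0_iff_gt)
      qed
      finally show ?thesis .
    next
      case False
      then show ?thesis using out g S(8) st by simp
    qed
    then show "\<exists>\<eta>\<in>test_functions (ball x0 t).
       (\<forall>x. 0 \<le> \<eta> x \<and> \<eta> x \<le> 1 \<and> norm (grad \<eta> x) \<le> 4 * K / (t - s)) \<and> (\<forall>x\<in>ball x0 s. \<eta> x = 1)"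
      using test N0 S by (intro bexI[of _ \<eta>]) (auto simp: \<eta>_def)
  qed (use S in auto)
qed

section \<open>Weak gradients\<close>

lemma locally_integrableD:
  assumes "locally_integrable f" "compact K"
  shows "integrable lebesgue (\<lambda>x. indicator K x *\<^sub>R f x)"
  using assms unfolding locally_integrable_def set_integrable_def by blast

lemma integrable_locally_integrable_mult:
  fixes f :: "'a::euclidean_space \<Rightarrow> real"
  assumes "locally_integrable f" "compact K" "h \<in> borel_measurable lebesgue"
    "\<And>x. \<bar>h x\<bar> \<le> M" "\<And>x. x \<notin> K \<Longrightarrow> h x = 0"
  shows "integrable lebesgue (\<lambda>x. f x * h x)"
proof -
  have i: "integrable lebesgue (\<lambda>x. indicator K x *\<^sub>R f x)"
    using assms(1,2) unfolding locally_integrable_def set_integrable_def by blast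
  have M: "0 \<le> M" using assms(4)[of undefined] by linarith
  have eq: "f x * h x = (indicator K x *\<^sub>R f x) * h x" for x
    using assms(5) by (cases "x \<in> K") auto
  have "integrable lebesgue (\<lambda>x. (indicator K x *\<^sub>R f x) * h x)"
  proof (rule Bochner_Integration.integrable_bound)
    show "integrable lebesgue (\<lambda>x. M * (indicator K x *\<^sub>R f x))"
      using i by (rule integrable_mult_right)
    show "(\<lambda>x. (indicator K x *\<^sub>R f x) * h x) \<in> borel_measurable lebesgue"
      using i assms(3) by (intro borel_measurable_times) auto
    show "AE x in lebesgue. norm ((indicator K x *\<^sub>R f x) * h x) \<le> norm (M * (indicator K x *\<^sub>R f x))"
    proof (rule AE_I2)
      fix x
      show "norm ((indicator K x *\<^sub>R f x) * h x) \<le> norm (M * (indicator K x *\<^sub>R f x))"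
        using mult_left_mono[OF assms(4)[of x], of "\<bar>indicator K x *\<^sub>R f x\<bar>"] M
        by (simp add: abs_mult mult.commute)
    qed
  qed
  then show ?thesis by (simp only: eq)
qed

lemma locally_integrable_const: "locally_integrable (\<lambda>_. c :: real)"
  unfolding locally_integrable_def
  by (simp add: absolutely_integrable_on_const lmeasurable_compact)

lemma integrable_bounded_compact_support:
  fixes h :: "'a::euclidean_space \<Rightarrow> real"
  assumes "compact K" "h \<in> borel_measurable lebesgue"
    "\<And>x. \<bar>h x\<bar> \<le> M" "\<And>x. x \<notin> K \<Longrightarrow> h x = 0"
  shows "integrable lebesgue h"
  using integrable_locally_integrable_mult[OF locally_integrable_const assms, of 1] by simp

lemma locally_integrable_measurable:
  fixes f :: "'a::euclidean_space \<Rightarrow> 'b::euclidean_space"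
  assumes "locally_integrable f"
  shows "f \<in> borel_measurable lebesgue"
proof (rule borel_measurable_LIMSEQ_metric)
  fix i :: nat
  show "(\<lambda>x. indicator (cball 0 (real i)) x *\<^sub>R f x) \<in> borel_measurable lebesgue"
    using assms unfolding locally_integrable_def set_integrable_def
    by (meson borel_measurable_integrable compact_cball)
next
  fix x :: 'a
  obtain N :: nat where N: "norm x \<le> real N" using real_arch_simple by blast
  have "(\<lambda>_. f x) \<longlonglongrightarrow> f x" by simp
  then show "(\<lambda>i. indicator (cball 0 (real i)) x *\<^sub>R f x) \<longlonglongrightarrow> f x"
    by (rule Lim_transform_eventually)
      (use N in \<open>auto simp: eventually_sequentially intro!: exI[of _ N]\<close>)
qed

section \<open>Integration by parts for test functions\<close>

text \<open>By translation invariance every difference quotient has integral 0. The quotients are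
  bounded by the Lipschitz constant and live on a common ball, so dominated convergence carries this
  over to the derivative.\<close>

lemma integral_pderiv_eq_0:
  fixes \<phi> :: "real^'n \<Rightarrow> real"
  assumes "\<phi> \<in> test_functions U"
  shows "(LINT x|lebesgue. pderiv_at i \<phi> x) = 0"
proof -
  obtain K where K: "compact K" "\<And>x. x \<notin> K \<Longrightarrow> \<phi> x = 0"
    using test_functionsE[OF assms] by metis
  obtain M where M: "M > 0" "\<And>x. \<bar>\<phi> x\<bar> \<le> M" "\<And>x. norm (grad \<phi> x) \<le> M"
    using test_functions_bounded[OF assms] by metis
  obtain r where r: "K \<subseteq> ball 0 r"
    using K(1) compact_imp_bounded bounded_subset_ballD by blast
  let ?e = "axis i (1::real)"
  define h where "h n = 1 / real (Suc n)" for n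
  have h: "0 < h n" "h n \<le> 1" for n by (simp_all add: h_def)
  define D where "D n x = (\<phi> (h n *\<^sub>R ?e + x) - \<phi> x) / h n" for n x
  have mphi: "\<phi> \<in> borel_measurable borel" using test_functions_measurable(1)[OF assms] .
  have mshift: "(\<lambda>x. \<phi> (c + x)) \<in> borel_measurable borel" for c
    by (rule measurable_compose[OF _ mphi]) simp
  have Dm: "D n \<in> borel_measurable borel" for n
    unfolding D_def[abs_def] using mphi mshift by (intro borel_measurable_divide borel_measurable_diff) auto
  have int: "integrable lborel \<phi>"
  proof -
    have "integrable lebesgue \<phi>"
      by (rule integrable_bounded_compact_support[OF K(1) measurable_lebesgueI[OF mphi] M(2)])
        (simp add: K(2))
    then show ?thesis by (subst (asm) integrable_completion) (use mphi in auto)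
  qed
  have shift: "integrable lborel (\<lambda>x. \<phi> (c + x))"
    "(LINT x|lborel. \<phi> (c + x)) = (LINT x|lborel. \<phi> x)" for c
    using int integrable_distr_eq[of "(+) c" lborel borel \<phi>] integral_distr[of "(+) c" lborel borel \<phi>] mphi
    by (auto simp: lborel_distr_plus)
  have D0: "(LINT x|lborel. D n x) = 0" for n
    unfolding D_def using shift[of "h n *\<^sub>R ?e"] int by simp
  have lip: "\<bar>\<phi> y - \<phi> x\<bar> \<le> M * norm (y - x)" for x y
  proof -
    have "norm (\<phi> y - \<phi> x) \<le> M * norm (y - x)"
    proof (rule differentiable_bound[of UNIV])
      show "(\<phi> has_derivative (\<lambda>h. grad \<phi> z \<bullet> h)) (at z within UNIV)" for z
        using test_functions_has_derivative[OF assms] by simp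
      show "onorm (\<lambda>h. grad \<phi> z \<bullet> h) \<le> M" for z
      proof (rule onorm_le)
        fix x
        have "norm (grad \<phi> z \<bullet> x) \<le> norm (grad \<phi> z) * norm x" by (simp add: Cauchy_Schwarz_ineq2)
        also have "\<dots> \<le> M * norm x" using M(3) by (intro mult_right_mono) auto
        finally show "norm (grad \<phi> z \<bullet> x) \<le> M * norm x" .
      qed
    qed auto
    then show ?thesis by simp
  qed
  \<comment> \<open>The steps have length at most 1, so enlarging the radius by 1 captures the
    supports of all quotients.\<close>
  have Dbound: "norm (D n x) \<le> M * indicator (ball 0 (r + 1)) x" for n x
  proof (cases "x \<in> ball 0 (r + 1)")
    case True
    have "\<bar>\<phi> (h n *\<^sub>R ?e + x) - \<phi> x\<bar> \<le> M * norm (h n *\<^sub>R ?e)"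
      using lip[of "h n *\<^sub>R ?e + x" x] by simp
    also have "\<dots> = M * h n" using h[of n] by simp
    finally show ?thesis using h[of n] True by (simp add: D_def field_simps)
  next
    case False
    have "x \<notin> K" using False r by auto
    moreover have "h n *\<^sub>R ?e + x \<notin> K"
    proof
      assume "h n *\<^sub>R ?e + x \<in> K"
      then have "norm (h n *\<^sub>R ?e + x) < r" using r by auto
      moreover have "norm x \<le> norm (h n *\<^sub>R ?e + x) + norm (h n *\<^sub>R ?e)"
        by (metis add_diff_cancel_left' norm_triangle_ineq4)
      ultimately show False using False h[of n] by simp
    qed
    ultimately show ?thesis using False K(2) by (simp add: D_def)
  qed
  have Dlim: "(\<lambda>n. D n x) \<longlonglongrightarrow> pderiv_at i \<phi> x" for x
  proof -
    have g: "((\<lambda>t. x + t *\<^sub>R ?e) has_derivative (\<lambda>t. t *\<^sub>R ?e)) (at 0)"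
      by (auto intro!: derivative_eq_intros)
    have "(\<phi> has_derivative (\<lambda>h. grad \<phi> x \<bullet> h)) (at (x + 0 *\<^sub>R ?e))"
      using test_functions_has_derivative[OF assms] by simp
    from has_derivative_compose[OF g this]
    have "((\<lambda>t. \<phi> (x + t *\<^sub>R ?e)) has_derivative (\<lambda>t. grad \<phi> x \<bullet> (t *\<^sub>R ?e))) (at 0)" .
    moreover have "(\<lambda>t. grad \<phi> x \<bullet> (t *\<^sub>R ?e)) = (\<lambda>t. pderiv_at i \<phi> x * t)"
      by (rule ext) (simp add: inner_axis)
    ultimately have "((\<lambda>t. \<phi> (x + t *\<^sub>R ?e)) has_real_derivative pderiv_at i \<phi> x) (at 0)"
      by (simp add: has_field_derivative_def)
    then have lim: "((\<lambda>t. (\<phi> (x + t *\<^sub>R ?e) - \<phi> x) / t) \<longlongrightarrow> pderiv_at i \<phi> x) (at 0)"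
      by (simp add: DERIV_def)
    have "filterlim h (at 0) sequentially"
    proof (rule filterlim_atI)
      show "h \<longlonglongrightarrow> 0" unfolding h_def[abs_def] using LIMSEQ_inverse_real_of_nat by (simp add: inverse_eq_divide)
      show "\<forall>\<^sub>F n in sequentially. h n \<noteq> 0" using h(1) by (intro always_eventually allI) (metis less_irrefl)
    qed
    from filterlim_compose[OF lim this] show ?thesis by (simp add: D_def add.commute)
  qed
  have mp: "pderiv_at i \<phi> \<in> borel_measurable borel" using test_functions_measurable(3)[OF assms] .
  have "(\<lambda>n. LINT x|lborel. D n x) \<longlonglongrightarrow> (LINT x|lborel. pderiv_at i \<phi> x)"
  proof (rule integral_dominated_convergence[where w="\<lambda>x. M * indicator (ball 0 (r + 1)) x"])
    show "integrable lborel (\<lambda>x::real^'n. M * indicator (ball 0 (r + 1)) x :: real)"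
      using emeasure_lborel_ball_finite[of "0::real^'n" "r + 1"]
      by (intro integrable_mult_right integrable_real_indicator) simp_all
    show "AE x in lborel. (\<lambda>n. D n x) \<longlonglongrightarrow> pderiv_at i \<phi> x"
      by (intro AE_I2 Dlim)
    show "AE x in lborel. norm (D n x) \<le> M * indicator (ball 0 (r + 1)) x" for n
      by (intro AE_I2 Dbound)
  qed (simp_all add: Dm mp)
  then have "(LINT x|lborel. pderiv_at i \<phi> x) = 0"
    unfolding D0 by (simp add: LIMSEQ_const_iff)
  then show ?thesis using mp by (subst integral_completion) auto
qed

lemma integrable_test_mult:
  assumes "locally_integrable u" "\<phi> \<in> test_functions U"
  shows "integrable lebesgue (\<lambda>x. u x * \<phi> x)" "integrable lebesgue (\<lambda>x. u x * pderiv_at i \<phi> x)"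
proof -
  obtain K where K: "compact K" "\<And>x. x \<notin> K \<Longrightarrow> \<phi> x = 0" "\<And>x. x \<notin> K \<Longrightarrow> grad \<phi> x = 0"
    using test_functionsE[OF assms(2)] by metis
  obtain M where M: "M > 0" "\<And>x. \<bar>\<phi> x\<bar> \<le> M" "\<And>x. norm (grad \<phi> x) \<le> M"
    using test_functions_bounded[OF assms(2)] by metis
  show "integrable lebesgue (\<lambda>x. u x * \<phi> x)"
    by (rule integrable_locally_integrable_mult[OF assms(1) K(1) test_functions_measurable_lebesgue(1)[OF assms(2)] M(2)])
      (simp add: K(2))
  have "\<bar>pderiv_at i \<phi> x\<bar> \<le> M" for x
    using order_trans[OF component_le_norm_cart M(3)] by (metis grad_component)
  moreover have "pderiv_at i \<phi> x = 0" if "x \<notin> K" for x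
    using K(3)[OF that] by (metis grad_component zero_index)
  ultimately show "integrable lebesgue (\<lambda>x. u x * pderiv_at i \<phi> x)"
    using integrable_locally_integrable_mult[OF assms(1) K(1)]
      test_functions_measurable_lebesgue(3)[OF assms(2)] by blast
qed

lemma locally_integrable_continuous:
  fixes f :: "'a::euclidean_space \<Rightarrow> 'b::euclidean_space"
  assumes "continuous_on UNIV f"
  shows "locally_integrable f"
proof -
  have "set_integrable lebesgue K f" if "compact K" for K
  proof -
    have "integrable lborel (\<lambda>x. indicator K x *\<^sub>R f x)"
      using that assms by (intro borel_integrable_compact continuous_on_subset[OF assms]) auto
    then show ?thesis
      unfolding set_integrable_def by (subst integrable_completion) auto
  qed
  then show ?thesis unfolding locally_integrable_def by blast
qed

lemma locally_integrable_component:
  fixes g :: "real^'n \<Rightarrow> real^'n"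
  assumes "locally_integrable g"
  shows "locally_integrable (\<lambda>x. g x $ i)"
proof -
  have "integrable lebesgue (\<lambda>x. indicator K x *\<^sub>R (g x $ i))" if "compact K" for K
  proof -
    have "integrable lebesgue (\<lambda>x. indicator K x *\<^sub>R g x)"
      using assms that unfolding locally_integrable_def set_integrable_def by blast
    from integrable_bounded_linear[OF bounded_linear_vec_nth this, of i] show ?thesis by simp
  qed
  then show ?thesis unfolding locally_integrable_def set_integrable_def by blast
qed

lemma test_functions_locally_integrable:
  assumes "\<phi> \<in> test_functions U"
  shows "locally_integrable \<phi>" "locally_integrable (grad \<phi>)"
  using assms by (auto intro!: locally_integrable_continuous test_functions_continuous test_functions_grad_continuous)

text \<open>The product with a further test function is again a test function, so its partial
  derivative integrates to 0; the product rule turns this into the defining identity.\<close>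

lemma is_weak_grad_test_function:
  assumes "\<phi> \<in> test_functions U"
  shows "is_weak_grad \<phi> (grad \<phi>)"
  unfolding is_weak_grad_def
proof (intro conjI ballI allI test_functions_locally_integrable[OF assms])
  fix \<psi> :: "real^'a \<Rightarrow> real" and i :: 'a
  assume \<psi>: "\<psi> \<in> test_functions UNIV"
  have "(\<lambda>x. \<phi> x * \<psi> x) \<in> test_functions U"
    using assms test_functions_Ck[OF \<psi>] by (rule test_functions_mult)
  then have "(LINT x|lebesgue. pderiv_at i (\<lambda>x. \<phi> x * \<psi> x) x) = 0"
    by (rule integral_pderiv_eq_0)
  moreover have "pderiv_at i (\<lambda>x. \<phi> x * \<psi> x) x = \<phi> x * pderiv_at i \<psi> x + pderiv_at i \<phi> x * \<psi> x" for x
    using grad_mult[OF test_functions_differentiable[OF assms] test_functions_differentiable[OF \<psi>], of x]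
    unfolding vec_eq_iff by (simp add: mult.commute)
  moreover have "integrable lebesgue (\<lambda>x. \<phi> x * pderiv_at i \<psi> x)"
    by (rule integrable_test_mult(2)[OF test_functions_locally_integrable(1)[OF assms] \<psi>])
  moreover have "integrable lebesgue (\<lambda>x. pderiv_at i \<phi> x * \<psi> x)"
    using integrable_test_mult(1)[OF locally_integrable_component[OF test_functions_locally_integrable(2)[OF assms], of i] \<psi>]
    by simp
  ultimately show "(LINT x|lebesgue. \<phi> x * pderiv_at i \<psi> x) = - (LINT x|lebesgue. grad \<phi> x $ i * \<psi> x)"
    by simp
qed

section \<open>The fundamental lemma of the calculus of variations\<close>

text \<open>Dynkin's argument: boxes form an intersection-stable generator of the Borel sets, and
  the sets over which f integrates to 0 are closed under complements and countable disjoint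
  unions.\<close>

lemma AE_eq_0_if_box_integrals_eq_0:
  fixes f :: "'a::euclidean_space \<Rightarrow> real"
  assumes int: "integrable lborel f" and box: "\<And>c d. (LINT x:box c d|lborel. f x) = 0"
  shows "AE x in lborel. f x = 0"
proof -
  let ?G = "range (\<lambda>(a, b). box a b :: 'a set)"
  have sets_eq: "sigma_sets UNIV ?G = sets borel"
    unfolding borel_eq_box by (simp add: sets_measure_of)
  have meas: "f \<in> borel_measurable borel" using borel_measurable_integrable[OF int] by simp
  have si: "set_integrable lborel A f" if "A \<in> sets borel" for A
    unfolding set_integrable_def using integrable_mult_indicator[OF _ int, of A] that by simp
  \<comment> \<open>Complements need the integral over the whole space, obtained by exhausting it
    with growing boxes.\<close>
  have total: "(LINT x|lborel. f x) = 0"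
  proof -
    have "(\<lambda>n. LINT x:box (- (real n *\<^sub>R One)) (real n *\<^sub>R One)|lborel. f x) \<longlonglongrightarrow>
      (LINT x:(\<Union>n. box (- (real n *\<^sub>R One)) (real n *\<^sub>R One))|lborel. f x)"
    proof (rule set_integral_cont_up)
      show "incseq (\<lambda>n. box (- (real n *\<^sub>R One)) (real n *\<^sub>R One) :: 'a set)"
        by (auto simp: incseq_def box_def intro: order.strict_trans2 order.strict_trans1)
      show "set_integrable lborel (\<Union>n. box (- (real n *\<^sub>R One)) (real n *\<^sub>R One)) f"
        by (rule si) auto
    qed auto
    then show ?thesis
      unfolding box UN_box_eq_UNIV by (simp add: LIMSEQ_const_iff set_lebesgue_integral_def)
  qed
  have all: "(LINT x:A|lborel. f x) = 0" if "A \<in> sets borel" for A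
  proof -
    have "Int_stable ?G"
    proof (rule Int_stableI)
      fix A B :: "'a set"
      assume "A \<in> ?G" "B \<in> ?G"
      then obtain a b c d where "A = box a b" "B = box c d" by auto
      moreover obtain x y where "box a b \<inter> box c d = box x y" using box_Int_box[of a b c d] by blast
      ultimately have "A \<inter> B = (case (x, y) of (a, b) \<Rightarrow> box a b)" by simp
      then show "A \<inter> B \<in> ?G" by (rule range_eqI)
    qed
    moreover have "?G \<subseteq> Pow UNIV" by auto
    moreover have "A \<in> sigma_sets UNIV ?G" using that sets_eq by simp
    ultimately show ?thesis
    proof (induction rule: sigma_sets_induct_disjoint)
      case (basic A)
      then show ?case using box by auto
    next
      case empty
      then show ?case by (simp add: set_lebesgue_integral_def)
    next
      case (compl A)
      then have A: "A \<in> sets borel" using sets_eq by simp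
      have "(LINT x:A \<union> (UNIV - A)|lborel. f x) = (LINT x:A|lborel. f x) + (LINT x:UNIV - A|lborel. f x)"
        by (rule set_integral_Un) (use A in \<open>auto intro!: si\<close>)
      then show ?case using compl total by (simp add: set_lebesgue_integral_def)
    next
      case (union A)
      then have A: "A i \<in> sets borel" for i using sets_eq by auto
      have "(LINT x:(\<Union>i. A i)|lborel. f x) = (\<Sum>i. LINT x:A i|lborel. f x)"
        by (rule lebesgue_integral_countable_add)
          (use A union in \<open>auto intro!: si simp: disjoint_family_on_def\<close>)
      then show ?case using union by simp
    qed
  qed
  show ?thesis
    by (rule density_unique_real[OF int integrable_zero]) (simp add: all)
qed

text \<open>A product of one-dimensional bumps is positive exactly on the open box. Multiplied by n
  it tends to infinity there, where the outer bump tends to 1, and it stays 0 elsewhere.\<close>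

lemma box_approximation:
  fixes c d :: "real^'n"
  obtains \<phi> :: "nat \<Rightarrow> real^'n \<Rightarrow> real" where
    "\<And>n U. cbox c d \<subseteq> U \<Longrightarrow> \<phi> n \<in> test_functions U" "\<And>n x. \<bar>\<phi> n x\<bar> \<le> indicator (box c d) x"
    "\<And>x. (\<lambda>n. \<phi> n x) \<longlonglongrightarrow> indicator (box c d) x"
proof -
  define z where "z x = (\<Prod>i\<in>UNIV. smooth_bump (x $ i - c $ i) * smooth_bump (d $ i - x $ i))" for x
  have zpos: "z x > 0" if "x \<in> box c d" for x
    unfolding z_def using that by (intro prod_pos) (auto simp: mem_box_cart)
  have z0: "z x = 0" if "x \<notin> box c d" for x
  proof -
    have "\<exists>i. x $ i \<le> c $ i \<or> d $ i \<le> x $ i"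
      using that unfolding mem_box_cart by (meson not_less)
    then obtain i where "x $ i \<le> c $ i \<or> d $ i \<le> x $ i" by blast
    then have "smooth_bump (x $ i - c $ i) * smooth_bump (d $ i - x $ i) = 0" by auto
    then show ?thesis unfolding z_def by (metis (mono_tags) UNIV_I finite prod_zero_iff)
  qed
  define \<phi> where "\<phi> n x = smooth_bump (real n * z x)" for n x
  have out: "\<phi> n x = 0" if "x \<notin> box c d" for n x
    unfolding \<phi>_def z0[OF that] by simp
  have Ckphi: "Ck k (\<phi> n)" for k n
    unfolding \<phi>_def[abs_def] z_def
    by (intro Ck_smooth_bump Ck_cmult Ck_prod Ck_mult Ck_diff Ck_component Ck_const)
  show ?thesis
  proof (rule that[of \<phi>])
    show "\<phi> n \<in> test_functions U" if "cbox c d \<subseteq> U" for n U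
    proof (rule test_functionsI[OF Ckphi compact_cbox that])
      show "\<phi> n x = 0" if "x \<notin> cbox c d" for x
        by (rule out) (use that box_subset_cbox in blast)
    qed
    show "\<bar>\<phi> n x\<bar> \<le> indicator (box c d) x" for n x
    proof (cases "x \<in> box c d")
      case True
      then show ?thesis using smooth_bump_le_1[of "real n * z x"] by (simp add: \<phi>_def)
    next
      case False
      then show ?thesis using out[OF False] by simp
    qed
    show "(\<lambda>n. \<phi> n x) \<longlonglongrightarrow> indicator (box c d) x" for x
    proof (cases "x \<in> box c d")
      case True
      have "filterlim (\<lambda>n. z x * real n) at_top sequentially"
        by (rule filterlim_tendsto_pos_mult_at_top[OF tendsto_const zpos[OF True] filterlim_real_sequentially])
      from filterlim_compose[OF tendsto_smooth_bump_at_top this]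
      show ?thesis using True by (simp add: \<phi>_def mult.commute)
    next
      case False
      then show ?thesis using out[OF False] by simp
    qed
  qed
qed

text \<open>Test functions converging boundedly to the indicator of a box show that all integrals
  over boxes with closure in U vanish. A Borel representative g' gives access to the statement about
  boxes, and by Lindelof countably many such boxes cover U.\<close>

lemma AE_eq_0_if_test_integrals_eq_0:
  fixes g :: "real^'n \<Rightarrow> real"
  assumes loc: "locally_integrable g" and U: "open U"
    and z: "\<And>\<phi>. \<phi> \<in> test_functions U \<Longrightarrow> (LINT x|lebesgue. g x * \<phi> x) = 0"
  shows "AE x in lebesgue. x \<in> U \<longrightarrow> g x = 0"
proof -
  have gm: "g \<in> borel_measurable lebesgue" by (rule locally_integrable_measurable[OF loc])
  obtain g' where g': "g' \<in> borel_measurable lborel" "AE x in lborel. g x = g' x"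
    using completion_ex_borel_measurable_real[OF gm] by blast
  have g'm: "g' \<in> borel_measurable lebesgue" using g'(1) by (intro measurable_lebesgueI) simp
  have AEg: "AE x in lebesgue. g x = g' x" using g'(2) by (rule AE_completion)
  have box0: "(LINT x:box c d|lborel. g' x) = 0" if cd: "cbox c d \<subseteq> U" for c d
  proof -
    obtain \<phi> :: "nat \<Rightarrow> real^'n \<Rightarrow> real" where \<phi>:
      "\<And>n U. cbox c d \<subseteq> U \<Longrightarrow> \<phi> n \<in> test_functions U" "\<And>n x. \<bar>\<phi> n x\<bar> \<le> indicator (box c d) x"
      "\<And>x. (\<lambda>n. \<phi> n x) \<longlonglongrightarrow> indicator (box c d) x"
      by (rule box_approximation[of c d]) (rule that)
    have "integrable lebesgue (\<lambda>x. indicator (cbox c d) x *\<^sub>R g x)"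
      by (rule locally_integrableD[OF loc compact_cbox])
    then have w: "integrable lebesgue (\<lambda>x. \<bar>indicator (cbox c d) x * g x\<bar>)" by simp
    have "(\<lambda>n. LINT x|lebesgue. g x * \<phi> n x) \<longlonglongrightarrow> (LINT x|lebesgue. g x * indicator (box c d) x)"
    proof (rule integral_dominated_convergence[OF _ _ w])
      show "(\<lambda>x. g x * indicator (box c d) x) \<in> borel_measurable lebesgue"
        using gm by (intro borel_measurable_times borel_measurable_indicator) auto
      show "(\<lambda>x. g x * \<phi> n x) \<in> borel_measurable lebesgue" for n
        using gm test_functions_measurable_lebesgue(1)[OF \<phi>(1)[OF cd]] by (intro borel_measurable_times) auto
      show "AE x in lebesgue. (\<lambda>n. g x * \<phi> n x) \<longlonglongrightarrow> g x * indicator (box c d) x"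
        by (intro AE_I2 tendsto_mult tendsto_const \<phi>(3))
      show "AE x in lebesgue. norm (g x * \<phi> n x) \<le> \<bar>indicator (cbox c d) x * g x\<bar>" for n
      proof (rule AE_I2)
        fix x
        have "indicator (box c d) x \<le> (indicator (cbox c d) x :: real)"
          using box_subset_cbox[of c d] by (auto simp: indicator_def)
        then have "\<bar>\<phi> n x\<bar> \<le> indicator (cbox c d) x"
          using \<phi>(2)[of n x] by linarith
        from mult_left_mono[OF this, of "\<bar>g x\<bar>"]
        show "norm (g x * \<phi> n x) \<le> \<bar>indicator (cbox c d) x * g x\<bar>"
          by (simp add: abs_mult mult.commute)
      qed
    qed
    then have "(LINT x|lebesgue. g x * indicator (box c d) x) = 0"
      using z[OF \<phi>(1)[OF cd]] by (simp add: LIMSEQ_const_iff)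
    moreover have "(LINT x|lebesgue. g x * indicator (box c d) x) = (LINT x|lebesgue. g' x * indicator (box c d) x)"
    proof (rule integral_cong_AE)
      show "AE x in lebesgue. g x * indicator (box c d) x = g' x * indicator (box c d) x"
        using AEg by eventually_elim simp
    qed (intro borel_measurable_times borel_measurable_indicator gm g'm; simp)+
    moreover have "(LINT x|lebesgue. g' x * indicator (box c d) x) = (LINT x|lborel. g' x * indicator (box c d) x)"
      using g'(1) by (intro integral_completion) simp
    ultimately show ?thesis by (simp add: set_lebesgue_integral_def mult.commute)
  qed
  have AEbox: "AE x in lborel. x \<in> box a b \<longrightarrow> g' x = 0" if ab: "cbox a b \<subseteq> U" for a b
  proof -
    have "AE x in lborel. indicator (box a b) x * g' x = 0"
    proof (rule AE_eq_0_if_box_integrals_eq_0)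
      have "integrable lebesgue (\<lambda>x. indicator (box a b) x *\<^sub>R (indicator (cbox a b) x *\<^sub>R g x))"
        by (intro integrable_mult_indicator locally_integrableD[OF loc compact_cbox]) auto
      then have "integrable lebesgue (\<lambda>x. indicator (box a b) x * g' x)"
      proof (rule integrable_cong_AE_imp)
        show "AE x in lebesgue. indicator (box a b) x *\<^sub>R indicator (cbox a b) x *\<^sub>R g x = indicator (box a b) x * g' x"
          using AEg
        proof eventually_elim
          case (elim x)
          then show ?case using box_subset_cbox[of a b] by (cases "x \<in> box a b") auto
        qed
      qed (intro borel_measurable_times borel_measurable_indicator g'm; simp)
      then show "integrable lborel (\<lambda>x. indicator (box a b) x * g' x)"
        using g'(1) by (subst (asm) integrable_completion) auto
      fix c d
      have eq: "(LINT x:box c d|lborel. indicator (box a b) x * g' x) = (LINT x:box a b \<inter> box c d|lborel. g' x)"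
        unfolding set_lebesgue_integral_def by (simp add: indicator_inter_arith mult_ac)
      show "(LINT x:box c d|lborel. indicator (box a b) x * g' x) = 0"
      \<comment> \<open>Only a nonempty open box determines its closed box as its closure; if the
        intersection is empty, its endpoints tell nothing about \<open>cbox c' d'\<close>.\<close>
      proof (cases "box a b \<inter> box c d = {}")
        case True
        then show ?thesis unfolding eq by (simp add: set_lebesgue_integral_def)
      next
        case False
        obtain c' d' where e: "box a b \<inter> box c d = box c' d'" using box_Int_box[of a b c d] by blast
        have "closure (box c' d') \<subseteq> closure (box a b)" unfolding e[symmetric] by (rule closure_mono) simp
        moreover have "box c' d' \<noteq> {}" "box a b \<noteq> {}" using False e by auto
        ultimately have "cbox c' d' \<subseteq> cbox a b" using closure_box[of c' d'] closure_box[of a b] by argo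
        then show ?thesis unfolding eq e using ab by (intro box0) (rule order_trans)
      qed
    qed
    then show ?thesis by eventually_elim auto
  qed
  define \<B> where "\<B> = {X. \<exists>a b. cbox a b \<subseteq> U \<and> X = box a b}"
  have "\<And>S. S \<in> \<B> \<Longrightarrow> open S" by (auto simp: \<B>_def)
  then obtain \<C> where "\<C> \<subseteq> \<B>" "countable \<C>" "\<Union>\<C> = \<Union>\<B>"
    by (rule Lindelof)
  moreover have "U \<subseteq> \<Union>\<B>"
  proof
    fix x assume "x \<in> U"
    then obtain a b where "cbox a b \<subseteq> U" "x \<in> box a b"
      using open_contains_cbox[OF U] by metis
    then show "x \<in> \<Union>\<B>" unfolding \<B>_def by blast
  qed
  ultimately have \<C>: "countable \<C>" "\<C> \<subseteq> \<B>" "U \<subseteq> \<Union>\<C>"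
    by simp_all
  have "AE x in lborel. \<forall>X\<in>\<C>. x \<in> X \<longrightarrow> g' x = 0"
  proof (rule AE_ball_countable'[OF _ \<C>(1)])
    fix X assume "X \<in> \<C>"
    then have "X \<in> \<B>" using \<C>(2) by (rule rev_subsetD)
    then obtain a b where "cbox a b \<subseteq> U" "X = box a b" unfolding \<B>_def by blast
    then show "AE x in lborel. x \<in> X \<longrightarrow> g' x = 0" using AEbox by simp
  qed
  then have "AE x in lborel. x \<in> U \<longrightarrow> g' x = 0"
  proof eventually_elim
    case (elim x)
    then show ?case using \<C>(3) by (meson UnionE subsetD)
  qed
  then have "AE x in lebesgue. x \<in> U \<longrightarrow> g' x = 0" by (rule AE_completion)
  with AEg show ?thesis by eventually_elim auto
qed

section \<open>Uniqueness of weak gradients\<close>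

lemma is_weak_grad_locally_integrable:
  assumes "is_weak_grad u g"
  shows "locally_integrable u" "locally_integrable g"
  using assms unfolding is_weak_grad_def by blast+

lemma locally_integrable_diff:
  "locally_integrable f \<Longrightarrow> locally_integrable g \<Longrightarrow> locally_integrable (\<lambda>x. f x - g x)"
  unfolding locally_integrable_def by (blast intro: set_integral_diff(1))

text \<open>Test functions supported in U see only the values of u and v in U. The local form is
  what later allows the solution to be replaced by an element of the form domain that agrees with it
  only on a ball.\<close>

lemma weak_grad_unique_on:
  fixes u v :: "real^'n \<Rightarrow> real"
  assumes g: "is_weak_grad u g" and h: "is_weak_grad v h" and U: "open U"
    and eq: "AE x in lebesgue. x \<in> U \<longrightarrow> u x = v x"
  shows "AE x in lebesgue. x \<in> U \<longrightarrow> g x = h x"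
proof -
  have "AE x in lebesgue. \<forall>i\<in>UNIV. x \<in> U \<longrightarrow> g x $ i - h x $ i = 0"
  proof (rule AE_ball_countable')
    fix i :: 'n
    note loc = is_weak_grad_locally_integrable[OF g] is_weak_grad_locally_integrable[OF h]
    show "AE x in lebesgue. x \<in> U \<longrightarrow> g x $ i - h x $ i = 0"
    proof (rule AE_eq_0_if_test_integrals_eq_0[OF _ U])
      show "locally_integrable (\<lambda>x. g x $ i - h x $ i)"
        by (intro locally_integrable_diff locally_integrable_component loc)
      fix \<phi> assume \<phi>: "\<phi> \<in> test_functions U"
      then have \<phi>': "\<phi> \<in> test_functions UNIV" by (rule test_functions_mono[rotated]) simp
      obtain K where K: "K \<subseteq> U" "\<And>x. x \<notin> K \<Longrightarrow> grad \<phi> x = 0"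
        using test_functionsE[OF \<phi>] by metis
      have "(LINT x|lebesgue. (g x $ i - h x $ i) * \<phi> x)
        = (LINT x|lebesgue. g x $ i * \<phi> x) - (LINT x|lebesgue. h x $ i * \<phi> x)"
        by (simp add: left_diff_distrib integrable_test_mult(1)[OF locally_integrable_component \<phi>] loc)
      also have "\<dots> = (LINT x|lebesgue. v x * pderiv_at i \<phi> x) - (LINT x|lebesgue. u x * pderiv_at i \<phi> x)"
        using g h \<phi>' unfolding is_weak_grad_def by simp
      also have "(LINT x|lebesgue. v x * pderiv_at i \<phi> x) = (LINT x|lebesgue. u x * pderiv_at i \<phi> x)"
      proof (rule integral_cong_AE)
        show "(\<lambda>x. v x * pderiv_at i \<phi> x) \<in> borel_measurable lebesgue"
          "(\<lambda>x. u x * pderiv_at i \<phi> x) \<in> borel_measurable lebesgue"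
          using integrable_test_mult(2)[OF loc(1) \<phi>] integrable_test_mult(2)[OF loc(3) \<phi>] by auto
        show "AE x in lebesgue. v x * pderiv_at i \<phi> x = u x * pderiv_at i \<phi> x"
          using eq
        proof eventually_elim
          case (elim x)
          show ?case
          proof (cases "x \<in> U")
            case False
            then have "grad \<phi> x $ i = 0" using K by (metis subsetD zero_index)
            then show ?thesis by simp
          qed (use elim in simp)
        qed
      qed
      finally show "(LINT x|lebesgue. (g x $ i - h x $ i) * \<phi> x) = 0" by simp
    qed
  qed auto
  then show ?thesis
  proof eventually_elim
    case (elim x)
    then show ?case by (simp add: vec_eq_iff)
  qed
qed

lemma is_weak_grad_weak_grad: "is_weak_grad u g \<Longrightarrow> is_weak_grad u (weak_grad u)"
  unfolding weak_grad_def by (rule someI[of "is_weak_grad u"])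

lemma weak_grad_AE_eq:
  assumes "is_weak_grad u g"
  shows "AE x in lebesgue. weak_grad u x = g x"
  using weak_grad_unique_on[OF is_weak_grad_weak_grad[OF assms] assms open_UNIV] by simp

section \<open>The energy form\<close>

text \<open>Fatou's lemma, in the form in which estimates for approximants pass to the
  limit.\<close>

lemma nn_integral_limit_le:
  fixes f :: "nat \<Rightarrow> 'a \<Rightarrow> ennreal"
  assumes "\<And>n. f n \<in> borel_measurable M" "AE x in M. (\<lambda>n. f n x) \<longlonglongrightarrow> F x"
    "\<forall>\<^sub>F n in sequentially. (\<integral>\<^sup>+x. f n x \<partial>M) \<le> c"
  shows "(\<integral>\<^sup>+x. F x \<partial>M) \<le> c"
proof -
  have "(\<integral>\<^sup>+x. F x \<partial>M) = (\<integral>\<^sup>+x. liminf (\<lambda>n. f n x) \<partial>M)"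
    by (rule nn_integral_cong_AE) (use assms(2) in eventually_elim, simp add: lim_imp_Liminf)
  also have "\<dots> \<le> liminf (\<lambda>n. \<integral>\<^sup>+x. f n x \<partial>M)"
    by (rule nn_integral_liminf) (rule assms(1))
  also have "\<dots> \<le> limsup (\<lambda>n. \<integral>\<^sup>+x. f n x \<partial>M)"
    by (rule Liminf_le_Limsup) simp
  also have "\<dots> \<le> c" using assms(3) by (rule Limsup_bounded)
  finally show ?thesis .
qed

text \<open>The sum of 4^k f k has integral at most the sum of (4/8)^k. So it is finite almost
  everywhere, and its value at x serves as C for all k at once.\<close>

lemma AE_geometric_bound:
  fixes f :: "nat \<Rightarrow> 'a \<Rightarrow> ennreal"
  assumes "\<And>k. f k \<in> borel_measurable M" "\<And>k. (\<integral>\<^sup>+x. f k x \<partial>M) \<le> ennreal ((1/8) ^ k)"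
  shows "AE x in M. \<exists>C\<ge>0. \<forall>k. f k x \<le> ennreal (C * (1/4) ^ k)"
proof -
  note [measurable] = assms(1)
  have "(\<integral>\<^sup>+x. (\<Sum>k. ennreal (4 ^ k) * f k x) \<partial>M) = (\<Sum>k. \<integral>\<^sup>+x. ennreal (4 ^ k) * f k x \<partial>M)"
    by (rule nn_integral_suminf) measurable
  also have "\<dots> = (\<Sum>k. ennreal (4 ^ k) * (\<integral>\<^sup>+x. f k x \<partial>M))"
    by (intro suminf_cong nn_integral_cmult assms(1))
  also have "\<dots> \<le> (\<Sum>k. ennreal ((1/2) ^ k))"
  proof (rule suminf_le)
    fix k
    have "ennreal (4 ^ k) * (\<integral>\<^sup>+x. f k x \<partial>M) \<le> ennreal (4 ^ k) * ennreal ((1/8) ^ k)"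
      by (intro mult_left_mono assms(2)) simp
    also have "\<dots> = ennreal ((1/2) ^ k)"
      by (simp add: ennreal_mult[symmetric] power_mult_distrib[symmetric])
    finally show "ennreal (4 ^ k) * (\<integral>\<^sup>+x. f k x \<partial>M) \<le> ennreal ((1/2) ^ k)" .
  qed auto
  also have "\<dots> = ennreal (\<Sum>k. (1/2) ^ k)"
    by (rule suminf_ennreal_eq) (auto intro: summable_sums summable_geometric)
  finally have "(\<integral>\<^sup>+x. (\<Sum>k. ennreal (4 ^ k) * f k x) \<partial>M) \<noteq> \<infinity>"
    using ennreal_less_top le_less_trans by (metis infinity_ennreal_def less_irrefl)
  then have "AE x in M. (\<Sum>k. ennreal (4 ^ k) * f k x) \<noteq> \<infinity>"
    by (intro nn_integral_PInf_AE) measurable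
  then show ?thesis
  proof eventually_elim
    case (elim x)
    let ?S = "\<Sum>k. ennreal (4 ^ k) * f k x"
    have "f k x \<le> ennreal (enn2real ?S * (1/4) ^ k)" for k
    proof -
      have S: "ennreal (enn2real ?S) = ?S" using elim by (simp add: less_top)
      have "ennreal (4 ^ k) * f k x = (\<Sum>j\<in>{k}. ennreal (4 ^ j) * f j x)" by simp
      also have "\<dots> \<le> ?S" by (rule sum_le_suminf) auto
      finally have "ennreal (4 ^ k) * f k x \<le> ennreal (enn2real ?S)" using S by simp
      then have "ennreal ((1/4) ^ k) * (ennreal (4 ^ k) * f k x) \<le> ennreal ((1/4) ^ k) * ennreal (enn2real ?S)"
        by (rule mult_left_mono) simp
      moreover have "ennreal ((1/4) ^ k) * (ennreal (4 ^ k) * f k x) = f k x"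
        by (simp add: mult.assoc[symmetric] ennreal_mult[symmetric] power_mult_distrib[symmetric])
      ultimately show ?thesis by (simp add: ennreal_mult[symmetric] mult.commute)
    qed
    then show ?case by (intro exI[of _ "enn2real ?S"]) simp
  qed
qed

text \<open>A replacement for the Cauchy-Schwarz inequality: e C is made small first, then A n / e
  by taking n large.\<close>

lemma tendsto_0_if_Young_bound:
  fixes c A :: "nat \<Rightarrow> real"
  assumes "A \<longlonglongrightarrow> 0" "\<And>e. e > 0 \<Longrightarrow> \<forall>\<^sub>F n in sequentially. \<bar>c n\<bar> \<le> e * C + A n / e" "C \<ge> 0"
  shows "c \<longlonglongrightarrow> 0"
proof (rule tendstoI)
  fix r :: real assume r: "r > 0"
  \<comment> \<open>C + 1 instead of C, since C may be 0.\<close>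
  define e where "e = r / (2 * (C + 1))"
  have e: "e > 0" "e * C < r / 2 + 0"
    using r assms(3) by (simp_all add: e_def field_simps)
  have "\<forall>\<^sub>F n in sequentially. A n < r * e / 2"
    using assms(1) r e by (intro order_tendstoD(2)[of _ 0]) auto
  with assms(2)[OF e(1)] show "\<forall>\<^sub>F n in sequentially. dist (c n) 0 < r"
  proof eventually_elim
    case (elim n)
    have "A n / e < r / 2" using elim(2) e(1) by (simp add: field_simps)
    then show ?case using elim(1) e(2) unfolding dist_real_def diff_0_right by linarith
  qed
qed

lemma borel_measurable_vec_nth:
  fixes f :: "'a \<Rightarrow> ('b::real_normed_vector)^'n"
  assumes "f \<in> borel_measurable M"
  shows "(\<lambda>x. f x $ i) \<in> borel_measurable M"
proof -
  have "(\<lambda>v::'b^'n. v $ i) \<in> borel_measurable borel"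
    by (intro borel_measurable_continuous_onI continuous_on_component continuous_on_id)
  from measurable_compose[OF assms this] show ?thesis .
qed

section \<open>The quadratic form of the coefficients\<close>

text \<open>The qualitative content of the moment condition: it yields the last three assumptions.
  Positivity of \<open>lam\<close> is stated on its own because 1 / 0 = 0 in the reals, so that
  local integrability of \<open>1 / lam\<close> would not exclude zeros of
  \<open>lam\<close>.\<close>

locale elliptic_coefficients =
  fixes a :: "real^'n \<Rightarrow> real^'n^'n" and lam Lam :: "real^'n \<Rightarrow> real"
  assumes a_measurable: "a \<in> borel_measurable lebesgue"
    and lam_measurable: "lam \<in> borel_measurable lebesgue"
    and Lam_measurable: "Lam \<in> borel_measurable lebesgue"
    and a_symmetric: "\<And>x. transpose (a x) = a x"
    and Lam_nonneg: "\<And>x. 0 \<le> Lam x"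
    and elliptic: "AE x in lebesgue. \<forall>\<xi>::real^'n.
           lam x * (norm \<xi>)\<^sup>2 \<le> (a x *v \<xi>) \<bullet> \<xi> \<and> (a x *v \<xi>) \<bullet> \<xi> \<le> Lam x * (norm \<xi>)\<^sup>2"
    and lam_pos: "AE x in lebesgue. 0 < lam x"
    and Lam_loc: "locally_integrable Lam"
    and lam_inv_loc: "locally_integrable (\<lambda>x. 1 / lam x)"
begin

definition Q :: "real^'n \<Rightarrow> real^'n \<Rightarrow> real" where
  "Q x \<xi> = (a x *v \<xi>) \<bullet> \<xi>"

text \<open>Collects the properties that hold off one null set, so that the pointwise estimates
  start from a single almost everywhere statement.\<close>

definition good :: "real^'n \<Rightarrow> bool" where
  "good x \<longleftrightarrow> 0 < lam x \<and> (\<forall>\<xi>. lam x * (norm \<xi>)\<^sup>2 \<le> Q x \<xi> \<and> Q x \<xi> \<le> Lam x * (norm \<xi>)\<^sup>2)"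

lemma AE_good: "AE x in lebesgue. good x"
  using elliptic lam_pos by eventually_elim (simp add: good_def Q_def)

lemma good_lower: "good x \<Longrightarrow> lam x * (norm \<xi>)\<^sup>2 \<le> Q x \<xi>"
  and good_upper: "good x \<Longrightarrow> Q x \<xi> \<le> Lam x * (norm \<xi>)\<^sup>2"
  and good_pos: "good x \<Longrightarrow> 0 < lam x"
  unfolding good_def by blast+

lemma Q_nonneg: "good x \<Longrightarrow> 0 \<le> Q x \<xi>"
  using good_lower[of x \<xi>] good_pos[of x] by (meson order_trans mult_nonneg_nonneg less_imp_le zero_le_power2)

lemma a_inner_commute: "(a x *v \<xi>) \<bullet> \<eta> = (a x *v \<eta>) \<bullet> \<xi>"
proof -
  have "(a x *v \<xi>) \<bullet> \<eta> = \<eta> \<bullet> (a x *v \<xi>)" by (rule inner_commute)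
  also have "\<dots> = (transpose (a x) *v \<eta>) \<bullet> \<xi>" by (simp add: dot_lmul_matrix)
  finally show ?thesis by (simp only: a_symmetric)
qed

lemma Q_scaleR: "Q x (c *\<^sub>R \<xi>) = c\<^sup>2 * Q x \<xi>"
  by (simp add: Q_def matrix_vector_mult_scaleR power2_eq_square)

lemma Q_uminus [simp]: "Q x (- \<xi>) = Q x \<xi>"
  using Q_scaleR[of x "-1" \<xi>] by simp

lemma Q_add: "Q x (\<xi> + \<eta>) = Q x \<xi> + 2 * ((a x *v \<xi>) \<bullet> \<eta>) + Q x \<eta>"
  using a_inner_commute[of x \<eta> \<xi>]
  by (simp add: Q_def matrix_vector_right_distrib inner_add_left inner_add_right)

text \<open>Expand Q \<ge> 0 at t \<xi> + \<eta> and at t \<xi> - \<eta> and divide by t.\<close>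

lemma Q_Young:
  assumes "good x" "t > 0"
  shows "2 * \<bar>(a x *v \<xi>) \<bullet> \<eta>\<bar> \<le> t * Q x \<xi> + Q x \<eta> / t"
proof -
  have 1: "0 \<le> t\<^sup>2 * Q x \<xi> + 2 * t * ((a x *v \<xi>) \<bullet> \<eta>) + Q x \<eta>"
    using Q_nonneg[OF assms(1), of "t *\<^sub>R \<xi> + \<eta>"]
    by (simp add: Q_add Q_scaleR matrix_vector_mult_scaleR)
  have 2: "0 \<le> t\<^sup>2 * Q x \<xi> - 2 * t * ((a x *v \<xi>) \<bullet> \<eta>) + Q x \<eta>"
    using Q_nonneg[OF assms(1), of "t *\<^sub>R \<xi> + - \<eta>"]
    unfolding Q_add by (simp add: Q_scaleR matrix_vector_mult_scaleR)
  have "t * (2 * \<bar>(a x *v \<xi>) \<bullet> \<eta>\<bar>) \<le> t\<^sup>2 * Q x \<xi> + Q x \<eta>"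
    using 1 2 by (cases "0 \<le> (a x *v \<xi>) \<bullet> \<eta>") simp_all
  also have "\<dots> = t * (t * Q x \<xi> + Q x \<eta> / t)"
    using assms(2) by (simp add: field_simps power2_eq_square)
  finally show ?thesis using assms(2) by simp
qed

lemma Q_add_le: "good x \<Longrightarrow> Q x (\<xi> + \<eta>) \<le> 2 * Q x \<xi> + 2 * Q x \<eta>"
  using Q_Young[of x 1 \<xi> \<eta>] abs_ge_self[of "(a x *v \<xi>) \<bullet> \<eta>"] by (simp add: Q_add)

lemma Q_commute: "Q x (\<xi> - \<eta>) = Q x (\<eta> - \<xi>)"
  using Q_uminus[of x "\<xi> - \<eta>"] by simp

lemma continuous_Q: "continuous_on UNIV (Q x)"
  unfolding Q_def[abs_def]
  by (intro continuous_on_inner linear_continuous_on matrix_vector_mul_bounded_linear continuous_on_id)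

lemma a_form_measurable:
  assumes "g \<in> borel_measurable lebesgue" "h \<in> borel_measurable lebesgue"
  shows "(\<lambda>x. (a x *v g x) \<bullet> h x) \<in> borel_measurable lebesgue"
proof -
  have "(\<lambda>x. (a x *v g x) \<bullet> h x) = (\<lambda>x. \<Sum>i\<in>UNIV. (\<Sum>j\<in>UNIV. a x $ i $ j * g x $ j) * h x $ i)"
    by (rule ext) (simp add: inner_vec_def matrix_vector_mult_def)
  then show ?thesis
    using assms a_measurable
    by (simp only:) (intro borel_measurable_sum borel_measurable_times borel_measurable_vec_nth)
qed

lemma Q_measurable: "g \<in> borel_measurable lebesgue \<Longrightarrow> (\<lambda>x. Q x (g x)) \<in> borel_measurable lebesgue"
  unfolding Q_def by (rule a_form_measurable)

text \<open>\<open>energy\<close> is built on an arbitrary choice of weak gradients; uniqueness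
  almost everywhere permits any convenient representatives.\<close>

lemma energy_eq:
  assumes "is_weak_grad u g" "is_weak_grad v h"
  shows "energy a u v = (LINT x|lebesgue. (a x *v g x) \<bullet> h x)"
  unfolding energy_def
proof (rule integral_cong_AE)
  note m = is_weak_grad_locally_integrable(2)[THEN locally_integrable_measurable]
  have eq: "(\<Sum>i\<in>UNIV. \<Sum>j\<in>UNIV. a x $ i $ j * \<xi> $ i * \<eta> $ j) = (a x *v \<xi>) \<bullet> \<eta>" for x \<xi> \<eta>
  proof -
    have "(\<Sum>i\<in>UNIV. \<Sum>j\<in>UNIV. a x $ i $ j * \<xi> $ i * \<eta> $ j) = (a x *v \<eta>) \<bullet> \<xi>"
      by (simp add: inner_vec_def matrix_vector_mult_def sum_distrib_left mult_ac)
    then show ?thesis by (simp add: a_inner_commute)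
  qed
  show "AE x in lebesgue. (\<Sum>i\<in>UNIV. \<Sum>j\<in>UNIV. a x $ i $ j * weak_grad u x $ i * weak_grad v x $ j)
      = (a x *v g x) \<bullet> h x"
    using weak_grad_AE_eq[OF assms(1)] weak_grad_AE_eq[OF assms(2)]
    by eventually_elim (simp add: eq)
  show "(\<lambda>x. (\<Sum>i\<in>UNIV. \<Sum>j\<in>UNIV. a x $ i $ j * weak_grad u x $ i * weak_grad v x $ j)) \<in> borel_measurable lebesgue"
    unfolding eq
    by (rule a_form_measurable[OF m[OF is_weak_grad_weak_grad[OF assms(1)]] m[OF is_weak_grad_weak_grad[OF assms(2)]]])
  show "(\<lambda>x. (a x *v g x) \<bullet> h x) \<in> borel_measurable lebesgue"
    by (rule a_form_measurable[OF m[OF assms(1)] m[OF assms(2)]])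
qed

lemma Q_locally_integrable:
  assumes "h \<in> borel_measurable lebesgue" "\<And>x. norm (h x) \<le> M" "compact K" "\<And>x. x \<notin> K \<Longrightarrow> h x = 0"
  shows "integrable lebesgue (\<lambda>x. Q x (h x))"
proof (rule Bochner_Integration.integrable_bound)
  show "integrable lebesgue (\<lambda>x. Lam x * (norm (h x))\<^sup>2)"
  proof (rule integrable_locally_integrable_mult[OF Lam_loc assms(3)])
    show "(\<lambda>x. (norm (h x))\<^sup>2) \<in> borel_measurable lebesgue"
      using assms(1) by measurable
    show "\<bar>(norm (h x))\<^sup>2\<bar> \<le> M\<^sup>2" for x
      using power_mono[OF assms(2)[of x], of 2] by simp
  qed (simp add: assms(4))
  show "(\<lambda>x. Q x (h x)) \<in> borel_measurable lebesgue" by (rule Q_measurable[OF assms(1)])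
  show "AE x in lebesgue. norm (Q x (h x)) \<le> norm (Lam x * (norm (h x))\<^sup>2)"
    using AE_good by eventually_elim (use Q_nonneg good_upper Lam_nonneg in simp)
qed

lemma nn_integral_Q_test_function:
  assumes "\<phi> \<in> test_functions U"
  shows "energy a \<phi> \<phi> = (LINT x|lebesgue. Q x (grad \<phi> x))"
    "(\<integral>\<^sup>+x. ennreal (Q x (grad \<phi> x)) \<partial>lebesgue) = ennreal (energy a \<phi> \<phi>)"
    "0 \<le> energy a \<phi> \<phi>"
proof -
  obtain K where K: "compact K" "\<And>x. x \<notin> K \<Longrightarrow> grad \<phi> x = 0"
    using test_functionsE[OF assms] by metis
  obtain M where M: "\<And>x. norm (grad \<phi> x) \<le> M"
    using test_functions_bounded[OF assms] by metis
  have int: "integrable lebesgue (\<lambda>x. Q x (grad \<phi> x))"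
    by (rule Q_locally_integrable[OF test_functions_measurable_lebesgue(2)[OF assms] M K])
  have nn: "AE x in lebesgue. 0 \<le> Q x (grad \<phi> x)"
    using AE_good by eventually_elim (rule Q_nonneg)
  show e: "energy a \<phi> \<phi> = (LINT x|lebesgue. Q x (grad \<phi> x))"
    unfolding Q_def by (intro energy_eq is_weak_grad_test_function[OF assms])
  show "(\<integral>\<^sup>+x. ennreal (Q x (grad \<phi> x)) \<partial>lebesgue) = ennreal (energy a \<phi> \<phi>)"
    unfolding e by (rule nn_integral_eq_integral[OF int nn])
  show "0 \<le> energy a \<phi> \<phi>" unfolding e by (rule integral_nonneg_AE[OF nn])
qed

lemma nn_integral_Q_diff:
  assumes "\<phi> \<in> test_functions U" "\<psi> \<in> test_functions U"
  shows "(\<integral>\<^sup>+x. ennreal (Q x (grad \<phi> x - grad \<psi> x)) \<partial>lebesgue)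
    = ennreal (energy a (\<lambda>x. \<phi> x - \<psi> x) (\<lambda>x. \<phi> x - \<psi> x))"
    "0 \<le> energy a (\<lambda>x. \<phi> x - \<psi> x) (\<lambda>x. \<phi> x - \<psi> x)"
  using nn_integral_Q_test_function(2,3)[OF test_functions_diff[OF assms]]
  by (simp_all add: grad_diff[OF assms[THEN test_functions_differentiable]])

end

lemma ennreal_lincomb:
  assumes "0 \<le> s" "0 \<le> x" "0 \<le> t" "0 \<le> y"
  shows "ennreal s * ennreal x + ennreal t * ennreal y = ennreal (s * x + t * y)"
  using assms by (simp only: ennreal_plus ennreal_mult mult_nonneg_nonneg)

lemma nn_integral_Young_le:
  fixes f b c :: "'a \<Rightarrow> real"
  assumes "AE x in M. \<bar>f x\<bar> \<le> e * b x + c x / e" "e > 0"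
    "AE x in M. 0 \<le> b x" "AE x in M. 0 \<le> c x"
    "b \<in> borel_measurable M" "c \<in> borel_measurable M" "integrable M f"
    "(\<integral>\<^sup>+x. ennreal (b x) \<partial>M) \<le> ennreal B" "(\<integral>\<^sup>+x. ennreal (c x) \<partial>M) \<le> ennreal C" "0 \<le> B" "0 \<le> C"
  shows "\<bar>LINT x|M. f x\<bar> \<le> e * B + C / e"
proof -
  note [measurable] = assms(5,6)
  have "ennreal \<bar>LINT x|M. f x\<bar> \<le> (\<integral>\<^sup>+x. ennreal (norm (f x)) \<partial>M)"
    using integral_norm_bound_ennreal[OF assms(7)] by simp
  also have "\<dots> \<le> (\<integral>\<^sup>+x. ennreal e * ennreal (b x) + ennreal (1 / e) * ennreal (c x) \<partial>M)"
  proof (rule nn_integral_mono_AE)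
    show "AE x in M. ennreal (norm (f x)) \<le> ennreal e * ennreal (b x) + ennreal (1 / e) * ennreal (c x)"
      using assms(1,3,4)
    proof eventually_elim
      case (elim x)
      have e: "0 \<le> e" "0 \<le> 1 / e" using assms(2) by simp_all
      have "ennreal (norm (f x)) \<le> ennreal (e * b x + 1 / e * c x)"
        using elim(1) by (intro ennreal_leI) simp
      also have "\<dots> = ennreal (e * b x) + ennreal (1 / e * c x)"
        using e elim by (intro ennreal_plus mult_nonneg_nonneg)
      also have "\<dots> = ennreal e * ennreal (b x) + ennreal (1 / e) * ennreal (c x)"
        by (simp only: ennreal_mult[OF e(1) elim(2)] ennreal_mult[OF e(2) elim(3)])
      finally show ?case .
    qed
  qed
  also have "\<dots> = ennreal e * (\<integral>\<^sup>+x. ennreal (b x) \<partial>M) + ennreal (1 / e) * (\<integral>\<^sup>+x. ennreal (c x) \<partial>M)"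
    by (subst nn_integral_add) (simp_all add: nn_integral_cmult)
  also have "\<dots> \<le> ennreal e * ennreal B + ennreal (1 / e) * ennreal C"
    by (intro add_mono mult_left_mono assms) auto
  also have "\<dots> = ennreal (e * B + C / e)"
    using ennreal_lincomb[of e B "1 / e" C] assms(2,10,11) by simp
  finally show ?thesis using assms by (subst (asm) ennreal_le_iff) (auto intro!: add_nonneg_nonneg)
qed

lemma L2_function_locally_integrable:
  fixes v :: "'a::euclidean_space \<Rightarrow> real"
  assumes "L2_function v"
  shows "locally_integrable v"
  unfolding locally_integrable_def set_integrable_def
proof (intro allI impI)
  fix K :: "'a set" assume K: "compact K"
  have m: "v \<in> borel_measurable lebesgue" using assms by (simp add: L2_function_def)
  have Km: "K \<in> sets lebesgue" using K by (simp add: lmeasurable_compact fmeasurableD)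
  show "integrable lebesgue (\<lambda>x. indicator K x *\<^sub>R v x)"
  proof (rule Bochner_Integration.integrable_bound)
    show "integrable lebesgue (\<lambda>x. indicator K x *\<^sub>R (1::real) + (v x)\<^sup>2)"
      using assms locally_integrableD[OF locally_integrable_const K, of 1]
      by (intro Bochner_Integration.integrable_add) (auto simp: L2_function_def)
    show "(\<lambda>x. indicator K x *\<^sub>R v x) \<in> borel_measurable lebesgue"
      using m Km by measurable
    have "\<bar>t\<bar> \<le> 1 + t\<^sup>2" for t :: real
      using zero_le_power2[of "\<bar>t\<bar> - 1"] by (simp add: power2_eq_square algebra_simps)
    then show "AE x in lebesgue. norm (indicator K x *\<^sub>R v x) \<le> norm (indicator K x *\<^sub>R (1::real) + (v x)\<^sup>2)"
      by (intro AE_I2) (simp add: indicator_def)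
  qed
qed

section \<open>Limits of test functions in the energy\<close>

context elliptic_coefficients
begin

text \<open>The limit g of the gradients is a datum of its own; only afterwards is it recognised as
  the weak gradient of v. Nonnegative integrals express the convergence without presupposing
  integrability of the differences.\<close>

definition approximates :: "(real^'n) set \<Rightarrow> (nat \<Rightarrow> real^'n \<Rightarrow> real) \<Rightarrow> (real^'n \<Rightarrow> real) \<Rightarrow> (real^'n \<Rightarrow> real^'n) \<Rightarrow> bool" where
  "approximates U \<phi> v g \<longleftrightarrow> (\<forall>n. \<phi> n \<in> test_functions U) \<and> L2_function v \<and>
     g \<in> borel_measurable lebesgue \<and>
     (\<lambda>n. \<integral>\<^sup>+x. ennreal ((\<phi> n x - v x)\<^sup>2) \<partial>lebesgue) \<longlonglongrightarrow> 0 \<and>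
     (\<lambda>n. \<integral>\<^sup>+x. ennreal (Q x (grad (\<phi> n) x - g x)) \<partial>lebesgue) \<longlonglongrightarrow> 0"

lemma nn_integral_Q_add_le:
  assumes [measurable]: "g \<in> borel_measurable lebesgue" "h \<in> borel_measurable lebesgue"
  shows "(\<integral>\<^sup>+x. ennreal (Q x (g x + h x)) \<partial>lebesgue)
    \<le> 2 * (\<integral>\<^sup>+x. ennreal (Q x (g x)) \<partial>lebesgue) + 2 * (\<integral>\<^sup>+x. ennreal (Q x (h x)) \<partial>lebesgue)"
proof -
  note [measurable] = Q_measurable
  have "(\<integral>\<^sup>+x. ennreal (Q x (g x + h x)) \<partial>lebesgue)
    \<le> (\<integral>\<^sup>+x. 2 * ennreal (Q x (g x)) + 2 * ennreal (Q x (h x)) \<partial>lebesgue)"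
  proof (rule nn_integral_mono_AE)
    show "AE x in lebesgue. ennreal (Q x (g x + h x)) \<le> 2 * ennreal (Q x (g x)) + 2 * ennreal (Q x (h x))"
      using AE_good
    proof eventually_elim
      case (elim x)
      have "ennreal (Q x (g x + h x)) \<le> ennreal (2 * Q x (g x) + 2 * Q x (h x))"
        by (intro ennreal_leI Q_add_le elim)
      also have "\<dots> = 2 * ennreal (Q x (g x)) + 2 * ennreal (Q x (h x))"
        using Q_nonneg[OF elim] by (simp add: ennreal_mult ennreal_plus)
      finally show ?case .
    qed
  qed
  also have "\<dots> = 2 * (\<integral>\<^sup>+x. ennreal (Q x (g x)) \<partial>lebesgue) + 2 * (\<integral>\<^sup>+x. ennreal (Q x (h x)) \<partial>lebesgue)"
    by (subst nn_integral_add) (auto simp: nn_integral_cmult)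
  finally show ?thesis .
qed

lemma nn_integral_Q_commute:
  "(\<integral>\<^sup>+x. ennreal (Q x (g x - h x)) \<partial>lebesgue) = (\<integral>\<^sup>+x. ennreal (Q x (h x - g x)) \<partial>lebesgue)"
  by (simp only: Q_commute[of _ "g _" "h _"])

lemma approximatesD:
  assumes "approximates U \<phi> v g"
  shows "\<phi> n \<in> test_functions U" "L2_function v" "v \<in> borel_measurable lebesgue"
    "g \<in> borel_measurable lebesgue"
    "(\<lambda>n. \<integral>\<^sup>+x. ennreal ((\<phi> n x - v x)\<^sup>2) \<partial>lebesgue) \<longlonglongrightarrow> 0"
    "(\<lambda>n. \<integral>\<^sup>+x. ennreal (Q x (grad (\<phi> n) x - g x)) \<partial>lebesgue) \<longlonglongrightarrow> 0"
  using assms by (auto simp: approximates_def L2_function_def)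

lemma approximates_finite_energy:
  assumes ap: "approximates U \<phi> v g"
  shows "(\<integral>\<^sup>+x. ennreal (Q x (g x)) \<partial>lebesgue) < \<infinity>"
proof -
  have "\<forall>\<^sub>F n in sequentially. (\<integral>\<^sup>+x. ennreal (Q x (grad (\<phi> n) x - g x)) \<partial>lebesgue) < 1"
    using approximatesD(6)[OF ap] by (rule order_tendstoD) simp
  then obtain n where n: "(\<integral>\<^sup>+x. ennreal (Q x (grad (\<phi> n) x - g x)) \<partial>lebesgue) < 1"
    using eventually_happens'[OF sequentially_bot] by blast
  have m: "grad (\<phi> n) \<in> borel_measurable lebesgue" "g \<in> borel_measurable lebesgue"
    using approximatesD[OF ap] test_functions_measurable_lebesgue by blast+
  have "(\<integral>\<^sup>+x. ennreal (Q x ((g x - grad (\<phi> n) x) + grad (\<phi> n) x)) \<partial>lebesgue)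
    \<le> 2 * (\<integral>\<^sup>+x. ennreal (Q x (g x - grad (\<phi> n) x)) \<partial>lebesgue) + 2 * (\<integral>\<^sup>+x. ennreal (Q x (grad (\<phi> n) x)) \<partial>lebesgue)"
    using m by (intro nn_integral_Q_add_le) measurable
  also have "\<dots> < \<infinity>"
    using n unfolding nn_integral_Q_commute[of g] nn_integral_Q_test_function(2)[OF approximatesD(1)[OF ap]]
    by (auto simp: ennreal_mult_less_top less_top intro: order.strict_trans)
  finally show ?thesis by simp
qed

text \<open>Write the product as (sqrt lam |\<xi>|) (|t| / sqrt lam): the first factor is controlled
  by Q, the second by the integrable weight \<open>1 / lam\<close>. This is how convergence in the
  energy is felt by integrals without a weight.\<close>

lemma norm_le_lam_Q:
  assumes "good x" "e > 0"
  shows "2 * (norm \<xi> * \<bar>t\<bar>) \<le> e * (t\<^sup>2 * (1 / lam x)) + Q x \<xi> / e"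
proof -
  have l: "lam x > 0" using good_pos[OF assms(1)] .
  let ?s = "sqrt (lam x)"
  have s: "?s > 0" "?s\<^sup>2 = lam x" using l by simp_all
  have "0 \<le> (e * \<bar>t\<bar> / ?s - ?s * norm \<xi>)\<^sup>2" by simp
  also have "\<dots> = e\<^sup>2 * (t\<^sup>2 * (1 / lam x)) - 2 * e * (norm \<xi> * \<bar>t\<bar>) + lam x * (norm \<xi>)\<^sup>2"
    using s by (simp add: power2_diff power_mult_distrib power_divide)
  also have "\<dots> \<le> e\<^sup>2 * (t\<^sup>2 * (1 / lam x)) - 2 * e * (norm \<xi> * \<bar>t\<bar>) + Q x \<xi>"
    using good_lower[OF assms(1)] by simp
  finally have "e * (2 * (norm \<xi> * \<bar>t\<bar>)) \<le> e * (e * (t\<^sup>2 * (1 / lam x)) + Q x \<xi> / e)"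
    using assms(2) by (simp add: distrib_left power2_eq_square mult_ac)
  then show ?thesis using assms(2) by simp
qed

text \<open>The preceding inequality with t = 1 gives |g| \<le> 1/lam + Q(g), and both terms are
  locally integrable.\<close>

lemma approximates_imp_locally_integrable:
  assumes ap: "approximates U \<phi> v g"
  shows "locally_integrable g"
  unfolding locally_integrable_def set_integrable_def
proof (intro allI impI)
  fix K :: "(real^'n) set" assume K: "compact K"
  have gm: "g \<in> borel_measurable lebesgue" using approximatesD[OF ap] by blast
  have Km: "K \<in> sets lebesgue" using K by (simp add: lmeasurable_compact fmeasurableD)
  have iQ: "integrable lebesgue (\<lambda>x. Q x (g x))"
  proof (rule integrableI_nn_integral_finite)
    show "(\<lambda>x. Q x (g x)) \<in> borel_measurable lebesgue" by (rule Q_measurable[OF gm])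
    show "AE x in lebesgue. 0 \<le> Q x (g x)" using AE_good by eventually_elim (rule Q_nonneg)
    show "(\<integral>\<^sup>+x. ennreal (Q x (g x)) \<partial>lebesgue) = ennreal (enn2real (\<integral>\<^sup>+x. ennreal (Q x (g x)) \<partial>lebesgue))"
      using approximates_finite_energy[OF ap] by simp
  qed
  show "integrable lebesgue (\<lambda>x. indicator K x *\<^sub>R g x)"
  proof (rule Bochner_Integration.integrable_bound)
    show "integrable lebesgue (\<lambda>x. indicator K x *\<^sub>R (1 / lam x) + Q x (g x))"
      by (intro Bochner_Integration.integrable_add iQ locally_integrableD[OF lam_inv_loc K])
    show "(\<lambda>x. indicator K x *\<^sub>R g x) \<in> borel_measurable lebesgue"
      using gm Km by measurable
    show "AE x in lebesgue. norm (indicator K x *\<^sub>R g x) \<le> norm (indicator K x *\<^sub>R (1 / lam x) + Q x (g x))"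
      using AE_good
    proof eventually_elim
      case (elim x)
      have "norm (g x) \<le> 2 * (norm (g x) * \<bar>1\<bar>)" by simp
      also have "\<dots> \<le> 1 / lam x + Q x (g x)" using norm_le_lam_Q[OF elim, of 1 "g x" 1] by simp
      finally have "norm (g x) \<le> 1 / lam x + Q x (g x)" .
      moreover have "0 \<le> Q x (g x)" "0 < 1 / lam x" using Q_nonneg[OF elim] good_pos[OF elim] by simp_all
      ultimately show ?case by (cases "x \<in> K") simp_all
    qed
  qed
qed

lemma approximates_imp_form_domain:
  assumes ap: "approximates U \<phi> v g"
  shows "v \<in> form_domain a U"
  unfolding form_domain_def mem_Collect_eq
proof (intro conjI exI[of _ \<phi>] allI impI)
  note D = approximatesD[OF ap]
  show "L2_function v" "\<phi> n \<in> test_functions U" for n using D by blast+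
  have m: "\<phi> n \<in> borel_measurable lebesgue" "grad (\<phi> n) \<in> borel_measurable lebesgue" for n
    using test_functions_measurable_lebesgue[OF D(1)] by blast+
  note [measurable] = m D(3,4)
  have eq: "(LINT x|lebesgue. (\<phi> n x - v x)\<^sup>2) = enn2real (\<integral>\<^sup>+x. ennreal ((\<phi> n x - v x)\<^sup>2) \<partial>lebesgue)" for n
    by (rule integral_eq_nn_integral) auto
  have "(\<lambda>n. \<integral>\<^sup>+x. ennreal ((\<phi> n x - v x)\<^sup>2) \<partial>lebesgue) \<longlonglongrightarrow> ennreal 0"
    using D(5) by simp
  then show "(\<lambda>n. LINT x|lebesgue. (\<phi> n x - v x)\<^sup>2) \<longlonglongrightarrow> 0"
    unfolding eq by (rule tendsto_enn2real) simp
  fix e :: real assume e: "e > 0"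
  have "\<forall>\<^sub>F n in sequentially. (\<integral>\<^sup>+x. ennreal (Q x (grad (\<phi> n) x - g x)) \<partial>lebesgue) < ennreal (e / 8)"
    using D(6) by (rule order_tendstoD) (use e in simp)
  then obtain N where N: "\<And>n. n \<ge> N \<Longrightarrow> (\<integral>\<^sup>+x. ennreal (Q x (grad (\<phi> n) x - g x)) \<partial>lebesgue) < ennreal (e / 8)"
    unfolding eventually_sequentially by blast
  show "\<exists>N. \<forall>m\<ge>N. \<forall>n\<ge>N. energy a (\<lambda>x. \<phi> m x - \<phi> n x) (\<lambda>x. \<phi> m x - \<phi> n x) < e"
  proof (intro exI[of _ N] allI impI)
    fix m n assume mn: "m \<ge> N" "n \<ge> N"
    have "ennreal (energy a (\<lambda>x. \<phi> m x - \<phi> n x) (\<lambda>x. \<phi> m x - \<phi> n x))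
      = (\<integral>\<^sup>+x. ennreal (Q x ((grad (\<phi> m) x - g x) + (g x - grad (\<phi> n) x))) \<partial>lebesgue)"
      using nn_integral_Q_diff(1)[OF D(1) D(1), of m n] by simp
    also have "\<dots> \<le> 2 * (\<integral>\<^sup>+x. ennreal (Q x (grad (\<phi> m) x - g x)) \<partial>lebesgue)
      + 2 * (\<integral>\<^sup>+x. ennreal (Q x (g x - grad (\<phi> n) x)) \<partial>lebesgue)"
      by (rule nn_integral_Q_add_le) measurable
    also have "\<dots> \<le> 2 * ennreal (e / 8) + 2 * ennreal (e / 8)"
      unfolding nn_integral_Q_commute[of g "grad (\<phi> n)"]
      by (intro add_mono mult_left_mono less_imp_le N mn) auto
    also have "\<dots> = ennreal (e / 2)"
    proof -
      have "2 * (e / 8) + 2 * (e / 8) = e / 2" by simp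
      with ennreal_lincomb[of 2 "e / 8" 2 "e / 8", unfolded ennreal_numeral] e show ?thesis
        by (metis divide_nonneg_nonneg less_imp_le zero_le_numeral)
    qed
    finally have "energy a (\<lambda>x. \<phi> m x - \<phi> n x) (\<lambda>x. \<phi> m x - \<phi> n x) \<le> e / 2"
      using e by (subst (asm) ennreal_le_iff) auto
    then show "energy a (\<lambda>x. \<phi> m x - \<phi> n x) (\<lambda>x. \<phi> m x - \<phi> n x) < e" using e by simp
  qed
qed

text \<open>Integration by parts for the approximants passes to the limit. Both differences are
  estimated by Young's inequality with a free parameter e; for the gradients the fixed term is the
  integral of \<psi>^2 / lam, finite because \<psi> has compact support and \<open>1 / lam\<close>
  is locally integrable.\<close>

lemma approximates_imp_weak_grad:
  assumes ap: "approximates U \<phi> v g"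
  shows "is_weak_grad v g"
  unfolding is_weak_grad_def
proof (intro conjI ballI allI)
  note D = approximatesD[OF ap]
  show lv: "locally_integrable v" by (rule L2_function_locally_integrable[OF D(2)])
  show lg: "locally_integrable g" by (rule approximates_imp_locally_integrable[OF ap])
  have m: "\<phi> n \<in> borel_measurable lebesgue" "grad (\<phi> n) \<in> borel_measurable lebesgue" for n
    using test_functions_measurable_lebesgue[OF D(1)] by blast+
  note [measurable] = m D(3,4) Q_measurable
  fix \<psi> :: "real^'n \<Rightarrow> real" and i :: 'n
  assume \<psi>: "\<psi> \<in> test_functions UNIV"
  note [measurable] = test_functions_measurable_lebesgue[OF \<psi>] lam_measurable borel_measurable_vec_nth
  obtain K where K: "compact K" "\<And>x. x \<notin> K \<Longrightarrow> \<psi> x = 0" "\<And>x. x \<notin> K \<Longrightarrow> grad \<psi> x = 0"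
    using test_functionsE[OF \<psi>] by metis
  obtain M where M: "M > 0" "\<And>x. \<bar>\<psi> x\<bar> \<le> M" "\<And>x. norm (grad \<psi> x) \<le> M"
    using test_functions_bounded[OF \<psi>] by metis
  have b: "\<bar>pderiv_at i \<psi> x\<bar> \<le> M" for x
    using order_trans[OF component_le_norm_cart M(3)] by (metis grad_component)
  have z: "pderiv_at i \<psi> x = 0" if "x \<notin> K" for x
    using K(3)[OF that] by (metis grad_component zero_index)
  note lphi = test_functions_locally_integrable[OF D(1)]
  \<comment> \<open>An extended-valued sequence tending to 0 may be infinite at first, and
    \<open>enn2real\<close> would then give 0; hence the bound by a real null sequence holds only
    eventually.\<close>
  have fin: "\<exists>A::nat \<Rightarrow> real. A \<longlonglongrightarrow> 0 \<and> (\<forall>n. 0 \<le> A n) \<and> (\<forall>\<^sub>F n in sequentially. F n \<le> ennreal (A n))"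
    if "F \<longlonglongrightarrow> 0" for F :: "nat \<Rightarrow> ennreal"
  proof (intro exI[of _ "\<lambda>n. enn2real (F n)"] conjI allI)
    have "F \<longlonglongrightarrow> ennreal 0" using that by simp
    then show "(\<lambda>n. enn2real (F n)) \<longlonglongrightarrow> 0" by (rule tendsto_enn2real) simp
    have "\<forall>\<^sub>F n in sequentially. F n < 1" using that by (rule order_tendstoD) simp
    then show "\<forall>\<^sub>F n in sequentially. F n \<le> ennreal (enn2real (F n))"
      by eventually_elim (metis ennreal_enn2real ennreal_one_less_top order.strict_trans order_refl)
  qed simp
  have lim1: "(\<lambda>n. LINT x|lebesgue. \<phi> n x * pderiv_at i \<psi> x) \<longlonglongrightarrow> (LINT x|lebesgue. v x * pderiv_at i \<psi> x)"
  proof -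
    from fin[OF D(5)] obtain A :: "nat \<Rightarrow> real" where A': "A \<longlonglongrightarrow> 0 \<and> (\<forall>n. 0 \<le> A n) \<and>
      (\<forall>\<^sub>F n in sequentially. (\<integral>\<^sup>+x. ennreal ((\<phi> n x - v x)\<^sup>2) \<partial>lebesgue) \<le> ennreal (A n))" by (rule exE)
    note A = A'[THEN conjunct1] A'[THEN conjunct2, THEN conjunct1, rule_format]
      A'[THEN conjunct2, THEN conjunct2]
    have i2: "integrable lebesgue (\<lambda>x. (pderiv_at i \<psi> x)\<^sup>2)"
    proof (rule integrable_bounded_compact_support[OF K(1)])
      show "\<bar>(pderiv_at i \<psi> x)\<^sup>2\<bar> \<le> M\<^sup>2" for x
        using power_mono[OF b[of x], of 2] by simp
    qed (simp_all add: z)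
    define B where "B = (LINT x|lebesgue. (pderiv_at i \<psi> x)\<^sup>2)"
    have B: "0 \<le> B" "(\<integral>\<^sup>+x. ennreal ((pderiv_at i \<psi> x)\<^sup>2) \<partial>lebesgue) \<le> ennreal B"
      unfolding B_def by (simp_all add: nn_integral_eq_integral[OF i2])
    have "(\<lambda>n. LINT x|lebesgue. (\<phi> n x - v x) * pderiv_at i \<psi> x) \<longlonglongrightarrow> 0"
    proof (rule tendsto_0_if_Young_bound[OF A(1) _ B(1)])
      fix e :: real assume e: "e > 0"
      show "\<forall>\<^sub>F n in sequentially. \<bar>LINT x|lebesgue. (\<phi> n x - v x) * pderiv_at i \<psi> x\<bar> \<le> e * B + A n / e"
        using A(3)
      proof eventually_elim
        case (elim n)
        show ?case
        proof (rule nn_integral_Young_le[OF _ e _ _ _ _ _ B(2) elim B(1) A(2)])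
          have yg: "\<bar>s * t\<bar> \<le> e * t\<^sup>2 + s\<^sup>2 / e" for s t :: real
          proof -
            have "0 \<le> (e * \<bar>t\<bar> - \<bar>s\<bar>)\<^sup>2" by simp
            then have "2 * e * \<bar>s * t\<bar> \<le> e\<^sup>2 * t\<^sup>2 + s\<^sup>2" by (simp add: power2_diff power_mult_distrib abs_mult mult_ac)
            moreover have "e * \<bar>s * t\<bar> \<le> 2 * e * \<bar>s * t\<bar>" using e by simp
            ultimately have "e * \<bar>s * t\<bar> \<le> e\<^sup>2 * t\<^sup>2 + s\<^sup>2" by linarith
            also have "\<dots> = e * (e * t\<^sup>2 + s\<^sup>2 / e)"
              using e by (simp add: distrib_left power2_eq_square)
            finally show ?thesis using e by simp
          qed
          show "AE x in lebesgue. \<bar>(\<phi> n x - v x) * pderiv_at i \<psi> x\<bar> \<le> e * (pderiv_at i \<psi> x)\<^sup>2 + (\<phi> n x - v x)\<^sup>2 / e"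
            by (intro AE_I2 yg)
          show "integrable lebesgue (\<lambda>x. (\<phi> n x - v x) * pderiv_at i \<psi> x)"
            by (intro integrable_test_mult(2)[OF _ \<psi>] locally_integrable_diff lphi lv)
        qed (auto intro: AE_I2)
      qed
    qed
    moreover have "(LINT x|lebesgue. (\<phi> n x - v x) * pderiv_at i \<psi> x)
      = (LINT x|lebesgue. \<phi> n x * pderiv_at i \<psi> x) - (LINT x|lebesgue. v x * pderiv_at i \<psi> x)" for n
      by (simp add: left_diff_distrib integrable_test_mult(2)[OF _ \<psi>] lphi lv)
    ultimately show ?thesis by (simp add: LIM_zero_iff)
  qed
  have lim2: "(\<lambda>n. LINT x|lebesgue. grad (\<phi> n) x $ i * \<psi> x) \<longlonglongrightarrow> (LINT x|lebesgue. g x $ i * \<psi> x)"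
  proof -
    from fin[OF D(6)] obtain A :: "nat \<Rightarrow> real" where A': "A \<longlonglongrightarrow> 0 \<and> (\<forall>n. 0 \<le> A n) \<and>
      (\<forall>\<^sub>F n in sequentially. (\<integral>\<^sup>+x. ennreal (Q x (grad (\<phi> n) x - g x)) \<partial>lebesgue) \<le> ennreal (A n))" by (rule exE)
    note A = A'[THEN conjunct1] A'[THEN conjunct2, THEN conjunct1, rule_format]
      A'[THEN conjunct2, THEN conjunct2]
    have i2: "integrable lebesgue (\<lambda>x. 1 / lam x * (\<psi> x)\<^sup>2)"
    proof (rule integrable_locally_integrable_mult[OF lam_inv_loc K(1)])
      show "\<bar>(\<psi> x)\<^sup>2\<bar> \<le> M\<^sup>2" for x
        using power_mono[OF M(2)[of x], of 2] by simp
    qed (simp_all add: K(2))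
    define B where "B = (LINT x|lebesgue. 1 / lam x * (\<psi> x)\<^sup>2)"
    have nn: "AE x in lebesgue. 0 \<le> 1 / lam x * (\<psi> x)\<^sup>2"
      using lam_pos by eventually_elim simp
    have B: "0 \<le> B" "(\<integral>\<^sup>+x. ennreal (1 / lam x * (\<psi> x)\<^sup>2) \<partial>lebesgue) \<le> ennreal B"
      unfolding B_def using integral_nonneg_AE[OF nn] nn_integral_eq_integral[OF i2 nn] by simp_all
    have "(\<lambda>n. LINT x|lebesgue. (grad (\<phi> n) x $ i - g x $ i) * \<psi> x) \<longlonglongrightarrow> 0"
    proof (rule tendsto_0_if_Young_bound[OF A(1) _ B(1)])
      fix e :: real assume e: "e > 0"
      show "\<forall>\<^sub>F n in sequentially. \<bar>LINT x|lebesgue. (grad (\<phi> n) x $ i - g x $ i) * \<psi> x\<bar> \<le> e * B + A n / e"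
        using A(3)
      proof eventually_elim
        case (elim n)
        show ?case
        proof (rule nn_integral_Young_le[OF _ e nn _ _ _ _ B(2) elim B(1) A(2)])
          show "AE x in lebesgue. \<bar>(grad (\<phi> n) x $ i - g x $ i) * \<psi> x\<bar>
            \<le> e * (1 / lam x * (\<psi> x)\<^sup>2) + Q x (grad (\<phi> n) x - g x) / e"
            using AE_good
          proof eventually_elim
            case (elim x)
            have "\<bar>(grad (\<phi> n) x $ i - g x $ i) * \<psi> x\<bar> \<le> norm (grad (\<phi> n) x - g x) * \<bar>\<psi> x\<bar>"
              unfolding abs_mult
              using component_le_norm_cart[of "grad (\<phi> n) x - g x" i]
              by (intro mult_right_mono) (simp_all only: vector_minus_component abs_ge_zero)
            also have "\<dots> \<le> 2 * (norm (grad (\<phi> n) x - g x) * \<bar>\<psi> x\<bar>)" by simp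
            also have "\<dots> \<le> e * ((\<psi> x)\<^sup>2 * (1 / lam x)) + Q x (grad (\<phi> n) x - g x) / e"
              by (rule norm_le_lam_Q[OF elim e])
            finally show ?case by (simp add: mult.commute)
          qed
          show "AE x in lebesgue. 0 \<le> Q x (grad (\<phi> n) x - g x)"
            using AE_good by eventually_elim (rule Q_nonneg)
          show "integrable lebesgue (\<lambda>x. (grad (\<phi> n) x $ i - g x $ i) * \<psi> x)"
            by (intro integrable_test_mult(1)[OF _ \<psi>] locally_integrable_diff locally_integrable_component lphi lg)
          show "(\<lambda>x. Q x (grad (\<phi> n) x - g x)) \<in> borel_measurable lebesgue" by measurable
          show "(\<lambda>x. 1 / lam x * (\<psi> x)\<^sup>2) \<in> borel_measurable lebesgue" by measurable
        qed
      qed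
    qed
    moreover have "(LINT x|lebesgue. (grad (\<phi> n) x $ i - g x $ i) * \<psi> x)
      = (LINT x|lebesgue. grad (\<phi> n) x $ i * \<psi> x) - (LINT x|lebesgue. g x $ i * \<psi> x)" for n
      using integrable_test_mult(1)[OF locally_integrable_component[OF lphi(2)] \<psi>, of n i]
        integrable_test_mult(1)[OF locally_integrable_component[OF lg] \<psi>, of i]
      by (simp add: left_diff_distrib)
    ultimately show ?thesis by (simp add: LIM_zero_iff)
  qed
  have eq: "(LINT x|lebesgue. \<phi> n x * pderiv_at i \<psi> x) = - (LINT x|lebesgue. grad (\<phi> n) x $ i * \<psi> x)" for n
    using is_weak_grad_test_function[OF D(1)] \<psi> unfolding is_weak_grad_def by blast
  show "(LINT x|lebesgue. v x * pderiv_at i \<psi> x) = - (LINT x|lebesgue. g x $ i * \<psi> x)"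
    using lim1 tendsto_minus[OF lim2] unfolding eq by (rule LIMSEQ_unique)
qed

end

section \<open>Polynomial approximation in C^1\<close>

text \<open>Weierstrass is applied to G', and the polynomial is then integrated from 0 with initial
  value G 0. Polynomials preserve every class \<open>Ck\<close> under composition, which a function
  that is merely C^1 does not.\<close>

lemma polynomial_C1_approximation:
  fixes G G' :: "real \<Rightarrow> real"
  assumes G: "\<And>t. (G has_real_derivative G' t) (at t)" and cont: "continuous_on UNIV G'"
    and M: "0 \<le> M" and e: "0 < e"
  shows "\<exists>P P'. (\<forall>t. (P has_real_derivative P' t) (at t)) \<and> continuous_on UNIV P' \<and>
    (\<forall>(\<phi> :: real^'n \<Rightarrow> real) k. Ck k \<phi> \<longrightarrow> Ck k (\<lambda>x. P (\<phi> x))) \<and>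
    (\<forall>t. \<bar>t\<bar> \<le> M \<longrightarrow> \<bar>P t - G t\<bar> \<le> e \<and> \<bar>P' t - G' t\<bar> \<le> e)"
proof -
  \<comment> \<open>An error d for the derivative becomes at most d M for the primitive; this choice
    keeps both below e, also for M = 0.\<close>
  define d where "d = e / (M + 1)"
  have d: "0 < d" "d \<le> e" "d * M \<le> e"
    using e M by (simp_all add: d_def field_simps)
  obtain q where q: "real_polynomial_function q" "\<And>t. t \<in> {-M..M} \<Longrightarrow> \<bar>G' t - q t\<bar> < d"
    using Stone_Weierstrass_real_polynomial_function[of "{-M..M}" G' d] cont d(1)
    by (metis compact_Icc continuous_on_subset subset_UNIV)
  obtain c n where c: "q = (\<lambda>t. \<Sum>i\<le>n. c i * t ^ i)"
    using q(1) real_polynomial_function_iff_sum by metis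
  define P where "P t = G 0 + (\<Sum>i\<le>n. c i / real (Suc i) * t ^ Suc i)" for t
  have DP: "(P has_real_derivative q t) (at t)" for t
  proof -
    have "((\<lambda>t. c i / real (Suc i) * t ^ Suc i) has_real_derivative c i * t ^ i) (at t)" for i
    proof -
      have "((\<lambda>t. c i / real (Suc i) * t ^ Suc i) has_real_derivative
          c i / real (Suc i) * (real (Suc i) * t ^ (Suc i - Suc 0))) (at t)"
        by (rule DERIV_cmult[OF DERIV_pow])
      then show ?thesis by simp
    qed
    then have "((\<lambda>t. \<Sum>i\<le>n. c i / real (Suc i) * t ^ Suc i) has_real_derivative (\<Sum>i\<le>n. c i * t ^ i)) (at t)"
      by (rule DERIV_sum)
    from DERIV_add[OF DERIV_const this, of "G 0"] show ?thesis
      unfolding c P_def[abs_def] by simp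
  qed
  have bP: "\<bar>P t - G t\<bar> \<le> e" if "\<bar>t\<bar> \<le> M" for t
  proof -
    have "norm ((\<lambda>t. P t - G t) t - (\<lambda>t. P t - G t) 0) \<le> d * norm (t - 0)"
    proof (rule field_differentiable_bound[of "{-M..M}"])
      show "((\<lambda>t. P t - G t) has_real_derivative q z - G' z) (at z within {-M..M})" for z
        by (intro DERIV_subset[OF DERIV_diff[OF DP G]]) simp
      show "norm (q z - G' z) \<le> d" if "z \<in> {-M..M}" for z
        using q(2)[OF that] by simp
    qed (use that M in auto)
    also have "\<dots> \<le> d * M" using d(1) that by simp
    finally show ?thesis using d(3) by (simp add: P_def)
  qed
  show ?thesis
  proof (intro exI conjI allI impI)
    show "(P has_real_derivative q t) (at t)" for t by (rule DP)
    show "continuous_on UNIV q" unfolding c by (intro continuous_intros)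
    show "Ck k (\<lambda>x. P (\<phi> x))" if "Ck k \<phi>" for k and \<phi> :: "real^'n \<Rightarrow> real"
      unfolding P_def by (intro Ck_add Ck_const Ck_sum Ck_cmult Ck_power that)
    show "\<bar>P t - G t\<bar> \<le> e" if "\<bar>t\<bar> \<le> M" for t by (rule bP[OF that])
    show "\<bar>q t - G' t\<bar> \<le> e" if "\<bar>t\<bar> \<le> M" for t
    proof -
      have "t \<in> {-M..M}" using that by auto
      from q(2)[OF this] show ?thesis using d(2) by linarith
    qed
  qed
qed

section \<open>Almost everywhere convergent approximation in the form domain\<close>

context elliptic_coefficients
begin

text \<open>The Cauchy condition gives no limit of the gradients by itself. Along a subsequence with
  increments of energy below (1/8)^k, almost every x satisfies Q \<le> C (1/4)^k for these
  increments; dividing by lam x > 0 makes the gradients summable, hence convergent, at x. Fatou's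
  lemma then turns the Cauchy bound into convergence in the energy.\<close>

lemma form_domain_imp_approximates:
  assumes v: "v \<in> form_domain a U"
  shows "\<exists>\<phi> g. approximates U \<phi> v g \<and> (AE x in lebesgue. (\<lambda>n. \<phi> n x) \<longlonglongrightarrow> v x)"
proof -
  obtain \<psi> where L2: "L2_function v" and \<psi>: "\<And>n. \<psi> n \<in> test_functions U"
    and lim: "(\<lambda>n. LINT x|lebesgue. (\<psi> n x - v x)\<^sup>2) \<longlonglongrightarrow> 0"
    and cau: "\<forall>e>0. \<exists>N::nat. \<forall>m\<ge>N. \<forall>n\<ge>N. energy a (\<lambda>x. \<psi> m x - \<psi> n x) (\<lambda>x. \<psi> m x - \<psi> n x) < e"
    using v unfolding form_domain_def by auto
  have "\<exists>N. (\<forall>m\<ge>N. \<forall>n\<ge>N. energy a (\<lambda>x. \<psi> m x - \<psi> n x) (\<lambda>x. \<psi> m x - \<psi> n x) < (1/8)^k)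
    \<and> (\<forall>n\<ge>N. (LINT x|lebesgue. (\<psi> n x - v x)\<^sup>2) < (1/8)^k)" for k :: nat
  proof -
    have p: "(0::real) < (1/8)^k" by simp
    obtain N1 where N1: "\<forall>m\<ge>N1. \<forall>n\<ge>N1. energy a (\<lambda>x. \<psi> m x - \<psi> n x) (\<lambda>x. \<psi> m x - \<psi> n x) < (1/8)^k"
      using cau p by blast
    obtain N2 where N2: "\<forall>n\<ge>N2. (LINT x|lebesgue. (\<psi> n x - v x)\<^sup>2) < (1/8)^k"
      using order_tendstoD(2)[OF lim p] unfolding eventually_sequentially by blast
    show ?thesis by (rule exI[of _ "max N1 N2"]) (use N1 N2 in simp)
  qed
  from choice[OF allI[OF this]] obtain N where
    N: "\<forall>k. (\<forall>m\<ge>N k. \<forall>n\<ge>N k. energy a (\<lambda>x. \<psi> m x - \<psi> n x) (\<lambda>x. \<psi> m x - \<psi> n x) < (1/8)^k)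
    \<and> (\<forall>n\<ge>N k. (LINT x|lebesgue. (\<psi> n x - v x)\<^sup>2) < (1/8)^k)"
    by (rule exE)
  note N1 = N[rule_format, THEN conjunct1, rule_format]
  note N2 = N[rule_format, THEN conjunct2, rule_format]
  \<comment> \<open>Partial sums make a monotone index: r j is at least N k whenever j \<ge> k,
    although N itself need not be monotone.\<close>
  define r where "r k = (\<Sum>j\<le>k. N j)" for k
  have rN: "N k \<le> r j" if "k \<le> j" for k j
    unfolding r_def by (rule member_le_sum) (use that in auto)
  define \<phi> where "\<phi> k = \<psi> (r k)" for k
  have \<phi>: "\<phi> k \<in> test_functions U" for k unfolding \<phi>_def by (rule \<psi>)
  have m: "\<phi> n \<in> borel_measurable lebesgue" "grad (\<phi> n) \<in> borel_measurable lebesgue" for n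
    using test_functions_measurable_lebesgue[OF \<phi>] by blast+
  have vm: "v \<in> borel_measurable lebesgue" using L2 by (simp add: L2_function_def)
  note [measurable] = m vm Q_measurable
  have E1: "(\<integral>\<^sup>+x. ennreal (Q x (grad (\<phi> k) x - grad (\<phi> j) x)) \<partial>lebesgue) \<le> ennreal ((1/8)^k)" if "k \<le> j" for k j
    unfolding nn_integral_Q_diff(1)[OF \<phi> \<phi>] unfolding \<phi>_def
    by (intro ennreal_leI less_imp_le N1 rN that order_refl)
  have E2: "(\<integral>\<^sup>+x. ennreal ((\<phi> k x - v x)\<^sup>2) \<partial>lebesgue) \<le> ennreal ((1/8)^k)" for k
  proof -
    have "integrable lebesgue (\<lambda>x. (\<phi> k x - v x)\<^sup>2)"
    proof (rule Bochner_Integration.integrable_bound)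
      obtain K where K: "compact K" "\<And>x. x \<notin> K \<Longrightarrow> \<phi> k x = 0" using test_functionsE[OF \<phi>] by metis
      obtain M where M: "\<And>x. \<bar>\<phi> k x\<bar> \<le> M" using test_functions_bounded[OF \<phi>] by metis
      have "integrable lebesgue (\<lambda>x. (\<phi> k x)\<^sup>2)"
      proof (rule integrable_bounded_compact_support[OF K(1)])
        show "\<bar>(\<phi> k x)\<^sup>2\<bar> \<le> M\<^sup>2" for x using power_mono[OF M[of x], of 2] by simp
      qed (simp_all add: K(2))
      then show "integrable lebesgue (\<lambda>x. 2 * (\<phi> k x)\<^sup>2 + 2 * (v x)\<^sup>2)"
        using L2 by (intro Bochner_Integration.integrable_add integrable_mult_right) (auto simp: L2_function_def)
      have "(s - t)\<^sup>2 \<le> 2 * s\<^sup>2 + 2 * t\<^sup>2" for s t :: real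
        using zero_le_power2[of "s + t"] by (simp add: power2_sum power2_diff)
      then show "AE x in lebesgue. norm ((\<phi> k x - v x)\<^sup>2) \<le> norm (2 * (\<phi> k x)\<^sup>2 + 2 * (v x)\<^sup>2)"
        by (intro AE_I2) simp
    qed measurable
    from nn_integral_eq_integral[OF this] have "(\<integral>\<^sup>+x. ennreal ((\<phi> k x - v x)\<^sup>2) \<partial>lebesgue) = ennreal (LINT x|lebesgue. (\<phi> k x - v x)\<^sup>2)"
      by simp
    also have "\<dots> \<le> ennreal ((1/8)^k)"
      unfolding \<phi>_def by (intro ennreal_leI less_imp_le N2 rN order_refl)
    finally show ?thesis .
  qed
  have lim8: "(\<lambda>k. ennreal ((1/8)^k)) \<longlonglongrightarrow> 0"
    using tendsto_ennrealI[OF LIMSEQ_realpow_zero[of "1/8"]] by simp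
  have AEv: "AE x in lebesgue. (\<lambda>n. \<phi> n x) \<longlonglongrightarrow> v x"
    using AE_geometric_bound[of "\<lambda>k x. ennreal ((\<phi> k x - v x)\<^sup>2)" lebesgue, OF _ E2, simplified]
  proof eventually_elim
    case (elim x)
    then obtain C where C: "C \<ge> 0" "\<And>k. (\<phi> k x - v x)\<^sup>2 \<le> C * (1/4)^k"
      by (auto simp: ennreal_le_iff)
    have l4: "(\<lambda>k. C * (1/4)^k) \<longlonglongrightarrow> 0"
      using tendsto_mult_right_zero[OF LIMSEQ_realpow_zero[of "1/4"], of C] by simp
    have "(\<lambda>k. (\<phi> k x - v x)\<^sup>2) \<longlonglongrightarrow> 0"
      by (rule tendsto_sandwich[OF _ _ tendsto_const l4])
        (intro always_eventually allI zero_le_power2, intro always_eventually allI C(2))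
    from tendsto_real_sqrt[OF this] have "(\<lambda>k. \<bar>\<phi> k x - v x\<bar>) \<longlonglongrightarrow> 0" by simp
    then have "(\<lambda>k. \<phi> k x - v x) \<longlonglongrightarrow> 0" by (simp only: tendsto_rabs_zero_iff)
    then show ?case by (simp only: LIM_zero_iff)
  qed
  \<comment> \<open>\<open>lim\<close> yields a measurable function whatever happens on the
    exceptional null set.\<close>
  define g where "g x = lim (\<lambda>k. grad (\<phi> k) x)" for x
  have gm: "g \<in> borel_measurable lebesgue"
    unfolding g_def[abs_def] by (rule borel_measurable_lim_metric) measurable
  have AEg: "AE x in lebesgue. (\<lambda>k. grad (\<phi> k) x) \<longlonglongrightarrow> g x"
  proof -
    have "AE x in lebesgue. \<exists>C\<ge>0. \<forall>k. ennreal (Q x (grad (\<phi> k) x - grad (\<phi> (Suc k)) x)) \<le> ennreal (C * (1/4)^k)"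
      by (rule AE_geometric_bound) (measurable, rule E1, simp)
    then show ?thesis using AE_good
    proof eventually_elim
      case (elim x)
      then obtain C where C: "C \<ge> 0" "\<And>k. ennreal (Q x (grad (\<phi> k) x - grad (\<phi> (Suc k)) x)) \<le> ennreal (C * (1/4)^k)"
        by blast
      note l = good_pos[OF elim(2)]
      have b: "norm (grad (\<phi> (Suc k)) x - grad (\<phi> k) x) \<le> sqrt (C / lam x) * (1/2)^k" for k
      proof -
        have "Q x (grad (\<phi> k) x - grad (\<phi> (Suc k)) x) \<le> C * (1/4)^k"
          using C(2)[of k] C(1) by (subst (asm) ennreal_le_iff) auto
        with good_lower[OF elim(2), of "grad (\<phi> k) x - grad (\<phi> (Suc k)) x"]
        have "lam x * (norm (grad (\<phi> k) x - grad (\<phi> (Suc k)) x))\<^sup>2 \<le> C * (1/4)^k" by linarith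
        then have "(norm (grad (\<phi> k) x - grad (\<phi> (Suc k)) x))\<^sup>2 \<le> C / lam x * (1/4)^k"
          using l by (simp add: field_simps)
        then have "sqrt ((norm (grad (\<phi> k) x - grad (\<phi> (Suc k)) x))\<^sup>2) \<le> sqrt (C / lam x * (1/4)^k)"
          by (rule real_sqrt_le_mono)
        also have "\<dots> = sqrt (C / lam x) * (1/2)^k"
          by (simp add: real_sqrt_mult real_sqrt_power real_sqrt_divide)
        finally show ?thesis by (simp add: norm_minus_commute)
      qed
      have "summable (\<lambda>k. grad (\<phi> (Suc k)) x - grad (\<phi> k) x)"
        by (rule summable_comparison_test[of _ "\<lambda>k. sqrt (C / lam x) * (1/2)^k"])
          (use b in \<open>auto intro: summable_mult summable_geometric\<close>)
      from summable_LIMSEQ[OF this]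
      have "(\<lambda>n. grad (\<phi> n) x - grad (\<phi> 0) x) \<longlonglongrightarrow> (\<Sum>k. grad (\<phi> (Suc k)) x - grad (\<phi> k) x)"
        by (simp only: sum_lessThan_telescope[of "\<lambda>n. grad (\<phi> n) x"])
      from tendsto_add[OF this tendsto_const[of "grad (\<phi> 0) x"]]
      have "convergent (\<lambda>n. grad (\<phi> n) x)" unfolding convergent_def by auto
      then show ?case unfolding g_def by (simp add: convergent_LIMSEQ_iff)
    qed
  qed
  have E3: "(\<integral>\<^sup>+x. ennreal (Q x (grad (\<phi> k) x - g x)) \<partial>lebesgue) \<le> ennreal ((1/8)^k)" for k
  proof (rule nn_integral_limit_le[where f="\<lambda>j x. ennreal (Q x (grad (\<phi> k) x - grad (\<phi> j) x))"])
    show "\<forall>\<^sub>F j in sequentially. (\<integral>\<^sup>+x. ennreal (Q x (grad (\<phi> k) x - grad (\<phi> j) x)) \<partial>lebesgue) \<le> ennreal ((1/8)^k)"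
      using eventually_ge_at_top[of k] by eventually_elim (rule E1)
    show "AE x in lebesgue. (\<lambda>j. ennreal (Q x (grad (\<phi> k) x - grad (\<phi> j) x))) \<longlonglongrightarrow> ennreal (Q x (grad (\<phi> k) x - g x))"
      using AEg
    proof eventually_elim
      case (elim x)
      have "(\<lambda>j. Q x (grad (\<phi> k) x - grad (\<phi> j) x)) \<longlonglongrightarrow> Q x (grad (\<phi> k) x - g x)"
        by (rule continuous_on_tendsto_compose[OF continuous_Q tendsto_diff[OF tendsto_const elim]]) auto
      then show ?case by (rule tendsto_ennrealI)
    qed
  qed measurable
  have "approximates U \<phi> v g"
    unfolding approximates_def
  proof (intro conjI allI \<phi> L2 gm)
    show "(\<lambda>n. \<integral>\<^sup>+x. ennreal ((\<phi> n x - v x)\<^sup>2) \<partial>lebesgue) \<longlonglongrightarrow> 0"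
      by (rule tendsto_sandwich[OF _ _ tendsto_const lim8])
        (intro always_eventually allI zero_le, intro always_eventually allI E2)
    show "(\<lambda>n. \<integral>\<^sup>+x. ennreal (Q x (grad (\<phi> n) x - g x)) \<partial>lebesgue) \<longlonglongrightarrow> 0"
      by (rule tendsto_sandwich[OF _ _ tendsto_const lim8])
        (intro always_eventually allI zero_le, intro always_eventually allI E3)
  qed
  with AEv show ?thesis by blast
qed

end

section \<open>Product and chain rule in the form domain\<close>

context elliptic_coefficients
begin

text \<open>The approximants are \<psi> P n(\<phi> n), where the polynomial P n is 1/(n+1)-close to
  G in C^1 on the range of \<phi> n. The factor \<psi> brings the support into U, although \<phi> n
  lives on V.\<close>

lemma approximates_mult_compose:
  fixes G G' :: "real \<Rightarrow> real"
  assumes ap: "approximates V \<phi> u g" and lim: "AE x in lebesgue. (\<lambda>n. \<phi> n x) \<longlonglongrightarrow> u x"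
    and \<psi>: "\<psi> \<in> test_functions U"
    and G: "\<And>t. (G has_real_derivative G' t) (at t)" and cont: "continuous_on UNIV G'"
    and GM: "\<And>t. \<bar>G t\<bar> \<le> M" "\<And>t. \<bar>G' t\<bar> \<le> M"
  shows "\<exists>\<zeta>. approximates U \<zeta> (\<lambda>x. \<psi> x * G (u x)) (\<lambda>x. (\<psi> x * G' (u x)) *\<^sub>R g x + G (u x) *\<^sub>R grad \<psi> x)"
proof -
  note D = approximatesD[OF ap]
  obtain K where K: "compact K" "\<And>x. x \<notin> K \<Longrightarrow> \<psi> x = 0" "\<And>x. x \<notin> K \<Longrightarrow> grad \<psi> x = 0"
    using test_functionsE[OF \<psi>] by metis
  obtain B where B: "B > 0" "\<And>x. \<bar>\<psi> x\<bar> \<le> B" "\<And>x. norm (grad \<psi> x) \<le> B"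
    using test_functions_bounded[OF \<psi>] by metis
  have M0: "0 \<le> M" using GM(1)[of 0] by linarith
  \<comment> \<open>A polynomial and its derivative are treated as one pair, so that a single choice
    over n picks both. Each n needs its own pair, because the range of \<phi> n varies with
    n.\<close>
  define A where "A n p \<longleftrightarrow> (\<forall>t. (fst p has_real_derivative snd p t) (at t)) \<and> continuous_on UNIV (snd p) \<and>
    (\<forall>(\<phi> :: real^'n \<Rightarrow> real) k. Ck k \<phi> \<longrightarrow> Ck k (\<lambda>x. fst p (\<phi> x))) \<and>
    (\<forall>x. \<bar>fst p (\<phi> n x) - G (\<phi> n x)\<bar> \<le> 1 / real (Suc n) \<and> \<bar>snd p (\<phi> n x) - G' (\<phi> n x)\<bar> \<le> 1 / real (Suc n))"
    for n and p :: "(real \<Rightarrow> real) \<times> (real \<Rightarrow> real)"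
  have "\<exists>p. A n p" for n
  proof -
    obtain b where b: "b > 0" "\<And>x. \<bar>\<phi> n x\<bar> \<le> b" using test_functions_bounded[OF D(1)] by metis
    have e: "0 < 1 / real (Suc n)" by simp
    from polynomial_C1_approximation[OF G cont less_imp_le[OF b(1)] e, where ?'n='n]
    obtain P P' where P: "\<forall>t. (P has_real_derivative P' t) (at t)" "continuous_on UNIV P'"
      "\<forall>(\<phi> :: real^'n \<Rightarrow> real) k. Ck k \<phi> \<longrightarrow> Ck k (\<lambda>x. P (\<phi> x))"
      "\<forall>t. \<bar>t\<bar> \<le> b \<longrightarrow> \<bar>P t - G t\<bar> \<le> 1 / real (Suc n) \<and> \<bar>P' t - G' t\<bar> \<le> 1 / real (Suc n)"
      by (elim exE conjE) (rule that)
    have "\<forall>x. \<bar>P (\<phi> n x) - G (\<phi> n x)\<bar> \<le> 1 / real (Suc n) \<and> \<bar>P' (\<phi> n x) - G' (\<phi> n x)\<bar> \<le> 1 / real (Suc n)"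
      by (intro allI P(4)[rule_format] b(2))
    then have "A n (P, P')" unfolding A_def fst_conv snd_conv by (intro conjI P(1,2,3))
    then show ?thesis by (rule exI)
  qed
  then obtain p where p: "\<And>n. A n (p n)" by (rule choice[THEN exE, OF allI]) (rule that, rule spec)
  define P P' where "P n = fst (p n)" and "P' n = snd (p n)" for n
  note A = p[unfolded A_def, folded P_def P'_def]
  have DP: "(P n has_real_derivative P' n t) (at t)" for n t
    using A[of n, THEN conjunct1] by (rule spec)
  have cP': "continuous_on UNIV (P' n)" for n
    by (rule A[THEN conjunct2, THEN conjunct1])
  have CP: "Ck k (\<lambda>x. P n (\<phi> x))" if "Ck k \<phi>" for n k and \<phi> :: "real^'n \<Rightarrow> real"
    using A[of n, THEN conjunct2, THEN conjunct2, THEN conjunct1] that by (elim allE impE)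
  have P1: "\<bar>P n (\<phi> n x) - G (\<phi> n x)\<bar> \<le> 1 / real (Suc n)" for n x
    by (rule A[THEN conjunct2, THEN conjunct2, THEN conjunct2, rule_format, THEN conjunct1])
  have P2: "\<bar>P' n (\<phi> n x) - G' (\<phi> n x)\<bar> \<le> 1 / real (Suc n)" for n x
    by (rule A[THEN conjunct2, THEN conjunct2, THEN conjunct2, rule_format, THEN conjunct2])
  have one: "1 / real (Suc n) \<le> 1" for n by simp
  have cG: "continuous_on UNIV G" using G by (meson DERIV_isCont continuous_at_imp_continuous_on)
  have cP: "continuous_on UNIV (P n)" for n using DP by (meson DERIV_isCont continuous_at_imp_continuous_on)
  have m: "\<phi> n \<in> borel_measurable lebesgue" "grad (\<phi> n) \<in> borel_measurable lebesgue" for n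
    using test_functions_measurable_lebesgue[OF D(1)] by blast+
  have mc: "G \<in> borel_measurable borel" "G' \<in> borel_measurable borel" "P n \<in> borel_measurable borel" "P' n \<in> borel_measurable borel" for n
    by (intro borel_measurable_continuous_onI cG cont cP cP')+
  have m\<psi>: "\<psi> \<in> borel_measurable lebesgue" "grad \<psi> \<in> borel_measurable lebesgue"
    using test_functions_measurable_lebesgue[OF \<psi>] by blast+
  have mcomp: "(\<lambda>x. G (u x)) \<in> borel_measurable lebesgue" "(\<lambda>x. G' (u x)) \<in> borel_measurable lebesgue"
    "(\<lambda>x. P n (\<phi> n x)) \<in> borel_measurable lebesgue" "(\<lambda>x. P' n (\<phi> n x)) \<in> borel_measurable lebesgue" for n
    using measurable_compose[OF D(3) mc(1)] measurable_compose[OF D(3) mc(2)]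
      measurable_compose[OF m(1) mc(3)] measurable_compose[OF m(1) mc(4)] by blast+
  note [measurable] = m m\<psi> mcomp D(4) Q_measurable
  have limP: "AE x in lebesgue. (\<lambda>n. P n (\<phi> n x)) \<longlonglongrightarrow> G (u x) \<and> (\<lambda>n. P' n (\<phi> n x)) \<longlonglongrightarrow> G' (u x)"
    using lim
  proof eventually_elim
    case (elim x)
    have z: "(\<lambda>n. 1 / real (Suc n)) \<longlonglongrightarrow> 0"
      using LIMSEQ_inverse_real_of_nat by (simp add: inverse_eq_divide)
    have "(\<lambda>n. P n (\<phi> n x) - G (\<phi> n x)) \<longlonglongrightarrow> 0"
      by (rule Lim_null_comparison[OF _ z]) (intro always_eventually allI, simp only: real_norm_def P1)
    from tendsto_add[OF this continuous_on_tendsto_compose[OF cG elim]]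
    have 1: "(\<lambda>n. P n (\<phi> n x)) \<longlonglongrightarrow> G (u x)" by simp
    have "(\<lambda>n. P' n (\<phi> n x) - G' (\<phi> n x)) \<longlonglongrightarrow> 0"
      by (rule Lim_null_comparison[OF _ z]) (intro always_eventually allI, simp only: real_norm_def P2)
    from tendsto_add[OF this continuous_on_tendsto_compose[OF cont elim]]
    have "(\<lambda>n. P' n (\<phi> n x)) \<longlonglongrightarrow> G' (u x)" by simp
    with 1 show ?case by blast
  qed
  have bd: "\<bar>P n (\<phi> n x) - G (u x)\<bar> \<le> 2 * M + 1" "\<bar>P' n (\<phi> n x) - G' (u x)\<bar> \<le> 2 * M + 1"
    "\<bar>P' n (\<phi> n x)\<bar> \<le> M + 1" for n x
    using P1[of n x] P2[of n x] GM(1)[of "\<phi> n x"] GM(1)[of "u x"] GM(2)[of "\<phi> n x"] GM(2)[of "u x"] one[of n]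
    by linarith+
  define \<zeta> where "\<zeta> n x = \<psi> x * P n (\<phi> n x)" for n x
  have \<zeta>: "\<zeta> n \<in> test_functions U" for n
    unfolding \<zeta>_def[abs_def] by (rule test_functions_mult[OF \<psi>]) (rule CP[OF test_functions_Ck[OF D(1)]])
  have g\<zeta>: "grad (\<zeta> n) x = (\<psi> x * P' n (\<phi> n x)) *\<^sub>R grad (\<phi> n) x + P n (\<phi> n x) *\<^sub>R grad \<psi> x" for n x
  proof -
    have d: "\<phi> n differentiable at x" by (rule test_functions_differentiable[OF D(1)])
    have c: "grad (\<lambda>x. P n (\<phi> n x)) x = P' n (\<phi> n x) *\<^sub>R grad (\<phi> n) x"
      by (rule grad_compose[OF d DP])
    have "Ck (Suc 0) (\<lambda>x. P n (\<phi> n x))" by (rule CP[OF test_functions_Ck[OF D(1)]])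
    then have "(\<lambda>x. P n (\<phi> n x)) differentiable at x" by (rule differentiable_if_Ck_Suc)
    from grad_mult[OF test_functions_differentiable[OF \<psi>] this] show ?thesis
      unfolding \<zeta>_def[abs_def] c by simp
  qed
  have ind: "\<bar>\<psi> x\<bar> \<le> B * indicator K x" for x using B(2)[of x] K(2)[of x] by (cases "x \<in> K") auto
  have Km: "K \<in> sets lebesgue" using K(1) by (simp add: lmeasurable_compact fmeasurableD)
  have Kfin: "emeasure lebesgue K < \<infinity>"
    using fmeasurableD2[OF lmeasurable_compact[OF K(1)]] by (simp add: less_top)
  note [measurable] = Km
  have L2: "L2_function (\<lambda>x. \<psi> x * G (u x))"
    unfolding L2_function_def
  proof
    show "integrable lebesgue (\<lambda>x. (\<psi> x * G (u x))\<^sup>2)"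
    proof (rule integrable_bounded_compact_support[OF K(1)])
      show "\<bar>(\<psi> x * G (u x))\<^sup>2\<bar> \<le> (B * M)\<^sup>2" for x
      proof -
        have "\<bar>\<psi> x * G (u x)\<bar> \<le> B * M" unfolding abs_mult using B(1) by (intro mult_mono B(2) GM(1)) auto
        from power_mono[OF this, of 2] show ?thesis by simp
      qed
    qed (simp_all add: K(2))
  qed measurable
  have "approximates U \<zeta> (\<lambda>x. \<psi> x * G (u x)) (\<lambda>x. (\<psi> x * G' (u x)) *\<^sub>R g x + G (u x) *\<^sub>R grad \<psi> x)"
    unfolding approximates_def
  proof (intro conjI allI \<zeta> L2)
    show "(\<lambda>x. (\<psi> x * G' (u x)) *\<^sub>R g x + G (u x) *\<^sub>R grad \<psi> x) \<in> borel_measurable lebesgue" by measurable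
    have "(\<lambda>n. \<integral>\<^sup>+x. ennreal ((\<zeta> n x - \<psi> x * G (u x))\<^sup>2) \<partial>lebesgue) \<longlonglongrightarrow> (\<integral>\<^sup>+x. 0 \<partial>(lebesgue :: (real^'n) measure))"
    proof (rule nn_integral_dominated_convergence[where w="\<lambda>x. ennreal ((B * (2 * M + 1))\<^sup>2) * indicator K x"])
      show "AE x in lebesgue. ennreal ((\<zeta> n x - \<psi> x * G (u x))\<^sup>2) \<le> ennreal ((B * (2 * M + 1))\<^sup>2) * indicator K x" for n
      proof (intro AE_I2)
        fix x
        have e: "\<zeta> n x - \<psi> x * G (u x) = \<psi> x * (P n (\<phi> n x) - G (u x))" by (simp add: \<zeta>_def right_diff_distrib)
        have "\<bar>\<zeta> n x - \<psi> x * G (u x)\<bar> \<le> B * (2 * M + 1)"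
          unfolding e abs_mult using B(1) by (intro mult_mono B(2) bd(1)) auto
        from power_mono[OF this, of 2] have "(\<zeta> n x - \<psi> x * G (u x))\<^sup>2 \<le> (B * (2 * M + 1))\<^sup>2" by simp
        then show "ennreal ((\<zeta> n x - \<psi> x * G (u x))\<^sup>2) \<le> ennreal ((B * (2 * M + 1))\<^sup>2) * indicator K x"
          using K(2)[of x] e by (cases "x \<in> K") (simp_all add: ennreal_leI)
      qed
      show "(\<integral>\<^sup>+x. ennreal ((B * (2 * M + 1))\<^sup>2) * indicator K x \<partial>lebesgue) < \<infinity>"
        using Kfin by (simp add: nn_integral_cmult_indicator ennreal_mult_less_top)
      show "AE x in lebesgue. (\<lambda>n. ennreal ((\<zeta> n x - \<psi> x * G (u x))\<^sup>2)) \<longlonglongrightarrow> 0"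
        using limP
      proof eventually_elim
        case (elim x)
        have "(\<lambda>n. (\<psi> x * P n (\<phi> n x) - \<psi> x * G (u x))\<^sup>2) \<longlonglongrightarrow> (\<psi> x * G (u x) - \<psi> x * G (u x))\<^sup>2"
          by (intro tendsto_power tendsto_diff tendsto_mult tendsto_const elim[THEN conjunct1])
        from tendsto_ennrealI[OF this] show ?case by (simp add: \<zeta>_def)
      qed
      show "(\<lambda>x. ennreal ((\<zeta> n x - \<psi> x * G (u x))\<^sup>2)) \<in> borel_measurable lebesgue" for n
        unfolding \<zeta>_def by measurable
    qed measurable
    then show "(\<lambda>n. \<integral>\<^sup>+x. ennreal ((\<zeta> n x - \<psi> x * G (u x))\<^sup>2) \<partial>lebesgue) \<longlonglongrightarrow> 0" by simp
    let ?T1 = "\<lambda>n x. (\<psi> x * P' n (\<phi> n x)) *\<^sub>R (grad (\<phi> n) x - g x)"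
    let ?T2 = "\<lambda>n x. (\<psi> x * (P' n (\<phi> n x) - G' (u x))) *\<^sub>R g x"
    let ?T3 = "\<lambda>n x. (P n (\<phi> n x) - G (u x)) *\<^sub>R grad \<psi> x"
    \<comment> \<open>The error of the gradient in three parts: convergence of grad (\<phi> n) in
      the energy handles the first, while the other two have a fixed field of finite energy
      multiplied by a bounded coefficient that tends to 0.\<close>
    have split: "grad (\<zeta> n) x - ((\<psi> x * G' (u x)) *\<^sub>R g x + G (u x) *\<^sub>R grad \<psi> x) = ?T1 n x + (?T2 n x + ?T3 n x)" for n x
      unfolding g\<zeta> by (simp add: algebra_simps)
    have t1: "(\<lambda>n. \<integral>\<^sup>+x. ennreal (Q x (?T1 n x)) \<partial>lebesgue) \<longlonglongrightarrow> 0"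
    proof (rule tendsto_sandwich[OF _ _ tendsto_const])
      show "(\<lambda>n. ennreal ((B * (M + 1))\<^sup>2) * (\<integral>\<^sup>+x. ennreal (Q x (grad (\<phi> n) x - g x)) \<partial>lebesgue)) \<longlonglongrightarrow> 0"
        using ennreal_tendsto_cmult[OF _ D(6), of "ennreal ((B * (M + 1))\<^sup>2)"] by simp
      show "\<forall>\<^sub>F n in sequentially. (\<integral>\<^sup>+x. ennreal (Q x (?T1 n x)) \<partial>lebesgue)
        \<le> ennreal ((B * (M + 1))\<^sup>2) * (\<integral>\<^sup>+x. ennreal (Q x (grad (\<phi> n) x - g x)) \<partial>lebesgue)"
      proof (intro always_eventually allI)
        fix n
        have "(\<integral>\<^sup>+x. ennreal (Q x (?T1 n x)) \<partial>lebesgue)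
          \<le> (\<integral>\<^sup>+x. ennreal ((B * (M + 1))\<^sup>2) * ennreal (Q x (grad (\<phi> n) x - g x)) \<partial>lebesgue)"
        proof (rule nn_integral_mono_AE)
          show "AE x in lebesgue. ennreal (Q x (?T1 n x)) \<le> ennreal ((B * (M + 1))\<^sup>2) * ennreal (Q x (grad (\<phi> n) x - g x))"
            using AE_good
          proof eventually_elim
            case (elim x)
            have "\<bar>\<psi> x * P' n (\<phi> n x)\<bar> \<le> B * (M + 1)"
              unfolding abs_mult using B(1) by (intro mult_mono B(2) bd(3)) auto
            from power_mono[OF this, of 2] have "(\<psi> x * P' n (\<phi> n x))\<^sup>2 \<le> (B * (M + 1))\<^sup>2" by simp
            then have "Q x (?T1 n x) \<le> (B * (M + 1))\<^sup>2 * Q x (grad (\<phi> n) x - g x)"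
              unfolding Q_scaleR by (rule mult_right_mono) (rule Q_nonneg[OF elim])
            then show ?case by (simp only: ennreal_mult[OF zero_le_power2 Q_nonneg[OF elim], symmetric] ennreal_leI)
          qed
        qed
        also have "\<dots> = ennreal ((B * (M + 1))\<^sup>2) * (\<integral>\<^sup>+x. ennreal (Q x (grad (\<phi> n) x - g x)) \<partial>lebesgue)"
          by (rule nn_integral_cmult) measurable
        finally show "(\<integral>\<^sup>+x. ennreal (Q x (?T1 n x)) \<partial>lebesgue)
          \<le> ennreal ((B * (M + 1))\<^sup>2) * (\<integral>\<^sup>+x. ennreal (Q x (grad (\<phi> n) x - g x)) \<partial>lebesgue)" .
      qed
    qed simp
    have dct: "(\<lambda>n. \<integral>\<^sup>+x. ennreal (Q x (c n x *\<^sub>R h x)) \<partial>lebesgue) \<longlonglongrightarrow> 0"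
      if [measurable]: "\<And>n. c n \<in> borel_measurable lebesgue" "h \<in> borel_measurable lebesgue"
        and bound: "\<And>n x. \<bar>c n x\<bar> \<le> L" and fin: "(\<integral>\<^sup>+x. ennreal (Q x (h x)) \<partial>lebesgue) < \<infinity>"
        and c0: "AE x in lebesgue. (\<lambda>n. c n x) \<longlonglongrightarrow> 0" for c :: "nat \<Rightarrow> real^'n \<Rightarrow> real" and h L
    proof -
      have "(\<lambda>n. \<integral>\<^sup>+x. ennreal (Q x (c n x *\<^sub>R h x)) \<partial>lebesgue) \<longlonglongrightarrow> (\<integral>\<^sup>+x. 0 \<partial>(lebesgue :: (real^'n) measure))"
      proof (rule nn_integral_dominated_convergence[where w="\<lambda>x. ennreal (L\<^sup>2) * ennreal (Q x (h x))"])
        show "AE x in lebesgue. ennreal (Q x (c n x *\<^sub>R h x)) \<le> ennreal (L\<^sup>2) * ennreal (Q x (h x))" for n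
          using AE_good
        proof eventually_elim
          case (elim x)
          from power_mono[OF bound[of n x], of 2] have "(c n x)\<^sup>2 \<le> L\<^sup>2" by simp
          then have "Q x (c n x *\<^sub>R h x) \<le> L\<^sup>2 * Q x (h x)"
            unfolding Q_scaleR by (rule mult_right_mono) (rule Q_nonneg[OF elim])
          then show ?case by (simp only: ennreal_mult[OF zero_le_power2 Q_nonneg[OF elim], symmetric] ennreal_leI)
        qed
        show "(\<integral>\<^sup>+x. ennreal (L\<^sup>2) * ennreal (Q x (h x)) \<partial>lebesgue) < \<infinity>"
          using fin by (subst nn_integral_cmult) (measurable, simp add: ennreal_mult_less_top)
        show "AE x in lebesgue. (\<lambda>n. ennreal (Q x (c n x *\<^sub>R h x))) \<longlonglongrightarrow> 0"
          using c0
        proof eventually_elim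
          case (elim x)
          have "(\<lambda>n. (c n x)\<^sup>2 * Q x (h x)) \<longlonglongrightarrow> 0\<^sup>2 * Q x (h x)"
            by (intro tendsto_mult tendsto_power elim tendsto_const)
          from tendsto_ennrealI[OF this] show ?case by (simp add: Q_scaleR)
        qed
      qed measurable
      then show ?thesis by simp
    qed
    have t2: "(\<lambda>n. \<integral>\<^sup>+x. ennreal (Q x (?T2 n x)) \<partial>lebesgue) \<longlonglongrightarrow> 0"
    proof (rule dct[where L="B * (2 * M + 1)"])
      show "\<bar>\<psi> x * (P' n (\<phi> n x) - G' (u x))\<bar> \<le> B * (2 * M + 1)" for n x
        unfolding abs_mult using B(1) by (intro mult_mono B(2) bd(2)) auto
      show "AE x in lebesgue. (\<lambda>n. \<psi> x * (P' n (\<phi> n x) - G' (u x))) \<longlonglongrightarrow> 0"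
        using limP
      proof eventually_elim
        case (elim x)
        have "(\<lambda>n. \<psi> x * (P' n (\<phi> n x) - G' (u x))) \<longlonglongrightarrow> \<psi> x * (G' (u x) - G' (u x))"
          by (intro tendsto_diff tendsto_mult tendsto_const elim[THEN conjunct2])
        then show ?case by simp
      qed
      show "(\<integral>\<^sup>+x. ennreal (Q x (g x)) \<partial>lebesgue) < \<infinity>" by (rule approximates_finite_energy[OF ap])
    qed measurable
    have t3: "(\<lambda>n. \<integral>\<^sup>+x. ennreal (Q x (?T3 n x)) \<partial>lebesgue) \<longlonglongrightarrow> 0"
    proof (rule dct[where L="2 * M + 1", OF _ _ bd(1)])
      show "AE x in lebesgue. (\<lambda>n. P n (\<phi> n x) - G (u x)) \<longlonglongrightarrow> 0"
        using limP by eventually_elim (simp only: LIM_zero_iff)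
      show "(\<integral>\<^sup>+x. ennreal (Q x (grad \<psi> x)) \<partial>lebesgue) < \<infinity>"
        unfolding nn_integral_Q_test_function(2)[OF \<psi>] by simp
    qed measurable
    have le: "(\<integral>\<^sup>+x. ennreal (Q x (?T1 n x + (?T2 n x + ?T3 n x))) \<partial>lebesgue)
      \<le> 2 * (\<integral>\<^sup>+x. ennreal (Q x (?T1 n x)) \<partial>lebesgue) +
        2 * (2 * (\<integral>\<^sup>+x. ennreal (Q x (?T2 n x)) \<partial>lebesgue) + 2 * (\<integral>\<^sup>+x. ennreal (Q x (?T3 n x)) \<partial>lebesgue))" for n
    proof -
      have "(\<integral>\<^sup>+x. ennreal (Q x (?T1 n x + (?T2 n x + ?T3 n x))) \<partial>lebesgue)
        \<le> 2 * (\<integral>\<^sup>+x. ennreal (Q x (?T1 n x)) \<partial>lebesgue) + 2 * (\<integral>\<^sup>+x. ennreal (Q x (?T2 n x + ?T3 n x)) \<partial>lebesgue)"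
        by (rule nn_integral_Q_add_le) measurable
      also have "\<dots> \<le> 2 * (\<integral>\<^sup>+x. ennreal (Q x (?T1 n x)) \<partial>lebesgue) +
        2 * (2 * (\<integral>\<^sup>+x. ennreal (Q x (?T2 n x)) \<partial>lebesgue) + 2 * (\<integral>\<^sup>+x. ennreal (Q x (?T3 n x)) \<partial>lebesgue))"
      proof (intro add_left_mono mult_left_mono)
        show "(\<integral>\<^sup>+x. ennreal (Q x (?T2 n x + ?T3 n x)) \<partial>lebesgue)
          \<le> 2 * (\<integral>\<^sup>+x. ennreal (Q x (?T2 n x)) \<partial>lebesgue) + 2 * (\<integral>\<^sup>+x. ennreal (Q x (?T3 n x)) \<partial>lebesgue)"
          by (rule nn_integral_Q_add_le) measurable
      qed simp
      finally show ?thesis .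
    qed
    have L: "(\<lambda>n. 2 * (\<integral>\<^sup>+x. ennreal (Q x (?T1 n x)) \<partial>lebesgue) +
        2 * (2 * (\<integral>\<^sup>+x. ennreal (Q x (?T2 n x)) \<partial>lebesgue) + 2 * (\<integral>\<^sup>+x. ennreal (Q x (?T3 n x)) \<partial>lebesgue)))
      \<longlonglongrightarrow> 2 * 0 + 2 * (2 * 0 + 2 * 0)"
      by (intro tendsto_add ennreal_tendsto_cmult t1 t2 t3) simp_all
    have z: "2 * 0 + 2 * (2 * 0 + 2 * 0) = (0 :: ennreal)" by simp
    show "(\<lambda>n. \<integral>\<^sup>+x. ennreal (Q x (grad (\<zeta> n) x - ((\<psi> x * G' (u x)) *\<^sub>R g x + G (u x) *\<^sub>R grad \<psi> x))) \<partial>lebesgue) \<longlonglongrightarrow> 0"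
      unfolding split
      by (rule tendsto_sandwich[OF _ _ tendsto_const L[unfolded z]])
        (intro always_eventually allI zero_le, intro always_eventually allI le)
  qed
  then show ?thesis by blast
qed

end

section \<open>The local form domain\<close>

text \<open>By local uniqueness the gradients agree on overlapping balls. At almost every x the
  sequence h n x is therefore eventually constant, and its limit is a measurable global
  gradient.\<close>

lemma is_weak_grad_if_local:
  fixes u :: "real^'n \<Rightarrow> real"
  assumes v: "\<And>n::nat. is_weak_grad (v n) (h n)"
    and eq: "\<And>n. AE x in lebesgue. x \<in> ball 0 (real n) \<longrightarrow> u x = v n x"
    and um: "u \<in> borel_measurable lebesgue"
  shows "\<exists>g. is_weak_grad u g"
proof -
  note hm = is_weak_grad_locally_integrable(2)[OF v, THEN locally_integrable_measurable]
  note vm = is_weak_grad_locally_integrable(1)[OF v, THEN locally_integrable_measurable]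
  define g where "g x = lim (\<lambda>n. h n x)" for x
  have gm: "g \<in> borel_measurable lebesgue"
    unfolding g_def[abs_def] by (rule borel_measurable_lim_metric) (rule hm)
  have "AE x in lebesgue. \<forall>m n. x \<in> ball 0 (real m) \<inter> ball 0 (real n) \<longrightarrow> h m x = h n x"
  proof (intro AE_all_countable[THEN iffD2] allI)
    fix m n
    show "AE x in lebesgue. x \<in> ball 0 (real m) \<inter> ball 0 (real n) \<longrightarrow> h m x = h n x"
    proof (rule weak_grad_unique_on[OF v v])
      show "AE x in lebesgue. x \<in> ball 0 (real m) \<inter> ball 0 (real n) \<longrightarrow> v m x = v n x"
        using eq[of m] eq[of n]
      proof eventually_elim
        case (elim x)
        then show ?case by (metis IntD1 IntD2)
      qed
    qed (intro open_Int open_ball)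
  qed
  then have gh: "AE x in lebesgue. \<forall>n. x \<in> ball 0 (real n) \<longrightarrow> g x = h n x"
  proof eventually_elim
    case (elim x)
    show ?case
    proof (intro allI impI)
      fix n assume n: "x \<in> ball 0 (real n)"
      have "(\<lambda>_. h n x) \<longlonglongrightarrow> h n x" by simp
      then have "(\<lambda>m. h m x) \<longlonglongrightarrow> h n x"
      proof (rule Lim_transform_eventually)
        show "\<forall>\<^sub>F m in sequentially. h n x = h m x"
          using eventually_ge_at_top[of n]
        proof eventually_elim
          case (elim m)
          then have "x \<in> ball 0 (real m)" using n by simp
          then show ?case using \<open>\<forall>m n. _ m n\<close> n by blast
        qed
      qed
      then show "g x = h n x" unfolding g_def by (rule limI)
    qed
  qed
  have loc: "\<exists>n. K \<subseteq> ball 0 (real n)" if K: "compact K" for K :: "(real^'n) set"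
  proof -
    obtain r where "K \<subseteq> ball 0 r"
      using bounded_subset_ballD[OF compact_imp_bounded[OF K], of 0] by blast
    moreover obtain n :: nat where "r \<le> real n" using real_arch_simple by blast
    ultimately show ?thesis by (meson order_trans subset_ball)
  qed
  have li: "integrable lebesgue (\<lambda>x. indicator K x *\<^sub>R f x)"
    if K: "compact K" "K \<subseteq> ball 0 (real n)" and F: "locally_integrable F" and f: "f \<in> borel_measurable lebesgue"
      and e: "AE x in lebesgue. x \<in> ball 0 (real n) \<longrightarrow> f x = F x"
    for K :: "(real^'n) set" and n and F f :: "real^'n \<Rightarrow> 'b::euclidean_space"
  proof -
    have [measurable]: "K \<in> sets lebesgue" using K by (simp add: lmeasurable_compact fmeasurableD)
    note [measurable] = f
    show ?thesis
    proof (rule integrable_cong_AE_imp[OF locally_integrableD[OF F K(1)]])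
      show "(\<lambda>x. indicator K x *\<^sub>R f x) \<in> borel_measurable lebesgue" by measurable
      show "AE x in lebesgue. indicator K x *\<^sub>R F x = indicator K x *\<^sub>R f x"
        using e
      proof eventually_elim
        case (elim x)
        then show ?case using K(2) by (cases "x \<in> K") auto
      qed
    qed
  qed
  have ghn: "AE x in lebesgue. x \<in> ball 0 (real n) \<longrightarrow> g x = h n x" for n
    using gh by eventually_elim (rule spec)
  have "is_weak_grad u g"
    unfolding is_weak_grad_def
  proof (intro conjI ballI allI)
    show "locally_integrable u"
      unfolding locally_integrable_def set_integrable_def
    proof (intro allI impI)
      fix K :: "(real^'n) set" assume K: "compact K"
      obtain n where "K \<subseteq> ball 0 (real n)" using loc[OF K] by blast
      from li[OF K this is_weak_grad_locally_integrable(1)[OF v] um eq]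
      show "integrable lebesgue (\<lambda>x. indicator K x *\<^sub>R u x)" .
    qed
    show "locally_integrable g"
      unfolding locally_integrable_def set_integrable_def
    proof (intro allI impI)
      fix K :: "(real^'n) set" assume K: "compact K"
      obtain n where "K \<subseteq> ball 0 (real n)" using loc[OF K] by blast
      from li[OF K this is_weak_grad_locally_integrable(2)[OF v] gm ghn]
      show "integrable lebesgue (\<lambda>x. indicator K x *\<^sub>R g x)" .
    qed
    fix \<phi> :: "real^'n \<Rightarrow> real" and i :: 'n
    assume \<phi>: "\<phi> \<in> test_functions UNIV"
    obtain K where K: "compact K" "\<And>x. x \<notin> K \<Longrightarrow> \<phi> x = 0" "\<And>x. x \<notin> K \<Longrightarrow> grad \<phi> x = 0"
      using test_functionsE[OF \<phi>] by metis
    obtain n where n: "K \<subseteq> ball 0 (real n)" using loc[OF K(1)] by blast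
    note [measurable] = gm um hm vm borel_measurable_vec_nth test_functions_measurable_lebesgue[OF \<phi>]
    have "(LINT x|lebesgue. u x * pderiv_at i \<phi> x) = (LINT x|lebesgue. v n x * pderiv_at i \<phi> x)"
    proof (rule integral_cong_AE)
      show "AE x in lebesgue. u x * pderiv_at i \<phi> x = v n x * pderiv_at i \<phi> x"
        using eq[of n]
      proof eventually_elim
        case (elim x)
        have "x \<notin> K \<Longrightarrow> pderiv_at i \<phi> x = 0" using K(3) by (metis grad_component zero_index)
        then show ?case using elim n by (cases "x \<in> K") auto
      qed
    qed measurable
    also have "\<dots> = - (LINT x|lebesgue. h n x $ i * \<phi> x)"
      using v[of n] \<phi> unfolding is_weak_grad_def by blast
    also have "(LINT x|lebesgue. h n x $ i * \<phi> x) = (LINT x|lebesgue. g x $ i * \<phi> x)"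
    proof (rule integral_cong_AE)
      show "AE x in lebesgue. h n x $ i * \<phi> x = g x $ i * \<phi> x"
        using ghn[of n]
      proof eventually_elim
        case (elim x)
        show ?case
        proof (cases "x \<in> K")
          case True
          then have "g x = h n x" using elim n by blast
          then show ?thesis by simp
        qed (simp add: K(2))
      qed
    qed measurable
    finally show "(LINT x|lebesgue. u x * pderiv_at i \<phi> x) = - (LINT x|lebesgue. g x $ i * \<phi> x)" .
  qed
  then show ?thesis by blast
qed

text \<open>Membership in \<open>form_domain_loc\<close> prescribes u only up to null sets. Since
  \<open>lebesgue\<close> is complete, u inherits measurability from a limit with which it agrees
  almost everywhere.\<close>

lemma borel_measurable_if_local:
  fixes u :: "real^'n \<Rightarrow> real"
  assumes v: "\<And>n::nat. v n \<in> borel_measurable lebesgue"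
    and eq: "\<And>n. AE x in lebesgue. x \<in> ball 0 (real n) \<longrightarrow> u x = v n x"
  shows "u \<in> borel_measurable lebesgue"
proof -
  define w where "w x = lim (\<lambda>n. v n x)" for x
  have wm: "w \<in> borel_measurable lebesgue"
    unfolding w_def[abs_def] by (rule borel_measurable_lim_metric) (rule v)
  have "AE x in lebesgue. \<forall>n. x \<in> ball 0 (real n) \<longrightarrow> u x = v n x"
    by (intro AE_all_countable[THEN iffD2] allI eq)
  then have wu: "AE x in lebesgue. w x = u x"
  proof eventually_elim
    case (elim x)
    obtain N :: nat where N: "norm x < real N" using reals_Archimedean2 by blast
    have "(\<lambda>_. u x) \<longlonglongrightarrow> u x" by simp
    then have "(\<lambda>m. v m x) \<longlonglongrightarrow> u x"
    proof (rule Lim_transform_eventually)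
      show "\<forall>\<^sub>F m in sequentially. u x = v m x"
        using eventually_ge_at_top[of N]
      proof eventually_elim
        case (elim m)
        then have "x \<in> ball 0 (real m)" using N by simp
        then show ?case using \<open>\<forall>n. _ n\<close> by blast
      qed
    qed
    then show ?case unfolding w_def by (rule limI)
  qed
  then obtain N where "N \<in> null_sets lebesgue" "{x \<in> space lebesgue. \<not> w x = u x} \<subseteq> N"
    unfolding eventually_ae_filter by blast
  then have N: "N \<in> null_sets lebesgue" "{x. w x \<noteq> u x} \<subseteq> N"
    by simp_all
  show ?thesis
  proof (rule measurableI)
    fix A :: "real set" assume A: "A \<in> sets borel"
    have nm: "(\<lambda>x. x) \<in> lebesgue \<rightarrow>\<^sub>M lebesgue" by simp
    have s: "{x \<in> N. P x} \<in> sets lebesgue" for P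
    proof -
      have "{x \<in> N. P x} \<in> null_sets lebesgue"
        by (rule null_sets_completion_subset[OF _ N(1)]) auto
      then show ?thesis by (rule null_setsD2)
    qed
    have "u -` A = (w -` A - {x \<in> N. w x \<in> A \<and> u x \<notin> A}) \<union> {x \<in> N. u x \<in> A}"
      using N(2) by (auto simp: subset_iff) (metis+)?
    moreover have "w -` A \<in> sets lebesgue" using measurable_sets[OF wm A] by simp
    ultimately show "u -` A \<inter> space lebesgue \<in> sets lebesgue"
      using s by simp
  qed simp
qed

context elliptic_coefficients
begin

lemma form_domain_loc_approximates:
  assumes u: "u \<in> form_domain_loc a" and R: "0 < R"
  shows "\<exists>\<phi> v g. approximates UNIV \<phi> v g \<and> (AE x in lebesgue. (\<lambda>n. \<phi> n x) \<longlonglongrightarrow> v x) \<and>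
    (AE x in lebesgue. x \<in> ball y R \<longrightarrow> u x = v x)"
proof -
  obtain v where v: "v \<in> form_domain a UNIV" "AE x in lebesgue. x \<in> ball y R \<longrightarrow> u x = v x"
    using u R unfolding form_domain_loc_def by blast
  from form_domain_imp_approximates[OF v(1)] v(2) show ?thesis by blast
qed

text \<open>The equation refers to \<open>weak_grad u\<close>, which is meaningful only if u has a
  weak gradient on the whole space; it is glued from balls.\<close>

lemma form_domain_loc_weak_grad:
  assumes u: "u \<in> form_domain_loc a"
  shows "u \<in> borel_measurable lebesgue" "\<exists>g. is_weak_grad u g"
proof -
  have "\<exists>vg. is_weak_grad (fst vg) (snd vg) \<and> (AE x in lebesgue. x \<in> ball 0 (real n) \<longrightarrow> u x = fst vg x)" for n
  proof -
    \<comment> \<open>Radius n + 1, since \<open>form_domain_loc\<close> speaks of positive radii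
      only and n may be 0.\<close>
    obtain \<phi> v g where "approximates UNIV \<phi> v g" "AE x in lebesgue. x \<in> ball 0 (real n + 1) \<longrightarrow> u x = v x"
      using form_domain_loc_approximates[OF u, of "real n + 1" 0] by auto
    moreover from this(2) have "AE x in lebesgue. x \<in> ball 0 (real n) \<longrightarrow> u x = v x"
      by eventually_elim simp
    ultimately show ?thesis
      by (intro exI[of _ "(v, g)"]) (simp add: approximates_imp_weak_grad)
  qed
  from choice[OF allI[OF this]] obtain vg where
    vg: "\<forall>n. is_weak_grad (fst (vg n)) (snd (vg n)) \<and> (AE x in lebesgue. x \<in> ball 0 (real n) \<longrightarrow> u x = fst (vg n) x)"
    by (rule exE)
  note w = vg[rule_format, THEN conjunct1] and e = vg[rule_format, THEN conjunct2]
  show um: "u \<in> borel_measurable lebesgue"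
    by (rule borel_measurable_if_local[OF _ e])
      (rule locally_integrable_measurable[OF is_weak_grad_locally_integrable(1)[OF w]])
  show "\<exists>g. is_weak_grad u g" by (rule is_weak_grad_if_local[OF w e um])
qed

section \<open>Testing the Poisson equation\<close>

text \<open>The function \<psi> G(v) lies in the form domain of the ball and is nonnegative, hence
  admissible. Its gradient vanishes off a compact set inside the ball, where the gradients of u and
  v agree, so that u disappears from the identity.\<close>

lemma poisson_solution_tested:
  assumes sol: "poisson_solution a f (ball y R) u" and R: "0 < R"
    and ap: "approximates UNIV \<phi> v g" and lim: "AE x in lebesgue. (\<lambda>n. \<phi> n x) \<longlonglongrightarrow> v x"
    and uv: "AE x in lebesgue. x \<in> ball y R \<longrightarrow> u x = v x"
    and f: "AE x in lebesgue. weak_grad f x = F x" "F \<in> borel_measurable lebesgue" "is_weak_grad f gf"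
    and \<psi>: "\<psi> \<in> test_functions (ball y R)" "\<And>x. 0 \<le> \<psi> x"
    and G: "\<And>t. (G has_real_derivative G' t) (at t)" "continuous_on UNIV G'"
      "\<And>t. \<bar>G t\<bar> \<le> M" "\<And>t. \<bar>G' t\<bar> \<le> M" "\<And>t. 0 \<le> G t"
  shows "(LINT x|lebesgue. (a x *v g x) \<bullet> ((\<psi> x * G' (v x)) *\<^sub>R g x + G (v x) *\<^sub>R grad \<psi> x))
    = - (LINT x|lebesgue. (a x *v F x) \<bullet> ((\<psi> x * G' (v x)) *\<^sub>R g x + G (v x) *\<^sub>R grad \<psi> x))"
proof -
  let ?h = "\<lambda>x. (\<psi> x * G' (v x)) *\<^sub>R g x + G (v x) *\<^sub>R grad \<psi> x"
  let ?w = "\<lambda>x. \<psi> x * G (v x)"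
  obtain \<zeta> where \<zeta>: "approximates (ball y R) \<zeta> ?w ?h"
    using approximates_mult_compose[OF ap lim \<psi>(1) G(1,2,3,4)] by blast
  have w: "is_weak_grad ?w ?h" by (rule approximates_imp_weak_grad[OF \<zeta>])
  have dom: "?w \<in> form_domain a (ball y R)" by (rule approximates_imp_form_domain[OF \<zeta>])
  have uloc: "u \<in> form_domain_loc a" using sol by (simp add: poisson_solution_def)
  obtain gu where gu: "is_weak_grad u gu" using form_domain_loc_weak_grad(2)[OF uloc] by blast
  have gg: "AE x in lebesgue. x \<in> ball y R \<longrightarrow> gu x = g x"
    by (rule weak_grad_unique_on[OF gu approximates_imp_weak_grad[OF ap] open_ball uv])
  obtain K where K: "K \<subseteq> ball y R" "\<And>x. x \<notin> K \<Longrightarrow> \<psi> x = 0" "\<And>x. x \<notin> K \<Longrightarrow> grad \<psi> x = 0"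
    using test_functionsE[OF \<psi>(1)] by metis
  note m = is_weak_grad_locally_integrable(2)[THEN locally_integrable_measurable]
  have "energy a u ?w = - (LINT x|lebesgue. (a x *v weak_grad f x) \<bullet> weak_grad ?w x)"
    using sol dom \<psi>(2) G(5) unfolding poisson_solution_def by simp
  moreover have "energy a u ?w = (LINT x|lebesgue. (a x *v gu x) \<bullet> ?h x)"
    by (rule energy_eq[OF gu w])
  moreover have "(LINT x|lebesgue. (a x *v gu x) \<bullet> ?h x) = (LINT x|lebesgue. (a x *v g x) \<bullet> ?h x)"
  proof (rule integral_cong_AE)
    show "AE x in lebesgue. (a x *v gu x) \<bullet> ?h x = (a x *v g x) \<bullet> ?h x"
      using gg
    proof eventually_elim
      case (elim x)
      show ?case
      proof (cases "x \<in> K")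
        case True
        then have "gu x = g x" using elim K(1) by blast
        then show ?thesis by simp
      next
        case False
        then show ?thesis by (simp add: K(2,3))
      qed
    qed
  qed (intro a_form_measurable m[OF gu] m[OF w] approximatesD(4)[OF ap])+
  moreover have "(LINT x|lebesgue. (a x *v weak_grad f x) \<bullet> weak_grad ?w x) = (LINT x|lebesgue. (a x *v F x) \<bullet> ?h x)"
  proof (rule integral_cong_AE)
    show "AE x in lebesgue. (a x *v weak_grad f x) \<bullet> weak_grad ?w x = (a x *v F x) \<bullet> ?h x"
      using f(1) weak_grad_AE_eq[OF w] by eventually_elim simp
    show "(\<lambda>x. (a x *v F x) \<bullet> ?h x) \<in> borel_measurable lebesgue"
      by (rule a_form_measurable[OF f(2) m[OF w]])
    show "(\<lambda>x. (a x *v weak_grad f x) \<bullet> weak_grad ?w x) \<in> borel_measurable lebesgue"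
      by (rule a_form_measurable[OF m[OF is_weak_grad_weak_grad[OF f(3)]] m[OF is_weak_grad_weak_grad[OF w]]])
  qed
  ultimately show ?thesis by simp
qed

end

section \<open>A subcritical Sobolev inequality\<close>

text \<open>Upper bounds A and B replace the integrals themselves. For positive A and B, the
  weighted mean inequality for F/A and G/B is integrated; if a bound is 0, one factor vanishes
  almost everywhere.\<close>

lemma nn_integral_Holder:
  fixes F G :: "'a \<Rightarrow> real"
  assumes [measurable]: "F \<in> borel_measurable M" "G \<in> borel_measurable M"
    and nn: "\<And>x. 0 \<le> F x" "\<And>x. 0 \<le> G x" and \<theta>: "0 < \<theta>" "\<theta> < 1"
    and int: "(\<integral>\<^sup>+x. ennreal (F x) \<partial>M) \<le> ennreal A" "(\<integral>\<^sup>+x. ennreal (G x) \<partial>M) \<le> ennreal B"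
    and AB: "0 \<le> A" "0 \<le> B"
  shows "(\<integral>\<^sup>+x. ennreal (F x powr \<theta> * G x powr (1 - \<theta>)) \<partial>M) \<le> ennreal (A powr \<theta> * B powr (1 - \<theta>))"
proof (cases "A = 0 \<or> B = 0")
  case True
  have "AE x in M. F x = 0 \<or> G x = 0"
  proof (cases "A = 0")
    case True
    then have "(\<integral>\<^sup>+x. ennreal (F x) \<partial>M) = 0" using int(1) by simp
    then have "AE x in M. ennreal (F x) = 0" by (subst (asm) nn_integral_0_iff_AE) measurable
    then show ?thesis by eventually_elim (use nn in \<open>simp add: ennreal_eq_0_iff antisym\<close>)
  next
    case False
    then have "(\<integral>\<^sup>+x. ennreal (G x) \<partial>M) = 0" using int(2) True by simp
    then have "AE x in M. ennreal (G x) = 0" by (subst (asm) nn_integral_0_iff_AE) measurable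
    then show ?thesis by eventually_elim (use nn in \<open>simp add: ennreal_eq_0_iff antisym\<close>)
  qed
  then have "AE x in M. ennreal (F x powr \<theta> * G x powr (1 - \<theta>)) = 0"
    by eventually_elim auto
  then have "(\<integral>\<^sup>+x. ennreal (F x powr \<theta> * G x powr (1 - \<theta>)) \<partial>M) = 0"
    by (subst nn_integral_0_iff_AE) measurable
  then show ?thesis by simp
next
  case False
  then have p: "0 < A" "0 < B" using AB by auto
  let ?c = "A powr \<theta> * B powr (1 - \<theta>)"
  have c: "0 \<le> ?c * \<theta> / A" "0 \<le> ?c * (1 - \<theta>) / B" using p \<theta> by simp_all
  have pt: "F x powr \<theta> * G x powr (1 - \<theta>) \<le> ?c * \<theta> / A * F x + ?c * (1 - \<theta>) / B * G x" for x
  proof (cases "F x = 0 \<or> G x = 0")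
    case True
    then show ?thesis using c nn[of x] by (metis add_nonneg_nonneg mult_nonneg_nonneg mult_zero_left mult_zero_right powr_0)
  next
    case False
    then have FG: "0 < F x" "0 < G x" using nn[of x] by auto
    have "(F x / A) powr \<theta> * (G x / B) powr (1 - \<theta>) \<le> \<theta> * (F x / A) + (1 - \<theta>) * (G x / B)"
      by (rule Youngs_inequality_0) (use \<theta> FG p in simp_all)
    then have "?c * ((F x / A) powr \<theta> * (G x / B) powr (1 - \<theta>)) \<le> ?c * (\<theta> * (F x / A) + (1 - \<theta>) * (G x / B))"
      by (rule mult_left_mono) (use p in simp)
    moreover have "?c * ((F x / A) powr \<theta> * (G x / B) powr (1 - \<theta>)) = F x powr \<theta> * G x powr (1 - \<theta>)"
      using p FG by (simp add: powr_divide)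
    moreover have "?c * (\<theta> * (F x / A) + (1 - \<theta>) * (G x / B)) = ?c * \<theta> / A * F x + ?c * (1 - \<theta>) / B * G x"
      by (simp add: distrib_left)
    ultimately show ?thesis by linarith
  qed
  have "(\<integral>\<^sup>+x. ennreal (F x powr \<theta> * G x powr (1 - \<theta>)) \<partial>M)
    \<le> (\<integral>\<^sup>+x. ennreal (?c * \<theta> / A) * ennreal (F x) + ennreal (?c * (1 - \<theta>) / B) * ennreal (G x) \<partial>M)"
  proof (rule nn_integral_mono)
    fix x
    have "ennreal (F x powr \<theta> * G x powr (1 - \<theta>)) \<le> ennreal (?c * \<theta> / A * F x + ?c * (1 - \<theta>) / B * G x)"
      by (rule ennreal_leI[OF pt])
    also have "\<dots> = ennreal (?c * \<theta> / A * F x) + ennreal (?c * (1 - \<theta>) / B * G x)"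
      by (intro ennreal_plus mult_nonneg_nonneg c nn)
    also have "\<dots> = ennreal (?c * \<theta> / A) * ennreal (F x) + ennreal (?c * (1 - \<theta>) / B) * ennreal (G x)"
      by (simp only: ennreal_mult[OF c(1) nn(1)] ennreal_mult[OF c(2) nn(2)])
    finally show "ennreal (F x powr \<theta> * G x powr (1 - \<theta>))
      \<le> ennreal (?c * \<theta> / A) * ennreal (F x) + ennreal (?c * (1 - \<theta>) / B) * ennreal (G x)" .
  qed
  also have "\<dots> = ennreal (?c * \<theta> / A) * (\<integral>\<^sup>+x. ennreal (F x) \<partial>M) + ennreal (?c * (1 - \<theta>) / B) * (\<integral>\<^sup>+x. ennreal (G x) \<partial>M)"
    by (subst nn_integral_add) (simp_all add: nn_integral_cmult)
  also have "\<dots> \<le> ennreal (?c * \<theta> / A) * ennreal A + ennreal (?c * (1 - \<theta>) / B) * ennreal B"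
    by (intro add_mono mult_left_mono int) auto
  also have "\<dots> = ennreal (?c * \<theta> / A * A) + ennreal (?c * (1 - \<theta>) / B * B)"
    by (simp only: ennreal_mult[OF c(1) AB(1)] ennreal_mult[OF c(2) AB(2)])
  also have "\<dots> = ennreal (?c * \<theta> / A * A + ?c * (1 - \<theta>) / B * B)"
    by (intro ennreal_plus[symmetric] mult_nonneg_nonneg c AB)
  also have "?c * \<theta> / A * A + ?c * (1 - \<theta>) / B * B = ?c"
  proof -
    have "?c * \<theta> / A * A = ?c * \<theta>" "?c * (1 - \<theta>) / B * B = ?c * (1 - \<theta>)"
      using p by simp_all
    then show ?thesis by (simp only:) (simp add: algebra_simps)
  qed
  finally show ?thesis .
qed

lemma nn_integral_lborel_affine:
  fixes h :: "'a::euclidean_space \<Rightarrow> ennreal"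
  assumes [measurable]: "h \<in> borel_measurable borel" and s: "0 < s"
  shows "(\<integral>\<^sup>+z. h (x + s *\<^sub>R z) \<partial>lborel) = ennreal (s powr - real DIM('a)) * (\<integral>\<^sup>+z. h z \<partial>lborel)"
proof -
  have "(\<integral>\<^sup>+z. h z \<partial>lborel) = (\<integral>\<^sup>+z. h z \<partial>density (distr lborel borel (\<lambda>z. x + s *\<^sub>R z)) (\<lambda>_. ennreal (\<bar>s\<bar> ^ DIM('a))))"
    using lborel_affine[of s x] s by simp
  also have "\<dots> = ennreal (s ^ DIM('a)) * (\<integral>\<^sup>+z. h (x + s *\<^sub>R z) \<partial>lborel)"
    using s by (simp add: nn_integral_density nn_integral_distr nn_integral_cmult)
  finally have "ennreal (s powr - real DIM('a)) * (\<integral>\<^sup>+z. h z \<partial>lborel)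
    = ennreal (s powr - real DIM('a)) * ennreal (s ^ DIM('a)) * (\<integral>\<^sup>+z. h (x + s *\<^sub>R z) \<partial>lborel)"
    by (simp only: mult.assoc)
  also have "ennreal (s powr - real DIM('a)) * ennreal (s ^ DIM('a)) = ennreal (s powr - real DIM('a) * s ^ DIM('a))"
    using s by (simp add: ennreal_mult)
  also have "s powr - real DIM('a) * s ^ DIM('a) = 1"
    using s by (simp add: powr_minus powr_realpow)
  finally show ?thesis by simp
qed

lemma nn_integral_powr_0:
  assumes "-1 < e" "0 \<le> b"
  shows "(\<integral>\<^sup>+s. ennreal (indicator {0<..b} s * s powr e) \<partial>lborel) = ennreal (b powr (e + 1) / (e + 1))"
proof -
  have "indicator {0<..b} s * s powr e = s powr e * indicator {0..b} s" for s :: real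
    by (cases "s = 0") (auto simp: indicator_def)
  then have "(\<integral>\<^sup>+s. ennreal (indicator {0<..b} s * s powr e) \<partial>lborel)
     = (\<integral>\<^sup>+s. ennreal (s powr e * indicator {0..b} s) \<partial>lborel)"
    by (simp only:)
  also have "\<dots> = ennreal (b powr (e + 1) / (e + 1))"
  proof (rule nn_integral_has_integral_lborel)
    have "(\<lambda>s. s powr e * indicator {0..b} s) = (\<lambda>s. if s \<in> {0..b} then s powr e else 0)"
      by (rule ext) simp
    with has_integral_powr_from_0[OF assms]
    show "((\<lambda>s. s powr e * indicator {0..b} s) has_integral b powr (e + 1) / (e + 1)) UNIV"
      by (simp only: has_integral_restrict_UNIV)
  qed auto
  finally show ?thesis .
qed

text \<open>The fundamental theorem along the ray: as |z| \<ge> 1/2, the endpoint x + 4R z is at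
  distance at least 2R from x, thus outside the ball, where \<phi> vanishes. Directions from a shell
  of positive volume allow averaging over Lebesgue measure instead of a sphere.\<close>

lemma norm_le_ray_integral:
  assumes \<phi>: "\<phi> \<in> test_functions (ball x0 R)" and R: "0 < R"
    and x: "x \<in> ball x0 R" and z: "1 / 2 \<le> norm z" "norm z \<le> 1"
  shows "ennreal \<bar>\<phi> x\<bar> \<le> (\<integral>\<^sup>+s. ennreal (indicator {0<..4 * R} s * norm (grad \<phi> (x + s *\<^sub>R z))) \<partial>lborel)"
proof -
  obtain K where K: "K \<subseteq> ball x0 R" "\<And>x. x \<notin> K \<Longrightarrow> \<phi> x = 0"
    using test_functionsE[OF \<phi>] by metis
  have end0: "\<phi> (x + (4 * R) *\<^sub>R z) = 0"
  proof (rule K(2))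
    have "norm ((4 * R) *\<^sub>R z) \<le> norm (x + (4 * R) *\<^sub>R z - x0) + norm (x0 - x)"
      using norm_triangle_ineq[of "x + (4 * R) *\<^sub>R z - x0" "x0 - x"] by simp
    moreover have "norm (x0 - x) < R" using x by (simp add: dist_norm)
    moreover have "2 * R \<le> norm ((4 * R) *\<^sub>R z)" using R z by simp
    ultimately have "R < norm (x + (4 * R) *\<^sub>R z - x0)" by linarith
    then have "x + (4 * R) *\<^sub>R z \<notin> ball x0 R" by (simp add: dist_norm norm_minus_commute)
    then show "x + (4 * R) *\<^sub>R z \<notin> K" using K(1) by blast
  qed
  define f where "f s = grad \<phi> (x + s *\<^sub>R z) \<bullet> z" for s
  have der: "((\<lambda>s. \<phi> (x + s *\<^sub>R z)) has_vector_derivative f s) (at s within S)" for s S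
  proof -
    have "((\<lambda>s. x + s *\<^sub>R z) has_derivative (\<lambda>s. s *\<^sub>R z)) (at s)"
      by (auto intro!: derivative_eq_intros)
    from has_derivative_compose[OF this test_functions_has_derivative[OF \<phi>]]
    have "((\<lambda>s. \<phi> (x + s *\<^sub>R z)) has_derivative (\<lambda>h. h *\<^sub>R f s)) (at s)"
      by (simp add: f_def)
    then show ?thesis unfolding has_vector_derivative_def by (rule has_derivative_at_withinI)
  qed
  have cf: "continuous_on {0..4 * R} f"
    unfolding f_def
    by (intro continuous_on_inner continuous_on_const
        continuous_on_compose2[OF test_functions_grad_continuous[OF \<phi>]] continuous_on_add
        continuous_on_scaleR continuous_on_id) auto
  have R0: "0 \<le> 4 * R" using R by simp
  have int: "(LINT s|lborel. indicator {0..4 * R} s *\<^sub>R f s) = \<phi> (x + (4 * R) *\<^sub>R z) - \<phi> (x + 0 *\<^sub>R z)"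
    by (rule integral_FTC_Icc[OF R0 der cf])
  have fi: "integrable lborel (\<lambda>s. indicator {0..4 * R} s *\<^sub>R f s)"
    by (rule borel_integrable_compact[OF compact_Icc cf])
  have "\<bar>\<phi> x\<bar> = norm (LINT s|lborel. indicator {0..4 * R} s *\<^sub>R f s)"
    unfolding int end0 by simp
  then have "ennreal \<bar>\<phi> x\<bar> \<le> (\<integral>\<^sup>+s. ennreal (norm (indicator {0..4 * R} s *\<^sub>R f s)) \<partial>lborel)"
    using integral_norm_bound_ennreal[OF fi] by simp
  also have "\<dots> \<le> (\<integral>\<^sup>+s. ennreal (indicator {0<..4 * R} s * norm (grad \<phi> (x + s *\<^sub>R z))) \<partial>lborel)"
  proof (rule nn_integral_mono_AE)
    have "AE s in lborel. s \<noteq> (0::real)" by (rule AE_lborel_singleton)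
    then show "AE s in lborel. ennreal (norm (indicator {0..4 * R} s *\<^sub>R f s))
      \<le> ennreal (indicator {0<..4 * R} s * norm (grad \<phi> (x + s *\<^sub>R z)))"
    proof eventually_elim
      case (elim s)
      have "\<bar>f s\<bar> \<le> norm (grad \<phi> (x + s *\<^sub>R z)) * norm z" unfolding f_def by (rule Cauchy_Schwarz_ineq2)
      also have "\<dots> \<le> norm (grad \<phi> (x + s *\<^sub>R z)) * 1" using z by (intro mult_left_mono) auto
      finally show ?case using elim by (intro ennreal_leI) (simp add: indicator_def)
    qed
  qed
  finally show ?thesis .
qed

text \<open>Averaging the ray estimate over the shell bounds |\<phi>(x)| by a double integral of the
  gradient g over directions z and lengths s. There g is split as F^(1/t) H^(1-1/t) with F = g^r
  s^e1 and H = g^\<theta> s^e2. After Hoelder's inequality the integral of H is bounded uniformly in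
  x, and that of F is integrated over x by Fubini. The two powers of s are integrable at 0 exactly
  because t is subcritical.\<close>

lemma sobolev_subcritical:
  fixes r t :: real
  assumes r: "1 < r" "r < t" and sub: "real CARD('n) * (1 / r - 1 / t) < 1"
  shows "\<exists>C>0. \<forall>(x0::real^'n) R \<phi> A. 0 < R \<longrightarrow> 0 \<le> A \<longrightarrow> \<phi> \<in> test_functions (ball x0 R) \<longrightarrow>
    (\<integral>\<^sup>+x. ennreal (norm (grad \<phi> x) powr r) \<partial>lborel) \<le> ennreal A \<longrightarrow>
    (\<integral>\<^sup>+x. ennreal (\<bar>\<phi> x\<bar> powr t) \<partial>lborel)
      \<le> ennreal (C * R powr (t - real CARD('n) * t / r + real CARD('n)) * A powr (t / r))"
proof -
  define d where "d = real CARD('n)"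
  have dim: "real DIM(real^'n) = d" by (simp add: d_def)
  have t: "1 < t" using r by simp
  define E where "E = d * (1 / r - 1 / t)"
  \<comment> \<open>Half of the slack 1 - E, one half for each of the two integrals over s.\<close>
  define \<delta> where "\<delta> = (1 - E) / 2"
  have \<delta>: "0 < \<delta>" using sub by (simp add: \<delta>_def E_def d_def)
  have tE: "t * E = d * t / r - d" using r by (simp add: E_def right_diff_distrib)
  \<comment> \<open>Solves r/t + \<theta> (1 - 1/t) = 1, so that the powers of the gradient multiply
    to the first power.\<close>
  define \<theta> where "\<theta> = (t - r) / (t - 1)"
  have \<theta>: "0 < \<theta>" "\<theta> < 1" using r by (simp_all add: \<theta>_def)
  define e1 where "e1 = \<delta> * t - 1"
  \<comment> \<open>Solves e1/t + e2 (1 - 1/t) = 0, so that the powers of s cancel.\<close>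
  define e2 where "e2 = - (\<delta> * t - 1) / (t - 1)"
  \<comment> \<open>What remains in the integral of H: substituting x + s z for z costs s^(-d),
    raised here to the power \<theta>/r.\<close>
  define e3 where "e3 = e2 - d * \<theta> / r"
  have e1: "-1 < e1" "e1 + 1 = \<delta> * t" using \<delta> t by (simp_all add: e1_def)
  have e3': "e3 + 1 = \<delta> * t / (t - 1)"
  proof -
    have k: "e2 * (t - 1) = - (\<delta> * t - 1)" "\<theta> * (t - 1) = t - r"
      using t by (simp_all add: e2_def \<theta>_def)
    have "(e3 + 1) * (t - 1) = e2 * (t - 1) - d * (\<theta> * (t - 1)) / r + (t - 1)"
      by (simp add: e3_def left_diff_distrib distrib_right)
    also have "\<dots> = t - \<delta> * t - d * (t - r) / r" unfolding k by simp
    also have "\<dots> = t - \<delta> * t - t * E" unfolding tE using r by (simp add: right_diff_distrib diff_divide_distrib)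
    also have "\<dots> = \<delta> * t"
    proof -
      have "E = 1 - 2 * \<delta>" by (simp add: \<delta>_def field_simps)
      then have "t * E = t - 2 * (\<delta> * t)" by (simp add: right_diff_distrib)
      then show ?thesis by linarith
    qed
    finally show ?thesis using t by (simp add: field_simps)
  qed
  have e3: "-1 < e3" using e3' \<delta> t by (smt (verit) divide_pos_pos mult_pos_pos)
  define Ann where "Ann = cball (0::real^'n) 1 - ball 0 (1 / 2)"
  have [measurable]: "Ann \<in> sets borel" by (simp add: Ann_def)
  define V where "V = measure lborel Ann"
  have Vf: "emeasure lborel Ann < \<infinity>"
  proof -
    have "emeasure lborel Ann \<le> emeasure lborel (cball (0::real^'n) 1)"
      by (rule emeasure_mono) (auto simp: Ann_def)
    also have "\<dots> < \<infinity>" by (rule emeasure_lborel_cball_finite)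
    finally show ?thesis .
  qed
  have Ve: "emeasure lborel Ann = ennreal V"
    unfolding V_def using Vf by (intro emeasure_eq_ennreal_measure) auto
  have V: "0 < V"
  proof -
    let ?b = "(3 / 4) *\<^sub>R axis undefined 1 :: real^'n"
    have "ball ?b (1 / 4) \<subseteq> Ann"
    proof
      fix y assume "y \<in> ball ?b (1 / 4)"
      then have y: "norm (?b - y) < 1 / 4" by (simp add: dist_norm)
      have b: "norm ?b = 3 / 4" by simp
      have "norm y \<le> norm ?b + norm (?b - y)" "norm ?b \<le> norm y + norm (?b - y)"
        using norm_triangle_ineq4[of ?b "?b - y"] norm_triangle_ineq[of y "?b - y"] by simp_all
      then show "y \<in> Ann" using y b by (simp add: Ann_def)
    qed
    then have "measure lborel (ball ?b (1 / 4)) \<le> V"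
      unfolding V_def using Vf by (intro measure_mono_fmeasurable) (auto simp: fmeasurable_def)
    moreover have "0 < measure lborel (ball ?b (1 / 4))"
      using content_ball_pos[of "1 / 4" ?b] by simp
    ultimately show ?thesis by linarith
  qed
  define K0 where "K0 = V powr (1 - \<theta> / r) / (e3 + 1)"
  have K0: "0 < K0" using V e3 by (simp add: K0_def)
  define C where "C = K0 powr (t - 1) * (V / (e1 + 1)) * 4 powr (2 * \<delta> * t) / V powr t"
  have C: "0 < C" using K0 V e1 by (simp add: C_def)
  have main: "(\<integral>\<^sup>+x. ennreal (\<bar>\<phi> x\<bar> powr t) \<partial>lborel)
      \<le> ennreal (C * R powr (t - d * t / r + d) * A powr (t / r))"
    if R: "0 < R" and A: "0 \<le> A" and \<phi>: "\<phi> \<in> test_functions (ball x0 R)"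
      and gA: "(\<integral>\<^sup>+x. ennreal (norm (grad \<phi> x) powr r) \<partial>lborel) \<le> ennreal A"
    for x0 :: "real^'n" and R A \<phi>
  proof -
    define g where "g x = norm (grad \<phi> x)" for x
    have gm [measurable]: "g \<in> borel_measurable borel"
      unfolding g_def[abs_def] using test_functions_measurable(2)[OF \<phi>] by measurable
    have \<phi>m [measurable]: "\<phi> \<in> borel_measurable borel" by (rule test_functions_measurable(1)[OF \<phi>])
    have g0: "0 \<le> g x" for x by (simp add: g_def)
    obtain B where B: "B > 0" "\<And>x. g x \<le> B" using test_functions_bounded[OF \<phi>] unfolding g_def by metis
    have gA': "(\<integral>\<^sup>+x. ennreal (g x powr r) \<partial>lborel) \<le> ennreal A" using gA by (simp add: g_def)
    let ?W = "indicator {0<..4 * R} :: real \<Rightarrow> real"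
    let ?I = "indicator Ann :: real^'n \<Rightarrow> real"
    let ?N = "lborel \<Otimes>\<^sub>M lborel :: ((real^'n) \<times> real) measure"
    define F where "F x zs = ?I (fst zs) * ?W (snd zs) * (g (x + snd zs *\<^sub>R fst zs) powr r * snd zs powr e1)" for x zs
    define H where "H x zs = ?I (fst zs) * ?W (snd zs) * (g (x + snd zs *\<^sub>R fst zs) powr \<theta> * snd zs powr e2)" for x zs
    have FH0: "0 \<le> F x zs" "0 \<le> H x zs" for x zs by (simp_all add: F_def H_def)
    have Fm [measurable]: "F x \<in> borel_measurable ?N" "H x \<in> borel_measurable ?N" for x
      unfolding F_def[abs_def] H_def[abs_def] by measurable
    define A1 where "A1 x = (\<integral>\<^sup>+z. \<integral>\<^sup>+s. ennreal (F x (z, s)) \<partial>lborel \<partial>lborel)" for x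
    define A2 where "A2 = A powr (\<theta> / r) * (4 * R) powr (e3 + 1) * K0"
    have A2: "0 \<le> A2" using K0 by (simp add: A2_def)
    have R4: "0 \<le> 4 * R" using R by simp
    have Vz: "(\<integral>\<^sup>+z. ennreal (?I z) * c \<partial>lborel) = ennreal V * c" for c
      by (simp add: nn_integral_multc Ve ennreal_indicator)
    \<comment> \<open>For fixed s, Hoelder's inequality on the shell lowers the exponent from r to
      \<theta>, and the change of variables removes x; hence a bound uniform in x.\<close>
    have HN: "(\<integral>\<^sup>+zs. ennreal (H x zs) \<partial>?N) \<le> ennreal A2" for x
    proof -
      have "(\<integral>\<^sup>+zs. ennreal (H x zs) \<partial>?N) = (\<integral>\<^sup>+z. \<integral>\<^sup>+s. ennreal (H x (z, s)) \<partial>lborel \<partial>lborel)"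
        by (rule lborel.nn_integral_fst[symmetric]) measurable
      also have "\<dots> = (\<integral>\<^sup>+s. \<integral>\<^sup>+z. ennreal (H x (z, s)) \<partial>lborel \<partial>lborel)"
        by (rule lborel_pair.Fubini'[symmetric]) measurable
      also have "\<dots> \<le> (\<integral>\<^sup>+s. ennreal (A powr (\<theta> / r) * V powr (1 - \<theta> / r)) * ennreal (?W s * s powr e3) \<partial>lborel)"
      proof (rule nn_integral_mono)
        fix s :: real
        show "(\<integral>\<^sup>+z. ennreal (H x (z, s)) \<partial>lborel) \<le> ennreal (A powr (\<theta> / r) * V powr (1 - \<theta> / r)) * ennreal (?W s * s powr e3)"
        proof (cases "s \<in> {0<..4 * R}")
          case False
          then show ?thesis by (simp add: H_def)
        next
          case True
          then have s: "0 < s" by simp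
          have "(\<integral>\<^sup>+z. ennreal ((g (x + s *\<^sub>R z) powr r) powr (\<theta> / r) * ?I z powr (1 - \<theta> / r)) \<partial>lborel)
            \<le> ennreal ((s powr - d * A) powr (\<theta> / r) * V powr (1 - \<theta> / r))"
          proof (rule nn_integral_Holder)
            have "(\<integral>\<^sup>+z. ennreal (g (x + s *\<^sub>R z) powr r) \<partial>lborel) = ennreal (s powr - d) * (\<integral>\<^sup>+z. ennreal (g z powr r) \<partial>lborel)"
              unfolding dim[symmetric] by (rule nn_integral_lborel_affine[OF _ s]) measurable
            also have "\<dots> \<le> ennreal (s powr - d) * ennreal A" by (intro mult_left_mono gA') simp
            also have "\<dots> = ennreal (s powr - d * A)" using A by (intro ennreal_mult[symmetric]) simp_all
            finally show "(\<integral>\<^sup>+z. ennreal (g (x + s *\<^sub>R z) powr r) \<partial>lborel) \<le> ennreal (s powr - d * A)" .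
            show "(\<integral>\<^sup>+z. ennreal (?I z) \<partial>lborel) \<le> ennreal V" using Vz[of 1] by simp
            show "\<theta> / r < 1" "0 < \<theta> / r" using \<theta> r by simp_all
          qed (use A V in \<open>simp_all add: mult_nonneg_nonneg\<close>)
          moreover have "(g (x + s *\<^sub>R z) powr r) powr (\<theta> / r) * ?I z powr (1 - \<theta> / r) = ?I z * g (x + s *\<^sub>R z) powr \<theta>" for z
            using r \<theta> by (simp add: powr_powr indicator_def)
          ultimately have h: "(\<integral>\<^sup>+z. ennreal (?I z * g (x + s *\<^sub>R z) powr \<theta>) \<partial>lborel)
            \<le> ennreal ((s powr - d * A) powr (\<theta> / r) * V powr (1 - \<theta> / r))" by simp
          have "(\<integral>\<^sup>+z. ennreal (H x (z, s)) \<partial>lborel) = (\<integral>\<^sup>+z. ennreal (s powr e2) * ennreal (?I z * g (x + s *\<^sub>R z) powr \<theta>) \<partial>lborel)"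
            using True by (intro nn_integral_cong) (simp add: H_def ennreal_mult''[symmetric] mult_ac)
          also have "\<dots> = ennreal (s powr e2) * (\<integral>\<^sup>+z. ennreal (?I z * g (x + s *\<^sub>R z) powr \<theta>) \<partial>lborel)"
            by (rule nn_integral_cmult) measurable
          also have "\<dots> \<le> ennreal (s powr e2) * ennreal ((s powr - d * A) powr (\<theta> / r) * V powr (1 - \<theta> / r))"
            by (intro mult_left_mono h) simp
          also have "\<dots> = ennreal (s powr e2 * ((s powr - d * A) powr (\<theta> / r) * V powr (1 - \<theta> / r)))"
            by (rule ennreal_mult[symmetric]) simp_all
          also have "s powr e2 * ((s powr - d * A) powr (\<theta> / r) * V powr (1 - \<theta> / r))
            = (A powr (\<theta> / r) * V powr (1 - \<theta> / r)) * (?W s * s powr e3)"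
          proof -
            have "(s powr - d * A) powr (\<theta> / r) = s powr (- d * (\<theta> / r)) * A powr (\<theta> / r)"
              using A by (simp add: powr_mult powr_powr)
            moreover have "s powr e2 * s powr (- d * (\<theta> / r)) = s powr e3"
              by (simp add: e3_def powr_add[symmetric])
            ultimately show ?thesis using True by (simp add: mult_ac)
          qed
          also have "ennreal ((A powr (\<theta> / r) * V powr (1 - \<theta> / r)) * (?W s * s powr e3))
            = ennreal (A powr (\<theta> / r) * V powr (1 - \<theta> / r)) * ennreal (?W s * s powr e3)"
            by (rule ennreal_mult) simp_all
          finally show ?thesis .
        qed
      qed
      also have "\<dots> = ennreal (A powr (\<theta> / r) * V powr (1 - \<theta> / r)) * (\<integral>\<^sup>+s. ennreal (?W s * s powr e3) \<partial>lborel)"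
        by (rule nn_integral_cmult) measurable
      also have "\<dots> = ennreal (A powr (\<theta> / r) * V powr (1 - \<theta> / r)) * ennreal ((4 * R) powr (e3 + 1) / (e3 + 1))"
        by (simp only: nn_integral_powr_0[OF e3 R4])
      also have "\<dots> = ennreal ((A powr (\<theta> / r) * V powr (1 - \<theta> / r)) * ((4 * R) powr (e3 + 1) / (e3 + 1)))"
        using e3 by (intro ennreal_mult[symmetric]) simp_all
      also have "(A powr (\<theta> / r) * V powr (1 - \<theta> / r)) * ((4 * R) powr (e3 + 1) / (e3 + 1)) = A2"
        by (simp add: A2_def K0_def)
      finally show ?thesis .
    qed
    have AN: "(\<integral>\<^sup>+zs. ennreal (F x zs) \<partial>?N) = A1 x" for x
      unfolding A1_def by (rule lborel.nn_integral_fst[symmetric]) measurable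
    \<comment> \<open>Hoelder's inequality is available with real bounds only. Finiteness is crude,
      from the bounded gradient of \<phi>, and its size does not enter the result.\<close>
    have A1fin: "A1 x < \<infinity>" for x
    proof -
      have "A1 x \<le> (\<integral>\<^sup>+z. ennreal (?I z) * (ennreal (B powr r) * ennreal ((4 * R) powr (e1 + 1) / (e1 + 1))) \<partial>lborel)"
        unfolding A1_def
      proof (rule nn_integral_mono)
        fix z
        have "(\<integral>\<^sup>+s. ennreal (F x (z, s)) \<partial>lborel) \<le> (\<integral>\<^sup>+s. ennreal (?I z * B powr r) * ennreal (?W s * s powr e1) \<partial>lborel)"
        proof (rule nn_integral_mono)
          fix s
          have "F x (z, s) = (?I z * g (x + s *\<^sub>R z) powr r) * (?W s * s powr e1)" by (simp add: F_def)
          also have "\<dots> \<le> (?I z * B powr r) * (?W s * s powr e1)"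
            using r by (intro mult_right_mono mult_left_mono powr_mono2 B g0) simp_all
          finally show "ennreal (F x (z, s)) \<le> ennreal (?I z * B powr r) * ennreal (?W s * s powr e1)"
            by (subst ennreal_mult[symmetric]) (simp_all add: ennreal_leI)
        qed
        also have "\<dots> = ennreal (?I z * B powr r) * (\<integral>\<^sup>+s. ennreal (?W s * s powr e1) \<partial>lborel)"
          by (rule nn_integral_cmult) measurable
        also have "\<dots> = ennreal (?I z) * (ennreal (B powr r) * ennreal ((4 * R) powr (e1 + 1) / (e1 + 1)))"
          by (simp only: nn_integral_powr_0[OF e1(1) R4]) (simp add: ennreal_mult mult.assoc)
        finally show "(\<integral>\<^sup>+s. ennreal (F x (z, s)) \<partial>lborel) \<le> ennreal (?I z) * (ennreal (B powr r) * ennreal ((4 * R) powr (e1 + 1) / (e1 + 1)))" .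
      qed
      also have "\<dots> < \<infinity>" unfolding Vz by (simp add: ennreal_mult_less_top)
      finally show ?thesis .
    qed
    have pt: "ennreal (\<bar>\<phi> x\<bar> powr t) \<le> ennreal (A2 powr (t - 1) / V powr t) * A1 x" for x
    proof (cases "x \<in> ball x0 R")
      case False
      then have "\<phi> x = 0" using test_functionsE[OF \<phi>] by (metis subsetD)
      then show ?thesis by simp
    next
      case True
      define a where "a = enn2real (A1 x)"
      have a: "A1 x = ennreal a" "0 \<le> a" using A1fin[of x] by (simp_all add: a_def)
      have eq: "F x zs powr (1 / t) * H x zs powr (1 - 1 / t) = ?I (fst zs) * (?W (snd zs) * g (x + snd zs *\<^sub>R fst zs))" for zs
      proof (cases "fst zs \<in> Ann \<and> snd zs \<in> {0<..4 * R}")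
        case True
        then have s: "0 < snd zs" by simp
        let ?g = "g (x + snd zs *\<^sub>R fst zs)"
        have "F x zs powr (1 / t) = ?g powr (r / t) * snd zs powr (e1 / t)"
          using True g0 by (simp add: F_def powr_mult powr_powr)
        moreover have "H x zs powr (1 - 1 / t) = ?g powr (\<theta> * (1 - 1 / t)) * snd zs powr (e2 * (1 - 1 / t))"
          using True g0 by (simp add: H_def powr_mult powr_powr)
        moreover have "\<theta> * (1 - 1 / t) = 1 - r / t" using t by (simp add: \<theta>_def field_simps)
        moreover have "e2 * (1 - 1 / t) = - (e1 / t)" using t by (simp add: e2_def e1_def field_simps)
        ultimately have "F x zs powr (1 / t) * H x zs powr (1 - 1 / t)
          = (?g powr (r / t) * ?g powr (1 - r / t)) * (snd zs powr (e1 / t) * snd zs powr (- (e1 / t)))"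
          by (simp only: mult_ac)
        also have "\<dots> = ?g * 1" using s g0[of "x + snd zs *\<^sub>R fst zs"]
          by (simp only: powr_add[symmetric]) (simp add: powr_one)
        finally show ?thesis using True by simp
      next
        case False
        then have "F x zs = 0" "?I (fst zs) * (?W (snd zs) * g (x + snd zs *\<^sub>R fst zs)) = 0"
          by (auto simp: F_def indicator_def)
        then show ?thesis by simp
      qed
      have "ennreal V * ennreal \<bar>\<phi> x\<bar> = (\<integral>\<^sup>+z. ennreal (?I z) * ennreal \<bar>\<phi> x\<bar> \<partial>lborel)" by (rule Vz[symmetric])
      also have "\<dots> \<le> (\<integral>\<^sup>+z. \<integral>\<^sup>+s. ennreal (?I z * (?W s * g (x + s *\<^sub>R z))) \<partial>lborel \<partial>lborel)"
      proof (rule nn_integral_mono)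
        fix z
        show "ennreal (?I z) * ennreal \<bar>\<phi> x\<bar> \<le> (\<integral>\<^sup>+s. ennreal (?I z * (?W s * g (x + s *\<^sub>R z))) \<partial>lborel)"
        proof (cases "z \<in> Ann")
          case True2: True
          then have "1 / 2 \<le> norm z" "norm z \<le> 1" by (simp_all add: Ann_def)
          from norm_le_ray_integral[OF \<phi> R True this] show ?thesis using True2 by (simp add: g_def)
        qed simp
      qed
      also have "\<dots> = (\<integral>\<^sup>+z. \<integral>\<^sup>+s. ennreal (F x (z, s) powr (1 / t) * H x (z, s) powr (1 - 1 / t)) \<partial>lborel \<partial>lborel)"
        by (simp only: eq fst_conv snd_conv)
      also have "\<dots> = (\<integral>\<^sup>+zs. ennreal (F x zs powr (1 / t) * H x zs powr (1 - 1 / t)) \<partial>?N)"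
        by (rule lborel.nn_integral_fst) measurable
      also have "\<dots> \<le> ennreal (a powr (1 / t) * A2 powr (1 - 1 / t))"
      proof (rule nn_integral_Holder)
        show "0 < 1 / t" "1 / t < 1" using t by simp_all
        show "(\<integral>\<^sup>+zs. ennreal (F x zs) \<partial>?N) \<le> ennreal a" unfolding AN a(1) by simp
      qed (fact Fm FH0 HN A2 a(2))+
      finally have "ennreal (V * \<bar>\<phi> x\<bar>) \<le> ennreal (a powr (1 / t) * A2 powr (1 - 1 / t))"
        using V by (simp add: ennreal_mult)
      then have "V * \<bar>\<phi> x\<bar> \<le> a powr (1 / t) * A2 powr (1 - 1 / t)"
        by (subst (asm) ennreal_le_iff) simp_all
      then have "(V * \<bar>\<phi> x\<bar>) powr t \<le> (a powr (1 / t) * A2 powr (1 - 1 / t)) powr t"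
        using t V by (intro powr_mono2) auto
      also have "\<dots> = a * A2 powr (t - 1)"
      proof -
        have "(1 - 1 / t) * t = t - 1" using t by (simp add: field_simps)
        then show ?thesis using t a(2) by (simp add: powr_mult powr_powr)
      qed
      finally have "V powr t * \<bar>\<phi> x\<bar> powr t \<le> a * A2 powr (t - 1)" using V by (simp add: powr_mult)
      then have "\<bar>\<phi> x\<bar> powr t \<le> A2 powr (t - 1) / V powr t * a"
        using V by (simp add: field_simps)
      then have "ennreal (\<bar>\<phi> x\<bar> powr t) \<le> ennreal (A2 powr (t - 1) / V powr t * a)" by (rule ennreal_leI)
      also have "\<dots> = ennreal (A2 powr (t - 1) / V powr t) * ennreal a"
        using a(2) by (intro ennreal_mult) simp_all
      finally show ?thesis unfolding a(1) .
    qed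
    \<comment> \<open>With x as innermost variable, translation invariance removes the shift by s z
      and leaves the integral of g^r.\<close>
    have intA1: "(\<integral>\<^sup>+x. A1 x \<partial>lborel) \<le> ennreal (V * (A * ((4 * R) powr (e1 + 1) / (e1 + 1))))"
    proof -
      have "(\<integral>\<^sup>+x. A1 x \<partial>lborel) = (\<integral>\<^sup>+z. \<integral>\<^sup>+x. \<integral>\<^sup>+s. ennreal (F x (z, s)) \<partial>lborel \<partial>lborel \<partial>lborel)"
        unfolding A1_def F_def by (rule lborel_pair.Fubini') measurable
      also have "\<dots> = (\<integral>\<^sup>+z. \<integral>\<^sup>+s. \<integral>\<^sup>+x. ennreal (F x (z, s)) \<partial>lborel \<partial>lborel \<partial>lborel)"
      proof (rule nn_integral_cong)
        fix z :: "real^'n"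
        show "(\<integral>\<^sup>+x. \<integral>\<^sup>+s. ennreal (F x (z, s)) \<partial>lborel \<partial>lborel) = (\<integral>\<^sup>+s. \<integral>\<^sup>+x. ennreal (F x (z, s)) \<partial>lborel \<partial>lborel)"
          unfolding F_def fst_conv snd_conv by (rule lborel_pair.Fubini') measurable
      qed
      also have "\<dots> \<le> (\<integral>\<^sup>+z. \<integral>\<^sup>+s. ennreal (?I z) * (ennreal A * ennreal (?W s * s powr e1)) \<partial>lborel \<partial>lborel)"
      proof (intro nn_integral_mono)
        fix z :: "real^'n" and s :: real
        have "(\<integral>\<^sup>+x. ennreal (F x (z, s)) \<partial>lborel)
          = (\<integral>\<^sup>+x. ennreal (?I z * (?W s * s powr e1)) * ennreal (g (x + s *\<^sub>R z) powr r) \<partial>lborel)"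
          by (intro nn_integral_cong, subst ennreal_mult[symmetric]) (simp_all add: F_def mult_ac)
        also have "\<dots> = ennreal (?I z * (?W s * s powr e1)) * (\<integral>\<^sup>+x. ennreal (g (x + s *\<^sub>R z) powr r) \<partial>lborel)"
          by (rule nn_integral_cmult) measurable
        also have "(\<integral>\<^sup>+x. ennreal (g (x + s *\<^sub>R z) powr r) \<partial>lborel) = (\<integral>\<^sup>+x. ennreal (g x powr r) \<partial>lborel)"
          using nn_integral_lborel_affine[of "\<lambda>x. ennreal (g x powr r)" 1 "s *\<^sub>R z"] by (simp add: add.commute)
        also have "ennreal (?I z * (?W s * s powr e1)) * (\<integral>\<^sup>+x. ennreal (g x powr r) \<partial>lborel)
          \<le> ennreal (?I z * (?W s * s powr e1)) * ennreal A" by (intro mult_left_mono gA') simp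
        also have "\<dots> = ennreal (?I z) * (ennreal A * ennreal (?W s * s powr e1))"
          by (simp add: ennreal_mult mult_ac)
        finally show "(\<integral>\<^sup>+x. ennreal (F x (z, s)) \<partial>lborel) \<le> ennreal (?I z) * (ennreal A * ennreal (?W s * s powr e1))" .
      qed
      also have "\<dots> = (\<integral>\<^sup>+z. ennreal (?I z) * (ennreal A * (\<integral>\<^sup>+s. ennreal (?W s * s powr e1) \<partial>lborel)) \<partial>lborel)"
        by (intro nn_integral_cong) (simp add: nn_integral_cmult)
      also have "\<dots> = ennreal V * (ennreal A * ennreal ((4 * R) powr (e1 + 1) / (e1 + 1)))"
        unfolding Vz by (simp only: nn_integral_powr_0[OF e1(1) R4])
      also have "\<dots> = ennreal (V * (A * ((4 * R) powr (e1 + 1) / (e1 + 1))))"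
      proof -
        have X: "0 \<le> (4 * R) powr (e1 + 1) / (e1 + 1)" using e1 by simp
        show ?thesis
          by (simp only: ennreal_mult[OF A X] ennreal_mult[OF less_imp_le[OF V] mult_nonneg_nonneg[OF A X]])
      qed
      finally show ?thesis .
    qed
    have "(\<integral>\<^sup>+x. ennreal (\<bar>\<phi> x\<bar> powr t) \<partial>lborel) \<le> (\<integral>\<^sup>+x. ennreal (A2 powr (t - 1) / V powr t) * A1 x \<partial>lborel)"
      by (intro nn_integral_mono pt)
    also have "\<dots> = ennreal (A2 powr (t - 1) / V powr t) * (\<integral>\<^sup>+x. A1 x \<partial>lborel)"
      unfolding A1_def F_def by (rule nn_integral_cmult) measurable
    also have "\<dots> \<le> ennreal (A2 powr (t - 1) / V powr t) * ennreal (V * (A * ((4 * R) powr (e1 + 1) / (e1 + 1))))"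
      by (intro mult_left_mono intA1) simp
    also have "\<dots> = ennreal (A2 powr (t - 1) / V powr t * (V * (A * ((4 * R) powr (e1 + 1) / (e1 + 1)))))"
      using V A e1 by (intro ennreal_mult[symmetric]) simp_all
    also have "A2 powr (t - 1) / V powr t * (V * (A * ((4 * R) powr (e1 + 1) / (e1 + 1))))
      = C * R powr (t - d * t / r + d) * A powr (t / r)"
    proof -
      have x1: "A2 powr (t - 1) = A powr ((t - r) / r) * (4 * R) powr (\<delta> * t) * K0 powr (t - 1)"
      proof -
        have "\<theta> / r * (t - 1) = (t - r) / r" using t by (simp add: \<theta>_def)
        moreover have "(e3 + 1) * (t - 1) = \<delta> * t" using t by (simp add: e3')
        ultimately show ?thesis using A K0 R r by (simp add: A2_def powr_mult powr_powr)
      qed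
      have x2: "A powr ((t - r) / r) * A = A powr (t / r)"
      proof -
        have "A powr ((t - r) / r) * A powr 1 = A powr ((t - r) / r + 1)" by (rule powr_add[symmetric])
        moreover have "(t - r) / r + 1 = t / r" using r by (simp add: field_simps)
        ultimately show ?thesis using A by simp
      qed
      have x3: "(4 * R) powr (\<delta> * t) * (4 * R) powr (\<delta> * t) = 4 powr (2 * \<delta> * t) * R powr (t - d * t / r + d)"
      proof -
        have "\<delta> * t + \<delta> * t = t - t * E" by (simp add: \<delta>_def field_simps)
        then have "\<delta> * t + \<delta> * t = t - d * t / r + d" unfolding tE by simp
        moreover have "2 * \<delta> * t = \<delta> * t + \<delta> * t" by simp
        ultimately have e: "\<delta> * t + \<delta> * t = t - d * t / r + d" "2 * \<delta> * t = t - d * t / r + d" by linarith+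
        have "(4 * R) powr (\<delta> * t + \<delta> * t) = 4 powr (2 * \<delta> * t) * R powr (t - d * t / r + d)"
          unfolding e using R by (simp add: powr_mult)
        then show ?thesis by (simp only: powr_add[of "4 * R" "\<delta> * t" "\<delta> * t"])
      qed
      have "A2 powr (t - 1) / V powr t * (V * (A * ((4 * R) powr (e1 + 1) / (e1 + 1))))
        = K0 powr (t - 1) * (V / (e1 + 1)) / V powr t * (A powr ((t - r) / r) * A)
          * ((4 * R) powr (\<delta> * t) * (4 * R) powr (\<delta> * t))"
        unfolding x1 e1(2) by (simp add: mult_ac)
      then show ?thesis unfolding x2 x3 C_def by (simp add: mult_ac)
    qed
    finally show ?thesis .
  qed
  show ?thesis using C main unfolding d_def by blast
qed

section \<open>Truncated powers\<close>

text \<open>At 0 the difference quotient is at most max h 0 to the power b - 1, which tends to 0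
  because b > 1. This is why all exponents of the iteration stay above 1.\<close>

lemma pos_part_powr_derivative:
  assumes b: "1 < b"
  shows "((\<lambda>t::real. max t 0 powr b) has_real_derivative b * max t 0 powr (b - 1)) (at t)"
proof -
  consider "t > 0" | "t < 0" | "t = 0" by linarith
  then show ?thesis
  proof cases
    case 1
    have "((\<lambda>t. t powr b) has_real_derivative b * t powr (b - 1)) (at t)"
      using 1 has_real_derivative_powr[of t b] by simp
    moreover have "\<forall>\<^sub>F s in nhds t. max s 0 powr b = s powr b"
      unfolding eventually_nhds using 1 by (intro exI[of _ "{0<..}"]) auto
    ultimately show ?thesis using 1 by (subst DERIV_cong_ev[OF refl _ refl]) auto
  next
    case 2
    have "\<forall>\<^sub>F s in nhds t. max s 0 powr b = 0"
      unfolding eventually_nhds using 2 by (intro exI[of _ "{..<0}"]) auto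
    then show ?thesis using 2 by (subst DERIV_cong_ev[OF refl _ refl, of _ "\<lambda>_. 0"]) auto
  next
    case 3
    have "((\<lambda>h. max h 0 powr (b - 1)) \<longlongrightarrow> max 0 0 powr (b - 1)) (at (0::real))"
      using b by (intro tendsto_powr' tendsto_max tendsto_ident_at tendsto_const) auto
    then have l: "((\<lambda>h. max h 0 powr (b - 1)) \<longlongrightarrow> 0) (at (0::real))" by simp
    have "((\<lambda>h. max h 0 powr b / h) \<longlongrightarrow> 0) (at (0::real))"
    proof (rule Lim_null_comparison[OF _ l])
      have "norm (max h 0 powr b / h) \<le> max h 0 powr (b - 1)" for h :: real
        by (cases "0 < h") (auto simp: powr_diff max_def)
      then show "\<forall>\<^sub>F h in at 0. norm (max h 0 powr b / h) \<le> max h 0 powr (b - 1)" for h :: real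
        by (intro always_eventually allI)
    qed
    with 3 show ?thesis by (simp add: DERIV_def)
  qed
qed

lemma continuous_pos_part_powr:
  assumes "0 < b"
  shows "continuous_on UNIV (\<lambda>t::real. max t 0 powr b)"
  using assms by (intro continuous_on_powr' continuous_intros) auto

text \<open>Taken with b = 2 * \<alpha> - 1 for the function inserted into the equation and with b =
  \<alpha> for the one whose energy is estimated; the denominator is the same.\<close>

definition trunc_pow :: "real \<Rightarrow> real \<Rightarrow> real \<Rightarrow> real \<Rightarrow> real" where
  "trunc_pow \<epsilon> \<alpha> b t = max t 0 powr b / (1 + \<epsilon> * max t 0 powr (2 * \<alpha> - 1))"

definition trunc_pow' :: "real \<Rightarrow> real \<Rightarrow> real \<Rightarrow> real \<Rightarrow> real" where
  "trunc_pow' \<epsilon> \<alpha> b t = max t 0 powr (b - 1) * (b - (2 * \<alpha> - 1 - b) * (\<epsilon> * max t 0 powr (2 * \<alpha> - 1)))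
     / (1 + \<epsilon> * max t 0 powr (2 * \<alpha> - 1))\<^sup>2"

lemma trunc_pow_derivative:
  assumes "1 < \<alpha>" "0 < \<epsilon>" "1 < b"
  shows "(trunc_pow \<epsilon> \<alpha> b has_real_derivative trunc_pow' \<epsilon> \<alpha> b t) (at t)"
proof -
  let ?m = "2 * \<alpha> - 1"
  have m: "1 < ?m" using assms by simp
  let ?D = "1 + \<epsilon> * max t 0 powr ?m"
  have D: "?D \<noteq> 0" using assms(2) by (smt (verit) mult_nonneg_nonneg powr_ge_zero)
  have "((\<lambda>t. 1 + \<epsilon> * max t 0 powr ?m) has_real_derivative \<epsilon> * (?m * max t 0 powr (?m - 1))) (at t)"
    using DERIV_add[OF DERIV_const DERIV_cmult[OF pos_part_powr_derivative[OF m]], of 1] by simp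
  from DERIV_divide[OF pos_part_powr_derivative[OF assms(3)] this D]
  have d: "(trunc_pow \<epsilon> \<alpha> b has_real_derivative
     (b * max t 0 powr (b - 1) * ?D - max t 0 powr b * (\<epsilon> * (?m * max t 0 powr (?m - 1)))) / (?D * ?D)) (at t)"
    unfolding trunc_pow_def[abs_def] .
  have x: "max t 0 powr b * max t 0 powr (?m - 1) = max t 0 powr (b - 1) * max t 0 powr ?m"
    by (simp add: powr_add[symmetric] add_diff_eq)
  have "b * max t 0 powr (b - 1) * ?D - max t 0 powr b * (\<epsilon> * (?m * max t 0 powr (?m - 1)))
    = b * max t 0 powr (b - 1) * ?D - \<epsilon> * ?m * (max t 0 powr b * max t 0 powr (?m - 1))" by (simp only: mult_ac)
  also have "\<dots> = max t 0 powr (b - 1) * (b - (?m - b) * (\<epsilon> * max t 0 powr ?m))"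
    unfolding x by (simp add: algebra_simps)
  finally show ?thesis using d unfolding trunc_pow'_def power2_eq_square by simp
qed

lemma trunc_pow'_continuous:
  assumes "1 < \<alpha>" "0 < \<epsilon>" "1 < b"
  shows "continuous_on UNIV (trunc_pow' \<epsilon> \<alpha> b)"
proof -
  have "1 + \<epsilon> * max t 0 powr (2 * \<alpha> - 1) \<noteq> 0" for t :: real
    using assms(2) by (smt (verit) mult_nonneg_nonneg powr_ge_zero)
  then show ?thesis
    unfolding trunc_pow'_def[abs_def] using assms
    by (intro continuous_on_divide continuous_on_mult continuous_on_diff continuous_on_const
        continuous_on_add continuous_on_power continuous_pos_part_powr) auto
qed

lemma pos_powr_le:
  assumes "0 \<le> w" "0 < b" "b \<le> m"
  shows "w powr b \<le> 1 + w powr (m::real)"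
proof (cases "w \<le> 1")
  case True
  have "w powr b \<le> 1 powr b" using assms True by (intro powr_mono2) auto
  then show ?thesis using powr_ge_zero[of w m] unfolding powr_one_eq_one by linarith
next
  case False
  then have "w powr b \<le> w powr m" using assms by (intro powr_mono) auto
  then show ?thesis by simp
qed

text \<open>The bounds that contain \<epsilon> in the form 2\<alpha>/\<epsilon> only certify that
  the truncations are admissible; they need b \<le> 2\<alpha> - 1, so that the denominator outgrows
  the numerator. The bound by the plain power is uniform in \<epsilon>.\<close>

lemma trunc_pow_bounds:
  fixes t :: real
  assumes \<alpha>: "1 < \<alpha>" and \<epsilon>: "0 < \<epsilon>" "\<epsilon> \<le> 1" and b: "1 < b" "b \<le> 2 * \<alpha> - 1"
  shows "0 \<le> trunc_pow \<epsilon> \<alpha> b t" "trunc_pow \<epsilon> \<alpha> b t \<le> max t 0 powr b"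
    "\<bar>trunc_pow \<epsilon> \<alpha> b t\<bar> \<le> 2 * \<alpha> / \<epsilon>"
    "\<bar>trunc_pow' \<epsilon> \<alpha> b t\<bar> \<le> (2 * \<alpha> - 1) * max t 0 powr (b - 1) / (1 + \<epsilon> * max t 0 powr (2 * \<alpha> - 1))"
    "\<bar>trunc_pow' \<epsilon> \<alpha> b t\<bar> \<le> 2 * \<alpha> / \<epsilon>"
proof -
  define w where "w = max t 0"
  define P where "P = w powr (2 * \<alpha> - 1)"
  have w: "0 \<le> w" by (simp add: w_def)
  have P: "0 \<le> P" by (simp add: P_def)
  have D: "1 \<le> 1 + \<epsilon> * P" "0 < 1 + \<epsilon> * P" using \<epsilon> P by simp_all (smt (verit) mult_nonneg_nonneg)
  have D2: "\<epsilon> * (1 + P) \<le> 1 + \<epsilon> * P" using \<epsilon> by (simp add: distrib_left)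
  have le: "w powr c / (1 + \<epsilon> * P) \<le> 1 / \<epsilon>" if "0 < c" "c \<le> 2 * \<alpha> - 1" for c
  proof -
    have "\<epsilon> * w powr c \<le> \<epsilon> * (1 + P)" unfolding P_def using \<epsilon> by (intro mult_left_mono pos_powr_le w that) auto
    then have "\<epsilon> * w powr c \<le> 1 + \<epsilon> * P" using D2 by linarith
    then show ?thesis using \<epsilon> D by (simp add: field_simps)
  qed
  have t1: "trunc_pow \<epsilon> \<alpha> b t = w powr b / (1 + \<epsilon> * P)" by (simp add: trunc_pow_def w_def P_def)
  show n: "0 \<le> trunc_pow \<epsilon> \<alpha> b t" unfolding t1 using D by simp
  show "trunc_pow \<epsilon> \<alpha> b t \<le> max t 0 powr b"
    unfolding t1 w_def[symmetric] using D mult_left_mono[OF D(1), of "w powr b"] by (simp add: field_simps)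
  have a1: "1 / \<epsilon> \<le> 2 * \<alpha> / \<epsilon>" using \<alpha> \<epsilon> by (intro divide_right_mono) auto
  show "\<bar>trunc_pow \<epsilon> \<alpha> b t\<bar> \<le> 2 * \<alpha> / \<epsilon>" using n le[of b] b a1 unfolding t1 by linarith
  have c: "\<bar>b - (2 * \<alpha> - 1 - b) * (\<epsilon> * P)\<bar> \<le> (2 * \<alpha> - 1) * (1 + \<epsilon> * P)"
  proof -
    have e: "0 \<le> \<epsilon> * P" using \<epsilon> P by simp
    have "(2 * \<alpha> - 1 - b) * (\<epsilon> * P) \<le> (2 * \<alpha> - 1) * (\<epsilon> * P)" using e b by (intro mult_right_mono) auto
    moreover have "0 \<le> (2 * \<alpha> - 1 - b) * (\<epsilon> * P)" using e b by simp
    moreover have "0 \<le> (2 * \<alpha> - 1) * (\<epsilon> * P)" using e \<alpha> by simp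
    ultimately have "- ((2 * \<alpha> - 1) * (1 + \<epsilon> * P)) \<le> b - (2 * \<alpha> - 1 - b) * (\<epsilon> * P)"
      "b - (2 * \<alpha> - 1 - b) * (\<epsilon> * P) \<le> (2 * \<alpha> - 1) * (1 + \<epsilon> * P)"
      using b unfolding distrib_left[of "2 * \<alpha> - 1" 1] mult_1_right by linarith+
    then show ?thesis by (intro abs_leI) linarith+
  qed
  have t2: "\<bar>trunc_pow' \<epsilon> \<alpha> b t\<bar> = w powr (b - 1) * \<bar>b - (2 * \<alpha> - 1 - b) * (\<epsilon> * P)\<bar> / (1 + \<epsilon> * P)\<^sup>2"
    by (simp add: trunc_pow'_def w_def P_def abs_mult)
  have "\<bar>trunc_pow' \<epsilon> \<alpha> b t\<bar> \<le> w powr (b - 1) * ((2 * \<alpha> - 1) * (1 + \<epsilon> * P)) / (1 + \<epsilon> * P)\<^sup>2"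
    unfolding t2 by (intro divide_right_mono mult_left_mono c) auto
  also have "\<dots> = (2 * \<alpha> - 1) * w powr (b - 1) / (1 + \<epsilon> * P)"
    using D by (simp add: power2_eq_square)
  finally show bb: "\<bar>trunc_pow' \<epsilon> \<alpha> b t\<bar> \<le> (2 * \<alpha> - 1) * max t 0 powr (b - 1) / (1 + \<epsilon> * max t 0 powr (2 * \<alpha> - 1))"
    by (simp add: w_def P_def)
  have "(2 * \<alpha> - 1) * (w powr (b - 1) / (1 + \<epsilon> * P)) \<le> (2 * \<alpha> - 1) * (1 / \<epsilon>)"
    using le[of "b - 1"] b \<alpha> by (intro mult_left_mono) auto
  also have "\<dots> \<le> 2 * \<alpha> / \<epsilon>" using \<epsilon> by (simp add: divide_right_mono)
  finally show "\<bar>trunc_pow' \<epsilon> \<alpha> b t\<bar> \<le> 2 * \<alpha> / \<epsilon>" using bb by (simp add: w_def P_def)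
qed

text \<open>The test exponent \<open>2\<alpha> - 1\<close> and the energy exponent \<open>\<alpha>\<close> are truncated by the same factor.
  The quotient \<open>G\<^sup>2 / G'\<close> is then independent of the truncation.\<close>

lemma trunc_pow_relations:
  fixes t :: real
  assumes \<alpha>: "1 < \<alpha>" and \<epsilon>: "0 < \<epsilon>" "\<epsilon> \<le> 1"
  defines "G \<equiv> trunc_pow \<epsilon> \<alpha> (2 * \<alpha> - 1)" and "G' \<equiv> trunc_pow' \<epsilon> \<alpha> (2 * \<alpha> - 1)"
  shows "0 \<le> G' t" "G' t \<le> (2 * \<alpha> - 1) * max t 0 powr (2 * \<alpha> - 2)"
    "(G t)\<^sup>2 = G' t * (max t 0 powr (2 * \<alpha>) / (2 * \<alpha> - 1))"
    "(trunc_pow' \<epsilon> \<alpha> \<alpha> t)\<^sup>2 \<le> \<alpha>\<^sup>2 / (2 * \<alpha> - 1) * G' t"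
proof -
  define w where "w = max t 0"
  define P where "P = w powr (2 * \<alpha> - 1)"
  have w: "0 \<le> w" by (simp add: w_def)
  have P: "0 \<le> P" by (simp add: P_def)
  have D: "1 \<le> 1 + \<epsilon> * P" "0 < 1 + \<epsilon> * P" using \<epsilon> P by simp_all (smt (verit) mult_nonneg_nonneg)
  have D2: "1 \<le> (1 + \<epsilon> * P)\<^sup>2" using power_mono[OF D(1), of 2] by simp
  \<comment> \<open>For b = 2\<alpha> - 1 the subtracted term in the numerator of
    \<open>trunc_pow'\<close> vanishes.\<close>
  have G': "G' t = (2 * \<alpha> - 1) * w powr (2 * \<alpha> - 2) / (1 + \<epsilon> * P)\<^sup>2"
    by (simp add: G'_def trunc_pow'_def w_def P_def)
  show "0 \<le> G' t" unfolding G' using \<alpha> by simp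
  have y: "0 \<le> (2 * \<alpha> - 1) * w powr (2 * \<alpha> - 2)" using \<alpha> by simp
  have "G' t \<le> (2 * \<alpha> - 1) * w powr (2 * \<alpha> - 2) / 1"
    unfolding G' by (rule divide_left_mono[OF D2 y]) (use D in simp)
  then show "G' t \<le> (2 * \<alpha> - 1) * max t 0 powr (2 * \<alpha> - 2)" by (simp add: w_def)
  have pp: "(w powr c)\<^sup>2 = w powr (2 * c)" for c
    by (simp add: power2_eq_square powr_add[symmetric])
  have "(G t)\<^sup>2 = w powr (2 * (2 * \<alpha> - 1)) / (1 + \<epsilon> * P)\<^sup>2"
    by (simp add: G_def trunc_pow_def w_def P_def power_divide pp[unfolded w_def])
  also have "2 * (2 * \<alpha> - 1) = (2 * \<alpha> - 2) + 2 * \<alpha>" by simp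
  also have "w powr ((2 * \<alpha> - 2) + 2 * \<alpha>) / (1 + \<epsilon> * P)\<^sup>2 = G' t * (w powr (2 * \<alpha>) / (2 * \<alpha> - 1))"
    unfolding G' powr_add using \<alpha> by simp
  finally show "(G t)\<^sup>2 = G' t * (max t 0 powr (2 * \<alpha>) / (2 * \<alpha> - 1))" by (simp add: w_def)
  have c: "\<bar>\<alpha> - (\<alpha> - 1) * (\<epsilon> * P)\<bar> \<le> \<alpha> * (1 + \<epsilon> * P)"
  proof -
    have e: "0 \<le> \<epsilon> * P" using \<epsilon> P by simp
    have "(\<alpha> - 1) * (\<epsilon> * P) \<le> \<alpha> * (\<epsilon> * P)" "0 \<le> (\<alpha> - 1) * (\<epsilon> * P)" using e \<alpha> by (auto intro: mult_right_mono)
    then show ?thesis using \<alpha> unfolding distrib_left by linarith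
  qed
  have h: "trunc_pow' \<epsilon> \<alpha> \<alpha> t = w powr (\<alpha> - 1) * (\<alpha> - (\<alpha> - 1) * (\<epsilon> * P)) / (1 + \<epsilon> * P)\<^sup>2"
    by (simp add: trunc_pow'_def w_def P_def)
  have "(trunc_pow' \<epsilon> \<alpha> \<alpha> t)\<^sup>2 = w powr (2 * (\<alpha> - 1)) * (\<bar>\<alpha> - (\<alpha> - 1) * (\<epsilon> * P)\<bar>)\<^sup>2 / ((1 + \<epsilon> * P)\<^sup>2)\<^sup>2"
    unfolding h by (simp add: power_divide power_mult_distrib pp)
  also have "\<dots> \<le> w powr (2 * (\<alpha> - 1)) * (\<alpha> * (1 + \<epsilon> * P))\<^sup>2 / ((1 + \<epsilon> * P)\<^sup>2)\<^sup>2"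
    by (intro divide_right_mono mult_left_mono power_mono c) auto
  also have "\<dots> = \<alpha>\<^sup>2 * w powr (2 * (\<alpha> - 1)) / (1 + \<epsilon> * P)\<^sup>2"
    using D by (simp add: power2_eq_square)
  also have "\<dots> = \<alpha>\<^sup>2 / (2 * \<alpha> - 1) * G' t"
    unfolding G' using \<alpha> by (simp add: right_diff_distrib)
  finally show "(trunc_pow' \<epsilon> \<alpha> \<alpha> t)\<^sup>2 \<le> \<alpha>\<^sup>2 / (2 * \<alpha> - 1) * G' t" .
qed

section \<open>The Caccioppoli inequality\<close>

text \<open>What the iteration uses of the equation: the identity \<open>tested\<close> for all
  bounded nonnegative C^1 functions of v, with F in the role of the gradient of the datum. In this
  form the hypotheses are invariant under a change of sign of the solution.\<close>

locale tested_solution = elliptic_coefficients a lam Lam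
  for a :: "real^'n \<Rightarrow> real^'n^'n" and lam Lam +
  fixes \<phi> :: "nat \<Rightarrow> real^'n \<Rightarrow> real" and v :: "real^'n \<Rightarrow> real" and g F :: "real^'n \<Rightarrow> real^'n"
    and y :: "real^'n" and R L :: real
  assumes approx: "approximates UNIV \<phi> v g"
    and approx_AE: "AE x in lebesgue. (\<lambda>n. \<phi> n x) \<longlonglongrightarrow> v x"
    and F_measurable: "F \<in> borel_measurable lebesgue"
    and F_bound: "\<And>x. norm (F x) \<le> L"
    and R_pos: "0 < R"
    and tested: "\<And>\<psi> G G' M. \<psi> \<in> test_functions (ball y R) \<Longrightarrow> (\<And>x. 0 \<le> \<psi> x) \<Longrightarrow>
      (\<And>t. (G has_real_derivative G' t) (at t)) \<Longrightarrow> continuous_on UNIV G' \<Longrightarrow>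
      (\<And>t. \<bar>G t\<bar> \<le> M) \<Longrightarrow> (\<And>t. \<bar>G' t\<bar> \<le> M) \<Longrightarrow> (\<And>t. 0 \<le> G t) \<Longrightarrow>
      (LINT x|lebesgue. (a x *v g x) \<bullet> ((\<psi> x * G' (v x)) *\<^sub>R g x + G (v x) *\<^sub>R grad \<psi> x))
      = - (LINT x|lebesgue. (a x *v F x) \<bullet> ((\<psi> x * G' (v x)) *\<^sub>R g x + G (v x) *\<^sub>R grad \<psi> x))"
begin

lemma v_measurable: "v \<in> borel_measurable lebesgue" and g_measurable: "g \<in> borel_measurable lebesgue"
  using approximatesD[OF approx] by blast+

lemma a_form_integrable:
  assumes "(\<integral>\<^sup>+x. ennreal (Q x (h x)) \<partial>lebesgue) < \<infinity>" "(\<integral>\<^sup>+x. ennreal (Q x (k x)) \<partial>lebesgue) < \<infinity>"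
    and hm: "h \<in> borel_measurable lebesgue" and km: "k \<in> borel_measurable lebesgue"
  shows "integrable lebesgue (\<lambda>x. (a x *v h x) \<bullet> k x)"
proof (rule Bochner_Integration.integrable_bound)
  have int: "integrable lebesgue (\<lambda>x. Q x (f x))"
    if "(\<integral>\<^sup>+x. ennreal (Q x (f x)) \<partial>lebesgue) < \<infinity>" "f \<in> borel_measurable lebesgue" for f
  proof (rule integrableI_nn_integral_finite)
    show "(\<lambda>x. Q x (f x)) \<in> borel_measurable lebesgue" by (rule Q_measurable[OF that(2)])
    show "AE x in lebesgue. 0 \<le> Q x (f x)" using AE_good by eventually_elim (rule Q_nonneg)
    show "(\<integral>\<^sup>+x. ennreal (Q x (f x)) \<partial>lebesgue) = ennreal (enn2real (\<integral>\<^sup>+x. ennreal (Q x (f x)) \<partial>lebesgue))"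
      using that(1) by simp
  qed
  show "integrable lebesgue (\<lambda>x. Q x (h x) + Q x (k x))"
    by (intro Bochner_Integration.integrable_add int assms)
  show "(\<lambda>x. (a x *v h x) \<bullet> k x) \<in> borel_measurable lebesgue" by (rule a_form_measurable[OF hm km])
  show "AE x in lebesgue. norm ((a x *v h x) \<bullet> k x) \<le> norm (Q x (h x) + Q x (k x))"
    using AE_good
  proof eventually_elim
    case (elim x)
    have "2 * \<bar>(a x *v h x) \<bullet> k x\<bar> \<le> 1 * Q x (h x) + Q x (k x) / 1" by (rule Q_Young[OF elim]) simp
    then show ?case using Q_nonneg[OF elim, of "h x"] Q_nonneg[OF elim, of "k x"] by simp
  qed
qed

text \<open>Here \<gamma>, \<xi>, \<zeta> stand for the gradients of the solution, the cutoff and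
  the datum, and e for the cutoff. Since G = sqrt G' sqrt W, each mixed term pairs two of the
  vectors e sqrt G' \<gamma>, e sqrt G' \<zeta>, sqrt W \<xi>. The weights in Young's inequality are
  chosen so that half of the energy of \<gamma> remains.\<close>

lemma Caccioppoli_pointwise:
  fixes \<gamma> \<xi> \<zeta> :: "real^'n"
  assumes x: "good x" and G: "0 \<le> G" "0 \<le> G'" "G\<^sup>2 = G' * W" "0 \<le> W" and e: "0 \<le> e"
  defines "h \<equiv> (e\<^sup>2 * G') *\<^sub>R \<gamma> + G *\<^sub>R ((2 * e) *\<^sub>R \<xi>)"
  shows "1 / 2 * (e\<^sup>2 * G' * Q x \<gamma>)
    \<le> (a x *v \<gamma>) \<bullet> h + (a x *v \<zeta>) \<bullet> h + (2 * (e\<^sup>2 * G' * Q x \<zeta>) + 5 * (W * Q x \<xi>))"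
proof -
  define s where "s = sqrt G'"
  define T where "T = sqrt W"
  have s: "0 \<le> s" "s\<^sup>2 = G'" and T: "0 \<le> T" "T\<^sup>2 = W" using G by (simp_all add: s_def T_def)
  have GsT: "G = s * T"
  proof -
    have "G\<^sup>2 = (s * T)\<^sup>2" by (simp add: power_mult_distrib s T G(3))
    then show ?thesis using G(1) s(1) T(1) by (simp add: power2_eq_iff_nonneg)
  qed
  have h1: "(a x *v \<gamma>) \<bullet> h = e\<^sup>2 * G' * Q x \<gamma> + 2 * ((a x *v ((e * s) *\<^sub>R \<gamma>)) \<bullet> (T *\<^sub>R \<xi>))"
    unfolding h_def by (simp add: Q_def inner_add_right matrix_vector_mult_scaleR GsT)
  have h2: "(a x *v \<zeta>) \<bullet> h = (a x *v ((e * s) *\<^sub>R \<zeta>)) \<bullet> ((e * s) *\<^sub>R \<gamma>) + 2 * ((a x *v ((e * s) *\<^sub>R \<zeta>)) \<bullet> (T *\<^sub>R \<xi>))"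
    unfolding h_def by (simp add: inner_add_right matrix_vector_mult_scaleR GsT s(2)[symmetric] power2_eq_square)
  have q: "Q x ((e * s) *\<^sub>R z) = e\<^sup>2 * G' * Q x z" "Q x (T *\<^sub>R z) = W * Q x z" for z
    by (simp_all add: Q_scaleR power_mult_distrib s T)
  have y1: "2 * \<bar>(a x *v ((e * s) *\<^sub>R \<gamma>)) \<bullet> (T *\<^sub>R \<xi>)\<bar> \<le> 1 / 4 * (e\<^sup>2 * G' * Q x \<gamma>) + (W * Q x \<xi>) / (1 / 4)"
    unfolding q[symmetric] by (rule Q_Young[OF x]) simp
  have y2: "2 * \<bar>(a x *v ((e * s) *\<^sub>R \<zeta>)) \<bullet> ((e * s) *\<^sub>R \<gamma>)\<bar> \<le> 2 * (e\<^sup>2 * G' * Q x \<zeta>) + (e\<^sup>2 * G' * Q x \<gamma>) / 2"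
    unfolding q[symmetric] by (rule Q_Young[OF x]) simp
  have y3: "2 * \<bar>(a x *v ((e * s) *\<^sub>R \<zeta>)) \<bullet> (T *\<^sub>R \<xi>)\<bar> \<le> 1 * (e\<^sup>2 * G' * Q x \<zeta>) + (W * Q x \<xi>) / 1"
    unfolding q[symmetric] by (rule Q_Young[OF x]) simp
  define i1 where "i1 = (a x *v ((e * s) *\<^sub>R \<gamma>)) \<bullet> (T *\<^sub>R \<xi>)"
  define i2 where "i2 = (a x *v ((e * s) *\<^sub>R \<zeta>)) \<bullet> ((e * s) *\<^sub>R \<gamma>)"
  define i3 where "i3 = (a x *v ((e * s) *\<^sub>R \<zeta>)) \<bullet> (T *\<^sub>R \<xi>)"
  define qg where "qg = e\<^sup>2 * G' * Q x \<gamma>"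
  define qz where "qz = e\<^sup>2 * G' * Q x \<zeta>"
  define qx where "qx = W * Q x \<xi>"
  have four: "qx / (1 / 4) = 4 * qx" by simp
  have "2 * \<bar>i1\<bar> \<le> 1 / 4 * qg + 4 * qx"
    using y1 unfolding i1_def[symmetric] qg_def[symmetric] qx_def[symmetric] four .
  then have z1: "- (2 * i1) \<le> 1 / 4 * qg + 4 * qx" by (simp add: abs_if split: if_splits)
  have "2 * \<bar>i2\<bar> \<le> 2 * qz + qg / 2"
    using y2 unfolding i2_def[symmetric] qg_def[symmetric] qz_def[symmetric] .
  then have z2: "- i2 \<le> qz + qg / 4" by (simp add: abs_if split: if_splits)
  have "2 * \<bar>i3\<bar> \<le> qz + qx"
    using y3 unfolding i3_def[symmetric] qx_def[symmetric] qz_def[symmetric] by simp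
  then have z3: "- (2 * i3) \<le> qz + qx" by (simp add: abs_if split: if_splits)
  have "1 / 2 * qg \<le> qg + 2 * i1 + (i2 + 2 * i3) + (2 * qz + 5 * qx)"
    using z1 z2 z3 by linarith
  then show ?thesis
    unfolding h1 h2 i1_def[symmetric] i2_def[symmetric] i3_def[symmetric]
      qg_def[symmetric] qz_def[symmetric] qx_def[symmetric] .
qed

text \<open>Testing with \<eta>^2 G(v) gives X \<le> Y + Z pointwise, where Y is the integrand of
  the equation and integrates to 0. What is left on the right depends on G only through G' and
  G^2/G', both bounded by powers of w independently of \<epsilon>.\<close>

lemma Caccioppoli:
  assumes \<alpha>: "1 < \<alpha>" and \<epsilon>: "0 < \<epsilon>" "\<epsilon> \<le> 1"
    and \<eta>: "\<eta> \<in> test_functions (ball y R)" "\<And>x. 0 \<le> \<eta> x"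
  defines "w \<equiv> \<lambda>x. max (v x) 0" and "H \<equiv> trunc_pow \<epsilon> \<alpha> \<alpha>" and "H' \<equiv> trunc_pow' \<epsilon> \<alpha> \<alpha>"
  shows "(\<integral>\<^sup>+x. ennreal (Q x ((\<eta> x * H' (v x)) *\<^sub>R g x + H (v x) *\<^sub>R grad \<eta> x)) \<partial>lebesgue)
    \<le> ennreal (22 * \<alpha>\<^sup>2) * (\<integral>\<^sup>+x. ennreal (Lam x * (L\<^sup>2 * (\<eta> x)\<^sup>2 * w x powr (2 * \<alpha> - 2)
      + (norm (grad \<eta> x))\<^sup>2 * w x powr (2 * \<alpha>))) \<partial>lebesgue)"
proof -
  define m where "m = 2 * \<alpha> - 1"
  have m: "1 < m" "\<alpha> \<le> m" using \<alpha> by (simp_all add: m_def)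
  define G where "G = trunc_pow \<epsilon> \<alpha> m"
  define G' where "G' = trunc_pow' \<epsilon> \<alpha> m"
  note rel = trunc_pow_relations[OF \<alpha> \<epsilon>, folded m_def, folded G_def G'_def]
  have GD: "(G has_real_derivative G' t) (at t)" for t
    unfolding G_def G'_def by (rule trunc_pow_derivative[OF \<alpha> \<epsilon>(1) m(1)])
  have cG': "continuous_on UNIV G'" unfolding G'_def by (rule trunc_pow'_continuous[OF \<alpha> \<epsilon>(1) m(1)])
  note bdG = trunc_pow_bounds[OF \<alpha> \<epsilon> m(1), folded m_def, OF order_refl, folded G_def G'_def]
  have bdH: "0 \<le> H t" "H t \<le> max t 0 powr \<alpha>" for t
    using trunc_pow_bounds(1,2)[OF \<alpha> \<epsilon> \<alpha> m(2)[unfolded m_def]] by (simp_all add: H_def)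
  have cG: "continuous_on UNIV G" using GD by (meson DERIV_isCont continuous_at_imp_continuous_on)
  have mG: "(\<lambda>x. G (v x)) \<in> borel_measurable lebesgue" "(\<lambda>x. G' (v x)) \<in> borel_measurable lebesgue"
    using measurable_compose[OF v_measurable borel_measurable_continuous_onI[OF cG]]
      measurable_compose[OF v_measurable borel_measurable_continuous_onI[OF cG']] by blast+
  define \<psi> where "\<psi> x = \<eta> x * \<eta> x" for x
  have \<psi>: "\<psi> \<in> test_functions (ball y R)" "\<And>x. 0 \<le> \<psi> x"
    unfolding \<psi>_def[abs_def] by (rule test_functions_mult[OF \<eta>(1) test_functions_Ck[OF \<eta>(1)]]) simp
  have g\<psi>: "grad \<psi> x = (2 * \<eta> x) *\<^sub>R grad \<eta> x" for x
    unfolding \<psi>_def[abs_def] grad_mult[OF test_functions_differentiable[OF \<eta>(1)] test_functions_differentiable[OF \<eta>(1)]]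
    by (simp add: scaleR_add_left[symmetric])
  define h where "h x = ((\<eta> x)\<^sup>2 * G' (v x)) *\<^sub>R g x + G (v x) *\<^sub>R ((2 * \<eta> x) *\<^sub>R grad \<eta> x)" for x
  have h: "h x = (\<psi> x * G' (v x)) *\<^sub>R g x + G (v x) *\<^sub>R grad \<psi> x" for x
    by (simp add: h_def g\<psi> \<psi>_def power2_eq_square)
  have m\<eta>: "\<eta> \<in> borel_measurable lebesgue" "grad \<eta> \<in> borel_measurable lebesgue"
    using test_functions_measurable_lebesgue[OF \<eta>(1)] by blast+
  have wm: "w \<in> borel_measurable lebesgue" unfolding w_def using v_measurable by measurable
  note [measurable] = m\<eta> mG g_measurable F_measurable v_measurable wm Lam_measurable Q_measurable
  have hm: "h \<in> borel_measurable lebesgue" unfolding h_def[abs_def] by measurable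
  obtain K where K: "compact K" "\<And>x. x \<notin> K \<Longrightarrow> \<eta> x = 0" "\<And>x. x \<notin> K \<Longrightarrow> grad \<eta> x = 0"
    using test_functionsE[OF \<eta>(1)] by metis
  have Km [measurable]: "K \<in> sets lebesgue" using K(1) by (simp add: lmeasurable_compact fmeasurableD)
  obtain B where B: "B > 0" "\<And>x. \<bar>\<eta> x\<bar> \<le> B" "\<And>x. norm (grad \<eta> x) \<le> B"
    using test_functions_bounded[OF \<eta>(1)] by metis
  have Qh: "(\<integral>\<^sup>+x. ennreal (Q x (h x)) \<partial>lebesgue) < \<infinity>"
  proof -
    obtain \<zeta> where "approximates (ball y R) \<zeta> (\<lambda>x. \<psi> x * G (v x)) h"
      using approximates_mult_compose[OF approx approx_AE \<psi>(1) GD cG' bdG(3,5)] unfolding h[abs_def] by blast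
    then show ?thesis by (rule approximates_finite_energy)
  qed
  have Qg: "(\<integral>\<^sup>+x. ennreal (Q x (g x)) \<partial>lebesgue) < \<infinity>" by (rule approximates_finite_energy[OF approx])
  \<comment> \<open>The bounded field F need not have finite energy, as \<open>Lam\<close> is only
    locally integrable. Cutting it off outside the support of \<eta> changes none of the
    integrands.\<close>
  define F0 where "F0 x = indicator K x *\<^sub>R F x" for x
  have F0m: "F0 \<in> borel_measurable lebesgue" unfolding F0_def[abs_def] by measurable
  have L0: "0 \<le> L" using F_bound[of 0] norm_ge_zero order_trans by blast
  have F0b: "norm (F0 x) \<le> L" for x using F_bound[of x] L0 by (simp add: F0_def indicator_def)
  have QF: "(\<integral>\<^sup>+x. ennreal (Q x (F0 x)) \<partial>lebesgue) < \<infinity>"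
  proof -
    have "integrable lebesgue (\<lambda>x. Q x (F0 x))"
      by (rule Q_locally_integrable[OF F0m F0b K(1)]) (simp add: F0_def)
    moreover have "AE x in lebesgue. 0 \<le> Q x (F0 x)" using AE_good by eventually_elim (rule Q_nonneg)
    ultimately have "(\<integral>\<^sup>+x. ennreal (Q x (F0 x)) \<partial>lebesgue) = ennreal (LINT x|lebesgue. Q x (F0 x))"
      by (rule nn_integral_eq_integral)
    then show ?thesis by simp
  qed
  have h0: "h x = 0" if "x \<notin> K" for x using K(2,3)[OF that] by (simp add: h_def)
  have Fh: "(a x *v F x) \<bullet> h x = (a x *v F0 x) \<bullet> h x" for x
    using h0[of x] by (cases "x \<in> K") (simp_all add: F0_def)
  define Y where "Y x = (a x *v g x) \<bullet> h x + (a x *v F0 x) \<bullet> h x" for x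
  have i1: "integrable lebesgue (\<lambda>x. (a x *v g x) \<bullet> h x)" by (rule a_form_integrable[OF Qg Qh g_measurable hm])
  have i2: "integrable lebesgue (\<lambda>x. (a x *v F0 x) \<bullet> h x)" by (rule a_form_integrable[OF QF Qh F0m hm])
  have Yi: "integrable lebesgue Y" unfolding Y_def[abs_def] by (rule Bochner_Integration.integrable_add[OF i1 i2])
  have Y0: "(LINT x|lebesgue. Y x) = 0"
    using tested[OF \<psi> GD cG' bdG(3,5,1)] unfolding h[symmetric] Fh unfolding Y_def
    by (simp add: Bochner_Integration.integral_add[OF i1 i2])
  define X where "X x = 1 / 2 * ((\<eta> x)\<^sup>2 * G' (v x) * Q x (g x))" for x
  define W where "W x = w x powr (2 * \<alpha>) / m" for x
  define Z where "Z x = 2 * ((\<eta> x)\<^sup>2 * G' (v x) * Q x (F0 x)) + 5 * (W x * Q x (grad \<eta> x))" for x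
  have W0: "0 \<le> W x" for x using m by (simp add: W_def)
  have mXZ: "X \<in> borel_measurable lebesgue" "Z \<in> borel_measurable lebesgue"
  proof -
    have [measurable]: "W \<in> borel_measurable lebesgue" unfolding W_def[abs_def] by measurable
    note [measurable] = Q_measurable[OF g_measurable] Q_measurable[OF F0m] Q_measurable[OF m\<eta>(2)]
    show "X \<in> borel_measurable lebesgue" "Z \<in> borel_measurable lebesgue"
      unfolding X_def[abs_def] Z_def[abs_def] by measurable
  qed
  note [measurable] = mXZ
  have X0: "AE x in lebesgue. 0 \<le> X x" and Z0: "AE x in lebesgue. 0 \<le> Z x"
    using AE_good by (eventually_elim, simp add: X_def Z_def Q_nonneg rel(1) W0)+
  have XYZ: "AE x in lebesgue. X x \<le> Y x + Z x"
    using AE_good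
  proof eventually_elim
    case (elim x)
    have GW: "(G (v x))\<^sup>2 = G' (v x) * W x" using rel(3)[of "v x"] by (simp add: W_def w_def)
    show ?case
      using Caccioppoli_pointwise[OF elim bdG(1)[of "v x"] rel(1)[of "v x"] GW W0 \<eta>(2)[of x], of "g x" "grad \<eta> x" "F0 x", folded h_def]
      by (simp add: X_def Y_def Z_def)
  qed
  \<comment> \<open>Additivity of the Bochner integral requires Z to be integrable; otherwise the
    right side is infinite.\<close>
  have XZ: "(\<integral>\<^sup>+x. ennreal (X x) \<partial>lebesgue) \<le> (\<integral>\<^sup>+x. ennreal (Z x) \<partial>lebesgue)"
  proof (cases "(\<integral>\<^sup>+x. ennreal (Z x) \<partial>lebesgue) = \<infinity>")
    case False
    then have Zi: "integrable lebesgue Z"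
      by (intro integrableI_nn_integral_finite[OF mXZ(2) Z0, of "enn2real (\<integral>\<^sup>+x. ennreal (Z x) \<partial>lebesgue)"])
        (simp add: less_top)
    have YZ: "integrable lebesgue (\<lambda>x. Y x + Z x)" by (rule Bochner_Integration.integrable_add[OF Yi Zi])
    have nYZ: "AE x in lebesgue. 0 \<le> Y x + Z x" using X0 XYZ by eventually_elim linarith
    have "(\<integral>\<^sup>+x. ennreal (X x) \<partial>lebesgue) \<le> (\<integral>\<^sup>+x. ennreal (Y x + Z x) \<partial>lebesgue)"
      by (rule nn_integral_mono_AE) (use XYZ in eventually_elim, rule ennreal_leI)
    also have "\<dots> = ennreal (LINT x|lebesgue. Y x + Z x)" by (rule nn_integral_eq_integral[OF YZ nYZ])
    also have "(LINT x|lebesgue. Y x + Z x) = (LINT x|lebesgue. Z x)"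
      using Bochner_Integration.integral_add[OF Yi Zi] Y0 by simp
    also have "ennreal (LINT x|lebesgue. Z x) = (\<integral>\<^sup>+x. ennreal (Z x) \<partial>lebesgue)"
      by (rule nn_integral_eq_integral[OF Zi Z0, symmetric])
    finally show ?thesis .
  qed simp
  define D where "D x = Lam x * (L\<^sup>2 * (\<eta> x)\<^sup>2 * w x powr (2 * \<alpha> - 2) + (norm (grad \<eta> x))\<^sup>2 * w x powr (2 * \<alpha>))" for x
  have D0: "0 \<le> D x" for x unfolding D_def using Lam_nonneg by (intro mult_nonneg_nonneg add_nonneg_nonneg) auto
  have Dm: "D \<in> borel_measurable lebesgue" unfolding D_def[abs_def] by measurable
  note [measurable] = Dm
  define k where "k x = (\<eta> x * H' (v x)) *\<^sub>R g x + H (v x) *\<^sub>R grad \<eta> x" for x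
  let ?c = "4 * \<alpha>\<^sup>2 / m"
  have c0: "0 \<le> ?c" using m by simp
  have kX: "AE x in lebesgue. ennreal (Q x (k x)) \<le> ennreal ?c * ennreal (X x) + 2 * ennreal (D x)"
    using AE_good X0
  proof eventually_elim
    case (elim x)
    note gd = elim(1)
    have "Q x (k x) \<le> 2 * Q x ((\<eta> x * H' (v x)) *\<^sub>R g x) + 2 * Q x (H (v x) *\<^sub>R grad \<eta> x)"
      unfolding k_def by (rule Q_add_le[OF gd])
    also have "\<dots> = 2 * ((\<eta> x)\<^sup>2 * (H' (v x))\<^sup>2 * Q x (g x)) + 2 * ((H (v x))\<^sup>2 * Q x (grad \<eta> x))"
      by (simp add: Q_scaleR power_mult_distrib)
    also have "\<dots> \<le> 2 * ((\<eta> x)\<^sup>2 * (\<alpha>\<^sup>2 / m * G' (v x)) * Q x (g x)) + 2 * (w x powr (2 * \<alpha>) * (Lam x * (norm (grad \<eta> x))\<^sup>2))"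
    proof (intro add_mono mult_left_mono mult_right_mono mult_mono)
      show "(H' (v x))\<^sup>2 \<le> \<alpha>\<^sup>2 / m * G' (v x)" unfolding H'_def by (rule rel(4))
      have "(H (v x))\<^sup>2 \<le> (max (v x) 0 powr \<alpha>)\<^sup>2" by (intro power_mono bdH)
      then show "(H (v x))\<^sup>2 \<le> w x powr (2 * \<alpha>)" by (simp add: w_def power2_eq_square powr_add[symmetric])
      show "Q x (grad \<eta> x) \<le> Lam x * (norm (grad \<eta> x))\<^sup>2" by (rule good_upper[OF gd])
    qed (simp_all add: Q_nonneg[OF gd])
    also have "\<dots> \<le> ?c * X x + 2 * D x"
    proof -
      have "2 * ((\<eta> x)\<^sup>2 * (\<alpha>\<^sup>2 / m * G' (v x)) * Q x (g x)) = ?c * X x" by (simp add: X_def)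
      moreover have "w x powr (2 * \<alpha>) * (Lam x * (norm (grad \<eta> x))\<^sup>2) \<le> D x"
      proof -
        have "0 \<le> Lam x * (L\<^sup>2 * (\<eta> x)\<^sup>2 * w x powr (2 * \<alpha> - 2))" using Lam_nonneg by simp
        then show ?thesis unfolding D_def distrib_left by (simp add: mult_ac)
      qed
      ultimately show ?thesis by linarith
    qed
    finally have "ennreal (Q x (k x)) \<le> ennreal (?c * X x + 2 * D x)" by (rule ennreal_leI)
    also have "\<dots> = ennreal ?c * ennreal (X x) + ennreal 2 * ennreal (D x)"
      by (rule ennreal_lincomb[OF c0 elim(2) zero_le_numeral D0, symmetric])
    finally show ?case by simp
  qed
  have ZD: "AE x in lebesgue. ennreal (Z x) \<le> ennreal (5 * m) * ennreal (D x)"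
    using AE_good
  proof eventually_elim
    case (elim x)
    have qF: "(\<eta> x)\<^sup>2 * Q x (F0 x) \<le> (\<eta> x)\<^sup>2 * (Lam x * L\<^sup>2)"
    proof (rule mult_left_mono)
      have "Q x (F0 x) \<le> Lam x * (norm (F0 x))\<^sup>2" by (rule good_upper[OF elim])
      also have "\<dots> \<le> Lam x * L\<^sup>2" by (intro mult_left_mono power_mono F0b Lam_nonneg) auto
      finally show "Q x (F0 x) \<le> Lam x * L\<^sup>2" .
    qed simp
    have "(\<eta> x)\<^sup>2 * G' (v x) * Q x (F0 x) = G' (v x) * ((\<eta> x)\<^sup>2 * Q x (F0 x))" by simp
    also have "\<dots> \<le> (m * w x powr (2 * \<alpha> - 2)) * ((\<eta> x)\<^sup>2 * (Lam x * L\<^sup>2))"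
    proof (rule mult_mono[OF _ qF])
      show "G' (v x) \<le> m * w x powr (2 * \<alpha> - 2)" using rel(2)[of "v x"] by (simp add: w_def)
    qed (use m Q_nonneg[OF elim] in simp_all)
    finally have 1: "(\<eta> x)\<^sup>2 * G' (v x) * Q x (F0 x) \<le> m * (Lam x * (L\<^sup>2 * (\<eta> x)\<^sup>2 * w x powr (2 * \<alpha> - 2)))"
      by (simp add: mult_ac)
    have "W x * Q x (grad \<eta> x) \<le> (m * w x powr (2 * \<alpha>)) * (Lam x * (norm (grad \<eta> x))\<^sup>2)"
    proof (rule mult_mono[OF _ good_upper[OF elim]])
      have "w x powr (2 * \<alpha>) * 1 \<le> w x powr (2 * \<alpha>) * (m * m)"
        using m mult_mono[of 1 m 1 m] by (intro mult_left_mono) auto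
      then show "W x \<le> m * w x powr (2 * \<alpha>)" unfolding W_def using m by (simp add: divide_le_eq mult_ac)
    qed (use m Q_nonneg[OF elim] in simp_all)
    then have 2: "W x * Q x (grad \<eta> x) \<le> m * (Lam x * ((norm (grad \<eta> x))\<^sup>2 * w x powr (2 * \<alpha>)))"
      by (simp add: mult_ac)
    have 3: "0 \<le> m * (Lam x * (L\<^sup>2 * (\<eta> x)\<^sup>2 * w x powr (2 * \<alpha> - 2)))" using m Lam_nonneg by simp
    have "Z x \<le> 5 * (m * (Lam x * (L\<^sup>2 * (\<eta> x)\<^sup>2 * w x powr (2 * \<alpha> - 2)))) + 5 * (m * (Lam x * ((norm (grad \<eta> x))\<^sup>2 * w x powr (2 * \<alpha>))))"
      unfolding Z_def using 1 2 3 by linarith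
    also have "\<dots> = 5 * m * D x" unfolding D_def by (simp add: distrib_left)
    finally have "ennreal (Z x) \<le> ennreal (5 * m * D x)" by (rule ennreal_leI)
    also have "\<dots> = ennreal (5 * m) * ennreal (D x)" using m D0 by (intro ennreal_mult) auto
    finally show ?case .
  qed
  have "(\<integral>\<^sup>+x. ennreal (Q x (k x)) \<partial>lebesgue) \<le> (\<integral>\<^sup>+x. ennreal ?c * ennreal (X x) + 2 * ennreal (D x) \<partial>lebesgue)"
    by (rule nn_integral_mono_AE[OF kX])
  also have "\<dots> = ennreal ?c * (\<integral>\<^sup>+x. ennreal (X x) \<partial>lebesgue) + 2 * (\<integral>\<^sup>+x. ennreal (D x) \<partial>lebesgue)"
    by (subst nn_integral_add) (simp_all add: nn_integral_cmult)
  also have "\<dots> \<le> ennreal ?c * (ennreal (5 * m) * (\<integral>\<^sup>+x. ennreal (D x) \<partial>lebesgue)) + 2 * (\<integral>\<^sup>+x. ennreal (D x) \<partial>lebesgue)"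
  proof (intro add_mono mult_left_mono order_refl)
    have "(\<integral>\<^sup>+x. ennreal (Z x) \<partial>lebesgue) \<le> (\<integral>\<^sup>+x. ennreal (5 * m) * ennreal (D x) \<partial>lebesgue)"
      by (rule nn_integral_mono_AE[OF ZD])
    also have "\<dots> = ennreal (5 * m) * (\<integral>\<^sup>+x. ennreal (D x) \<partial>lebesgue)" by (rule nn_integral_cmult) measurable
    finally show "(\<integral>\<^sup>+x. ennreal (X x) \<partial>lebesgue) \<le> ennreal (5 * m) * (\<integral>\<^sup>+x. ennreal (D x) \<partial>lebesgue)"
      using XZ by (rule order_trans[rotated])
  qed (rule zero_le)+
  also have "\<dots> = (ennreal ?c * ennreal (5 * m) + ennreal 2 * ennreal 1) * (\<integral>\<^sup>+x. ennreal (D x) \<partial>lebesgue)"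
    by (simp add: distrib_right mult.assoc)
  also have "ennreal ?c * ennreal (5 * m) + ennreal 2 * ennreal 1 = ennreal (?c * (5 * m) + 2 * 1)"
    using m by (intro ennreal_lincomb c0) auto
  \<comment> \<open>The product (4\<alpha>^2/m)(5m) is 20\<alpha>^2, and the remaining 2 is absorbed
    since \<alpha> > 1.\<close>
  also have "\<dots> \<le> ennreal (22 * \<alpha>\<^sup>2)"
  proof (rule ennreal_leI)
    have "?c * (5 * m) = 20 * \<alpha>\<^sup>2" using m by simp
    moreover have "1 \<le> \<alpha>\<^sup>2" using \<alpha> by simp
    ultimately show "?c * (5 * m) + 2 * 1 \<le> 22 * \<alpha>\<^sup>2" by linarith
  qed
  finally show ?thesis unfolding k_def D_def by (simp add: mult_right_mono)
qed

end

section \<open>One step of the iteration\<close>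

lemma measure_ball_scale:
  assumes "0 \<le> R"
  shows "measure lborel (ball (y::real^'n) R) = R powr real CARD('n) * measure lborel (ball (0::real^'n) 1)"
proof (cases "R = 0")
  case False
  then show ?thesis
    using content_ball_conv_unit_ball[of R y] assms by (simp add: powr_realpow)
qed simp

context elliptic_coefficients
begin

text \<open>Write |grad|^r as (lam |grad|^2)^(r/2) times lam^(-r/2). The value r = 2q/(q + 1) is the
  one with q (1 - r/2) = r/2, so Hoelder's inequality produces exactly the q-th moment of
  1/lam.\<close>

lemma nn_integral_grad_powr_le:
  assumes q: "1 < q" and r: "r = 2 * q / (q + 1)"
    and \<zeta>: "\<zeta> \<in> test_functions (ball y R)"
    and E: "(\<integral>\<^sup>+x. ennreal (Q x (grad \<zeta> x)) \<partial>lebesgue) \<le> ennreal E" "0 \<le> E"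
    and S: "(\<integral>\<^sup>+x. ennreal (indicator (ball y R) x * (1 / lam x) powr q) \<partial>lebesgue) \<le> ennreal S" "0 \<le> S"
  shows "(\<integral>\<^sup>+x. ennreal (norm (grad \<zeta> x) powr r) \<partial>lborel) \<le> ennreal (E powr (r / 2) * S powr (1 - r / 2))"
proof -
  have r2: "0 < r / 2" "r / 2 < 1" using q by (simp_all add: r field_simps)
  have e: "q * (1 - r / 2) = r / 2" using q by (simp add: r field_simps)
  obtain K where K: "K \<subseteq> ball y R" "\<And>x. x \<notin> K \<Longrightarrow> grad \<zeta> x = 0"
    using test_functionsE[OF \<zeta>] by metis
  have gm: "grad \<zeta> \<in> borel_measurable lebesgue" using test_functions_measurable_lebesgue[OF \<zeta>] by blast
  note [measurable] = gm lam_measurable Q_measurable[OF gm]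
  let ?F = "\<lambda>x. max 0 (Q x (grad \<zeta> x))"
  let ?G = "\<lambda>x. indicator (ball y R) x * (1 / lam x) powr q"
  have "(\<integral>\<^sup>+x. ennreal (norm (grad \<zeta> x) powr r) \<partial>lborel) = (\<integral>\<^sup>+x. ennreal (norm (grad \<zeta> x) powr r) \<partial>lebesgue)"
    by (rule nn_integral_completion[symmetric])
  also have "\<dots> \<le> (\<integral>\<^sup>+x. ennreal (?F x powr (r / 2) * ?G x powr (1 - r / 2)) \<partial>lebesgue)"
  proof (rule nn_integral_mono_AE)
    show "AE x in lebesgue. ennreal (norm (grad \<zeta> x) powr r) \<le> ennreal (?F x powr (r / 2) * ?G x powr (1 - r / 2))"
      using AE_good
    proof eventually_elim
      case (elim x)
      show ?case
      proof (cases "x \<in> K")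
        case False
        then show ?thesis using K(2) r2 by simp
      next
        case True
        then have x: "x \<in> ball y R" using K(1) by blast
        note l = good_pos[OF elim]
        have "norm (grad \<zeta> x) powr r = ((norm (grad \<zeta> x))\<^sup>2) powr (r / 2)"
          using powr_powr[of "norm (grad \<zeta> x)" 2 "r / 2"] by simp
        also have "(norm (grad \<zeta> x))\<^sup>2 = (lam x * (norm (grad \<zeta> x))\<^sup>2) * (1 / lam x)" using l by simp
        also have "\<dots> powr (r / 2) = (lam x * (norm (grad \<zeta> x))\<^sup>2) powr (r / 2) * (1 / lam x) powr (r / 2)"
          by (rule powr_mult)
        also have "\<dots> \<le> ?F x powr (r / 2) * (1 / lam x) powr (r / 2)"
          using good_lower[OF elim, of "grad \<zeta> x"] l r2 by (intro mult_right_mono powr_mono2) auto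
        also have "(1 / lam x) powr (r / 2) = ?G x powr (1 - r / 2)"
          using x by (simp add: powr_powr e)
        finally show ?thesis by (rule ennreal_leI)
      qed
    qed
  qed
  also have "\<dots> \<le> ennreal (E powr (r / 2) * S powr (1 - r / 2))"
  proof (rule nn_integral_Holder[OF _ _ _ _ r2 _ S(1) E(2) S(2)])
    have "(\<integral>\<^sup>+x. ennreal (?F x) \<partial>lebesgue) = (\<integral>\<^sup>+x. ennreal (Q x (grad \<zeta> x)) \<partial>lebesgue)"
      by (intro nn_integral_cong) (simp add: max_def ennreal_neg)
    then show "(\<integral>\<^sup>+x. ennreal (?F x) \<partial>lebesgue) \<le> ennreal E" using E(1) by simp
  next
    have [measurable]: "ball y R \<in> sets lebesgue" by simp
    show "?F \<in> borel_measurable lebesgue" "?G \<in> borel_measurable lebesgue" by measurable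
  qed simp_all
  finally show ?thesis .
qed

text \<open>Sobolev's inequality is known for test functions and reaches w by Fatou's lemma. Since
  the volume of the ball is a multiple of R^d, the powers of V and R combine to a single factor V
  and to R^2 beside the energy: the estimate is scale invariant.\<close>

lemma sobolev_weighted:
  fixes y :: "real^'n" and R :: real
  defines "d \<equiv> real CARD('n)" and "V \<equiv> measure lborel (ball y R)" and "\<omega> \<equiv> measure lborel (ball (0::real^'n) 1)"
  assumes sob: "\<And>\<phi> A. 0 \<le> A \<Longrightarrow> \<phi> \<in> test_functions (ball y R) \<Longrightarrow>
    (\<integral>\<^sup>+x. ennreal (norm (grad \<phi> x) powr r) \<partial>lborel) \<le> ennreal A \<Longrightarrow>
    (\<integral>\<^sup>+x. ennreal (\<bar>\<phi> x\<bar> powr t) \<partial>lborel) \<le> ennreal (C * R powr (t - d * t / r + d) * A powr (t / r))"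
    and C: "0 < C" and q: "1 < q" and r: "r = 2 * q / (q + 1)" and t: "r < t" and R: "0 < R"
    and ap: "approximates (ball y R) \<zeta> w k"
    and E: "(\<integral>\<^sup>+x. ennreal (Q x (k x)) \<partial>lebesgue) \<le> ennreal (V * E)" "0 \<le> E"
    and S: "(\<integral>\<^sup>+x. ennreal (indicator (ball y R) x * (1 / lam x) powr q) \<partial>lebesgue) \<le> ennreal (V * Aq powr q)" "0 \<le> Aq"
  shows "(\<integral>\<^sup>+x. ennreal (\<bar>w x\<bar> powr t) \<partial>lebesgue)
    \<le> ennreal (V * (C * \<omega> powr (t / r - 1)) * (R\<^sup>2 * (2 * E) * Aq) powr (t / 2))"
proof -
  have r1: "1 < r" "r < 2" using q by (simp_all add: r field_simps)
  have t0: "0 < t" using r1 t by simp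
  have \<omega>: "0 < \<omega>" unfolding \<omega>_def using content_ball_pos[of 1 "0::real^'n"] by simp
  have Vd: "V = R powr d * \<omega>" unfolding V_def d_def \<omega>_def using R by (intro measure_ball_scale) simp
  have V: "0 < V" unfolding Vd using R \<omega> by simp
  define S0 where "S0 = V * Aq powr q"
  have S0: "0 \<le> S0" using V by (simp add: S0_def)
  \<comment> \<open>The bound for approximants whose energy is at most 2VE + e; the 2 comes from
    splitting Q of a sum.\<close>
  define f where "f e = C * R powr (t - d * t / r + d) * ((2 * (V * E) + e) powr (r / 2) * S0 powr (1 - r / 2)) powr (t / r)" for e
  \<comment> \<open>The given approximants need not converge almost everywhere. Membership in the
    form domain provides others that do, with the same limit gradient up to a null set.\<close>
  obtain \<zeta>' k' where ap': "approximates (ball y R) \<zeta>' w k'" and AE': "AE x in lebesgue. (\<lambda>n. \<zeta>' n x) \<longlonglongrightarrow> w x"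
    using form_domain_imp_approximates[OF approximates_imp_form_domain[OF ap]] by blast
  have kk: "AE x in lebesgue. k' x = k x"
    using weak_grad_unique_on[OF approximates_imp_weak_grad[OF ap'] approximates_imp_weak_grad[OF ap] open_UNIV] by simp
  note D = approximatesD[OF ap']
  have m: "\<zeta>' n \<in> borel_measurable lebesgue" "grad (\<zeta>' n) \<in> borel_measurable lebesgue" for n
    using test_functions_measurable_lebesgue[OF D(1)] by blast+
  note [measurable] = m D(4)
  have Ek: "(\<integral>\<^sup>+x. ennreal (Q x (k' x)) \<partial>lebesgue) \<le> ennreal (V * E)"
  proof -
    have "(\<integral>\<^sup>+x. ennreal (Q x (k' x)) \<partial>lebesgue) = (\<integral>\<^sup>+x. ennreal (Q x (k x)) \<partial>lebesgue)"
      by (rule nn_integral_cong_AE) (use kk in eventually_elim, simp)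
    then show ?thesis using E(1) by simp
  qed
  have bound: "(\<integral>\<^sup>+x. ennreal (\<bar>w x\<bar> powr t) \<partial>lebesgue) \<le> ennreal (f e)" if e: "0 < e" for e
  proof (rule nn_integral_limit_le[where f="\<lambda>n x. ennreal (\<bar>\<zeta>' n x\<bar> powr t)"])
    show "(\<lambda>x. ennreal (\<bar>\<zeta>' n x\<bar> powr t)) \<in> borel_measurable lebesgue" for n by measurable
    show "AE x in lebesgue. (\<lambda>n. ennreal (\<bar>\<zeta>' n x\<bar> powr t)) \<longlonglongrightarrow> ennreal (\<bar>w x\<bar> powr t)"
      using AE'
    proof eventually_elim
      case (elim x)
      show ?case
        by (intro tendsto_ennrealI tendsto_powr' tendsto_rabs elim tendsto_const) (use t0 in simp)
    qed
    have "\<forall>\<^sub>F n in sequentially. (\<integral>\<^sup>+x. ennreal (Q x (grad (\<zeta>' n) x - k' x)) \<partial>lebesgue) < ennreal (e / 2)"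
      using D(6) by (rule order_tendstoD) (use e in simp)
    then show "\<forall>\<^sub>F n in sequentially. (\<integral>\<^sup>+x. ennreal (\<bar>\<zeta>' n x\<bar> powr t) \<partial>lebesgue) \<le> ennreal (f e)"
    proof eventually_elim
      case (elim n)
      have "(\<integral>\<^sup>+x. ennreal (Q x (grad (\<zeta>' n) x)) \<partial>lebesgue) = (\<integral>\<^sup>+x. ennreal (Q x (k' x + (grad (\<zeta>' n) x - k' x))) \<partial>lebesgue)"
        by simp
      also have "\<dots> \<le> 2 * (\<integral>\<^sup>+x. ennreal (Q x (k' x)) \<partial>lebesgue) + 2 * (\<integral>\<^sup>+x. ennreal (Q x (grad (\<zeta>' n) x - k' x)) \<partial>lebesgue)"
        by (rule nn_integral_Q_add_le) measurable
      also have "\<dots> \<le> 2 * ennreal (V * E) + 2 * ennreal (e / 2)"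
        using elim by (intro add_mono mult_left_mono Ek) auto
      also have "\<dots> = ennreal (2 * (V * E) + 2 * (e / 2))"
        using ennreal_lincomb[of 2 "V * E" 2 "e / 2"] V E(2) e by simp
      also have "2 * (e / 2) = e" by simp
      finally have en: "(\<integral>\<^sup>+x. ennreal (Q x (grad (\<zeta>' n) x)) \<partial>lebesgue) \<le> ennreal (2 * (V * E) + e)" .
      have nn: "0 \<le> 2 * (V * E) + e" using V E(2) e by simp
      have "(\<integral>\<^sup>+x. ennreal (\<bar>\<zeta>' n x\<bar> powr t) \<partial>lborel) \<le> ennreal (f e)"
        unfolding f_def
        by (rule sob[OF _ D(1) nn_integral_grad_powr_le[OF q r D(1) en nn S(1)[folded S0_def] S0]]) simp
      then show ?case by (simp only: nn_integral_completion)
    qed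
  qed
  \<comment> \<open>The error e is removed by continuity of f at 0, even if the energy bound E is
    0.\<close>
  have "(\<lambda>n. f (1 / real (Suc n))) \<longlonglongrightarrow> f 0"
    unfolding f_def
  proof (intro tendsto_mult tendsto_const tendsto_powr')
    show "(\<lambda>n. 2 * (V * E) + 1 / real (Suc n)) \<longlonglongrightarrow> 2 * (V * E) + 0"
      using LIMSEQ_inverse_real_of_nat by (intro tendsto_add tendsto_const) (simp add: inverse_eq_divide)
  qed (use r1 t0 V E(2) in \<open>auto intro!: always_eventually\<close>)
  then have "(\<lambda>n. ennreal (f (1 / real (Suc n)))) \<longlonglongrightarrow> ennreal (f 0)" by (rule tendsto_ennrealI)
  then have "(\<integral>\<^sup>+x. ennreal (\<bar>w x\<bar> powr t) \<partial>lebesgue) \<le> ennreal (f 0)"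
    by (rule LIMSEQ_le_const) (intro exI allI impI bound, simp)
  also have "f 0 = V * (C * \<omega> powr (t / r - 1)) * (R\<^sup>2 * (2 * E) * Aq) powr (t / 2)"
  proof -
    have a1: "r / 2 * (t / r) = t / 2" using r1 by simp
    have a2: "(1 - r / 2) * (t / r) = t / r - t / 2" using r1 by (simp add: field_simps)
    have a3: "q * (t / r - t / 2) = t / 2" using q by (simp add: r field_simps)
    have x1: "((2 * (V * E) + 0) powr (r / 2) * S0 powr (1 - r / 2)) powr (t / r) = (2 * (V * E)) powr (t / 2) * S0 powr (t / r - t / 2)"
      by (simp only: add_0_right powr_mult powr_ge_zero powr_powr a1 a2)
    have x2: "(2 * (V * E)) powr (t / 2) = V powr (t / 2) * (2 * E) powr (t / 2)"
      using V E(2) by (simp add: powr_mult)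
    have x3: "S0 powr (t / r - t / 2) = V powr (t / r - t / 2) * Aq powr (t / 2)"
      unfolding S0_def using V S(2) by (simp add: powr_mult powr_powr a3)
    have x4: "V powr (t / 2) * V powr (t / r - t / 2) = V * V powr (t / r - 1)"
    proof -
      have "V powr (t / 2) * V powr (t / r - t / 2) = V powr (1 + (t / r - 1))"
        by (simp add: powr_add[symmetric])
      also have "\<dots> = V powr 1 * V powr (t / r - 1)" by (rule powr_add)
      finally show ?thesis using V by simp
    qed
    have x5: "V powr (t / r - 1) = R powr (d * (t / r - 1)) * \<omega> powr (t / r - 1)"
      unfolding Vd using R \<omega> by (simp add: powr_mult powr_powr)
    have x6: "R powr (t - d * t / r + d) * R powr (d * (t / r - 1)) = (R\<^sup>2) powr (t / 2)"
    proof -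
      have "R powr (t - d * t / r + d) * R powr (d * (t / r - 1)) = R powr (t - d * t / r + d + d * (t / r - 1))"
        by (rule powr_add[symmetric])
      also have "t - d * t / r + d + d * (t / r - 1) = 2 * (t / 2)" by (simp add: right_diff_distrib)
      also have "R powr (2 * (t / 2)) = (R\<^sup>2) powr (t / 2)"
        using R powr_powr[of R 2 "t / 2"] by (simp add: powr_realpow)
      finally show ?thesis .
    qed
    have x7: "(R\<^sup>2 * (2 * E) * Aq) powr (t / 2) = (R\<^sup>2) powr (t / 2) * (2 * E) powr (t / 2) * Aq powr (t / 2)"
      using E(2) S(2) by (simp add: powr_mult)
    have "f 0 = C * (R powr (t - d * t / r + d) * (V powr (t / 2) * V powr (t / r - t / 2))) * (2 * E) powr (t / 2) * Aq powr (t / 2)"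
      unfolding f_def x1 x2 x3 by (simp only: mult_ac)
    also have "\<dots> = C * V * \<omega> powr (t / r - 1) * (R powr (t - d * t / r + d) * R powr (d * (t / r - 1))) * (2 * E) powr (t / 2) * Aq powr (t / 2)"
      unfolding x4 x5 by (simp only: mult_ac)
    also have "\<dots> = V * (C * \<omega> powr (t / r - 1)) * (R\<^sup>2 * (2 * E) * Aq) powr (t / 2)"
      unfolding x6 x7 by (simp only: mult_ac)
    finally show ?thesis .
  qed
  finally show ?thesis .
qed

end

context tested_solution
begin

text \<open>Hoelder's inequality with the exponents p and p/(p - 1). All integrals are measured
  against the volume V of the full ball, also those over a smaller set B, so that no ratios of
  volumes accumulate in the iteration.\<close>

lemma Lam_Holder:
  fixes w :: "real^'n \<Rightarrow> real"
  assumes p: "1 < p" and wm: "w \<in> borel_measurable lebesgue" and w0: "\<And>x. 0 \<le> w x"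
    and B: "B \<subseteq> ball y R" "B \<in> sets lebesgue" and V: "0 \<le> V"
    and Ap: "(\<integral>\<^sup>+x. ennreal (indicator (ball y R) x * Lam x powr p) \<partial>lebesgue) \<le> ennreal (V * Ap powr p)" "0 \<le> Ap"
    and X: "(\<integral>\<^sup>+x. ennreal (indicator B x * w x powr (b * (p / (p - 1)))) \<partial>lebesgue) \<le> ennreal (V * X powr (b * (p / (p - 1))))" "0 \<le> X"
  shows "(\<integral>\<^sup>+x. ennreal (indicator B x * (Lam x * w x powr b)) \<partial>lebesgue) \<le> ennreal (V * (Ap * X powr b))"
proof -
  note [measurable] = wm B(2) Lam_measurable
  have p1: "0 < 1 / p" "1 / p < 1" using p by simp_all
  have e: "p / (p - 1) * (1 - 1 / p) = 1" using p by (simp add: field_simps)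
  have e': "b * (p / (p - 1)) * (1 - 1 / p) = b" by (simp only: mult.assoc e mult_1_right)
  have "(\<integral>\<^sup>+x. ennreal (indicator B x * (Lam x * w x powr b)) \<partial>lebesgue)
    \<le> (\<integral>\<^sup>+x. ennreal ((indicator (ball y R) x * Lam x powr p) powr (1 / p)
        * (indicator B x * w x powr (b * (p / (p - 1)))) powr (1 - 1 / p)) \<partial>lebesgue)"
  proof (intro nn_integral_mono ennreal_leI)
    fix x
    show "indicator B x * (Lam x * w x powr b) \<le> (indicator (ball y R) x * Lam x powr p) powr (1 / p)
        * (indicator B x * w x powr (b * (p / (p - 1)))) powr (1 - 1 / p)"
    proof (cases "x \<in> B")
      case True
      then have "x \<in> ball y R" using B(1) by blast
      then show ?thesis using True p Lam_nonneg[of x] by (simp only: indicator_simps mult_1_left powr_powr e') simp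
    qed simp
  qed
  also have "\<dots> \<le> ennreal ((V * Ap powr p) powr (1 / p) * (V * X powr (b * (p / (p - 1)))) powr (1 - 1 / p))"
  proof (rule nn_integral_Holder[OF _ _ _ _ p1 Ap(1) X(1)])
    have [measurable]: "ball y R \<in> sets lebesgue" by simp
    show "(\<lambda>x. indicator (ball y R) x * Lam x powr p) \<in> borel_measurable lebesgue" by measurable
    show "(\<lambda>x. indicator B x * w x powr (b * (p / (p - 1)))) \<in> borel_measurable lebesgue" by measurable
  qed (use V in simp_all)
  also have "(V * Ap powr p) powr (1 / p) * (V * X powr (b * (p / (p - 1)))) powr (1 - 1 / p) = V * (Ap * X powr b)"
  proof -
    have 1: "(V * Ap powr p) powr (1 / p) = V powr (1 / p) * Ap"
      using V Ap(2) p by (simp add: powr_mult powr_powr)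
    have 2: "(V * X powr (b * (p / (p - 1)))) powr (1 - 1 / p) = V powr (1 - 1 / p) * X powr b"
      using V by (simp only: powr_mult powr_ge_zero powr_powr e')
    have 3: "V powr (1 / p) * V powr (1 - 1 / p) = V"
      using V powr_add[of V "1 / p" "1 - 1 / p"] by simp
    have "V powr (1 / p) * Ap * (V powr (1 - 1 / p) * X powr b) = (V powr (1 / p) * V powr (1 - 1 / p)) * (Ap * X powr b)"
      by (simp only: mult_ac)
    then show ?thesis unfolding 1 2 3 .
  qed
  finally show ?thesis .
qed

text \<open>The reverse Hoelder inequality: exponent \<alpha> t on the smaller ball against
  2\<alpha> p/(p - 1) on the larger one. The Caccioppoli inequality bounds the energy of \<eta>
  H(v), the weighted Sobolev inequality its t-th moment. The power 2\<alpha> - 2 of X comes from the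
  datum, the power 2\<alpha> from the cutoff.\<close>

lemma moser_step:
  fixes \<alpha> t p q r C Ce c \<sigma> \<sigma>' X Ap Aq :: real
  defines "d \<equiv> real CARD('n)" and "V \<equiv> measure lborel (ball y R)" and "\<omega> \<equiv> measure lborel (ball (0::real^'n) 1)"
    and "w \<equiv> \<lambda>x. max (v x) 0"
  defines "K \<equiv> 44 * (c\<^sup>2 + Ce\<^sup>2) * (C * \<omega> powr (t / r - 1)) powr (2 / t)"
  assumes sob: "\<And>\<phi> A. 0 \<le> A \<Longrightarrow> \<phi> \<in> test_functions (ball y R) \<Longrightarrow>
    (\<integral>\<^sup>+x. ennreal (norm (grad \<phi> x) powr r) \<partial>lborel) \<le> ennreal A \<Longrightarrow>
    (\<integral>\<^sup>+x. ennreal (\<bar>\<phi> x\<bar> powr t) \<partial>lborel) \<le> ennreal (C * R powr (t - d * t / r + d) * A powr (t / r))"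
    and C: "0 < C" and q: "1 < q" and r: "r = 2 * q / (q + 1)" and t: "r < t" and p: "1 < p"
    and cut: "\<And>(x0::real^'n) s t. 0 < s \<Longrightarrow> s < t \<Longrightarrow> \<exists>\<eta>\<in>test_functions (ball x0 t).
       (\<forall>x. 0 \<le> \<eta> x \<and> \<eta> x \<le> 1 \<and> norm (grad \<eta> x) \<le> Ce / (t - s)) \<and> (\<forall>x\<in>ball x0 s. \<eta> x = 1)"
    and Ce: "0 < Ce"
    and \<sigma>: "0 < \<sigma>'" "\<sigma>' < \<sigma>" "\<sigma> \<le> 1" and \<alpha>: "1 < \<alpha>" and L: "L = c / R"
    and Ap: "(\<integral>\<^sup>+x. ennreal (indicator (ball y R) x * Lam x powr p) \<partial>lebesgue) \<le> ennreal (V * Ap powr p)" "0 \<le> Ap"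
    and Aq: "(\<integral>\<^sup>+x. ennreal (indicator (ball y R) x * (1 / lam x) powr q) \<partial>lebesgue) \<le> ennreal (V * Aq powr q)" "0 \<le> Aq"
    and X: "(\<integral>\<^sup>+x. ennreal (indicator (ball y (\<sigma> * R)) x * w x powr (2 * \<alpha> * (p / (p - 1)))) \<partial>lebesgue)
      \<le> ennreal (V * X powr (2 * \<alpha> * (p / (p - 1))))" "0 \<le> X"
  shows "(\<integral>\<^sup>+x. ennreal (indicator (ball y (\<sigma>' * R)) x * w x powr (\<alpha> * t)) \<partial>lebesgue)
    \<le> ennreal (V * (K * \<alpha>\<^sup>2 * (Ap * Aq) / (\<sigma> - \<sigma>')\<^sup>2 * max (X powr (2 * \<alpha> - 2)) (X powr (2 * \<alpha>))) powr (t / 2))"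
proof -
  have r1: "1 < r" using q by (simp add: r field_simps)
  have t0: "0 < t" using r1 t by simp
  have V: "0 < V" unfolding V_def using content_ball_pos[OF R_pos, of y] by simp
  have wm: "w \<in> borel_measurable lebesgue" unfolding w_def using v_measurable by measurable
  have w0: "0 \<le> w x" for x by (simp add: w_def)
  let ?B = "ball y (\<sigma> * R)"
  have Bsub: "?B \<subseteq> ball y R" using \<sigma> R_pos by (intro subset_ball) simp
  have Bm: "?B \<in> sets lebesgue" by simp
  note [measurable] = wm Bm Lam_measurable
  define ps where "ps = p / (p - 1)"
  have ps: "0 < ps" using p by (simp add: ps_def)
  have I2: "(\<integral>\<^sup>+x. ennreal (indicator ?B x * (Lam x * w x powr (2 * \<alpha>))) \<partial>lebesgue) \<le> ennreal (V * (Ap * X powr (2 * \<alpha>)))"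
    by (rule Lam_Holder[OF p wm w0 Bsub Bm less_imp_le[OF V] Ap X])
  \<comment> \<open>The lower power due to the datum is reduced to the given moment by Hoelder's
    inequality against the constant 1.\<close>
  have I1': "(\<integral>\<^sup>+x. ennreal (indicator ?B x * w x powr ((2 * \<alpha> - 2) * ps)) \<partial>lebesgue) \<le> ennreal (V * X powr ((2 * \<alpha> - 2) * ps))"
  proof -
    define \<theta> where "\<theta> = (\<alpha> - 1) / \<alpha>"
    have \<theta>: "0 < \<theta>" "\<theta> < 1" using \<alpha> by (simp_all add: \<theta>_def)
    have e: "2 * \<alpha> * ps * \<theta> = (2 * \<alpha> - 2) * ps" using \<alpha> by (simp add: \<theta>_def field_simps)
    have "(\<integral>\<^sup>+x. ennreal (indicator ?B x * w x powr ((2 * \<alpha> - 2) * ps)) \<partial>lebesgue)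
      = (\<integral>\<^sup>+x. ennreal ((indicator ?B x * w x powr (2 * \<alpha> * ps)) powr \<theta> * indicator ?B x powr (1 - \<theta>)) \<partial>lebesgue)"
    proof (rule nn_integral_cong)
      fix x
      show "ennreal (indicator ?B x * w x powr ((2 * \<alpha> - 2) * ps))
        = ennreal ((indicator ?B x * w x powr (2 * \<alpha> * ps)) powr \<theta> * indicator ?B x powr (1 - \<theta>))"
        using \<theta> by (cases "x \<in> ?B") (simp_all only: indicator_simps mult_1_left powr_powr e, simp_all)
    qed
    also have "\<dots> \<le> ennreal ((V * X powr (2 * \<alpha> * ps)) powr \<theta> * V powr (1 - \<theta>))"
    proof (rule nn_integral_Holder[OF _ _ _ _ \<theta> X(1)[folded ps_def]])
      have "(\<integral>\<^sup>+x. ennreal (indicator ?B x) \<partial>lebesgue) = emeasure lebesgue ?B"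
        by (simp add: ennreal_indicator)
      also have "\<dots> \<le> emeasure lebesgue (ball y R)" by (rule emeasure_mono[OF Bsub]) simp
      also have "\<dots> = ennreal V"
        unfolding V_def using emeasure_lborel_ball_finite[of y R] by (simp add: emeasure_eq_ennreal_measure)
      finally show "(\<integral>\<^sup>+x. ennreal (indicator ?B x) \<partial>lebesgue) \<le> ennreal V" .
      show "(\<lambda>x. indicator ?B x * w x powr (2 * \<alpha> * ps)) \<in> borel_measurable lebesgue" by measurable
      show "(indicator ?B :: real^'n \<Rightarrow> real) \<in> borel_measurable lebesgue" by measurable
    qed (use V in simp_all)
    also have "(V * X powr (2 * \<alpha> * ps)) powr \<theta> * V powr (1 - \<theta>) = V * X powr ((2 * \<alpha> - 2) * ps)"
    proof -
      have 1: "(V * X powr (2 * \<alpha> * ps)) powr \<theta> = V powr \<theta> * X powr ((2 * \<alpha> - 2) * ps)"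
        by (simp only: powr_mult powr_powr e)
      have 2: "V powr \<theta> * V powr (1 - \<theta>) = V"
        using V powr_add[of V \<theta> "1 - \<theta>"] by simp
      have "V powr \<theta> * X powr ((2 * \<alpha> - 2) * ps) * V powr (1 - \<theta>) = (V powr \<theta> * V powr (1 - \<theta>)) * X powr ((2 * \<alpha> - 2) * ps)"
        by (simp only: mult_ac)
      then show ?thesis unfolding 1 2 .
    qed
    finally show ?thesis .
  qed
  have I1: "(\<integral>\<^sup>+x. ennreal (indicator ?B x * (Lam x * w x powr (2 * \<alpha> - 2))) \<partial>lebesgue) \<le> ennreal (V * (Ap * X powr (2 * \<alpha> - 2)))"
    by (rule Lam_Holder[OF p wm w0 Bsub Bm less_imp_le[OF V] Ap I1'[unfolded ps_def] X(2)])
  have sR: "0 < \<sigma>' * R" "\<sigma>' * R < \<sigma> * R" using \<sigma> R_pos by simp_all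
  obtain \<eta> where \<eta>: "\<eta> \<in> test_functions ?B"
    and \<eta>1: "\<And>x. 0 \<le> \<eta> x" "\<And>x. \<eta> x \<le> 1" "\<And>x. norm (grad \<eta> x) \<le> Ce / (\<sigma> * R - \<sigma>' * R)"
    and \<eta>2: "\<And>x. x \<in> ball y (\<sigma>' * R) \<Longrightarrow> \<eta> x = 1"
    using cut[OF sR, of y] by blast
  have \<eta>': "\<eta> \<in> test_functions (ball y R)" by (rule test_functions_mono[OF Bsub \<eta>])
  obtain K0 where K0: "K0 \<subseteq> ?B" "\<And>x. x \<notin> K0 \<Longrightarrow> \<eta> x = 0" "\<And>x. x \<notin> K0 \<Longrightarrow> grad \<eta> x = 0"
    using test_functionsE[OF \<eta>] by metis
  note [measurable] = test_functions_measurable_lebesgue(1,2)[OF \<eta>]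
  define M where "M = max (X powr (2 * \<alpha> - 2)) (X powr (2 * \<alpha>))"
  have M0: "0 \<le> M" by (simp add: M_def le_max_iff_disj)
  define s where "s = \<sigma> - \<sigma>'"
  have s: "0 < s" "s \<le> 1" using \<sigma> by (simp_all add: s_def)
  define b where "b = 1 / (s * R)\<^sup>2"
  have b: "0 \<le> b" by (simp add: b_def)
  \<comment> \<open>Since L = c/R and \<sigma> - \<sigma>' \<le> 1, the datum scales no worse than
    the gradient of the cutoff, whose square is bounded by Ce^2 b.\<close>
  have Lb: "L\<^sup>2 \<le> c\<^sup>2 * b"
  proof -
    have "(s * R)\<^sup>2 \<le> R\<^sup>2" using s R_pos by (intro power_mono) (simp_all add: mult_left_le_one_le)
    then have "c\<^sup>2 / R\<^sup>2 \<le> c\<^sup>2 / (s * R)\<^sup>2" using s R_pos by (intro divide_left_mono) simp_all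
    then show ?thesis by (simp add: L b_def power_divide)
  qed
  have \<eta>b: "(norm (grad \<eta> x))\<^sup>2 \<le> Ce\<^sup>2 * b" for x
  proof -
    have "(norm (grad \<eta> x))\<^sup>2 \<le> (Ce / (\<sigma> * R - \<sigma>' * R))\<^sup>2" by (intro power_mono \<eta>1) simp
    also have "\<sigma> * R - \<sigma>' * R = s * R" by (simp add: s_def left_diff_distrib)
    finally show ?thesis by (simp add: b_def power_divide)
  qed
  define E where "E = 22 * \<alpha>\<^sup>2 * (Ap * (c\<^sup>2 * b * X powr (2 * \<alpha> - 2) + Ce\<^sup>2 * b * X powr (2 * \<alpha>)))"
  have E0: "0 \<le> E" unfolding E_def using Ap(2) b by (intro mult_nonneg_nonneg add_nonneg_nonneg) auto
  let ?D = "\<lambda>x. Lam x * (L\<^sup>2 * (\<eta> x)\<^sup>2 * w x powr (2 * \<alpha> - 2) + (norm (grad \<eta> x))\<^sup>2 * w x powr (2 * \<alpha>))"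
  have intD: "ennreal (22 * \<alpha>\<^sup>2) * (\<integral>\<^sup>+x. ennreal (?D x) \<partial>lebesgue) \<le> ennreal (V * E)"
  proof -
    let ?f = "\<lambda>x. indicator ?B x * (Lam x * w x powr (2 * \<alpha> - 2))"
    let ?g = "\<lambda>x. indicator ?B x * (Lam x * w x powr (2 * \<alpha>))"
    have fg: "0 \<le> ?f x" "0 \<le> ?g x" for x using Lam_nonneg by simp_all
    have cb: "0 \<le> c\<^sup>2 * b" "0 \<le> Ce\<^sup>2 * b" using b by simp_all
    have "(\<integral>\<^sup>+x. ennreal (?D x) \<partial>lebesgue) \<le> (\<integral>\<^sup>+x. ennreal (c\<^sup>2 * b) * ennreal (?f x) + ennreal (Ce\<^sup>2 * b) * ennreal (?g x) \<partial>lebesgue)"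
    proof (rule nn_integral_mono)
      fix x
      have "?D x \<le> c\<^sup>2 * b * ?f x + Ce\<^sup>2 * b * ?g x"
      proof (cases "x \<in> K0")
        case False
        then show ?thesis using K0(2,3)[OF False] fg[of x] cb by simp
      next
        case True
        then have xB: "x \<in> ?B" using K0(1) by blast
        have "L\<^sup>2 * (\<eta> x)\<^sup>2 \<le> c\<^sup>2 * b * 1"
          using Lb cb power_mono[OF \<eta>1(2)[of x] \<eta>1(1)[of x], of 2] by (intro mult_mono) auto
        then have "L\<^sup>2 * (\<eta> x)\<^sup>2 * w x powr (2 * \<alpha> - 2) \<le> c\<^sup>2 * b * 1 * w x powr (2 * \<alpha> - 2)"
          by (rule mult_right_mono) simp
        moreover have "(norm (grad \<eta> x))\<^sup>2 * w x powr (2 * \<alpha>) \<le> Ce\<^sup>2 * b * w x powr (2 * \<alpha>)"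
          by (rule mult_right_mono[OF \<eta>b]) simp
        ultimately have "?D x \<le> Lam x * (c\<^sup>2 * b * w x powr (2 * \<alpha> - 2) + Ce\<^sup>2 * b * w x powr (2 * \<alpha>))"
          by (intro mult_left_mono Lam_nonneg) linarith
        then show ?thesis using xB by (simp add: distrib_left mult_ac)
      qed
      then have "ennreal (?D x) \<le> ennreal (c\<^sup>2 * b * ?f x + Ce\<^sup>2 * b * ?g x)" by (rule ennreal_leI)
      then show "ennreal (?D x) \<le> ennreal (c\<^sup>2 * b) * ennreal (?f x) + ennreal (Ce\<^sup>2 * b) * ennreal (?g x)"
        unfolding ennreal_lincomb[OF cb(1) fg(1) cb(2) fg(2)] .
    qed
    also have "\<dots> = ennreal (c\<^sup>2 * b) * (\<integral>\<^sup>+x. ennreal (?f x) \<partial>lebesgue) + ennreal (Ce\<^sup>2 * b) * (\<integral>\<^sup>+x. ennreal (?g x) \<partial>lebesgue)"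
    proof -
      have [measurable]: "?f \<in> borel_measurable lebesgue" "?g \<in> borel_measurable lebesgue" by measurable
      have "(\<integral>\<^sup>+x. ennreal (c\<^sup>2 * b) * ennreal (?f x) + ennreal (Ce\<^sup>2 * b) * ennreal (?g x) \<partial>lebesgue)
        = (\<integral>\<^sup>+x. ennreal (c\<^sup>2 * b) * ennreal (?f x) \<partial>lebesgue) + (\<integral>\<^sup>+x. ennreal (Ce\<^sup>2 * b) * ennreal (?g x) \<partial>lebesgue)"
        by (rule nn_integral_add) measurable
      also have "(\<integral>\<^sup>+x. ennreal (c\<^sup>2 * b) * ennreal (?f x) \<partial>lebesgue) = ennreal (c\<^sup>2 * b) * (\<integral>\<^sup>+x. ennreal (?f x) \<partial>lebesgue)"
        by (rule nn_integral_cmult) measurable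
      also have "(\<integral>\<^sup>+x. ennreal (Ce\<^sup>2 * b) * ennreal (?g x) \<partial>lebesgue) = ennreal (Ce\<^sup>2 * b) * (\<integral>\<^sup>+x. ennreal (?g x) \<partial>lebesgue)"
        by (rule nn_integral_cmult) measurable
      finally show ?thesis .
    qed
    also have "\<dots> \<le> ennreal (c\<^sup>2 * b) * ennreal (V * (Ap * X powr (2 * \<alpha> - 2))) + ennreal (Ce\<^sup>2 * b) * ennreal (V * (Ap * X powr (2 * \<alpha>)))"
      by (intro add_mono mult_left_mono I1 I2) auto
    also have "\<dots> = ennreal (c\<^sup>2 * b * (V * (Ap * X powr (2 * \<alpha> - 2))) + Ce\<^sup>2 * b * (V * (Ap * X powr (2 * \<alpha>))))"
      using V Ap(2) by (intro ennreal_lincomb cb) simp_all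
    finally have "ennreal (22 * \<alpha>\<^sup>2) * (\<integral>\<^sup>+x. ennreal (?D x) \<partial>lebesgue)
      \<le> ennreal (22 * \<alpha>\<^sup>2) * ennreal (c\<^sup>2 * b * (V * (Ap * X powr (2 * \<alpha> - 2))) + Ce\<^sup>2 * b * (V * (Ap * X powr (2 * \<alpha>))))"
      by (rule mult_left_mono) simp
    also have "\<dots> = ennreal (22 * \<alpha>\<^sup>2 * (c\<^sup>2 * b * (V * (Ap * X powr (2 * \<alpha> - 2))) + Ce\<^sup>2 * b * (V * (Ap * X powr (2 * \<alpha>)))))"
      using V Ap(2) b by (intro ennreal_mult[symmetric] add_nonneg_nonneg mult_nonneg_nonneg) auto
    also have "22 * \<alpha>\<^sup>2 * (c\<^sup>2 * b * (V * (Ap * X powr (2 * \<alpha> - 2))) + Ce\<^sup>2 * b * (V * (Ap * X powr (2 * \<alpha>)))) = V * E"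
      unfolding E_def distrib_left by (simp only: mult_ac)
    finally show ?thesis .
  qed
  define C2 where "C2 = C * \<omega> powr (t / r - 1)"
  have \<omega>: "0 < \<omega>" unfolding \<omega>_def using content_ball_pos[of 1 "0::real^'n"] by simp
  have C2: "0 < C2" using C \<omega> by (simp add: C2_def)
  define Bd where "Bd = V * C2 * (R\<^sup>2 * (2 * E) * Aq) powr (t / 2)"
  have step: "(\<integral>\<^sup>+x. ennreal (\<bar>\<eta> x * trunc_pow \<epsilon> \<alpha> \<alpha> (v x)\<bar> powr t) \<partial>lebesgue) \<le> ennreal Bd"
    if \<epsilon>: "0 < \<epsilon>" "\<epsilon> \<le> 1" for \<epsilon>
  proof -
    have am: "\<alpha> \<le> 2 * \<alpha> - 1" using \<alpha> by simp
    let ?k = "\<lambda>x. (\<eta> x * trunc_pow' \<epsilon> \<alpha> \<alpha> (v x)) *\<^sub>R g x + trunc_pow \<epsilon> \<alpha> \<alpha> (v x) *\<^sub>R grad \<eta> x"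
    obtain \<zeta> where \<zeta>: "approximates (ball y R) \<zeta> (\<lambda>x. \<eta> x * trunc_pow \<epsilon> \<alpha> \<alpha> (v x)) ?k"
      using approximates_mult_compose[OF approx approx_AE \<eta>' trunc_pow_derivative[OF \<alpha> \<epsilon>(1) \<alpha>]
          trunc_pow'_continuous[OF \<alpha> \<epsilon>(1) \<alpha>] trunc_pow_bounds(3)[OF \<alpha> \<epsilon> \<alpha> am] trunc_pow_bounds(5)[OF \<alpha> \<epsilon> \<alpha> am]]
      by blast
    have "(\<integral>\<^sup>+x. ennreal (Q x (?k x)) \<partial>lebesgue) \<le> ennreal (22 * \<alpha>\<^sup>2) * (\<integral>\<^sup>+x. ennreal (?D x) \<partial>lebesgue)"
      unfolding w_def by (rule Caccioppoli[OF \<alpha> \<epsilon> \<eta>' \<eta>1(1)])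
    also have "\<dots> \<le> ennreal (V * E)" by (rule intD)
    finally have QE: "(\<integral>\<^sup>+x. ennreal (Q x (?k x)) \<partial>lebesgue) \<le> ennreal (V * E)" .
    show ?thesis
      unfolding Bd_def C2_def V_def \<omega>_def
      by (rule sobolev_weighted[OF sob[unfolded d_def] C q r t R_pos \<zeta> QE[unfolded V_def] E0 Aq(1)[unfolded V_def] Aq(2)])
  qed
  have hm: "(\<lambda>x. trunc_pow e \<alpha> \<alpha> (v x)) \<in> borel_measurable lebesgue" for e
    unfolding trunc_pow_def using v_measurable by measurable
  note [measurable] = hm
  \<comment> \<open>The bound does not contain \<epsilon>, so \<epsilon> = 1/(n + 1) tends to 0 and
    Fatou's lemma removes the truncation.\<close>
  have "(\<integral>\<^sup>+x. ennreal (\<bar>\<eta> x * w x powr \<alpha>\<bar> powr t) \<partial>lebesgue) \<le> ennreal Bd"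
  proof (rule nn_integral_limit_le[where f="\<lambda>n x. ennreal (\<bar>\<eta> x * trunc_pow (1 / real (Suc n)) \<alpha> \<alpha> (v x)\<bar> powr t)"])
    show "\<forall>\<^sub>F n in sequentially. (\<integral>\<^sup>+x. ennreal (\<bar>\<eta> x * trunc_pow (1 / real (Suc n)) \<alpha> \<alpha> (v x)\<bar> powr t) \<partial>lebesgue) \<le> ennreal Bd"
      by (intro always_eventually allI step) simp_all
    show "AE x in lebesgue. (\<lambda>n. ennreal (\<bar>\<eta> x * trunc_pow (1 / real (Suc n)) \<alpha> \<alpha> (v x)\<bar> powr t)) \<longlonglongrightarrow> ennreal (\<bar>\<eta> x * w x powr \<alpha>\<bar> powr t)"
    proof (rule AE_I2)
      fix x
      have z: "(\<lambda>n. 1 / real (Suc n)) \<longlonglongrightarrow> 0"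
        using LIMSEQ_inverse_real_of_nat by (simp add: inverse_eq_divide)
      have "(\<lambda>n. w x powr \<alpha> / (1 + 1 / real (Suc n) * w x powr (2 * \<alpha> - 1))) \<longlonglongrightarrow> w x powr \<alpha> / (1 + 0 * w x powr (2 * \<alpha> - 1))"
        by (intro tendsto_divide tendsto_add tendsto_mult tendsto_const z) simp
      then have "(\<lambda>n. trunc_pow (1 / real (Suc n)) \<alpha> \<alpha> (v x)) \<longlonglongrightarrow> w x powr \<alpha>"
        by (simp add: trunc_pow_def w_def)
      then show "(\<lambda>n. ennreal (\<bar>\<eta> x * trunc_pow (1 / real (Suc n)) \<alpha> \<alpha> (v x)\<bar> powr t)) \<longlonglongrightarrow> ennreal (\<bar>\<eta> x * w x powr \<alpha>\<bar> powr t)"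
        by (intro tendsto_ennrealI tendsto_powr' tendsto_rabs tendsto_mult tendsto_const) (use t0 in simp_all)
    qed
  qed measurable
  moreover have "(\<integral>\<^sup>+x. ennreal (indicator (ball y (\<sigma>' * R)) x * w x powr (\<alpha> * t)) \<partial>lebesgue)
    \<le> (\<integral>\<^sup>+x. ennreal (\<bar>\<eta> x * w x powr \<alpha>\<bar> powr t) \<partial>lebesgue)"
  proof (intro nn_integral_mono ennreal_leI)
    fix x
    show "indicator (ball y (\<sigma>' * R)) x * w x powr (\<alpha> * t) \<le> \<bar>\<eta> x * w x powr \<alpha>\<bar> powr t"
    proof (cases "x \<in> ball y (\<sigma>' * R)")
      case True
      then show ?thesis using \<eta>2[OF True] by (simp add: powr_powr)
    qed simp
  qed
  moreover have "Bd \<le> V * (K * \<alpha>\<^sup>2 * (Ap * Aq) / (\<sigma> - \<sigma>')\<^sup>2 * M) powr (t / 2)"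
  proof -
    define Y where "Y = 44 * (c\<^sup>2 + Ce\<^sup>2) * \<alpha>\<^sup>2 * (Ap * Aq) / s\<^sup>2 * M"
    have Y0: "0 \<le> Y" unfolding Y_def using Ap(2) Aq(2) M0 by simp
    have Rb: "R\<^sup>2 * b = 1 / s\<^sup>2" using R_pos s by (simp add: b_def power_mult_distrib)
    have "c\<^sup>2 * b * X powr (2 * \<alpha> - 2) + Ce\<^sup>2 * b * X powr (2 * \<alpha>) \<le> c\<^sup>2 * b * M + Ce\<^sup>2 * b * M"
      using b by (intro add_mono mult_left_mono) (simp_all add: M_def)
    then have "22 * \<alpha>\<^sup>2 * (Ap * (c\<^sup>2 * b * X powr (2 * \<alpha> - 2) + Ce\<^sup>2 * b * X powr (2 * \<alpha>))) \<le> 22 * \<alpha>\<^sup>2 * (Ap * (c\<^sup>2 * b * M + Ce\<^sup>2 * b * M))"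
      using Ap(2) by (intro mult_left_mono) auto
    then have "E \<le> 22 * \<alpha>\<^sup>2 * (Ap * (c\<^sup>2 * b * M + Ce\<^sup>2 * b * M))" unfolding E_def .
    then have "R\<^sup>2 * (2 * E) * Aq \<le> R\<^sup>2 * (2 * (22 * \<alpha>\<^sup>2 * (Ap * (c\<^sup>2 * b * M + Ce\<^sup>2 * b * M)))) * Aq"
      using Aq(2) by (intro mult_right_mono mult_left_mono) auto
    also have "\<dots> = 44 * (c\<^sup>2 + Ce\<^sup>2) * \<alpha>\<^sup>2 * (Ap * Aq) * (R\<^sup>2 * b) * M" by (simp add: algebra_simps)
    also have "\<dots> = Y" unfolding Rb Y_def by simp
    finally have le: "R\<^sup>2 * (2 * E) * Aq \<le> Y" .
    have "Bd \<le> V * C2 * Y powr (t / 2)"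
      unfolding Bd_def using V C2 t0 E0 Aq(2) by (intro mult_left_mono powr_mono2 le) auto
    \<comment> \<open>The Sobolev constant moves inside the power t/2; hence the exponent 2/t in
      K.\<close>
    also have "C2 = (C2 powr (2 / t)) powr (t / 2)" using C2 t0 by (simp add: powr_powr)
    also have "V * (C2 powr (2 / t)) powr (t / 2) * Y powr (t / 2) = V * (C2 powr (2 / t) * Y) powr (t / 2)"
      using Y0 by (simp add: powr_mult)
    also have "C2 powr (2 / t) * Y = K * \<alpha>\<^sup>2 * (Ap * Aq) / (\<sigma> - \<sigma>')\<^sup>2 * M"
      unfolding K_def Y_def C2_def s_def by simp
    finally show ?thesis .
  qed
  ultimately show ?thesis
    unfolding M_def by (meson ennreal_leI order_trans)
qed

end

section \<open>Iteration\<close>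

text \<open>Below 1 the smaller exponent gives the larger power, above 1 the exponent 1 does. This
  is the origin of the maximum in the final estimate.\<close>

lemma powr_le_max:
  assumes "0 \<le> (X::real)" "\<gamma> \<le> e" "e \<le> 1"
  shows "X powr e \<le> max (X powr \<gamma>) X"
proof (cases "X \<le> 1")
  case True
  show ?thesis
  proof (cases "X = 0")
    case False
    then have "X powr e \<le> X powr \<gamma>" using assms True by (intro powr_mono') auto
    then show ?thesis by simp
  qed simp
next
  case False
  then have "X powr e \<le> X powr 1" using assms by (intro powr_mono) auto
  then show ?thesis using False by simp
qed

lemma max_powr:
  assumes "0 \<le> (a::real)" "0 \<le> b" "0 \<le> c"
  shows "max a b powr c = max (a powr c) (b powr c)"
proof (cases "a \<le> b")
  case True
  then show ?thesis using powr_mono2[of c a b] assms by (simp add: max_absorb2)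
next
  case False
  then show ?thesis using powr_mono2[of c b a] assms by (simp add: max_absorb1)
qed

lemma sum_geometric_le:
  fixes x :: real
  assumes x: "0 < x" "x < 1"
  shows "(\<Sum>i<k. x ^ Suc i) \<le> x / (1 - x)" "(\<Sum>i<k. real (Suc i) * x ^ Suc i) \<le> x / (1 - x)\<^sup>2"
proof -
  have "(\<Sum>i<k. x ^ i) \<le> (\<Sum>i. x ^ i)"
    using x by (intro sum_le_suminf summable_geometric) auto
  also have "\<dots> = 1 / (1 - x)" using x by (intro suminf_geometric) simp
  finally have "x * (\<Sum>i<k. x ^ i) \<le> x * (1 / (1 - x))" using x by (intro mult_left_mono) auto
  then show "(\<Sum>i<k. x ^ Suc i) \<le> x / (1 - x)" by (simp add: sum_distrib_left)
  have s: "(\<lambda>n. real (Suc n) * x ^ n) sums (1 / (1 - x)\<^sup>2)"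
    using geometric_deriv_sums[of x] x by simp
  have "(\<Sum>i<k. real (Suc i) * x ^ i) \<le> (\<Sum>i. real (Suc i) * x ^ i)"
    using x sums_summable[OF s] by (intro sum_le_suminf) auto
  also have "\<dots> = 1 / (1 - x)\<^sup>2" using s by (rule sums_unique[symmetric])
  finally have "x * (\<Sum>i<k. real (Suc i) * x ^ i) \<le> x * (1 / (1 - x)\<^sup>2)" using x by (intro mult_left_mono) auto
  then show "(\<Sum>i<k. real (Suc i) * x ^ Suc i) \<le> x / (1 - x)\<^sup>2" by (simp add: sum_distrib_left mult_ac)
qed

text \<open>For z = x^(i+1) one has 1/(1 - z) = 1 + z/(1 - z) \<le> exp(z/(1 - x)); the exponents
  sum to at most x/(1 - x)^2. The lower bound keeps the iterated lowering of the exponent away from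
  0 and becomes \<gamma>.\<close>

lemma prod_one_minus_geometric_ge:
  fixes x :: real
  assumes x: "0 < x" "x < 1"
  shows "exp (- (x / (1 - x)\<^sup>2)) \<le> (\<Prod>i<k. 1 - x ^ Suc i)" "(\<Prod>i<k. 1 - x ^ Suc i) \<le> 1"
    "0 < (\<Prod>i<k. 1 - x ^ Suc i)"
proof -
  have xi: "0 < x ^ Suc i" "x ^ Suc i \<le> x" for i
    using x power_le_one[of x i] by (simp_all add: mult_left_le)
  have "exp (- (x ^ Suc i / (1 - x))) \<le> 1 - x ^ Suc i" for i
  proof -
    let ?z = "x ^ Suc i"
    have z: "0 < ?z" "?z < 1" using xi[of i] x by linarith+
    have "1 / (1 - ?z) = 1 + ?z / (1 - ?z)" using z by (simp add: field_simps)
    also have "\<dots> \<le> 1 + ?z / (1 - x)" using z xi(2)[of i] x by (intro add_left_mono divide_left_mono) auto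
    also have "\<dots> \<le> exp (?z / (1 - x))" by (rule exp_ge_add_one_self)
    finally have "1 / (1 - ?z) \<le> exp (?z / (1 - x))" .
    then have "1 / exp (?z / (1 - x)) \<le> 1 - ?z" using z by (simp add: field_simps)
    then show ?thesis by (simp add: exp_minus inverse_eq_divide)
  qed
  then have "(\<Prod>i<k. exp (- (x ^ Suc i / (1 - x)))) \<le> (\<Prod>i<k. 1 - x ^ Suc i)"
    by (intro prod_mono) auto
  moreover have "(\<Prod>i<k. exp (- (x ^ Suc i / (1 - x)))) = exp (- ((\<Sum>i<k. x ^ Suc i) / (1 - x)))"
    by (simp add: exp_sum[symmetric] sum_negf sum_divide_distrib)
  moreover have "(\<Sum>i<k. x ^ Suc i) / (1 - x) \<le> x / (1 - x) / (1 - x)"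
    using sum_geometric_le(1)[OF x, of k] x by (intro divide_right_mono) auto
  then have "exp (- (x / (1 - x)\<^sup>2)) \<le> exp (- ((\<Sum>i<k. x ^ Suc i) / (1 - x)))"
    by (simp add: power2_eq_square)
  ultimately show "exp (- (x / (1 - x)\<^sup>2)) \<le> (\<Prod>i<k. 1 - x ^ Suc i)" by linarith
  then show "0 < (\<Prod>i<k. 1 - x ^ Suc i)" by (rule less_le_trans[OF exp_gt_zero])
  have "0 \<le> 1 - x ^ Suc i \<and> 1 - x ^ Suc i \<le> 1" for i using xi[of i] x by linarith
  then show "(\<Prod>i<k. 1 - x ^ Suc i) \<le> 1" by (intro prod_le_1) auto
qed

text \<open>After the root of order 2\<alpha> with \<alpha> = \<beta>^(k+1), a step multiplies by
  powers of the constants and replaces X by the larger of X and X^(1 - 1/\<alpha>). The exponents of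
  X 0 multiply to the partial products \<open>\<gamma> k\<close>. Those of K and D add up to a
  geometric series, that of 4\<beta>^2 to its derivative. Since D \<ge> 1, its exponent may be
  raised by 1, which makes it exceed 1.\<close>

lemma iteration_bound:
  fixes \<beta> K D :: real and X :: "nat \<Rightarrow> real"
  assumes \<beta>: "1 < \<beta>" and K: "1 \<le> K" and D: "1 \<le> D" and X0: "\<And>k. 0 \<le> X k"
    and step: "\<And>k. X (Suc k) \<le> (K * (4 * \<beta>\<^sup>2) ^ Suc k * D *
      max (X k powr (2 * \<beta> ^ Suc k - 2)) (X k powr (2 * \<beta> ^ Suc k))) powr (1 / (2 * \<beta> ^ Suc k))"
  defines "x \<equiv> 1 / \<beta>"
  shows "X k \<le> K powr (x / (1 - x)) * (4 * \<beta>\<^sup>2) powr (x / (1 - x)\<^sup>2) * D powr (1 + x / (1 - x))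
      * max (X 0 powr exp (- (x / (1 - x)\<^sup>2))) (X 0)"
proof -
  have x: "0 < x" "x < 1" using \<beta> by (simp_all add: x_def)
  have b4: "1 \<le> 4 * \<beta>\<^sup>2" using \<beta> one_le_power[of \<beta> 2] by linarith
  define s where "s k = (\<Sum>i<k. x ^ Suc i)" for k
  define u where "u k = (\<Sum>i<k. real (Suc i) * x ^ Suc i)" for k
  define \<gamma> where "\<gamma> k = (\<Prod>i<k. 1 - x ^ Suc i)" for k
  define m where "m k = max (X 0 powr \<gamma> k) (X 0)" for k
  define M where "M k = K powr s k * (4 * \<beta>\<^sup>2) powr u k * D powr s k" for k
  note gam = prod_one_minus_geometric_ge[OF x, folded \<gamma>_def]
  have s0: "0 \<le> s k" and u0: "0 \<le> u k" for k unfolding s_def u_def using x by (auto intro!: sum_nonneg)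
  have M1: "1 \<le> M k" for k
  proof -
    have "1 \<le> K powr s k" "1 \<le> (4 * \<beta>\<^sup>2) powr u k" "1 \<le> D powr s k"
      using K b4 D s0 u0 by (auto intro: ge_one_powr_ge_zero)
    then have "1 * 1 * 1 \<le> M k" unfolding M_def by (intro mult_mono) auto
    then show ?thesis by simp
  qed
  have m0: "0 \<le> m k" for k by (simp add: m_def le_max_iff_disj)
  have main: "X k \<le> M k * m k" for k
  proof (induction k)
    case 0
    have "X 0 \<le> m 0" by (simp add: m_def)
    moreover have "M 0 = 1" using K D \<beta> by (simp add: M_def s_def u_def)
    ultimately show ?case by simp
  next
    case (Suc k)
    define \<alpha> where "\<alpha> = \<beta> ^ Suc k"
    have \<alpha>: "1 < \<alpha>" unfolding \<alpha>_def using \<beta> by (intro one_less_power) auto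
    have ax: "1 / \<alpha> = x ^ Suc k" unfolding \<alpha>_def x_def by (rule power_one_over[symmetric])
    let ?c = "1 / (2 * \<alpha>)"
    \<comment> \<open>The exponent 1/(2\<alpha>) is relaxed to 1/\<alpha> = x^(k+1); the base to
      which this is applied is at least 1.\<close>
    have c: "0 < ?c" "?c \<le> x ^ Suc k"
      unfolding ax[symmetric] using \<alpha> by (simp_all add: divide_left_mono)
    have pos: "0 \<le> K * (4 * \<beta>\<^sup>2) ^ Suc k * D" using K b4 D by simp
    have mx: "max (X k powr (2 * \<alpha> - 2)) (X k powr (2 * \<alpha>)) powr ?c = max (X k powr (1 - 1 / \<alpha>)) (X k)"
    proof -
      have e: "(2 * \<alpha> - 2) * ?c = 1 - 1 / \<alpha>" "2 * \<alpha> * ?c = 1" using \<alpha> by (simp_all add: field_simps)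
      have "max (X k powr (2 * \<alpha> - 2)) (X k powr (2 * \<alpha>)) powr ?c
        = max ((X k powr (2 * \<alpha> - 2)) powr ?c) ((X k powr (2 * \<alpha>)) powr ?c)"
        using c by (intro max_powr) auto
      then show ?thesis unfolding powr_powr e using X0[of k] by simp
    qed
    have "X (Suc k) \<le> (K * (4 * \<beta>\<^sup>2) ^ Suc k * D * max (X k powr (2 * \<alpha> - 2)) (X k powr (2 * \<alpha>))) powr ?c"
      using step[of k] unfolding \<alpha>_def .
    also have "\<dots> = (K * (4 * \<beta>\<^sup>2) ^ Suc k * D) powr ?c * max (X k powr (1 - 1 / \<alpha>)) (X k)"
      unfolding powr_mult[of "K * (4 * \<beta>\<^sup>2) ^ Suc k * D"] mx ..
    also have "\<dots> \<le> (K powr x ^ Suc k * (4 * \<beta>\<^sup>2) powr (real (Suc k) * x ^ Suc k) * D powr x ^ Suc k) * (M k * m (Suc k))"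
    proof (rule mult_mono)
      have "(K * (4 * \<beta>\<^sup>2) ^ Suc k * D) powr ?c \<le> (K * (4 * \<beta>\<^sup>2) ^ Suc k * D) powr (x ^ Suc k)"
      proof (rule powr_mono[OF c(2)])
        have "1 * 1 * 1 \<le> K * (4 * \<beta>\<^sup>2) ^ Suc k * D"
          using K D one_le_power[OF b4, of "Suc k"] by (intro mult_mono) auto
        then show "1 \<le> K * (4 * \<beta>\<^sup>2) ^ Suc k * D" by simp
      qed
      also have "\<dots> = K powr x ^ Suc k * ((4 * \<beta>\<^sup>2) ^ Suc k) powr (x ^ Suc k) * D powr x ^ Suc k"
        by (simp only: powr_mult)
      also have "((4 * \<beta>\<^sup>2) ^ Suc k) powr (x ^ Suc k) = (4 * \<beta>\<^sup>2) powr (real (Suc k) * x ^ Suc k)"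
      proof -
        have "0 < 4 * \<beta>\<^sup>2" using b4 by linarith
        from powr_realpow[OF this, of "Suc k"] show ?thesis by (metis powr_powr)
      qed
      finally show "(K * (4 * \<beta>\<^sup>2) ^ Suc k * D) powr ?c
        \<le> K powr x ^ Suc k * (4 * \<beta>\<^sup>2) powr (real (Suc k) * x ^ Suc k) * D powr x ^ Suc k" .
      have gS: "\<gamma> (Suc k) = \<gamma> k * (1 - 1 / \<alpha>)" by (simp add: \<gamma>_def ax)
      have e1: "0 < 1 - 1 / \<alpha>" "1 - 1 / \<alpha> < 1" using \<alpha> by simp_all
      have gle: "\<gamma> (Suc k) \<le> \<gamma> k" "\<gamma> (Suc k) \<le> 1 - 1 / \<alpha>"
        unfolding gS using gam(2,3)[of k] e1 by (simp_all add: mult_left_le mult_left_le_one_le)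
      have mm: "m k \<le> m (Suc k)"
        unfolding m_def using powr_le_max[OF X0 gle(1) gam(2)] by simp
      have "X k powr (1 - 1 / \<alpha>) \<le> (M k * m k) powr (1 - 1 / \<alpha>)"
        using e1 by (intro powr_mono2 Suc X0) auto
      also have "\<dots> = M k powr (1 - 1 / \<alpha>) * m k powr (1 - 1 / \<alpha>)" by (rule powr_mult)
      also have "\<dots> \<le> M k * m (Suc k)"
      proof (rule mult_mono)
        have "M k powr (1 - 1 / \<alpha>) \<le> M k powr 1" using e1 M1 by (intro powr_mono) auto
        then show "M k powr (1 - 1 / \<alpha>) \<le> M k" using M1[of k] by simp
        have "m k powr (1 - 1 / \<alpha>) = max ((X 0 powr \<gamma> k) powr (1 - 1 / \<alpha>)) (X 0 powr (1 - 1 / \<alpha>))"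
          unfolding m_def using X0 e1 by (intro max_powr) auto
        also have "\<dots> \<le> m (Suc k)"
          unfolding powr_powr gS[symmetric] m_def
          using powr_le_max[OF X0[of 0] gle(2) less_imp_le[OF e1(2)]] by simp
        finally show "m k powr (1 - 1 / \<alpha>) \<le> m (Suc k)" .
      qed (use M1[of k] in simp_all)
      finally have 1: "X k powr (1 - 1 / \<alpha>) \<le> M k * m (Suc k)" .
      have "X k \<le> M k * m (Suc k)"
        using Suc mult_left_mono[OF mm, of "M k"] M1[of k] by linarith
      with 1 show "max (X k powr (1 - 1 / \<alpha>)) (X k) \<le> M k * m (Suc k)" by simp
    qed (use X0[of k] in \<open>simp_all add: le_max_iff_disj\<close>)
    also have "\<dots> = M (Suc k) * m (Suc k)"
      unfolding M_def s_def u_def sum.lessThan_Suc powr_add by (simp only: mult_ac)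
    finally show ?case .
  qed
  have s1: "s k \<le> x / (1 - x)" and u1: "u k \<le> x / (1 - x)\<^sup>2"
    unfolding s_def u_def using sum_geometric_le[OF x] by blast+
  have "M k \<le> K powr (x / (1 - x)) * (4 * \<beta>\<^sup>2) powr (x / (1 - x)\<^sup>2) * D powr (1 + x / (1 - x))"
    unfolding M_def using K b4 D s1 u1 by (intro mult_mono powr_mono) auto
  moreover have "m k \<le> max (X 0 powr exp (- (x / (1 - x)\<^sup>2))) (X 0)"
    unfolding m_def using powr_le_max[OF X0[of 0] gam(1)[of k] gam(2)[of k]] by simp
  ultimately have "M k * m k \<le> (K powr (x / (1 - x)) * (4 * \<beta>\<^sup>2) powr (x / (1 - x)\<^sup>2) * D powr (1 + x / (1 - x)))
      * max (X 0 powr exp (- (x / (1 - x)\<^sup>2))) (X 0)"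
    using m0[of k] by (intro mult_mono) auto
  with main[of k] show ?thesis by linarith
qed

section \<open>From moments to the essential supremum\<close>

text \<open>Chebyshev's inequality: the part of S where w exceeds Z + \<delta> has measure at most V
  (Z/(Z + \<delta>))^(T k), which tends to 0 as the exponents grow.\<close>

lemma AE_le_if_moments_le:
  fixes w :: "'a \<Rightarrow> real"
  assumes [measurable]: "w \<in> borel_measurable M" "S \<in> sets M"
    and w0: "\<And>x. 0 \<le> w x" and VZ: "0 \<le> V" "0 \<le> Z"
    and T: "filterlim T at_top sequentially" "\<And>k. 0 < T k"
    and mom: "\<And>k. (\<integral>\<^sup>+x. ennreal (indicator S x * w x powr T k) \<partial>M) \<le> ennreal (V * Z powr T k)"
  shows "AE x in M. x \<in> S \<longrightarrow> w x \<le> Z"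
proof -
  have null: "AE x in M. x \<in> S \<longrightarrow> w x \<le> Z + \<delta>" if \<delta>: "0 < \<delta>" for \<delta>
  proof -
    define E where "E = {x \<in> space M. x \<in> S \<and> Z + \<delta> < w x}"
    have [measurable]: "E \<in> sets M" unfolding E_def by measurable
    define \<rho> where "\<rho> = Z / (Z + \<delta>)"
    have \<rho>: "0 \<le> \<rho>" "\<rho> < 1" using VZ \<delta> by (simp_all add: \<rho>_def)
    have "emeasure M E \<le> ennreal (V * \<rho> powr T k)" for k
    proof -
      have "ennreal ((Z + \<delta>) powr T k) * emeasure M E = (\<integral>\<^sup>+x. ennreal ((Z + \<delta>) powr T k) * indicator E x \<partial>M)"
        by (rule nn_integral_cmult_indicator[symmetric]) measurable
      also have "\<dots> \<le> (\<integral>\<^sup>+x. ennreal (indicator S x * w x powr T k) \<partial>M)"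
      proof (rule nn_integral_mono)
        fix x
        show "ennreal ((Z + \<delta>) powr T k) * indicator E x \<le> ennreal (indicator S x * w x powr T k)"
        proof (cases "x \<in> E")
          case True
          then have "x \<in> S" "Z + \<delta> \<le> w x" by (auto simp: E_def)
          then show ?thesis using True VZ \<delta> T(2)[of k] by (simp add: ennreal_leI powr_mono2)
        qed simp
      qed
      also have "\<dots> \<le> ennreal (V * Z powr T k)" by (rule mom)
      finally have le: "ennreal ((Z + \<delta>) powr T k) * emeasure M E \<le> ennreal (V * Z powr T k)" .
      have p: "0 < (Z + \<delta>) powr T k" using VZ \<delta> by simp
      have "emeasure M E = ennreal (1 / (Z + \<delta>) powr T k) * (ennreal ((Z + \<delta>) powr T k) * emeasure M E)"
        using p by (simp add: mult.assoc[symmetric] ennreal_mult[symmetric])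
      also have "\<dots> \<le> ennreal (1 / (Z + \<delta>) powr T k) * ennreal (V * Z powr T k)"
        by (intro mult_left_mono le) simp
      also have "\<dots> = ennreal (1 / (Z + \<delta>) powr T k * (V * Z powr T k))"
        using VZ by (intro ennreal_mult[symmetric]) simp_all
      also have "1 / (Z + \<delta>) powr T k * (V * Z powr T k) = V * \<rho> powr T k"
        using VZ \<delta> by (simp add: \<rho>_def powr_divide)
      finally show ?thesis .
    qed
    moreover have "(\<lambda>k. ennreal (V * \<rho> powr T k)) \<longlonglongrightarrow> ennreal (V * 0)"
    proof (intro tendsto_ennrealI tendsto_mult tendsto_const)
      show "(\<lambda>k. \<rho> powr T k) \<longlonglongrightarrow> 0"
      proof (cases "\<rho> = 0")
        case False
        then have r: "0 < \<rho>" using \<rho> by simp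
        then have "ln \<rho> < 0" using \<rho> by simp
        then have "filterlim (\<lambda>k. ln \<rho> * T k) at_bot sequentially"
          using T(1) by (intro filterlim_tendsto_neg_mult_at_bot[OF tendsto_const])
        from filterlim_compose[OF exp_at_bot this] show ?thesis
          using r by (simp add: powr_def mult.commute)
      qed simp
    qed
    ultimately have "emeasure M E \<le> ennreal (V * 0)"
      by (intro LIMSEQ_le_const[where X="\<lambda>k. ennreal (V * \<rho> powr T k)"]) auto
    then have "E \<in> null_sets M" by (intro null_setsI) auto
    then show ?thesis by (rule AE_I') (auto simp: E_def)
  qed
  have "AE x in M. \<forall>n. x \<in> S \<longrightarrow> w x \<le> Z + 1 / real (Suc n)"
    by (intro AE_all_countable[THEN iffD2] allI null) simp
  then show ?thesis
  proof eventually_elim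
    case (elim x)
    show ?case
    proof
      assume "x \<in> S"
      then have le: "w x \<le> Z + 1 / real (Suc n)" for n using elim by blast
      have "(\<lambda>n. Z + 1 / real (Suc n)) \<longlonglongrightarrow> Z + 0"
        using LIMSEQ_inverse_real_of_nat by (intro tendsto_add tendsto_const) (simp add: inverse_eq_divide)
      from LIMSEQ_le_const[OF this] show "w x \<le> Z" using le by auto
    qed
  qed
qed

context tested_solution
begin

text \<open>The value \<beta> = t / (2 p/(p - 1)) makes the steps fit together: with \<alpha> =
  \<beta>^(k+1) the exponent required by a step is \<beta>^k t, the one the preceding step has
  delivered.\<close>

lemma moser_sup:
  fixes t p q r C Ce c \<sigma> \<sigma>' X0 Ap Aq :: real
  defines "d \<equiv> real CARD('n)" and "V \<equiv> measure lborel (ball y R)" and "\<omega> \<equiv> measure lborel (ball (0::real^'n) 1)"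
    and "w \<equiv> \<lambda>x. max (v x) 0" and "\<beta> \<equiv> t / (2 * (p / (p - 1)))"
  defines "K \<equiv> 44 * (c\<^sup>2 + Ce\<^sup>2) * (C * \<omega> powr (t / r - 1)) powr (2 / t)" and "x \<equiv> 1 / \<beta>"
  defines "Z \<equiv> max 1 K powr (x / (1 - x)) * (4 * \<beta>\<^sup>2) powr (x / (1 - x)\<^sup>2) *
      (max 1 (Ap * Aq) / (\<sigma> - \<sigma>')\<^sup>2) powr (1 + x / (1 - x)) * max (X0 powr exp (- (x / (1 - x)\<^sup>2))) X0"
  assumes sob: "\<And>\<phi> A. 0 \<le> A \<Longrightarrow> \<phi> \<in> test_functions (ball y R) \<Longrightarrow>
    (\<integral>\<^sup>+x. ennreal (norm (grad \<phi> x) powr r) \<partial>lborel) \<le> ennreal A \<Longrightarrow>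
    (\<integral>\<^sup>+x. ennreal (\<bar>\<phi> x\<bar> powr t) \<partial>lborel) \<le> ennreal (C * R powr (t - d * t / r + d) * A powr (t / r))"
    and C: "0 < C" and q: "1 < q" and r: "r = 2 * q / (q + 1)" and t: "r < t" and p: "1 < p"
    and cut: "\<And>(x0::real^'n) s t. 0 < s \<Longrightarrow> s < t \<Longrightarrow> \<exists>\<eta>\<in>test_functions (ball x0 t).
       (\<forall>x. 0 \<le> \<eta> x \<and> \<eta> x \<le> 1 \<and> norm (grad \<eta> x) \<le> Ce / (t - s)) \<and> (\<forall>x\<in>ball x0 s. \<eta> x = 1)"
    and Ce: "0 < Ce"
    and \<sigma>: "0 < \<sigma>'" "\<sigma>' < \<sigma>" "\<sigma> \<le> 1" and \<beta>: "1 < \<beta>" and L: "L = c / R"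
    and Ap: "(\<integral>\<^sup>+x. ennreal (indicator (ball y R) x * Lam x powr p) \<partial>lebesgue) \<le> ennreal (V * Ap powr p)" "0 \<le> Ap"
    and Aq: "(\<integral>\<^sup>+x. ennreal (indicator (ball y R) x * (1 / lam x) powr q) \<partial>lebesgue) \<le> ennreal (V * Aq powr q)" "0 \<le> Aq"
    and X0: "(\<integral>\<^sup>+x. ennreal (indicator (ball y (\<sigma> * R)) x * w x powr t) \<partial>lebesgue) \<le> ennreal (V * X0 powr t)" "0 \<le> X0"
  shows "AE x in lebesgue. x \<in> ball y (\<sigma>' * R) \<longrightarrow> w x \<le> Z"
proof -
  have V: "0 \<le> V" unfolding V_def by simp
  have t0: "0 < t" using t q r by (smt (verit) divide_pos_pos)
  have wm: "w \<in> borel_measurable lebesgue" unfolding w_def using v_measurable by measurable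
  define s where "s = \<sigma> - \<sigma>'"
  have s: "0 < s" "s \<le> 1" using \<sigma> by (simp_all add: s_def)
  define D where "D = max 1 (Ap * Aq) / s\<^sup>2"
  have s2: "s\<^sup>2 \<le> 1" using s power_le_one[of s 2] by simp
  have D1: "1 \<le> D" unfolding D_def using s s2 by (simp add: le_divide_eq)
  \<comment> \<open>The radii decrease from \<sigma> to \<sigma>' with halving gaps. The inverse
    square of the k-th gap is 4^(k+1)/s^2, whence the 4 in 4\<beta>^2.\<close>
  define \<sigma>s where "\<sigma>s k = \<sigma>' + s / 2 ^ k" for k :: nat
  \<comment> \<open>X k is not the norm itself but the bound for it: the estimate of the step, read
    as a recursion with equality.\<close>
  define X where "X = rec_nat X0 (\<lambda>k X. (K * (\<beta> ^ Suc k)\<^sup>2 * (Ap * Aq) / (\<sigma>s k - \<sigma>s (Suc k))\<^sup>2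
    * max (X powr (2 * \<beta> ^ Suc k - 2)) (X powr (2 * \<beta> ^ Suc k))) powr (1 / (2 * \<beta> ^ Suc k)))"
  have X_0: "X 0 = X0" by (simp add: X_def)
  have X_Suc: "X (Suc k) = (K * (\<beta> ^ Suc k)\<^sup>2 * (Ap * Aq) / (\<sigma>s k - \<sigma>s (Suc k))\<^sup>2
    * max (X k powr (2 * \<beta> ^ Suc k - 2)) (X k powr (2 * \<beta> ^ Suc k))) powr (1 / (2 * \<beta> ^ Suc k))" for k
    by (simp add: X_def)
  have Xnn: "0 \<le> X k" for k by (cases k) (simp_all add: X_0 X_Suc X0(2))
  have diff: "\<sigma>s k - \<sigma>s (Suc k) = s / 2 ^ Suc k" for k by (simp add: \<sigma>s_def)
  have K0: "0 \<le> K" unfolding K_def by simp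
  have bk: "1 < \<beta> ^ Suc k" for k using \<beta> by (intro one_less_power) auto
  have mom: "(\<integral>\<^sup>+x. ennreal (indicator (ball y (\<sigma>s k * R)) x * w x powr (\<beta> ^ k * t)) \<partial>lebesgue)
    \<le> ennreal (V * X k powr (\<beta> ^ k * t))" for k
  proof (induction k)
    case 0
    show ?case using X0 by (simp add: \<sigma>s_def s_def X_0)
  next
    case (Suc k)
    have e: "2 * \<beta> ^ Suc k * (p / (p - 1)) = \<beta> ^ k * t"
      using p by (simp add: \<beta>_def)
    have sg: "0 < \<sigma>s (Suc k)" "\<sigma>s (Suc k) < \<sigma>s k" "\<sigma>s k \<le> 1"
    proof -
      show "0 < \<sigma>s (Suc k)" unfolding \<sigma>s_def using \<sigma>(1) s(1) by (intro add_pos_pos) simp_all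
      show "\<sigma>s (Suc k) < \<sigma>s k" using diff[of k] s(1) by (smt (verit) divide_pos_pos zero_less_power)
      have "s / 2 ^ k \<le> s / 1" using s(1) by (intro divide_left_mono) simp_all
      then show "\<sigma>s k \<le> 1" unfolding \<sigma>s_def using \<sigma>(3) by (simp add: s_def)
    qed
    note st = moser_step[OF sob[unfolded d_def] C q r t p cut Ce sg bk[of k] L Ap[unfolded V_def] Aq[unfolded V_def]
        Suc[unfolded w_def V_def, folded e] Xnn]
    define Y where "Y = K * (\<beta> ^ Suc k)\<^sup>2 * (Ap * Aq) / (\<sigma>s k - \<sigma>s (Suc k))\<^sup>2
      * max (X k powr (2 * \<beta> ^ Suc k - 2)) (X k powr (2 * \<beta> ^ Suc k))"
    have b0: "\<beta> ^ Suc k \<noteq> 0" using bk[of k] by linarith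
    have "1 / (2 * B) * (B * t) = t / 2" if "B \<noteq> 0" for B using that by simp
    from this[OF b0] have "1 / (2 * \<beta> ^ Suc k) * (\<beta> ^ Suc k * t) = t / 2" .
    then have Xe: "X (Suc k) powr (\<beta> ^ Suc k * t) = Y powr (t / 2)"
      unfolding X_Suc Y_def[symmetric] powr_powr by (simp only:)
    show ?case unfolding Xe unfolding Y_def K_def V_def \<omega>_def w_def by (rule st)
  qed
  have XZ: "X k \<le> Z" for k
  proof -
    have "X k \<le> max 1 K powr (x / (1 - x)) * (4 * \<beta>\<^sup>2) powr (x / (1 - x)\<^sup>2) * D powr (1 + x / (1 - x))
      * max (X 0 powr exp (- (x / (1 - x)\<^sup>2))) (X 0)"
      unfolding x_def
    proof (rule iteration_bound[OF \<beta> _ D1 Xnn])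
      fix k
      have "K * (\<beta> ^ Suc k)\<^sup>2 * (Ap * Aq) / (\<sigma>s k - \<sigma>s (Suc k))\<^sup>2 = K * (4 * \<beta>\<^sup>2) ^ Suc k * (Ap * Aq / s\<^sup>2)"
      proof -
        have sw: "(b ^ Suc k)\<^sup>2 = (b\<^sup>2) ^ Suc k" for b :: real
          by (simp only: power_mult[symmetric] mult.commute)
        have e: "(\<beta> ^ Suc k)\<^sup>2 = (\<beta>\<^sup>2) ^ Suc k" "(2 ^ Suc k)\<^sup>2 = (4::real) ^ Suc k"
          using sw[of \<beta>] sw[of 2] by simp_all
        show ?thesis unfolding diff power_divide e power_mult_distrib[of 4] by simp
      qed
      also have "\<dots> \<le> max 1 K * (4 * \<beta>\<^sup>2) ^ Suc k * D"
        using K0 Ap(2) Aq(2) unfolding D_def by (intro mult_mono divide_right_mono) auto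
      finally show "X (Suc k) \<le> (max 1 K * (4 * \<beta>\<^sup>2) ^ Suc k * D *
          max (X k powr (2 * \<beta> ^ Suc k - 2)) (X k powr (2 * \<beta> ^ Suc k))) powr (1 / (2 * \<beta> ^ Suc k))"
        unfolding X_Suc using K0 Ap(2) Aq(2) bk[of k]
        by (intro powr_mono2 mult_right_mono) (auto simp: le_max_iff_disj)
    qed simp
    then show ?thesis by (simp add: Z_def D_def s_def X_0)
  qed
  have Z0: "0 \<le> Z" using XZ[of 0] Xnn[of 0] by linarith
  show ?thesis
  proof (rule AE_le_if_moments_le[OF wm _ _ V Z0])
    show "ball y (\<sigma>' * R) \<in> sets lebesgue" by simp
    show "0 \<le> w x" for x by (simp add: w_def)
    show "0 < \<beta> ^ k * t" for k using \<beta> t0 by simp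
    show "filterlim (\<lambda>k. \<beta> ^ k * t) at_top sequentially"
      using filterlim_realpow_sequentially_gt1[of \<beta>] \<beta> t0
      by (intro filterlim_at_top_mult_tendsto_pos[OF tendsto_const]) (auto simp: filterlim_at_infinity_conv_norm_at_top)
    fix k
    have "(\<integral>\<^sup>+x. ennreal (indicator (ball y (\<sigma>' * R)) x * w x powr (\<beta> ^ k * t)) \<partial>lebesgue)
      \<le> (\<integral>\<^sup>+x. ennreal (indicator (ball y (\<sigma>s k * R)) x * w x powr (\<beta> ^ k * t)) \<partial>lebesgue)"
    proof (intro nn_integral_mono ennreal_leI mult_right_mono)
      fix x
      have "\<sigma>' * R \<le> \<sigma>s k * R" using s(1) R_pos by (intro mult_right_mono) (simp_all add: \<sigma>s_def)
      then have "ball y (\<sigma>' * R) \<subseteq> ball y (\<sigma>s k * R)" by (rule subset_ball)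
      then show "indicator (ball y (\<sigma>' * R)) x \<le> (indicator (ball y (\<sigma>s k * R)) x :: real)"
        by (auto simp: indicator_def)
    qed simp
    also have "\<dots> \<le> ennreal (V * X k powr (\<beta> ^ k * t))" by (rule mom)
    also have "\<dots> \<le> ennreal (V * Z powr (\<beta> ^ k * t))"
      using V \<beta> t0 by (intro ennreal_leI mult_left_mono powr_mono2 XZ Xnn) auto
    finally show "(\<integral>\<^sup>+x. ennreal (indicator (ball y (\<sigma>' * R)) x * w x powr (\<beta> ^ k * t)) \<partial>lebesgue)
      \<le> ennreal (V * Z powr (\<beta> ^ k * t))" .
  qed
qed

text \<open>The identity for - v and G is the one for v and the reflected function G(-t), again C^1,
  bounded and nonnegative. Only positive parts enter the iteration, so this supplies the bound from
  below.\<close>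

lemma tested_solution_uminus:
  "tested_solution a lam Lam (\<lambda>n x. - \<phi> n x) (\<lambda>x. - v x) (\<lambda>x. - g x) (\<lambda>x. - F x) y R L"
proof
  note D = approximatesD[OF approx]
  have gr: "grad (\<lambda>x. - \<phi> n x) x = - grad (\<phi> n) x" for n x
    by (rule grad_unique) (use has_derivative_minus[OF test_functions_has_derivative[OF D(1)]] in simp)
  have ts: "(\<lambda>x. - \<phi> n x) \<in> test_functions UNIV" for n
    using test_functions_mult[OF D(1) Ck_const[of _ "-1"]] by simp
  have sq: "(- a - - b)\<^sup>2 = (a - b)\<^sup>2" for a b :: real by (simp add: power2_commute)
  have qq: "Q x (- \<xi> - - \<eta>) = Q x (\<xi> - \<eta>)" for x \<xi> \<eta> using Q_commute[of x \<eta> \<xi>] by simp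
  show "approximates UNIV (\<lambda>n x. - \<phi> n x) (\<lambda>x. - v x) (\<lambda>x. - g x)"
    unfolding approximates_def gr sq qq
  proof (intro conjI allI ts D(5,6))
    show "L2_function (\<lambda>x. - v x)" using D(2) unfolding L2_function_def by simp
    show "(\<lambda>x. - g x) \<in> borel_measurable lebesgue" using D(4) by measurable
  qed
  show "AE x in lebesgue. (\<lambda>n. - \<phi> n x) \<longlonglongrightarrow> - v x"
    using approx_AE by eventually_elim (rule tendsto_minus)
  show "(\<lambda>x. - F x) \<in> borel_measurable lebesgue" using F_measurable by measurable
  show "norm (- F x) \<le> L" for x using F_bound by simp
  show "0 < R" by (rule R_pos)
  fix \<psi> :: "real^'n \<Rightarrow> real" and G G' :: "real \<Rightarrow> real" and M
  assume \<psi>: "\<psi> \<in> test_functions (ball y R)" "\<And>x. 0 \<le> \<psi> x"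
    and G: "\<And>t. (G has_real_derivative G' t) (at t)" "continuous_on UNIV G'"
      "\<And>t. \<bar>G t\<bar> \<le> M" "\<And>t. \<bar>G' t\<bar> \<le> M" "\<And>t. 0 \<le> G t"
  have d: "((\<lambda>t. G (- t)) has_real_derivative - G' (- t)) (at t)" for t
    using DERIV_chain2[OF G(1) DERIV_minus[OF DERIV_ident]] by simp
  have c: "continuous_on UNIV (\<lambda>t. - G' (- t))"
    by (intro continuous_on_minus continuous_on_compose2[OF G(2)] continuous_on_id) auto
  have b: "\<bar>- G' (- t)\<bar> \<le> M" for t using G(4) by simp
  have "(LINT x|lebesgue. (a x *v g x) \<bullet> ((\<psi> x * - G' (- v x)) *\<^sub>R g x + G (- v x) *\<^sub>R grad \<psi> x))
    = - (LINT x|lebesgue. (a x *v F x) \<bullet> ((\<psi> x * - G' (- v x)) *\<^sub>R g x + G (- v x) *\<^sub>R grad \<psi> x))"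
    by (rule tested[OF \<psi> d c G(3) b G(5)])
  moreover have "(a x *v - k) \<bullet> h = - ((a x *v k) \<bullet> h)" for x k h
    using matrix_vector_mult_scaleR[of "a x" "-1" k] by simp
  ultimately show "(LINT x|lebesgue. (a x *v - g x) \<bullet> ((\<psi> x * G' (- v x)) *\<^sub>R - g x + G (- v x) *\<^sub>R grad \<psi> x))
    = - (LINT x|lebesgue. (a x *v - F x) \<bullet> ((\<psi> x * G' (- v x)) *\<^sub>R - g x + G (- v x) *\<^sub>R grad \<psi> x))"
    by simp
qed

end

section \<open>Averaged norms\<close>

lemma ennpowr_ennreal: "0 \<le> x \<Longrightarrow> ennpowr (ennreal x) r = ennreal (x powr r)"
  by (simp add: ennpowr_def)

lemma ennpowr_top: "ennpowr \<infinity> r = \<infinity>"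
  by (simp add: ennpowr_def)

lemma ennpowr_measurable:
  assumes [measurable]: "g \<in> borel_measurable M"
  shows "(\<lambda>x. ennpowr (g x) r) \<in> borel_measurable M"
  unfolding ennpowr_def by measurable

lemma emeasure_lebesgue_ball: "emeasure lebesgue (ball (y::'a::euclidean_space) s) = ennreal (measure lborel (ball y s))"
  using emeasure_lborel_ball_finite[of y s] by (simp add: emeasure_eq_ennreal_measure)

lemma AE_lebesgue_on_ball:
  "(AE x in lebesgue_on (ball (y::'a::euclidean_space) s). P x) \<longleftrightarrow> (AE x in lebesgue. x \<in> ball y s \<longrightarrow> P x)"
  by (rule AE_restrict_space_iff) simp

text \<open>Monotonicity of averaged norms in the exponent, stated with the real integrals used by
  the iteration; P may be infinite. As \<open>enn2real\<close> sends infinity to 0, finiteness of g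
  almost everywhere is recorded beside the moment bound.\<close>

lemma avg_norm_moments:
  fixes y :: "'a::euclidean_space" and b s :: real and P :: ennreal
  assumes gm: "g \<in> borel_measurable lebesgue" and b: "0 < b" and s: "0 < s" "ennreal s \<le> P"
    and fin: "avg_norm (ball y b) P g < \<infinity>"
  shows "AE x in lebesgue. x \<in> ball y b \<longrightarrow> g x < \<infinity>"
    "(\<integral>\<^sup>+x. ennreal (indicator (ball y b) x * enn2real (g x) powr s) \<partial>lebesgue)
      \<le> ennreal (measure lborel (ball y b) * enn2real (avg_norm (ball y b) P g) powr s)"
proof -
  let ?B = "ball y b"
  define V where "V = measure lborel ?B"
  have V: "0 < V" unfolding V_def using content_ball_pos[OF b, of y] by simp
  have VB: "emeasure lebesgue ?B = ennreal V" unfolding V_def by (rule emeasure_lebesgue_ball)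
  define n where "n = enn2real (avg_norm ?B P g)"
  have n: "avg_norm ?B P g = ennreal n" "0 \<le> n" using fin by (simp_all add: n_def)
  have [measurable]: "?B \<in> sets lebesgue" by simp
  note [measurable] = gm ennpowr_measurable[OF gm]
  have iV: "(\<integral>\<^sup>+x. ennreal (indicator ?B x) \<partial>lebesgue) = ennreal V" by (simp add: ennreal_indicator VB)
  have "(AE x in lebesgue. x \<in> ?B \<longrightarrow> g x < \<infinity>) \<and>
    (\<integral>\<^sup>+x. ennreal (indicator ?B x * enn2real (g x) powr s) \<partial>lebesgue) \<le> ennreal (V * n powr s)"
  proof (cases "P = \<infinity>")
    case True
    have "AE x in lebesgue_on ?B. g x \<le> ennreal n"
      using esssup_AE[of g "lebesgue_on ?B"] n(1) True by (simp add: avg_norm_def)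
    then have le: "AE x in lebesgue. x \<in> ?B \<longrightarrow> g x \<le> ennreal n" by (simp only: AE_lebesgue_on_ball)
    have "(\<integral>\<^sup>+x. ennreal (indicator ?B x * enn2real (g x) powr s) \<partial>lebesgue) \<le> (\<integral>\<^sup>+x. ennreal (n powr s) * ennreal (indicator ?B x) \<partial>lebesgue)"
    proof (rule nn_integral_mono_AE)
      show "AE x in lebesgue. ennreal (indicator ?B x * enn2real (g x) powr s) \<le> ennreal (n powr s) * ennreal (indicator ?B x)"
        using le
      proof eventually_elim
        case (elim x)
        show ?case
        proof (cases "x \<in> ?B")
          case True
          then have "enn2real (g x) \<le> n" using elim n(2) by (simp add: enn2real_leI)
          then have "enn2real (g x) powr s \<le> n powr s" using s by (intro powr_mono2) auto
          then show ?thesis using True by (simp add: ennreal_leI)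
        qed simp
      qed
    qed
    also have "\<dots> = ennreal (n powr s) * ennreal V" by (subst nn_integral_cmult) (simp_all add: iV)
    also have "\<dots> = ennreal (V * n powr s)" using V by (simp add: ennreal_mult mult.commute)
    finally have "(\<integral>\<^sup>+x. ennreal (indicator ?B x * enn2real (g x) powr s) \<partial>lebesgue) \<le> ennreal (V * n powr s)" .
    moreover have "AE x in lebesgue. x \<in> ?B \<longrightarrow> g x < \<infinity>"
      using le
    proof eventually_elim
      case (elim x)
      then show ?case unfolding infinity_ennreal_def by (intro impI) (rule le_less_trans[OF _ ennreal_less_top], blast)
    qed
    ultimately show ?thesis by blast
  next
    case False
    define p where "p = enn2real P"
    have P: "P = ennreal p" using False by (simp add: p_def less_top)
    have p: "s \<le> p" "0 < p" using s unfolding P by (auto simp: ennreal_le_iff2)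
    define I where "I = (\<integral>\<^sup>+x\<in>?B. ennpowr (g x) p \<partial>lebesgue)"
    have N: "ennreal n = ennpowr (I / ennreal V) (1 / p)"
      using n(1) False p by (simp add: avg_norm_def avg_moment_def P I_def VB)
    have Ifin: "I < \<infinity>"
    proof (rule ccontr)
      assume "\<not> I < \<infinity>"
      then have "I / ennreal V = \<infinity>" using V by (simp add: not_less top_unique ennreal_top_divide)
      then have "ennreal n = \<infinity>" using N by (simp only: ennpowr_top)
      then show False by simp
    qed
    define i where "i = enn2real I"
    have i: "I = ennreal i" "0 \<le> i" using Ifin by (simp_all add: i_def)
    have np: "n powr p = i / V"
    proof -
      have "ennreal n = ennreal ((i / V) powr (1 / p))"
        unfolding N i(1) using i(2) V by (simp add: divide_ennreal ennpowr_ennreal)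
      then have "n = (i / V) powr (1 / p)" using n(2) by simp
      then show ?thesis using p i(2) V by (simp add: powr_powr)
    qed
    have "AE x in lebesgue. ennpowr (g x) p * indicator ?B x \<noteq> \<infinity>"
      by (rule nn_integral_PInf_AE) (measurable, use Ifin in \<open>simp add: I_def\<close>)
    then have gf: "AE x in lebesgue. x \<in> ?B \<longrightarrow> g x < \<infinity>"
    proof eventually_elim
      case (elim x)
      show ?case
      proof (intro impI, rule ccontr)
        assume x: "x \<in> ?B" and "\<not> g x < \<infinity>"
        then have "g x = \<infinity>" by (simp add: not_less top_unique)
        then show False using elim x by (simp add: ennpowr_def)
      qed
    qed
    have Ip: "(\<integral>\<^sup>+x. ennreal (indicator ?B x * enn2real (g x) powr p) \<partial>lebesgue) = ennreal (V * n powr p)"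
    proof -
      have "(\<integral>\<^sup>+x. ennreal (indicator ?B x * enn2real (g x) powr p) \<partial>lebesgue) = I"
        unfolding I_def
      proof (rule nn_integral_cong_AE)
        show "AE x in lebesgue. ennreal (indicator ?B x * enn2real (g x) powr p) = ennpowr (g x) p * indicator ?B x"
          using gf
        proof eventually_elim
          case (elim x)
          then show ?case by (cases "x \<in> ?B") (simp_all add: ennpowr_def less_top)
        qed
      qed
      also have "\<dots> = ennreal (V * n powr p)" unfolding np i(1) using V by simp
      finally show ?thesis .
    qed
    have "(\<integral>\<^sup>+x. ennreal (indicator ?B x * enn2real (g x) powr s) \<partial>lebesgue) \<le> ennreal (V * n powr s)"
    proof (cases "s = p")
      case True
      then show ?thesis using Ip by simp
    next
      case False
      define \<theta> where "\<theta> = s / p"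
      have \<theta>: "0 < \<theta>" "\<theta> < 1" using False p s by (simp_all add: \<theta>_def)
      have ps: "p * \<theta> = s" using p by (simp add: \<theta>_def)
      have "(\<integral>\<^sup>+x. ennreal (indicator ?B x * enn2real (g x) powr s) \<partial>lebesgue)
        = (\<integral>\<^sup>+x. ennreal ((indicator ?B x * enn2real (g x) powr p) powr \<theta> * indicator ?B x powr (1 - \<theta>)) \<partial>lebesgue)"
      proof (rule nn_integral_cong)
        fix x
        show "ennreal (indicator ?B x * enn2real (g x) powr s)
          = ennreal ((indicator ?B x * enn2real (g x) powr p) powr \<theta> * indicator ?B x powr (1 - \<theta>))"
          by (cases "x \<in> ?B") (simp_all only: indicator_simps mult_1_left powr_powr ps, simp_all)
      qed
      also have "\<dots> \<le> ennreal ((V * n powr p) powr \<theta> * V powr (1 - \<theta>))"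
      proof (rule nn_integral_Holder[OF _ _ _ _ \<theta> eq_refl[OF Ip] eq_refl[OF iV]])
        show "(\<lambda>x. indicator ?B x * enn2real (g x) powr p) \<in> borel_measurable lebesgue" by measurable
        show "(indicator ?B :: 'a \<Rightarrow> real) \<in> borel_measurable lebesgue" by measurable
      qed (use V in simp_all)
      also have "(V * n powr p) powr \<theta> * V powr (1 - \<theta>) = V * n powr s"
      proof -
        have 1: "(V * n powr p) powr \<theta> = V powr \<theta> * n powr s" by (simp only: powr_mult powr_powr ps)
        have 2: "V powr \<theta> * V powr (1 - \<theta>) = V" using V powr_add[of V \<theta> "1 - \<theta>"] by simp
        have "V powr \<theta> * n powr s * V powr (1 - \<theta>) = (V powr \<theta> * V powr (1 - \<theta>)) * n powr s" by (simp only: mult_ac)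
        then show ?thesis unfolding 1 2 .
      qed
      finally show ?thesis .
    qed
    with gf show ?thesis by blast
  qed
  then show "AE x in lebesgue. x \<in> ball y b \<longrightarrow> g x < \<infinity>"
    "(\<integral>\<^sup>+x. ennreal (indicator (ball y b) x * enn2real (g x) powr s) \<partial>lebesgue)
      \<le> ennreal (measure lborel (ball y b) * enn2real (avg_norm (ball y b) P g) powr s)"
    unfolding V_def n_def by blast+
qed

text \<open>The moment condition concerns balls about the origin, while the estimate is about
  arbitrary centres. Only finiteness is transferred: the volumes are positive and finite, so a
  finite mean is the same as a finite integral.\<close>

lemma avg_norm_finite_subball:
  fixes y z :: "'a::euclidean_space" and b c :: real and P :: ennreal
  assumes gm: "g \<in> borel_measurable lebesgue" and b: "0 < b" and sub: "ball y b \<subseteq> ball z c"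
    and fin: "avg_moment (ball z c) P g < \<infinity>"
  shows "avg_norm (ball y b) P g < \<infinity>"
proof (cases "P = \<infinity>")
  case True
  have "AE x in lebesgue_on (ball z c). g x \<le> esssup (lebesgue_on (ball z c)) g" by (rule esssup_AE)
  then have "AE x in lebesgue. x \<in> ball z c \<longrightarrow> g x \<le> esssup (lebesgue_on (ball z c)) g"
    by (simp only: AE_lebesgue_on_ball)
  then have "AE x in lebesgue. x \<in> ball y b \<longrightarrow> g x \<le> esssup (lebesgue_on (ball z c)) g"
    by eventually_elim (use sub in blast)
  then have "AE x in lebesgue_on (ball y b). g x \<le> esssup (lebesgue_on (ball z c)) g"
    by (simp only: AE_lebesgue_on_ball)
  then have "esssup (lebesgue_on (ball y b)) g \<le> esssup (lebesgue_on (ball z c)) g"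
    by (intro esssup_I measurable_restrict_space1 gm)
  also have "\<dots> < \<infinity>" using fin True by (simp add: avg_moment_def)
  finally show ?thesis using True by (simp add: avg_norm_def)
next
  case False
  let ?p = "enn2real P"
  have c: "0 < c"
    using sub b by (metis ball_eq_empty ball_empty centre_in_ball not_le subset_empty empty_iff)
  have V: "0 < measure lborel (ball z c)" "0 < measure lborel (ball y b)"
    using content_ball_pos[OF c, of z] content_ball_pos[OF b, of y] by simp_all
  have "(\<integral>\<^sup>+x\<in>ball y b. ennpowr (g x) ?p \<partial>lebesgue) \<le> (\<integral>\<^sup>+x\<in>ball z c. ennpowr (g x) ?p \<partial>lebesgue)"
    using sub by (intro nn_integral_mono) (auto simp: indicator_def)
  also have "\<dots> < \<infinity>"
  proof (rule ccontr)
    assume "\<not> (\<integral>\<^sup>+x\<in>ball z c. ennpowr (g x) ?p \<partial>lebesgue) < \<infinity>"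
    then have t: "(\<integral>\<^sup>+x\<in>ball z c. ennpowr (g x) ?p \<partial>lebesgue) = top" by (simp add: not_less top_unique)
    show False using fin False unfolding avg_moment_def emeasure_lebesgue_ball t
      by (simp add: ennreal_top_divide)
  qed
  finally obtain i where i: "(\<integral>\<^sup>+x\<in>ball y b. ennpowr (g x) ?p \<partial>lebesgue) = ennreal i" "0 \<le> i"
    by (cases "(\<integral>\<^sup>+x\<in>ball y b. ennpowr (g x) ?p \<partial>lebesgue)") auto
  have "avg_norm (ball y b) P g = ennreal ((i / measure lborel (ball y b)) powr (1 / ?p))"
    unfolding avg_norm_def avg_moment_def emeasure_lebesgue_ball i(1)
    using False V i(2) by (simp add: divide_ennreal ennpowr_ennreal)
  then show ?thesis by simp
qed

section \<open>Choice of exponents\<close>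

text \<open>In terms of its reciprocal, an infinite exponent is just the value 0, and both cases can
  be perturbed alike.\<close>

lemma ennreal_exponent_inverse:
  assumes "1 < (p::ennreal)"
  obtains a :: real where "0 \<le> a" "a < 1" "1 / p = ennreal a" "\<And>x. a < x \<Longrightarrow> ennreal (1 / x) \<le> p"
proof (cases p)
  case top
  have "(1::ennreal) / top = ennreal 0" by simp
  then show ?thesis using that[of 0] top by simp
next
  case (real P)
  have P: "1 < P" using assms real by (metis ennreal_1 ennreal_less_iff zero_le_one)
  show ?thesis
  proof (rule that[of "1 / P"])
    show "1 / p = ennreal (1 / P)"
      using P real by (metis divide_ennreal ennreal_1 less_trans zero_le_one zero_less_one)
    show "ennreal (1 / x) \<le> p" if "1 / P < x" for x
    proof -
      have "0 < 1 / P" using P by simp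
      then have x0: "0 < x" using that by linarith
      have "1 < P * x" using that P by (simp add: divide_less_eq mult.commute)
      then have "1 / x < P" using x0 by (simp add: divide_less_eq)
      then show ?thesis using real by (simp add: ennreal_leI)
    qed
  qed (use P in simp_all)
qed

text \<open>The condition on 1/p + 1/q is open, so both reciprocals may be increased slightly. They
  become positive, that is, the exponents finite, and remain below 1.\<close>

lemma finite_exponents:
  fixes p q :: ennreal and d :: nat
  assumes "2 \<le> d" "1 < p" "1 < q" "1 / p + 1 / q < 2 / of_nat d"
  obtains p1 q1 :: real where "1 < p1" "1 < q1" "ennreal p1 \<le> p" "ennreal q1 \<le> q" "1 / p1 + 1 / q1 < 2 / real d"
proof -
  obtain a where a: "0 \<le> a" "a < 1" "1 / p = ennreal a" "\<And>x. a < x \<Longrightarrow> ennreal (1 / x) \<le> p"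
    using ennreal_exponent_inverse[OF assms(2)] by blast
  obtain b where b: "0 \<le> b" "b < 1" "1 / q = ennreal b" "\<And>x. b < x \<Longrightarrow> ennreal (1 / x) \<le> q"
    using ennreal_exponent_inverse[OF assms(3)] by blast
  have "2 / of_nat d = ennreal (2 / real d)"
    using assms(1) divide_ennreal[of 2 "real d"] by (simp add: ennreal_of_nat_eq_real_of_nat)
  with assms(4) have "ennreal (a + b) < ennreal (2 / real d)"
    unfolding a(3) b(3) using a(1) b(1) by simp
  then have ab: "a + b < 2 / real d"
    by (rule ennreal_less_iff[THEN iffD1, rotated]) (use a(1) b(1) in simp)
  \<comment> \<open>Both reciprocals grow by \<delta>, so a third of the slack leaves the sum
    strictly below 2/d.\<close>
  define \<delta> where "\<delta> = min ((2 / real d - a - b) / 3) (min ((1 - a) / 2) ((1 - b) / 2))"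
  have \<delta>: "0 < \<delta>" "\<delta> \<le> (2 / real d - a - b) / 3" "\<delta> \<le> (1 - a) / 2" "\<delta> \<le> (1 - b) / 2"
  proof -
    show "0 < \<delta>" using ab a(2) b(2) by (simp add: \<delta>_def)
    show "\<delta> \<le> (2 / real d - a - b) / 3" unfolding \<delta>_def by (rule min.cobounded1)
    show "\<delta> \<le> (1 - a) / 2" "\<delta> \<le> (1 - b) / 2"
      unfolding \<delta>_def by (meson min.cobounded1 min.cobounded2 order_trans)+
  qed
  show ?thesis
  proof (rule that[of "1 / (a + \<delta>)" "1 / (b + \<delta>)"])
    have "a + \<delta> < 1" "b + \<delta> < 1" using \<delta> a(2) b(2) by (auto simp: field_simps)
    then show "1 < 1 / (a + \<delta>)" "1 < 1 / (b + \<delta>)" using \<delta>(1) a(1) b(1) by simp_all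
    show "ennreal (1 / (a + \<delta>)) \<le> p" "ennreal (1 / (b + \<delta>)) \<le> q" using a(4) b(4) \<delta>(1) by simp_all
    show "1 / (1 / (a + \<delta>)) + 1 / (1 / (b + \<delta>)) < 2 / real d" using \<delta>(1,2) ab by (simp add: field_simps)
  qed
qed

text \<open>For \<tau> = 1/t the subcritical Sobolev condition reads \<tau> > e and \<beta> > 1
  reads \<tau> < f; the hypothesis on the exponents is exactly e < f. Since e is the reciprocal of
  the exponent \<rho> belonging to q1, and \<rho> increases with q, \<tau> > e also gives t \<le>
  \<rho>.\<close>

lemma sobolev_exponent:
  fixes p1 q1 :: real and q :: ennreal and d :: nat
  assumes d: "2 \<le> d" and p1: "1 < p1" and q1: "1 < q1" "ennreal q1 \<le> q" and pq: "1 / p1 + 1 / q1 < 2 / real d"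
  defines "r \<equiv> 2 * q1 / (q1 + 1)"
  obtains t where "r < t" "real d * (1 / r - 1 / t) < 1" "1 < t / (2 * (p1 / (p1 - 1)))" "ennreal t \<le> rho d q"
proof -
  define e where "e = 1 / 2 + 1 / (2 * q1) - 1 / real d"
  define f where "f = 1 / 2 - 1 / (2 * p1)"
  have ri: "1 / r = 1 / 2 + 1 / (2 * q1)" using q1 by (simp add: r_def field_simps)
  have ef: "e < f" using pq by (simp add: e_def f_def)
  have "1 / real d \<le> 1 / 2" using d by simp
  moreover have "0 < 1 / (2 * q1)" using q1 by simp
  ultimately have e0: "0 < e" unfolding e_def by linarith
  define \<tau> where "\<tau> = (e + f) / 2"
  have \<tau>: "e < \<tau>" "\<tau> < f" "0 < \<tau>" using ef e0 by (simp_all add: \<tau>_def)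
  show ?thesis
  proof (rule that[of "1 / \<tau>"])
    have r0: "0 < r" using q1 by (simp add: r_def)
    have "f < 1 / 2" using p1 by (simp add: f_def)
    moreover have "1 / 2 < 1 / r" unfolding ri using q1 by simp
    ultimately have "\<tau> < 1 / r" using \<tau> by linarith
    then show "r < 1 / \<tau>" using \<tau>(3) r0 by (simp add: field_simps)
    have "1 / r - \<tau> < 1 / real d" using \<tau>(1) unfolding ri e_def by linarith
    then show "real d * (1 / r - 1 / (1 / \<tau>)) < 1" using d by (simp add: field_simps)
    have "2 * (p1 / (p1 - 1)) = 1 / f" using p1 by (simp add: f_def field_simps)
    then show "1 < 1 / \<tau> / (2 * (p1 / (p1 - 1)))" using \<tau> by simp
    show "ennreal (1 / \<tau>) \<le> rho d q"
    proof (cases q)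
      case top
      show ?thesis
      proof (cases "d = 2")
        case False
        then have d3: "2 < real d" using d by simp
        have "(real d - 2) / (2 * real d) < \<tau>"
        proof -
          have "(real d - 2) / (2 * real d) = 1 / 2 - 1 / real d" using d3 by (simp add: field_simps)
          also have "\<dots> < e" using q1 by (simp add: e_def)
          finally show ?thesis using \<tau>(1) by linarith
        qed
        then have "1 / \<tau> \<le> 2 * real d / (real d - 2)" using d3 \<tau>(3) by (simp add: field_simps)
        then show ?thesis using top False by (simp add: rho_def ennreal_leI)
      qed (use top in \<open>simp add: rho_def\<close>)
    next
      case (real q')
      have q': "q1 \<le> q'" using q1 real by (simp add: ennreal_le_iff)
      have dn: "0 < q' * (real d - 2) + real d" using d q' q1 by (intro add_nonneg_pos) auto
      have "(q' * (real d - 2) + real d) / (2 * q' * real d) = 1 / 2 + 1 / (2 * q') - 1 / real d"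
        using d q' q1 by (simp add: field_simps)
      also have "\<dots> \<le> e" unfolding e_def using q' q1 by (intro diff_right_mono add_left_mono divide_left_mono) auto
      also have "\<dots> < \<tau>" by (rule \<tau>(1))
      finally have "1 / \<tau> \<le> 2 * q' * real d / (q' * (real d - 2) + real d)"
        using dn \<tau>(3) d q' q1 by (simp add: field_simps)
      then show ?thesis using real by (simp add: rho_def ennreal_leI)
    qed
  qed
qed

section \<open>The maximal inequality\<close>

text \<open>The identity persists at 0 by convention: the inverse is infinite,
  \<open>enn2real\<close> makes it 0, and 1 / 0 = 0.\<close>

lemma enn2real_inverse_ennreal: "0 \<le> x \<Longrightarrow> enn2real (inverse (ennreal x)) = 1 / x"
  by (cases "x = 0") (simp_all add: inverse_ennreal inverse_eq_divide)

lemma locally_integrable_if_balls: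
  fixes f :: "'a::euclidean_space \<Rightarrow> real"
  assumes fm: "f \<in> borel_measurable lebesgue" and f0: "\<And>x. 0 \<le> f x"
    and fin: "\<And>n::nat. (\<integral>\<^sup>+x. ennreal (indicator (ball 0 (real n + 1)) x * f x) \<partial>lebesgue) < \<infinity>"
  shows "locally_integrable f"
  unfolding locally_integrable_def set_integrable_def
proof (intro allI impI)
  fix K :: "'a set" assume K: "compact K"
  have Km [measurable]: "K \<in> sets lebesgue" using K by (simp add: lmeasurable_compact fmeasurableD)
  note [measurable] = fm
  obtain b where b: "K \<subseteq> ball 0 b"
    using bounded_subset_ballD[OF compact_imp_bounded[OF K], of 0] by blast
  obtain n :: nat where n: "b \<le> real n" using real_arch_simple by blast
  have sub: "K \<subseteq> ball 0 (real n + 1)" using b n subset_ball[of b "real n + 1" 0] by fastforce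
  have "(\<integral>\<^sup>+x. ennreal (indicator K x * f x) \<partial>lebesgue) \<le> (\<integral>\<^sup>+x. ennreal (indicator (ball 0 (real n + 1)) x * f x) \<partial>lebesgue)"
  proof (intro nn_integral_mono ennreal_leI mult_right_mono f0)
    fix x
    show "indicator K x \<le> (indicator (ball 0 (real n + 1)) x :: real)"
      using sub by (cases "x \<in> K") auto
  qed
  then have "(\<integral>\<^sup>+x. ennreal (indicator K x * f x) \<partial>lebesgue) < \<infinity>" using fin[of n] by (rule le_less_trans)
  then have "integrable lebesgue (\<lambda>x. indicator K x * f x)"
    using f0 by (intro integrableI_nonneg) auto
  then show "integrable lebesgue (\<lambda>x. indicator K x *\<^sub>R f x)" by simp
qed

text \<open>Exponents above 1 make the first moments finite, which gives local integrability.
  Positivity comes from the extended-valued inverse, infinite exactly where \<open>lam\<close>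
  vanishes.\<close>

lemma elliptic_coefficientsI:
  fixes a :: "real^'n \<Rightarrow> real^'n^'n" and p q :: ennreal
  assumes am: "a \<in> borel_measurable lebesgue" "lam \<in> borel_measurable lebesgue" "Lam \<in> borel_measurable lebesgue"
    and sym: "\<forall>x. transpose (a x) = a x" and nn: "\<forall>x. 0 \<le> lam x" "\<forall>x. 0 \<le> Lam x"
    and ell: "AE x in lebesgue. \<forall>\<xi>::real^'n.
           lam x * (norm \<xi>)\<^sup>2 \<le> (a x *v \<xi>) \<bullet> \<xi> \<and> (a x *v \<xi>) \<bullet> \<xi> \<le> Lam x * (norm \<xi>)\<^sup>2"
    and pq: "1 < p" "1 < q"
    and fin: "\<And>y b. 0 < b \<Longrightarrow> avg_norm (ball y b) p (\<lambda>x. ennreal (Lam x)) < \<infinity>"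
      "\<And>y b. 0 < b \<Longrightarrow> avg_norm (ball y b) q (\<lambda>x. inverse (ennreal (lam x))) < \<infinity>"
  shows "elliptic_coefficients a lam Lam"
proof
  note [measurable] = am
  have one: "ennreal 1 \<le> p" "ennreal 1 \<le> q" using pq by simp_all
  have mL: "(\<lambda>x. ennreal (Lam x)) \<in> borel_measurable lebesgue" by measurable
  have ml: "(\<lambda>x. inverse (ennreal (lam x))) \<in> borel_measurable lebesgue" by measurable
  have b0: "0 < real n + 1" for n :: nat by simp
  note NL = avg_norm_moments[OF mL b0 zero_less_one one(1) fin(1)[OF b0]]
  note Nl = avg_norm_moments[OF ml b0 zero_less_one one(2) fin(2)[OF b0]]
  show "locally_integrable Lam"
  proof (rule locally_integrable_if_balls[OF am(3)])
    show "(\<integral>\<^sup>+x. ennreal (indicator (ball 0 (real n + 1)) x * Lam x) \<partial>lebesgue) < \<infinity>" for n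
      using le_less_trans[OF NL(2)[of 0 n] ennreal_less_top] nn(2) by simp
  qed (use nn(2) in simp)
  show "locally_integrable (\<lambda>x. 1 / lam x)"
  proof (rule locally_integrable_if_balls)
    show "(\<lambda>x. 1 / lam x) \<in> borel_measurable lebesgue" by measurable
    show "(\<integral>\<^sup>+x. ennreal (indicator (ball 0 (real n + 1)) x * (1 / lam x)) \<partial>lebesgue) < \<infinity>" for n
      using le_less_trans[OF Nl(2)[of 0 n] ennreal_less_top] nn(1)
      by (simp add: enn2real_inverse_ennreal)
  qed (use nn(1) in simp)
  have "AE x in lebesgue. \<forall>n::nat. x \<in> ball 0 (real n + 1) \<longrightarrow> inverse (ennreal (lam x)) < \<infinity>"
    by (intro AE_all_countable[THEN iffD2] allI Nl(1))
  then show "AE x in lebesgue. 0 < lam x"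
  proof eventually_elim
    case (elim x)
    obtain n :: nat where "norm x \<le> real n" using real_arch_simple by blast
    then have "x \<in> ball 0 (real n + 1)" by simp
    then have "inverse (ennreal (lam x)) < \<infinity>" using elim by blast
    then have "lam x \<noteq> 0" by auto
    then show ?case using nn(1)[rule_format, of x] by linarith
  qed
qed (use am sym nn ell in auto)

lemma avg_norms_finite:
  fixes lam Lam :: "real^'n \<Rightarrow> real"
  assumes m: "lam \<in> borel_measurable lebesgue" "Lam \<in> borel_measurable lebesgue"
    and sup: "(SUP r\<in>{1::real..}.
           avg_moment (ball (0::real^'n) r) p (\<lambda>x. ennreal (Lam x)) +
           avg_moment (ball (0::real^'n) r) q (\<lambda>x. inverse (ennreal (lam x)))) < \<infinity>"
    and b: "0 < b"
  shows "avg_norm (ball y b) p (\<lambda>x. ennreal (Lam x)) < \<infinity>"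
    "avg_norm (ball y b) q (\<lambda>x. inverse (ennreal (lam x))) < \<infinity>"
proof -
  note [measurable] = m
  \<comment> \<open>The supremum covers only radii at least 1.\<close>
  define c where "c = max 1 (norm y + b)"
  have sub: "ball y b \<subseteq> ball 0 c"
  proof
    fix x assume "x \<in> ball y b"
    then have "norm (y - x) < b" by (simp add: dist_norm)
    moreover have "norm x \<le> norm y + norm (y - x)" using norm_triangle_ineq4[of y "y - x"] by simp
    ultimately show "x \<in> ball 0 c" by (simp add: c_def)
  qed
  have c1: "c \<in> {1..}" by (simp add: c_def)
  have "avg_moment (ball (0::real^'n) c) p (\<lambda>x. ennreal (Lam x)) +
    avg_moment (ball (0::real^'n) c) q (\<lambda>x. inverse (ennreal (lam x))) < \<infinity>"
    by (rule le_less_trans[OF SUP_upper[OF c1] sup])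
  then have f: "avg_moment (ball (0::real^'n) c) p (\<lambda>x. ennreal (Lam x)) < \<infinity>"
    "avg_moment (ball (0::real^'n) c) q (\<lambda>x. inverse (ennreal (lam x))) < \<infinity>"
    by simp_all
  show "avg_norm (ball y b) p (\<lambda>x. ennreal (Lam x)) < \<infinity>"
    by (rule avg_norm_finite_subball[OF _ b sub f(1)]) measurable
  show "avg_norm (ball y b) q (\<lambda>x. inverse (ennreal (lam x))) < \<infinity>"
    by (rule avg_norm_finite_subball[OF _ b sub f(2)]) measurable
qed

lemma poisson_solution_imp_tested:
  assumes ell: "elliptic_coefficients a lam Lam" and R: "0 < R" and L0: "0 \<le> L"
    and f: "is_weak_grad f gf" "AE x in lebesgue. norm (weak_grad f x) \<le> L"
    and sol: "poisson_solution a f (ball y R) u"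
  obtains \<phi> v g F where "tested_solution a lam Lam \<phi> v g F y R L"
    "AE x in lebesgue. x \<in> ball y R \<longrightarrow> u x = v x"
proof -
  interpret elliptic_coefficients a lam Lam by (rule ell)
  have uloc: "u \<in> form_domain_loc a" using sol by (simp add: poisson_solution_def)
  obtain \<phi> v g where ap: "approximates UNIV \<phi> v g" and lim: "AE x in lebesgue. (\<lambda>n. \<phi> n x) \<longlonglongrightarrow> v x"
    and uv: "AE x in lebesgue. x \<in> ball y R \<longrightarrow> u x = v x"
    using form_domain_loc_approximates[OF uloc R] by blast
  \<comment> \<open>The gradient of the datum is bounded only almost everywhere; setting it to 0 on
    the exceptional set gives the everywhere bound that \<open>tested_solution\<close> asks
    for.\<close>
  define F where "F x = (if norm (weak_grad f x) \<le> L then weak_grad f x else 0)" for x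
  have wm: "weak_grad f \<in> borel_measurable lebesgue"
    by (rule locally_integrable_measurable[OF is_weak_grad_locally_integrable(2)[OF is_weak_grad_weak_grad[OF f(1)]]])
  note [measurable] = wm
  have Fm: "F \<in> borel_measurable lebesgue" unfolding F_def[abs_def] by measurable
  have FA: "AE x in lebesgue. weak_grad f x = F x" using f(2) by eventually_elim (simp add: F_def)

  have "tested_solution a lam Lam \<phi> v g F y R L"
  proof
    show "norm (F x) \<le> L" for x using L0 by (simp add: F_def)
    fix \<psi> :: "real^'a \<Rightarrow> real" and G G' :: "real \<Rightarrow> real" and M
    assume \<psi>: "\<psi> \<in> test_functions (ball y R)" "\<And>x. 0 \<le> \<psi> x"
      and G: "\<And>t. (G has_real_derivative G' t) (at t)" "continuous_on UNIV G'"
      "\<And>t. \<bar>G t\<bar> \<le> M" "\<And>t. \<bar>G' t\<bar> \<le> M" "\<And>t. 0 \<le> G t"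
    show "(LINT x|lebesgue. (a x *v g x) \<bullet> ((\<psi> x * G' (v x)) *\<^sub>R g x + G (v x) *\<^sub>R grad \<psi> x))
      = - (LINT x|lebesgue. (a x *v F x) \<bullet> ((\<psi> x * G' (v x)) *\<^sub>R g x + G (v x) *\<^sub>R grad \<psi> x))"
      by (rule poisson_solution_tested[OF sol R ap lim uv FA Fm f(1) \<psi> G])
  qed (fact ap lim Fm R)+
  then show ?thesis using uv by (rule that)
qed

theorem theorem2p1:
  fixes p q :: ennreal
  assumes "CARD('n::finite) \<ge> 2"
    and "1 < p" and "1 < q"
    and "1 / p + 1 / q < 2 / of_nat CARD('n)"
  shows "\<exists>\<kappa> \<gamma> :: real. 1 < \<kappa> \<and> 0 < \<gamma> \<and> \<gamma> \<le> 1 \<and>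
    (\<forall>c_f::real. 0 < c_f \<longrightarrow> (\<exists>C2::real. 0 < C2 \<and>
      (\<forall>(a :: real^'n \<Rightarrow> real^'n^'n) (lam :: real^'n \<Rightarrow> real) (Lam :: real^'n \<Rightarrow> real)
         (f :: real^'n \<Rightarrow> real) (u :: real^'n \<Rightarrow> real) (x0 :: real^'n) (R::real) (\<sigma>'::real) (\<sigma>::real).
        a \<in> borel_measurable lebesgue \<longrightarrow>
        lam \<in> borel_measurable lebesgue \<longrightarrow>
        Lam \<in> borel_measurable lebesgue \<longrightarrow>
        (\<forall>x. transpose (a x) = a x) \<longrightarrow>
        (\<forall>x. 0 \<le> lam x) \<longrightarrow>
        (\<forall>x. 0 \<le> Lam x) \<longrightarrow>
        (AE x in lebesgue. \<forall>\<xi>::real^'n.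
           lam x * (norm \<xi>)\<^sup>2 \<le> (a x *v \<xi>) \<bullet> \<xi> \<and> (a x *v \<xi>) \<bullet> \<xi> \<le> Lam x * (norm \<xi>)\<^sup>2) \<longrightarrow>
        (SUP r\<in>{1::real..}.
           avg_moment (ball (0::real^'n) r) p (\<lambda>x. ennreal (Lam x)) +
           avg_moment (ball (0::real^'n) r) q (\<lambda>x. inverse (ennreal (lam x)))) < \<infinity> \<longrightarrow>
        0 < R \<longrightarrow>
        (\<exists>g. is_weak_grad f g) \<longrightarrow>
        (\<exists>M. AE x in lebesgue. norm (weak_grad f x) \<le> M) \<longrightarrow>
        (AE x in lebesgue. norm (weak_grad f x) \<le> c_f / R) \<longrightarrow>
        poisson_solution a f (ball x0 R) u \<longrightarrow>
        1 / 2 \<le> \<sigma>' \<longrightarrow> \<sigma>' < \<sigma> \<longrightarrow> \<sigma> \<le> 1 \<longrightarrow>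
        avg_norm (ball x0 (\<sigma>' * R)) \<infinity> (\<lambda>x. ennreal \<bar>u x\<bar>)
          \<le> ennreal C2
             * ennpowr
                 (max 1 (avg_norm (ball x0 R) q (\<lambda>x. inverse (ennreal (lam x)))
                         * avg_norm (ball x0 R) p (\<lambda>x. ennreal (Lam x)))
                  / ennreal ((\<sigma> - \<sigma>')\<^sup>2)) \<kappa>
             * max (ennpowr (avg_norm (ball x0 (\<sigma> * R)) (rho CARD('n) q) (\<lambda>x. ennreal \<bar>u x\<bar>)) \<gamma>)
                   (avg_norm (ball x0 (\<sigma> * R)) (rho CARD('n) q) (\<lambda>x. ennreal \<bar>u x\<bar>)))))"
proof -
  obtain p1 q1 :: real where p1: "1 < p1" "ennreal p1 \<le> p" and q1: "1 < q1" "ennreal q1 \<le> q"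
    and pq1: "1 / p1 + 1 / q1 < 2 / real CARD('n)"
    using finite_exponents[OF assms] by blast
  define d where "d = real CARD('n)"
  define r where "r = 2 * q1 / (q1 + 1)"
  obtain t where t: "r < t" "d * (1 / r - 1 / t) < 1" "1 < t / (2 * (p1 / (p1 - 1)))" "ennreal t \<le> rho CARD('n) q"
    using sobolev_exponent[OF assms(1) p1(1) q1 pq1] unfolding r_def d_def by blast
  have r1: "1 < r" using q1(1) by (simp add: r_def field_simps)
  have t0: "0 < t" using r1 t(1) by simp
  define \<beta> where "\<beta> = t / (2 * (p1 / (p1 - 1)))"
  have \<beta>: "1 < \<beta>" using t(3) by (simp add: \<beta>_def)
  define x where "x = 1 / \<beta>"
  have x: "0 < x" "x < 1" using \<beta> by (simp_all add: x_def)
  define \<kappa> where "\<kappa> = 1 + x / (1 - x)"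
  define \<gamma> where "\<gamma> = exp (- (x / (1 - x)\<^sup>2))"
  have \<kappa>: "1 < \<kappa>" using x by (simp add: \<kappa>_def)
  have \<gamma>: "0 < \<gamma>" "\<gamma> \<le> 1" using x by (simp_all add: \<gamma>_def)
  obtain C where C: "0 < C" and sob: "\<And>(x0::real^'n) R \<phi> A. 0 < R \<Longrightarrow> 0 \<le> A \<Longrightarrow> \<phi> \<in> test_functions (ball x0 R) \<Longrightarrow>
    (\<integral>\<^sup>+x. ennreal (norm (grad \<phi> x) powr r) \<partial>lborel) \<le> ennreal A \<Longrightarrow>
    (\<integral>\<^sup>+x. ennreal (\<bar>\<phi> x\<bar> powr t) \<partial>lborel) \<le> ennreal (C * R powr (t - real CARD('n) * t / r + real CARD('n)) * A powr (t / r))"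
    using sobolev_subcritical[where 'n='n, OF r1 t(1)] t(2) unfolding d_def by blast
  obtain Ce where Ce: "0 < Ce"
    and cut: "\<And>(x0::real^'n) s t. 0 < s \<Longrightarrow> s < t \<Longrightarrow> \<exists>\<eta>\<in>test_functions (ball x0 t).
       (\<forall>x. 0 \<le> \<eta> x \<and> \<eta> x \<le> 1 \<and> norm (grad \<eta> x) \<le> Ce / (t - s)) \<and> (\<forall>x\<in>ball x0 s. \<eta> x = 1)"
    using cutoff_exists[where 'n='n] by blast
  define K where "K c = 44 * (c\<^sup>2 + Ce\<^sup>2) * (C * measure lborel (ball (0::real^'n) 1) powr (t / r - 1)) powr (2 / t)" for c
  \<comment> \<open>The bound on the datum enters only through \<open>K c\<close>; the exponents
    \<kappa> and \<gamma> are fixed before it.\<close>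
  define C2 where "C2 c = max 1 (K c) powr (x / (1 - x)) * (4 * \<beta>\<^sup>2) powr (x / (1 - x)\<^sup>2)" for c
  have C2: "0 < C2 c" for c using \<beta> by (simp add: C2_def)
  show ?thesis
  proof (rule exI[of _ \<kappa>], rule exI[of _ \<gamma>], intro conjI \<kappa> \<gamma> allI impI)
    fix c_f :: real assume cf: "0 < c_f"
    show "\<exists>C2::real. 0 < C2 \<and>
      (\<forall>(a :: real^'n \<Rightarrow> real^'n^'n) (lam :: real^'n \<Rightarrow> real) (Lam :: real^'n \<Rightarrow> real)
         (f :: real^'n \<Rightarrow> real) (u :: real^'n \<Rightarrow> real) (x0 :: real^'n) (R::real) (\<sigma>'::real) (\<sigma>::real).
        a \<in> borel_measurable lebesgue \<longrightarrow>
        lam \<in> borel_measurable lebesgue \<longrightarrow>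
        Lam \<in> borel_measurable lebesgue \<longrightarrow>
        (\<forall>x. transpose (a x) = a x) \<longrightarrow>
        (\<forall>x. 0 \<le> lam x) \<longrightarrow>
        (\<forall>x. 0 \<le> Lam x) \<longrightarrow>
        (AE x in lebesgue. \<forall>\<xi>::real^'n.
           lam x * (norm \<xi>)\<^sup>2 \<le> (a x *v \<xi>) \<bullet> \<xi> \<and> (a x *v \<xi>) \<bullet> \<xi> \<le> Lam x * (norm \<xi>)\<^sup>2) \<longrightarrow>
        (SUP r\<in>{1::real..}.
           avg_moment (ball (0::real^'n) r) p (\<lambda>x. ennreal (Lam x)) +
           avg_moment (ball (0::real^'n) r) q (\<lambda>x. inverse (ennreal (lam x)))) < \<infinity> \<longrightarrow>
        0 < R \<longrightarrow>
        (\<exists>g. is_weak_grad f g) \<longrightarrow>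
        (\<exists>M. AE x in lebesgue. norm (weak_grad f x) \<le> M) \<longrightarrow>
        (AE x in lebesgue. norm (weak_grad f x) \<le> c_f / R) \<longrightarrow>
        poisson_solution a f (ball x0 R) u \<longrightarrow>
        1 / 2 \<le> \<sigma>' \<longrightarrow> \<sigma>' < \<sigma> \<longrightarrow> \<sigma> \<le> 1 \<longrightarrow>
        avg_norm (ball x0 (\<sigma>' * R)) \<infinity> (\<lambda>x. ennreal \<bar>u x\<bar>)
          \<le> ennreal C2
             * ennpowr
                 (max 1 (avg_norm (ball x0 R) q (\<lambda>x. inverse (ennreal (lam x)))
                         * avg_norm (ball x0 R) p (\<lambda>x. ennreal (Lam x)))
                  / ennreal ((\<sigma> - \<sigma>')\<^sup>2)) \<kappa>
             * max (ennpowr (avg_norm (ball x0 (\<sigma> * R)) (rho CARD('n) q) (\<lambda>x. ennreal \<bar>u x\<bar>)) \<gamma>)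
                   (avg_norm (ball x0 (\<sigma> * R)) (rho CARD('n) q) (\<lambda>x. ennreal \<bar>u x\<bar>)))"
    proof (rule exI[of _ "C2 c_f"], intro conjI C2 allI impI)
      fix a :: "real^'n \<Rightarrow> real^'n^'n" and lam Lam f u :: "real^'n \<Rightarrow> real" and x0 :: "real^'n" and R \<sigma>' \<sigma> :: real
      assume m: "a \<in> borel_measurable lebesgue" "lam \<in> borel_measurable lebesgue" "Lam \<in> borel_measurable lebesgue"
        and sym: "\<forall>x. transpose (a x) = a x" and nn: "\<forall>x. 0 \<le> lam x" "\<forall>x. 0 \<le> Lam x"
        and ell: "AE x in lebesgue. \<forall>\<xi>::real^'n.
           lam x * (norm \<xi>)\<^sup>2 \<le> (a x *v \<xi>) \<bullet> \<xi> \<and> (a x *v \<xi>) \<bullet> \<xi> \<le> Lam x * (norm \<xi>)\<^sup>2"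
        and sup: "(SUP r\<in>{1::real..}.
           avg_moment (ball (0::real^'n) r) p (\<lambda>x. ennreal (Lam x)) +
           avg_moment (ball (0::real^'n) r) q (\<lambda>x. inverse (ennreal (lam x)))) < \<infinity>"
        and R: "0 < R" and fw: "\<exists>g. is_weak_grad f g"
        and fb: "AE x in lebesgue. norm (weak_grad f x) \<le> c_f / R"
        and sol: "poisson_solution a f (ball x0 R) u"
        and \<sigma>: "1 / 2 \<le> \<sigma>'" "\<sigma>' < \<sigma>" "\<sigma> \<le> 1"
      note [measurable] = m(2,3)
      note fin = avg_norms_finite[OF m(2,3) sup]
      have EC: "elliptic_coefficients a lam Lam"
        by (rule elliptic_coefficientsI[OF m sym nn ell assms(2,3) fin])
      have cR: "0 \<le> c_f / R" using cf R by simp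
      obtain gf where gf: "is_weak_grad f gf" using fw by blast
      obtain \<phi> v g F where TS: "tested_solution a lam Lam \<phi> v g F x0 R (c_f / R)"
        and uv: "AE x in lebesgue. x \<in> ball x0 R \<longrightarrow> u x = v x"
        using poisson_solution_imp_tested[OF EC R cR gf fb sol] by blast
      interpret tested_solution a lam Lam \<phi> v g F x0 R "c_f / R" by (rule TS)
      have um: "u \<in> borel_measurable lebesgue"
        by (rule form_domain_loc_weak_grad(1)) (use sol in \<open>simp add: poisson_solution_def\<close>)
      note [measurable] = um
      have uem: "(\<lambda>x. ennreal \<bar>u x\<bar>) \<in> borel_measurable lebesgue" by measurable
      let ?Np = "avg_norm (ball x0 R) p (\<lambda>x. ennreal (Lam x))"
      let ?Nq = "avg_norm (ball x0 R) q (\<lambda>x. inverse (ennreal (lam x)))"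
      let ?Nu = "avg_norm (ball x0 (\<sigma> * R)) (rho CARD('n) q) (\<lambda>x. ennreal \<bar>u x\<bar>)"
      define Ap where "Ap = enn2real ?Np"
      define Aq where "Aq = enn2real ?Nq"
      have Np: "?Np = ennreal Ap" "0 \<le> Ap" and Nq: "?Nq = ennreal Aq" "0 \<le> Aq"
        using fin[OF R, of x0] by (simp_all add: Ap_def Aq_def)
      define D where "D = max 1 (Ap * Aq) / (\<sigma> - \<sigma>')\<^sup>2"
      have s: "0 < (\<sigma> - \<sigma>')\<^sup>2" using \<sigma> by simp
      have D: "0 < D" unfolding D_def using s by (intro divide_pos_pos) auto
      have Dn: "ennpowr (max 1 (?Nq * ?Np) / ennreal ((\<sigma> - \<sigma>')\<^sup>2)) \<kappa> = ennreal (D powr \<kappa>)"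
      proof -
        have "max 1 (?Nq * ?Np) = ennreal (max 1 (Ap * Aq))"
          unfolding Np(1) Nq(1) using Np(2) Nq(2)
          by (simp add: ennreal_mult[symmetric] mult.commute max_def flip: ennreal_1)
        then have "max 1 (?Nq * ?Np) / ennreal ((\<sigma> - \<sigma>')\<^sup>2) = ennreal D"
          using s by (simp add: D_def divide_ennreal le_max_iff_disj)
        then show ?thesis using D by (simp add: ennpowr_ennreal)
      qed
      show "avg_norm (ball x0 (\<sigma>' * R)) \<infinity> (\<lambda>x. ennreal \<bar>u x\<bar>)
          \<le> ennreal (C2 c_f) * ennpowr (max 1 (?Nq * ?Np) / ennreal ((\<sigma> - \<sigma>')\<^sup>2)) \<kappa> * max (ennpowr ?Nu \<gamma>) ?Nu"
      \<comment> \<open>If the norm of u is infinite, so is the right side, because the factors in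
        front of the maximum are positive.\<close>
      proof (cases "?Nu = \<infinity>")
        case True
        have "ennreal (C2 c_f) * ennreal (D powr \<kappa>) \<noteq> 0" using C2[of c_f] D by simp
        then show ?thesis unfolding Dn True by (simp add: ennreal_mult_top)
      next
        case False
        define X0 where "X0 = enn2real ?Nu"
        have Nu: "?Nu = ennreal X0" "0 \<le> X0" using False by (simp_all add: X0_def less_top)
        define Z where "Z = C2 c_f * D powr \<kappa> * max (X0 powr \<gamma>) X0"
        have sR: "0 < \<sigma> * R" using \<sigma> R by simp
        have sub: "ball x0 (\<sigma> * R) \<subseteq> ball x0 R" using \<sigma> R by (intro subset_ball) simp
        have sub': "ball x0 (\<sigma>' * R) \<subseteq> ball x0 R" using \<sigma> R by (intro subset_ball) simp
        let ?V = "measure lborel (ball x0 R)"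
        \<comment> \<open>The average over the ball of radius \<sigma> R is renormalised by the
          larger volume of the full ball, which only weakens the bound and costs no
          constant.\<close>
        have mu: "(\<integral>\<^sup>+x. ennreal (indicator (ball x0 (\<sigma> * R)) x * \<bar>u x\<bar> powr t) \<partial>lebesgue) \<le> ennreal (?V * X0 powr t)"
        proof -
          have "(\<integral>\<^sup>+x. ennreal (indicator (ball x0 (\<sigma> * R)) x * \<bar>u x\<bar> powr t) \<partial>lebesgue)
            \<le> ennreal (measure lborel (ball x0 (\<sigma> * R)) * X0 powr t)"
            using avg_norm_moments(2)[OF uem sR t0 t(4), of x0] False unfolding X0_def by (simp add: less_top)
          also have "\<dots> \<le> ennreal (?V * X0 powr t)"
          proof (intro ennreal_leI mult_right_mono)
            have "ennreal (measure lborel (ball x0 (\<sigma> * R))) \<le> ennreal ?V"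
              unfolding emeasure_lebesgue_ball[symmetric] by (rule emeasure_mono[OF sub]) simp
            then show "measure lborel (ball x0 (\<sigma> * R)) \<le> ?V" by (subst (asm) ennreal_le_iff) simp_all
          qed simp
          finally show ?thesis .
        qed
        have mAp: "(\<integral>\<^sup>+x. ennreal (indicator (ball x0 R) x * Lam x powr p1) \<partial>lebesgue) \<le> ennreal (?V * Ap powr p1)"
          using avg_norm_moments(2)[of "\<lambda>x. ennreal (Lam x)" R p1 p x0] R p1 fin(1)[OF R, of x0] nn(2)
          unfolding Ap_def by simp
        have mAq: "(\<integral>\<^sup>+x. ennreal (indicator (ball x0 R) x * (1 / lam x) powr q1) \<partial>lebesgue) \<le> ennreal (?V * Aq powr q1)"
          using avg_norm_moments(2)[of "\<lambda>x. inverse (ennreal (lam x))" R q1 q x0] R q1 fin(2)[OF R, of x0] nn(1)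
          unfolding Aq_def by (simp add: enn2real_inverse_ennreal)
        \<comment> \<open>Stated for an arbitrary tested solution whose positive part is at most
          |u|, so that it serves for both v and - v.\<close>
        have bound: "AE x in lebesgue. x \<in> ball x0 (\<sigma>' * R) \<longrightarrow> max (v' x) 0 \<le> Z"
          if ts: "tested_solution a lam Lam \<phi>' v' g' F' x0 R (c_f / R)"
            and le: "AE x in lebesgue. x \<in> ball x0 R \<longrightarrow> max (v' x) 0 \<le> \<bar>u x\<bar>" for \<phi>' v' g' F'
        proof -
          have mv: "(\<integral>\<^sup>+x. ennreal (indicator (ball x0 (\<sigma> * R)) x * max (v' x) 0 powr t) \<partial>lebesgue) \<le> ennreal (?V * X0 powr t)"
          proof (rule order_trans[OF nn_integral_mono_AE mu])
            show "AE x in lebesgue. ennreal (indicator (ball x0 (\<sigma> * R)) x * max (v' x) 0 powr t)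
              \<le> ennreal (indicator (ball x0 (\<sigma> * R)) x * \<bar>u x\<bar> powr t)"
              using le
            proof eventually_elim
              case (elim x)
              show ?case
              proof (cases "x \<in> ball x0 (\<sigma> * R)")
                case True
                then have "max (v' x) 0 \<le> \<bar>u x\<bar>" using elim sub by blast
                then show ?thesis using True t0 by (intro ennreal_leI mult_left_mono powr_mono2) auto
              qed simp
            qed
          qed
          have "0 < \<sigma>'" using \<sigma>(1) by simp
          from tested_solution.moser_sup[OF ts sob[OF R] C q1(1) r_def t(1) p1(1) cut Ce this \<sigma>(2,3) \<beta>[unfolded \<beta>_def] refl
              mAp Np(2) mAq Nq(2) mv Nu(2)]
          show ?thesis
            unfolding Z_def C2_def D_def K_def \<kappa>_def \<gamma>_def x_def \<beta>_def .
        qed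
        have AEv: "AE x in lebesgue. x \<in> ball x0 (\<sigma>' * R) \<longrightarrow> max (v x) 0 \<le> Z"
          by (rule bound[OF TS]) (use uv in eventually_elim, auto)
        have AEmv: "AE x in lebesgue. x \<in> ball x0 (\<sigma>' * R) \<longrightarrow> max (- v x) 0 \<le> Z"
          by (rule bound[OF tested_solution_uminus]) (use uv in eventually_elim, auto)
        have AEu: "AE x in lebesgue. x \<in> ball x0 (\<sigma>' * R) \<longrightarrow> ennreal \<bar>u x\<bar> \<le> ennreal Z"
          using AEv AEmv uv
        proof eventually_elim
          case (elim x)
          show ?case
          proof
            assume x: "x \<in> ball x0 (\<sigma>' * R)"
            then have "u x = v x" using elim(3) sub' by blast
            moreover have "v x \<le> Z" "- v x \<le> Z" using elim(1,2) x by auto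
            ultimately show "ennreal \<bar>u x\<bar> \<le> ennreal Z" by (intro ennreal_leI) (simp add: abs_le_iff)
          qed
        qed
        have "avg_norm (ball x0 (\<sigma>' * R)) \<infinity> (\<lambda>x. ennreal \<bar>u x\<bar>) = esssup (lebesgue_on (ball x0 (\<sigma>' * R))) (\<lambda>x. ennreal \<bar>u x\<bar>)"
          by (simp add: avg_norm_def)
        also have "\<dots> \<le> ennreal Z"
        proof (rule esssup_I)
          show "(\<lambda>x. ennreal \<bar>u x\<bar>) \<in> borel_measurable (lebesgue_on (ball x0 (\<sigma>' * R)))"
            by (rule measurable_restrict_space1[OF uem])
          show "AE x in lebesgue_on (ball x0 (\<sigma>' * R)). ennreal \<bar>u x\<bar> \<le> ennreal Z"
            unfolding AE_lebesgue_on_ball by (rule AEu)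
        qed
        also have "ennreal Z = ennreal (C2 c_f) * ennreal (D powr \<kappa>) * ennreal (max (X0 powr \<gamma>) X0)"
          unfolding Z_def using C2[of c_f] Nu(2) by (simp add: ennreal_mult le_max_iff_disj)
        also have "ennreal (max (X0 powr \<gamma>) X0) = max (ennpowr ?Nu \<gamma>) ?Nu"
          unfolding Nu(1) using Nu(2) by (simp add: ennpowr_ennreal max_def)
        finally show ?thesis unfolding Dn .
      qed
    qed
  qed
qed

end
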